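(* Let $S$ be a field. The linear tridle is an invariant of oriented links: if $D$ and $D'$ are oriented planar diagrams of the same oriented link, then $LT(D)$ and $LT(D')$ are isomorphic linear tridles.
   Context: Let $\Lambda=S[x,x^{-1},y,y^{-1}]$ be the Laurent polynomial ring in two commuting variables. On any $\Lambda$-module, the equation $\alpha_1+x\alpha_2+xy\alpha_3+y\alpha_4=0$ can be solved uniquely for any one of the $\alpha_i$ in terms of the other three; write the solutions as $\alpha_1=F_1(\alpha_2,\alpha_3,\alpha_4)=-(x\alpha_2+xy\alpha_3+y\alpha_4)$, $\alpha_2=F_2(\alpha_3,\alpha_4,\alpha_1)=-x^{-1}(\alpha_1+xy\alpha_3+y\alpha_4)$, $\alpha_3=F_3(\alpha_4,\alpha_1,\alpha_2)=-(xy)^{-1}(\alpha_1+x\alpha_2+y\alpha_4)$, $\alpha_4=F_4(\alpha_1,\alpha_2,\alpha_3)=-y^{-1}(\alpha_1+x\alpha_2+xy\alpha_3)$. Let $D$ be an oriented link diagram in the plane; it divides the plane into regions (connected components of the complement of the underlying curve). Assign a generator to each region. Each crossing of $D$ has four corners, cut out by the over-strand and the under-strand; let $a$ be the generator of the region at the corner lying to the left of the oriented over-strand and to the right of the oriented under-strand, $b$ the one left of the over-strand and left of the under-strand, $c$ the one right of the over-strand and left of the under-strand, and $d$ the one right of the over-strand and right of the under-strand (two corners may belong to the same region). The crossing contributes the relation $a+xb+xyc+yd=0$. Let $M$ be the free $\Lambda$-module on the generators (regions), and let $N$ be the quotient of $M$ by the submodule generated by all crossing relations. The linear tridle $LT(D)$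 is the smallest subset of $N$ that contains the images of all generators and is closed under $F_1,F_2,F_3,F_4$. Equivalently, $LT(D)=\bigcup_{n\ge 1}R_n$, where $R_1$ is the set of images of the generators and $R_{n+1}$ is the set of all values $F_k(\alpha,\beta,\gamma)$ with $k\in\{1,2,3,4\}$ and $\alpha,\beta,\gamma\in\bigcup_{i\le n}R_i$. A homomorphism $f:LT\to LT'$ of linear tridles is a map with $f(F_k(a,b,c))=F_k(f(a),f(b),f(c))$ for all $a,b,c\in LT$ and $k=1,2,3,4$; an isomorphism is a bijective homomorphism. *)

theory Defs
  imports "HOL-Analysis.Analysis" "HOL-Library.Poly_Mapping"
begin

section \<open>Oriented links and their diagrams\<close>

text \<open>Space is split as plane times height; diagrams are obtained by projecting along the
  height axis, and a larger height means closer to the viewer.\<close>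

type_synonym plane = "real \<times> real"
type_synonym space = "plane \<times> real"

text \<open>Links are piecewise linear. An oriented polygonal link is given by its finite set of directed
  edges. Each vertex has exactly one outgoing and one incoming edge, so the edges form
  finitely many oriented closed polygons; distinct edges meet at most in common end points, so these
  polygons are simple and pairwise disjoint. (A pair of mutually inverse edges is
  excluded by the last clause. The empty link is allowed.)\<close>

type_synonym directed_edges = "(space \<times> space) set"

definition vertices :: "directed_edges \<Rightarrow> space set" where
  "vertices L = fst ` L \<union> snd ` L"

definition support :: "directed_edges \<Rightarrow> space set" where
  "support L = (\<Union>(P, Q)\<in>L. closed_segment P Q)"

definition oriented_link :: "directed_edges \<Rightarrow> bool" where
  "oriented_link L \<longleftrightarrow>
     finite L \<and>
     (\<forall>(P, Q)\<in>L. P \<noteq> Q) \<and>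
     inj_on fst L \<and> inj_on snd L \<and> fst ` L = snd ` L \<and>
     (\<forall>(P, Q)\<in>L. \<forall>(P', Q')\<in>L. (P, Q) \<noteq> (P', Q') \<longrightarrow>
        closed_segment P Q \<inter> closed_segment P' Q' \<subseteq> {P, Q} \<inter> {P', Q'})"

text \<open>Two polygonal links are the same oriented link if they are connected by finitely many
  triangle moves and inverses of triangle moves (Reidemeister's combinatorial isotopy): an edge
  \<open>AB\<close> is replaced by \<open>AC\<close>, \<open>CB\<close> when the triangle \<open>ABC\<close> meets the link in \<open>AB\<close> only.
  The triangle may degenerate to \<open>C\<close> lying on \<open>AB\<close>, which is a subdivision; all other degenerate
  cases violate \<open>oriented_link L'\<close>.\<close>

definition triangle_move :: "directed_edges \<Rightarrow> directed_edges \<Rightarrow> bool" where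
  "triangle_move L L' \<longleftrightarrow>
     oriented_link L \<and> oriented_link L' \<and>
     (\<exists>A B C. (A, B) \<in> L \<and>
        convex hull {A, B, C} \<inter> support L = closed_segment A B \<and>
        L' = (L - {(A, B)}) \<union> {(A, C), (C, B)})"

definition same_oriented_link :: "directed_edges \<Rightarrow> directed_edges \<Rightarrow> bool" where
  "same_oriented_link L L' \<longleftrightarrow> oriented_link L \<and> oriented_link L' \<and> equivclp triangle_move L L'"

text \<open>Regular position with respect to the projection: no vertex is
  projected to the same point as another point of the link, and at most two points of the link have
  the same projection. Hence no edge is vertical, and the multiple points of the projection are
  finitely many transverse double points in the interior of projected edges.\<close>

definition regular_position :: "directed_edges \<Rightarrow> bool" where
  "regular_position L \<longleftrightarrow>
     (\<forall>v\<in>vertices L. \<forall>p\<in>support L. fst p = fst v \<longrightarrow> p = v) \<and>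
     (\<forall>p\<in>support L. \<forall>q\<in>support L. \<forall>r\<in>support L.
        fst p = fst q \<and> fst q = fst r \<longrightarrow> p = q \<or> q = r \<or> p = r)"

text \<open>A diagram is an oriented plane curve with over/under information at its crossings, and it does
  not remember how the curve is subdivided into edges. The oriented curve is the set of its
  points, paired with the unit direction(s) in which it is traversed there (two
  directions at a corner and at a crossing). A crossing \<open>(p, u, v)\<close> is a double point \<open>p\<close> whose
  over-strand has direction \<open>u\<close> and whose under-strand has direction \<open>v\<close>.\<close>

record oriented_diagram =
  oriented_curve :: "(plane \<times> plane) set"
  crossings :: "(plane \<times> plane \<times> plane) set"

definition direction :: "space \<times> space \<Rightarrow> plane" where
  "direction e = sgn (fst (snd e) - fst (fst e))"

definition projection :: "directed_edges \<Rightarrow> oriented_diagram" where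
  "projection L = \<lparr>
     oriented_curve = {(fst p, direction (P, Q)) | p P Q. (P, Q) \<in> L \<and> p \<in> closed_segment P Q},
     crossings = {(fst p, direction (P, Q), direction (P', Q')) | p p' P Q P' Q'.
       (P, Q) \<in> L \<and> (P', Q') \<in> L \<and> p \<in> closed_segment P Q \<and> p' \<in> closed_segment P' Q' \<and>
       fst p = fst p' \<and> snd p > snd p'}\<rparr>"

definition is_diagram_of :: "oriented_diagram \<Rightarrow> directed_edges \<Rightarrow> bool" where
  "is_diagram_of D L \<longleftrightarrow>
     (\<exists>L'. same_oriented_link L L' \<and> regular_position L' \<and> D = projection L')"

definition underlying_curve :: "oriented_diagram \<Rightarrow> plane set" where
  "underlying_curve D = fst ` oriented_curve D"

definition regions :: "oriented_diagram \<Rightarrow> plane set set" where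
  "regions D = components (- underlying_curve D)"

definition left_of :: "plane \<Rightarrow> plane \<Rightarrow> bool" where
  "left_of u w \<longleftrightarrow> fst u * snd w - snd u * fst w > 0"

definition right_of :: "plane \<Rightarrow> plane \<Rightarrow> bool" where
  "right_of u w \<longleftrightarrow> fst u * snd w - snd u * fst w < 0"

text \<open>The region \<open>R\<close> lies at the corner of \<open>p\<close> consisting of the directions satisfying \<open>S\<close>.\<close>

definition at_corner :: "oriented_diagram \<Rightarrow> plane \<Rightarrow> (plane \<Rightarrow> bool) \<Rightarrow> plane set \<Rightarrow> bool" where
  "at_corner D p S R \<longleftrightarrow>
     R \<in> regions D \<and> (\<exists>\<epsilon>>0. {q \<in> ball p \<epsilon>. S (q - p)} \<subseteq> R)"

section \<open>The Laurent polynomial ring and free modules\<close>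

text \<open>The ring \<open>S[x, x\<inverse>, y, y\<inverse>]\<close> is the group ring of \<open>int \<times> int\<close>: the key \<open>(i, j)\<close> stands
  for the monomial \<open>x\<^sup>i y\<^sup>j\<close>.\<close>

type_synonym 's laurent = "(int \<times> int) \<Rightarrow>\<^sub>0 's"

definition x_var :: "'s::field laurent" where "x_var = Poly_Mapping.single (1, 0) 1"
definition y_var :: "'s::field laurent" where "y_var = Poly_Mapping.single (0, 1) 1"
definition x_inv :: "'s::field laurent" where "x_inv = Poly_Mapping.single (-1, 0) 1"
definition y_inv :: "'s::field laurent" where "y_inv = Poly_Mapping.single (0, -1) 1"

lemma x_mult_inv: "x_var * x_inv = (1 :: 's::field laurent)"
  unfolding x_var_def x_inv_def mult_single by (simp flip: zero_prod_def)

lemma y_mult_inv: "y_var * y_inv = (1 :: 's::field laurent)"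
  unfolding y_var_def y_inv_def mult_single by (simp flip: zero_prod_def)

type_synonym ('g, 's) free_mod = "'g \<Rightarrow>\<^sub>0 's laurent"

definition scale :: "'s::field laurent \<Rightarrow> ('g, 's) free_mod \<Rightarrow> ('g, 's) free_mod" (infixr \<open>*\<^sub>L\<close> 75)
  where "r *\<^sub>L m = Poly_Mapping.map ((*) r) m"

lemma lookup_scale: "Poly_Mapping.lookup (r *\<^sub>L m) g = r * Poly_Mapping.lookup m g"
  by (simp add: scale_def Poly_Mapping.map.rep_eq when_def)

interpretation free: module "scale :: 's::field laurent \<Rightarrow> ('g, 's) free_mod \<Rightarrow> ('g, 's) free_mod"
  by unfold_locales
    (auto intro!: poly_mapping_eqI simp: lookup_scale lookup_add algebra_simps)

definition gen :: "'g \<Rightarrow> ('g, 's::field) free_mod" where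
  "gen g = Poly_Mapping.single g 1"

text \<open>\<open>F_op k\<close> solves \<open>\<alpha>\<^sub>1 + x \<alpha>\<^sub>2 + x y \<alpha>\<^sub>3 + y \<alpha>\<^sub>4 = 0\<close> for \<open>\<alpha>\<^sub>k\<close>; its arguments
  are the other three unknowns in cyclic order, starting with the one after \<open>\<alpha>\<^sub>k\<close>. Only
  \<open>k \<in> {1, 2, 3, 4}\<close> is ever used.\<close>

definition F_op :: "nat \<Rightarrow> ('g, 's::field) free_mod \<Rightarrow> ('g, 's) free_mod \<Rightarrow> ('g, 's) free_mod
    \<Rightarrow> ('g, 's) free_mod" where
  "F_op k a b c =
     (if k = 1 then - (x_var *\<^sub>L a + (x_var * y_var) *\<^sub>L b + y_var *\<^sub>L c)
      else if k = 2 then - (x_inv *\<^sub>L (c + (x_var * y_var) *\<^sub>L a + y_var *\<^sub>L b))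
      else if k = 3 then - ((x_inv * y_inv) *\<^sub>L (b + x_var *\<^sub>L c + y_var *\<^sub>L a))
      else - (y_inv *\<^sub>L (a + x_var *\<^sub>L b + (x_var * y_var) *\<^sub>L c)))"

lemma F_op_solves:
  fixes a1 a2 a3 a4 :: "('g, 's::field) free_mod"
  shows
  "a1 + x_var *\<^sub>L a2 + (x_var * y_var) *\<^sub>L a3 + y_var *\<^sub>L a4 = 0 \<longleftrightarrow> a1 = F_op 1 a2 a3 a4"
  "a1 + x_var *\<^sub>L a2 + (x_var * y_var) *\<^sub>L a3 + y_var *\<^sub>L a4 = 0 \<longleftrightarrow> a2 = F_op 2 a3 a4 a1"
  "a1 + x_var *\<^sub>L a2 + (x_var * y_var) *\<^sub>L a3 + y_var *\<^sub>L a4 = 0 \<longleftrightarrow> a3 = F_op 3 a4 a1 a2"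
  "a1 + x_var *\<^sub>L a2 + (x_var * y_var) *\<^sub>L a3 + y_var *\<^sub>L a4 = 0 \<longleftrightarrow> a4 = F_op 4 a1 a2 a3"
proof -
  have solve: "r *\<^sub>L m + z = 0 \<longleftrightarrow> m = - (s *\<^sub>L z)" if "r * s = 1"
    for r s :: "'s laurent" and m z :: "('g, 's) free_mod"
  proof
    assume "r *\<^sub>L m + z = 0"
    then have "s *\<^sub>L (r *\<^sub>L m + z) = 0" by simp
    then have "m + s *\<^sub>L z = 0"
      using that by (simp add: free.scale_right_distrib mult.commute)
    then show "m = - (s *\<^sub>L z)" by (simp add: eq_neg_iff_add_eq_0)
  next
    assume "m = - (s *\<^sub>L z)"
    then show "r *\<^sub>L m + z = 0" using that by simp
  qed
  have xy: "(x_var * y_var) * (x_inv * y_inv) = (1 :: 's laurent)"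
    using x_mult_inv[where 's='s] y_mult_inv[where 's='s]
    by (metis (no_types, opaque_lifting) mult.assoc mult.commute mult_1)
  show "a1 + x_var *\<^sub>L a2 + (x_var * y_var) *\<^sub>L a3 + y_var *\<^sub>L a4 = 0 \<longleftrightarrow> a1 = F_op 1 a2 a3 a4"
    unfolding F_op_def by (simp only: simp_thms if_True add.assoc flip: eq_neg_iff_add_eq_0)
  show "a1 + x_var *\<^sub>L a2 + (x_var * y_var) *\<^sub>L a3 + y_var *\<^sub>L a4 = 0 \<longleftrightarrow> a2 = F_op 2 a3 a4 a1"
    using solve[OF x_mult_inv, of a2 "a1 + (x_var * y_var) *\<^sub>L a3 + y_var *\<^sub>L a4"]
    by (simp add: F_op_def add.assoc add.left_commute)
  show "a1 + x_var *\<^sub>L a2 + (x_var * y_var) *\<^sub>L a3 + y_var *\<^sub>L a4 = 0 \<longleftrightarrow> a3 = F_op 3 a4 a1 a2"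
    using solve[OF xy, of a3 "a1 + x_var *\<^sub>L a2 + y_var *\<^sub>L a4"]
    by (simp add: F_op_def add.assoc add.left_commute)
  show "a1 + x_var *\<^sub>L a2 + (x_var * y_var) *\<^sub>L a3 + y_var *\<^sub>L a4 = 0 \<longleftrightarrow> a4 = F_op 4 a1 a2 a3"
    using solve[OF y_mult_inv, of a4 "a1 + x_var *\<^sub>L a2 + (x_var * y_var) *\<^sub>L a3"]
    by (simp add: F_op_def add.commute)
qed

section \<open>The linear tridle of a diagram\<close>

definition free_on_regions :: "oriented_diagram \<Rightarrow> (plane set, 's::field) free_mod set" where
  "free_on_regions D = {m. Poly_Mapping.keys m \<subseteq> regions D}"

definition crossing_relations :: "oriented_diagram \<Rightarrow> (plane set, 's::field) free_mod set" where
  "crossing_relations D =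
     {gen a + x_var *\<^sub>L gen b + (x_var * y_var) *\<^sub>L gen c + y_var *\<^sub>L gen d | a b c d.
        \<exists>(p, u, v)\<in>crossings D.
          at_corner D p (\<lambda>w. left_of u w \<and> right_of v w) a \<and>
          at_corner D p (\<lambda>w. left_of u w \<and> left_of v w) b \<and>
          at_corner D p (\<lambda>w. right_of u w \<and> left_of v w) c \<and>
          at_corner D p (\<lambda>w. right_of u w \<and> right_of v w) d}"

text \<open>The quotient of the free module by the submodule generated by the crossing relations consists
  of the classes of the following relation, and \<open>quot_F\<close> is the operation induced by \<open>F_op\<close> on
  classes.\<close>

definition cong_rel ::
  "oriented_diagram \<Rightarrow> ((plane set, 's::field) free_mod \<times> (plane set, 's) free_mod) set" where
  "cong_rel D = {(m, m'). m \<in> free_on_regions D \<and> m' \<in> free_on_regions D \<and>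
     m - m' \<in> free.span (crossing_relations D)}"

type_synonym 's quot = "(plane set, 's) free_mod set"

definition quot_F :: "oriented_diagram \<Rightarrow> nat \<Rightarrow> 's::field quot \<Rightarrow> 's quot \<Rightarrow> 's quot \<Rightarrow> 's quot" where
  "quot_F D k A B C = (\<Union>a\<in>A. \<Union>b\<in>B. \<Union>c\<in>C. cong_rel D `` {F_op k a b c})"

lemma equiv_cong_rel: "equiv (free_on_regions D) (cong_rel D)"
proof (rule equivI)
  show "cong_rel D \<subseteq> free_on_regions D \<times> free_on_regions D"
    by (auto simp: cong_rel_def)
  show "refl_on (free_on_regions D) (cong_rel D)"
    by (auto simp: refl_on_def cong_rel_def free.span_zero)
  show "sym (cong_rel D)"
    unfolding sym_def cong_rel_def using free.span_neg by fastforce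
  show "trans (cong_rel D)"
  proof (rule transI)
    fix a b c assume "(a, b) \<in> cong_rel D" "(b, c) \<in> cong_rel D"
    then show "(a, c) \<in> cong_rel D"
      using free.span_add[of "a - b" _ "b - c"] by (auto simp: cong_rel_def)
  qed
qed

lemma subspace_free_on_regions: "free.subspace (free_on_regions D)"
  unfolding free.subspace_def free_on_regions_def
  by (auto simp: subset_iff in_keys_iff lookup_scale lookup_add)
     (metis add.right_neutral, metis mult_zero_right)

lemma F_op_in_subspace:
  assumes "free.subspace V" "a \<in> V" "b \<in> V" "c \<in> V"
  shows "F_op k a b c \<in> V"
  using assms
  by (auto simp: F_op_def intro!: free.subspace_neg free.subspace_add free.subspace_scale
      free.subspace_diff)

lemma F_op_diff: "F_op k a b c - F_op k a' b' c' = F_op k (a - a') (b - b') (c - c')"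
  by (simp add: F_op_def free.scale_right_distrib free.scale_right_diff_distrib)

lemma quot_F_class:
  assumes "a \<in> free_on_regions D" "b \<in> free_on_regions D" "c \<in> free_on_regions D"
  shows "quot_F D k (cong_rel D `` {a}) (cong_rel D `` {b}) (cong_rel D `` {c})
    = cong_rel D `` {F_op k a b c}"
proof -
  let ?cl = "\<lambda>m. cong_rel D `` {m}"
  have "?cl (F_op k a' b' c') = ?cl (F_op k a b c)"
    if "(a, a') \<in> cong_rel D" "(b, b') \<in> cong_rel D" "(c, c') \<in> cong_rel D" for a' b' c'
  proof -
    have "(F_op k a b c, F_op k a' b' c') \<in> cong_rel D"
      using that
      by (auto simp: cong_rel_def F_op_diff
          intro!: F_op_in_subspace subspace_free_on_regions free.subspace_span)
    then show ?thesis using equiv_class_eq[OF equiv_cong_rel] by metis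
  qed
  moreover have "a \<in> ?cl a" "b \<in> ?cl b" "c \<in> ?cl c"
    using assms equiv_class_self[OF equiv_cong_rel] by blast+
  ultimately show ?thesis unfolding quot_F_def by blast
qed

inductive_set LT_elems :: "oriented_diagram \<Rightarrow> 's::field quot set" for D where
  generator: "R \<in> regions D \<Longrightarrow> cong_rel D `` {gen R} \<in> LT_elems D"
| closed: "k \<in> {1, 2, 3, 4} \<Longrightarrow> A \<in> LT_elems D \<Longrightarrow> B \<in> LT_elems D \<Longrightarrow> C \<in> LT_elems D \<Longrightarrow>
    quot_F D k A B C \<in> LT_elems D"

record 'a tridle =
  elems :: "'a set"
  oper :: "nat \<Rightarrow> 'a \<Rightarrow> 'a \<Rightarrow> 'a \<Rightarrow> 'a"

definition linear_tridle :: "oriented_diagram \<Rightarrow> 's::field quot tridle" where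
  "linear_tridle D = \<lparr>elems = LT_elems D, oper = quot_F D\<rparr>"

definition tridle_hom :: "('a \<Rightarrow> 'b) \<Rightarrow> 'a tridle \<Rightarrow> 'b tridle \<Rightarrow> bool" where
  "tridle_hom f T T' \<longleftrightarrow> f \<in> elems T \<rightarrow> elems T' \<and>
     (\<forall>k\<in>{1, 2, 3, 4}. \<forall>a\<in>elems T. \<forall>b\<in>elems T. \<forall>c\<in>elems T.
        f (oper T k a b c) = oper T' k (f a) (f b) (f c))"

definition tridle_isomorphic :: "'a tridle \<Rightarrow> 'b tridle \<Rightarrow> bool" where
  "tridle_isomorphic T T' \<longleftrightarrow> (\<exists>f. tridle_hom f T T' \<and> bij_betw f (elems T) (elems T'))"

end

theory Submission
  imports Defs
begin

text \<open>A colouring of the regions of a diagram by elements of a group, satisfying one relation at each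
  crossing, describes a flat bundle on the link complement together with trivialisations high above and
  far below the link: the colour of a region is the holonomy along a vertical line through it. A
  triangle move is realised by a piecewise linear homeomorphism of space that is the identity outside a
  neighbourhood of the triangle, and homeomorphisms carry flat bundles to flat bundles. Hence the
  colourings of two diagrams of the same link correspond to each other without any analysis of
  Reidemeister moves, naturally in the group, and the new colours are alternating words in the old ones.

  The linear tridle is captured by the group of pairs \<open>(n, v \<mapsto> m + (xy)\<^sup>n v)\<close> of an integer and an
  affine map of the module \<open>N\<close>, where the region \<open>R\<close> is coloured by its winding number \<open>n\<close> and
  \<open>m = (-x)\<^sup>n R\<close>: the relation at a crossing becomes exactly the crossing relation of the tridle, and
  the alternating words become compositions of the operations \<open>F\<^sub>k\<close>. Winding numbers are characterised
  by the monodromy of the corresponding bundle around the edges of the link, which the homeomorphism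
  preserves.\<close>

section \<open>Local systems\<close>

text \<open>The four corners enter a crossing relation with four different coefficients, so the
  additive group of \<open>N\<close> cannot serve as the holonomy group: composing holonomies has to
  multiply by monomials. Affine maps do this, but their linear part depends on the position in the
  plane, so every colour carries an integer index, and the index has to be transported by the same
  homeomorphism as the labels.

  Bundles are given by transitions between \<open>above L\<close>, \<open>below L\<close> and one
  convex box per crossing, instead of by paths and a presentation of the link group. Existence of
  sections becomes contraction into a chart, and uniqueness becomes connectedness. Colours get their
  meaning from normalisations far above and far below the link, so the homeomorphisms must fix all
  points of large height.

  That the two assignments of labels are mutually inverse modulo relations cannot be seen in one
  group. It follows by transporting a pair of colourings in a product group, where a subset closed
  under \<open>a - b + c\<close> ties the two coordinates together.\<close>

definition loc_const :: "'a::topological_space set \<Rightarrow> ('a \<Rightarrow> 'b) \<Rightarrow> bool" where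
  "loc_const S c \<longleftrightarrow> (\<forall>x\<in>S. \<exists>W. open W \<and> x \<in> W \<and> (\<forall>y\<in>W \<inter> S. c y = c x))"

lemma loc_constI:
  assumes "\<And>x. x \<in> S \<Longrightarrow> \<exists>W. open W \<and> x \<in> W \<and> (\<forall>y\<in>W \<inter> S. c y = c x)"
  shows "loc_const S c"
  using assms by (auto simp: loc_const_def)

lemma loc_constE:
  assumes "loc_const S c" "x \<in> S"
  obtains W where "open W" "x \<in> W" "\<And>y. y \<in> W \<Longrightarrow> y \<in> S \<Longrightarrow> c y = c x"
proof -
  have "\<exists>W. open W \<and> x \<in> W \<and> (\<forall>y\<in>W \<inter> S. c y = c x)"
    using assms by (simp add: loc_const_def)
  then show ?thesis using that by (elim exE conjE) (rule that, auto)
qed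

lemma loc_const_subset:
  assumes "loc_const S c" "T \<subseteq> S"
  shows "loc_const T c"
proof (rule loc_constI)
  fix x assume "x \<in> T"
  then have "x \<in> S" using assms(2) by auto
  then obtain W where "open W" "x \<in> W" "\<And>y. y \<in> W \<Longrightarrow> y \<in> S \<Longrightarrow> c y = c x"
    using loc_constE[OF assms(1)] by metis
  then show "\<exists>W. open W \<and> x \<in> W \<and> (\<forall>y\<in>W \<inter> T. c y = c x)"
    using assms(2) by (intro exI[of _ W]) auto
qed

lemma loc_const_const [simp]: "loc_const S (\<lambda>x. a)"
  by (rule loc_constI) (auto intro: exI[of _ UNIV])

lemma loc_const_cong: "(\<And>x. x \<in> S \<Longrightarrow> c x = c' x) \<Longrightarrow> loc_const S c \<longleftrightarrow> loc_const S c'"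
  unfolding loc_const_def by (metis IntD2)

lemma loc_const_comp2:
  assumes "loc_const S a" "loc_const S b"
  shows "loc_const S (\<lambda>x. F (a x) (b x))"
proof (rule loc_constI)
  fix x assume x: "x \<in> S"
  obtain W where "open W" "x \<in> W" "\<And>y. y \<in> W \<Longrightarrow> y \<in> S \<Longrightarrow> a y = a x"
    using loc_constE[OF assms(1) x] by blast
  moreover obtain W' where "open W'" "x \<in> W'" "\<And>y. y \<in> W' \<Longrightarrow> y \<in> S \<Longrightarrow> b y = b x"
    using loc_constE[OF assms(2) x] by blast
  ultimately show "\<exists>W. open W \<and> x \<in> W \<and> (\<forall>y\<in>W \<inter> S. F (a y) (b y) = F (a x) (b x))"
    by (intro exI[of _ "W \<inter> W'"]) auto
qed

lemma loc_const_comp: "loc_const S a \<Longrightarrow> loc_const S (\<lambda>x. F (a x))"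
  using loc_const_comp2[of S a a "\<lambda>x _. F x"] .

lemma loc_const_vimage:
  assumes "continuous_on T \<gamma>" "loc_const S c" "\<gamma> ` T \<subseteq> S"
  shows "loc_const T (\<lambda>t. c (\<gamma> t))"
proof (rule loc_constI)
  fix t assume t: "t \<in> T"
  obtain W where W: "open W" "\<gamma> t \<in> W" "\<And>y. y \<in> W \<Longrightarrow> y \<in> S \<Longrightarrow> c y = c (\<gamma> t)"
    using loc_constE[OF assms(2), of "\<gamma> t"] t assms(3) by blast
  obtain A where A: "open A" "A \<inter> T = \<gamma> -` W \<inter> T"
    using assms(1) W(1) by (metis continuous_on_open_invariant)
  show "\<exists>W. open W \<and> t \<in> W \<and> (\<forall>y\<in>W \<inter> T. c (\<gamma> y) = c (\<gamma> t))"
    using A W t assms(3) by (intro exI[of _ A]) blast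
qed

lemma loc_const_connected:
  assumes "loc_const S c" "connected S" "x \<in> S" "y \<in> S"
  shows "c x = c y"
proof -
  have "\<exists>T. openin (top_of_set S) T \<and> a \<in> T \<and> (\<forall>x\<in>T. c x = c a)" if a: "a \<in> S" for a
  proof -
    obtain W where "open W" "a \<in> W" "\<And>y. y \<in> W \<Longrightarrow> y \<in> S \<Longrightarrow> c y = c a"
      using loc_constE[OF assms(1) a] by metis
    then show ?thesis using a openin_open_Int[of W S] by (metis IntD1 IntD2 IntI)
  qed
  then have "c constant_on S"
    using locally_constant_imp_constant[OF assms(2), of c] by blast
  then show ?thesis using assms by (auto simp: constant_on_def)
qed

lemma loc_const_sign:
  fixes h :: "'a::topological_space \<Rightarrow> real"
  assumes "continuous_on UNIV h" "\<And>x. x \<in> S \<Longrightarrow> h x \<noteq> 0"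
  shows "loc_const S (\<lambda>x. if h x > 0 then a else b)"
proof (rule loc_constI)
  fix x assume x: "x \<in> S"
  have o: "open {y. h y > 0}" "open {y. h y < 0}"
    using assms(1) by (auto intro!: open_Collect_less continuous_intros)
  show "\<exists>W. open W \<and> x \<in> W \<and> (\<forall>y\<in>W \<inter> S. (if h y > 0 then a else b) = (if h x > 0 then a else b))"
  proof (cases "h x > 0")
    case True then show ?thesis using o by (intro exI[of _ "{y. h y > 0}"]) auto
  next
    case False then show ?thesis using o assms(2)[OF x]
      by (intro exI[of _ "{y. h y < 0}"]) auto
  qed
qed

text \<open>A pasting argument for closed pieces: a point outside \<open>C1\<close> has a
  neighbourhood that misses \<open>C1\<close>, so each piece imposes a condition only at its own
  points.\<close>

lemma loc_const_Un_closed: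
  assumes "loc_const S1 c" "loc_const S2 c"
    and "closed C1" "closed C2" "T \<inter> C1 = S1" "T \<inter> C2 = S2" "T \<subseteq> C1 \<union> C2"
  shows "loc_const T c"
proof (rule loc_constI)
  fix x assume x: "x \<in> T"
  have 1: "\<exists>W. open W \<and> x \<in> W \<and> (\<forall>y\<in>W \<inter> S1. c y = c x)"
  proof (cases "x \<in> C1")
    case True then show ?thesis using assms(1,5) x by (auto simp: loc_const_def)
  next
    case False then show ?thesis using assms(3,5) by (intro exI[of _ "- C1"]) auto
  qed
  have 2: "\<exists>W. open W \<and> x \<in> W \<and> (\<forall>y\<in>W \<inter> S2. c y = c x)"
  proof (cases "x \<in> C2")
    case True then show ?thesis using assms(2,6) x by (auto simp: loc_const_def)
  next
    case False then show ?thesis using assms(4,6) by (intro exI[of _ "- C2"]) auto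
  qed
  obtain W1 where W1: "open W1" "x \<in> W1" "\<forall>y\<in>W1 \<inter> S1. c y = c x" using 1 by blast
  obtain W2 where W2: "open W2" "x \<in> W2" "\<forall>y\<in>W2 \<inter> S2. c y = c x" using 2 by blast
  have "c y = c x" if "y \<in> W1 \<inter> W2 \<inter> T" for y
    using that W1(3) W2(3) assms(5-7) by (cases "y \<in> C1") auto
  then show "\<exists>W. open W \<and> x \<in> W \<and> (\<forall>y\<in>W \<inter> T. c y = c x)"
    using W1 W2 by (intro exI[of _ "W1 \<inter> W2"]) auto
qed

section \<open>Cocycles, flat sections and their rigidity\<close>

definition local_system ::
  "'a::topological_space set \<Rightarrow> ('i \<Rightarrow> 'a set) \<Rightarrow> ('i \<Rightarrow> 'i \<Rightarrow> 'a \<Rightarrow> 'g::group_add) \<Rightarrow> bool" where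
  "local_system Om U k \<longleftrightarrow> (\<forall>i. open (U i)) \<and> Om = (\<Union>i. U i) \<and>
     (\<forall>i j. loc_const (U i \<inter> U j) (k i j)) \<and>
     (\<forall>i j l x. x \<in> U i \<inter> U j \<inter> U l \<longrightarrow> k i l x = k i j x + k j l x)"

text \<open>Sections are taken along a map \<open>\<gamma>\<close>, so that one notion serves open
  sets (\<open>\<gamma> = id\<close>), vertical lines and homotopies. Transitions act on the left;
  right translation by a constant therefore keeps a section flat.\<close>

definition flat_section ::
  "'t::topological_space set \<Rightarrow> ('t \<Rightarrow> 'a) \<Rightarrow> ('i \<Rightarrow> 'a set) \<Rightarrow> ('i \<Rightarrow> 'i \<Rightarrow> 'a \<Rightarrow> 'g::group_add)
    \<Rightarrow> ('i \<Rightarrow> 't \<Rightarrow> 'g) \<Rightarrow> bool" where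
  "flat_section T \<gamma> U k s \<longleftrightarrow> (\<forall>i. loc_const {t\<in>T. \<gamma> t \<in> U i} (s i)) \<and>
     (\<forall>i j. \<forall>t\<in>T. \<gamma> t \<in> U i \<inter> U j \<longrightarrow> s i t = k i j (\<gamma> t) + s j t)"

lemma local_system_cocycle:
  "local_system Om U k \<Longrightarrow> x \<in> U i \<Longrightarrow> x \<in> U j \<Longrightarrow> x \<in> U l \<Longrightarrow> k i l x = k i j x + k j l x"
  unfolding local_system_def by blast

lemma flat_sectionI:
  assumes "\<And>i. loc_const {t\<in>T. \<gamma> t \<in> U i} (s i)"
    and "\<And>i j t. t \<in> T \<Longrightarrow> \<gamma> t \<in> U i \<Longrightarrow> \<gamma> t \<in> U j \<Longrightarrow> s i t = k i j (\<gamma> t) + s j t"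
  shows "flat_section T \<gamma> U k s"
  using assms unfolding flat_section_def by blast

lemma flat_section_loc_const: "flat_section T \<gamma> U k s \<Longrightarrow> loc_const {t\<in>T. \<gamma> t \<in> U i} (s i)"
  unfolding flat_section_def by blast

lemma flat_sectionD:
  "flat_section T \<gamma> U k s \<Longrightarrow> t \<in> T \<Longrightarrow> \<gamma> t \<in> U i \<Longrightarrow> \<gamma> t \<in> U j \<Longrightarrow> s i t = k i j (\<gamma> t) + s j t"
  unfolding flat_section_def by blast

lemma flat_section_subset:
  assumes "flat_section T \<gamma> U k s" "T' \<subseteq> T"
  shows "flat_section T' \<gamma> U k s"
proof (rule flat_sectionI)
  show "loc_const {t\<in>T'. \<gamma> t \<in> U i} (s i)" for i
    by (rule loc_const_subset[OF flat_section_loc_const[OF assms(1)]]) (use assms(2) in auto)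
qed (use assms in \<open>blast intro: flat_sectionD[OF assms(1)]\<close>)

lemma flat_section_add:
  assumes "flat_section T \<gamma> U k s"
  shows "flat_section T \<gamma> U k (\<lambda>i t. s i t + a)"
proof (rule flat_sectionI)
  fix i j t assume "t \<in> T" "\<gamma> t \<in> U i" "\<gamma> t \<in> U j"
  from flat_sectionD[OF assms this] show "s i t + a = k i j (\<gamma> t) + (s j t + a)"
    by (metis add.assoc)
qed (rule loc_const_comp[OF flat_section_loc_const[OF assms]])

text \<open>Continuation for properties instead of values: inside a chart the values are locally
  constant, so \<open>P\<close> only has to survive the transitions. This later keeps holonomies
  inside a set closed under \<open>a - b + c\<close>.\<close>

lemma flat_section_invariant:
  assumes s: "flat_section T \<gamma> U k s" and T: "connected T" "continuous_on T \<gamma>"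
    and U: "\<And>i. open (U i)" "\<gamma> ` T \<subseteq> (\<Union>i. U i)"
    and P: "\<And>i j x g. x \<in> U i \<Longrightarrow> x \<in> U j \<Longrightarrow> P j g \<Longrightarrow> P i (k i j x + g)"
    and start: "t0 \<in> T" "\<gamma> t0 \<in> U i0" "P i0 (s i0 t0)"
    and t: "t \<in> T" "\<gamma> t \<in> U i"
  shows "P i (s i t)"
proof -
  define Q where "Q = (\<lambda>t. \<exists>i. \<gamma> t \<in> U i \<and> P i (s i t))"
  have all: "P i (s i t)" if "t \<in> T" "\<gamma> t \<in> U i" "Q t" for t i
  proof -
    obtain j where j: "\<gamma> t \<in> U j" "P j (s j t)" using \<open>Q t\<close> unfolding Q_def by blast
    show ?thesis
      unfolding flat_sectionD[OF s that(1,2) j(1)] by (rule P[OF that(2) j])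
  qed
  have "loc_const T Q"
  proof (rule loc_constI)
    fix x assume x: "x \<in> T"
    then obtain i where i: "\<gamma> x \<in> U i" using U by blast
    obtain W where W: "open W" "x \<in> W" "\<And>y. y \<in> W \<Longrightarrow> y \<in> T \<Longrightarrow> \<gamma> y \<in> U i \<Longrightarrow> s i y = s i x"
      using i x loc_constE[OF flat_section_loc_const[OF s], of x i] by (metis (mono_tags, lifting) mem_Collect_eq)
    obtain A where A: "open A" "A \<inter> T = \<gamma> -` U i \<inter> T"
      using T(2) U(1) by (metis continuous_on_open_invariant)
    have "Q y = Q x" if "y \<in> W \<inter> A \<inter> T" for y
    proof -
      have "\<gamma> y \<in> U i" "y \<in> T" using that A by blast+
      moreover have "s i y = s i x" using W(3) calculation that by blast
      ultimately show ?thesis using all[of y i] all[of x i] x i unfolding Q_def by metis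
    qed
    then show "\<exists>W. open W \<and> x \<in> W \<and> (\<forall>y\<in>W \<inter> T. Q y = Q x)"
      using A W i x by (intro exI[of _ "W \<inter> A"]) blast
  qed
  then have "Q t = Q t0" using loc_const_connected[OF _ T(1) t(1) start(1)] by blast
  then show ?thesis using all[OF t] start by (auto simp: Q_def)
qed

text \<open>The transition acting on the left cancels in \<open>- s + s'\<close>, so this difference
  is a function independent of the chart. Comparisons of sections are written in this order
  throughout.\<close>

lemma flat_section_diff:
  assumes "flat_section T \<gamma> U k s" "flat_section T \<gamma> U k s'"
    and "t \<in> T" "\<gamma> t \<in> U i" "\<gamma> t \<in> U j"
  shows "- s i t + s' i t = - s j t + s' j t"
proof -
  have "s i t = k i j (\<gamma> t) + s j t" "s' i t = k i j (\<gamma> t) + s' j t"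
    using flat_sectionD[OF assms(1,3,4,5)] flat_sectionD[OF assms(2,3,4,5)] by auto
  then have "- s i t + s' i t = - s j t + (- k i j (\<gamma> t) + k i j (\<gamma> t)) + s' j t"
    by (simp only: minus_add add.assoc)
  then show ?thesis by simp
qed

lemma flat_section_diff_loc_const:
  assumes s: "flat_section T \<gamma> U k s" "flat_section T \<gamma> U k s'"
    and T: "continuous_on T \<gamma>"
    and U: "\<And>i. open (U i)" "\<gamma> ` T \<subseteq> (\<Union>i. U i)"
    and d: "\<And>t i. t \<in> T \<Longrightarrow> \<gamma> t \<in> U i \<Longrightarrow> d t = - s i t + s' i t"
  shows "loc_const T d"
proof (rule loc_constI)
  fix x assume x: "x \<in> T"
  then obtain i where i: "\<gamma> x \<in> U i" using U by blast
  obtain A where A: "open A" "A \<inter> T = \<gamma> -` U i \<inter> T"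
    using T U(1) by (metis continuous_on_open_invariant)
  have "loc_const {t\<in>T. \<gamma> t \<in> U i} (\<lambda>t. - s i t + s' i t)"
    by (rule loc_const_comp2[where F="\<lambda>u v. - u + v", OF flat_section_loc_const[OF s(1)] flat_section_loc_const[OF s(2)]])
  then obtain W where W: "open W" "x \<in> W"
      "\<And>y. y \<in> W \<Longrightarrow> y \<in> {t\<in>T. \<gamma> t \<in> U i} \<Longrightarrow> - s i y + s' i y = - s i x + s' i x"
    using loc_constE[of "{t\<in>T. \<gamma> t \<in> U i}" _ x] x i
    by (metis (mono_tags, lifting) mem_Collect_eq)
  have "d y = d x" if "y \<in> W \<inter> A \<inter> T" for y
  proof -
    have "\<gamma> y \<in> U i" "y \<in> T" using that A by blast+
    then show ?thesis using d[of y i] d[of x i] W(3)[of y] x i that by auto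
  qed
  then show "\<exists>W. open W \<and> x \<in> W \<and> (\<forall>y\<in>W \<inter> T. d y = d x)"
    using A W i x by (intro exI[of _ "W \<inter> A"]) blast
qed

lemma flat_section_unique:
  assumes s: "flat_section T \<gamma> U k s" "flat_section T \<gamma> U k s'"
    and T: "connected T" "continuous_on T \<gamma>"
    and U: "\<And>i. open (U i)" "\<gamma> ` T \<subseteq> (\<Union>i. U i)"
    and start: "t0 \<in> T" "\<gamma> t0 \<in> U i0" "s i0 t0 = s' i0 t0"
    and t: "t \<in> T" "\<gamma> t \<in> U i"
  shows "s i t = s' i t"
proof -
  define d where "d t = (let i = SOME i. \<gamma> t \<in> U i in - s i t + s' i t)" for t
  have d: "d t = - s i t + s' i t" if "t \<in> T" "\<gamma> t \<in> U i" for t i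
  proof -
    have "\<gamma> t \<in> U (SOME i. \<gamma> t \<in> U i)" using that(2) by (rule someI)
    then show ?thesis
      using flat_section_diff[OF s that(1) _ that(2)] by (simp add: d_def Let_def)
  qed
  have "loc_const T d" using flat_section_diff_loc_const[OF s T(2) U d] .
  then have "d t = d t0" using loc_const_connected T(1) t(1) start(1) by metis
  then show ?thesis
    using d[OF t] d[OF start(1,2)] start(3)
    by (metis left_minus minus_unique minus_minus)
qed

section \<open>Existence of flat sections by continuation along homotopies\<close>

lemma flat_section_along_homotopy:
  fixes H :: "'t::topological_space \<times> real \<Rightarrow> 'a::topological_space"
  assumes ls: "local_system Om U k" and V: "open V"
    and H: "continuous_on (V \<times> {0..1}) H" "H ` (V \<times> {0..1}) \<subseteq> Om"
    and x0: "x0 \<in> V"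
  shows "\<exists>W s. open W \<and> x0 \<in> W \<and> W \<subseteq> V \<and> flat_section (W \<times> {0..1}) H U k s"
proof -
  have oU: "\<And>i. open (U i)" and cov: "Om = (\<Union>i. U i)"
    and cc: "\<And>i j l x. x \<in> U i \<inter> U j \<inter> U l \<Longrightarrow> k i l x = k i j x + k j l x"
    and lc: "\<And>i j. loc_const (U i \<inter> U j) (k i j)"
    for i using ls unfolding local_system_def by blast+
  define P where "P a b \<longleftrightarrow> 0 \<le> a \<longrightarrow> b \<le> 1 \<longrightarrow>
    (\<exists>W s. open W \<and> x0 \<in> W \<and> W \<subseteq> V \<and> flat_section (W \<times> {a..b}) H U k s)" for a b
  have "P 0 (1::real)"
  proof (rule Bolzano)
    show "0 \<le> (1::real)" by simp
  next
    fix a b c assume trans: "P a b" "P b c" "a \<le> b" "b \<le> c"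
    show "P a c" unfolding P_def
    proof (intro impI)
      assume ac: "0 \<le> a" "c \<le> 1"
      have "b \<le> 1" "0 \<le> b" using trans ac by auto
      obtain W1 s1 where 1: "open W1" "x0 \<in> W1" "W1 \<subseteq> V" "flat_section (W1 \<times> {a..b}) H U k s1"
        using trans(1) ac(1) \<open>b \<le> 1\<close> unfolding P_def by blast
      obtain W2 s2 where 2: "open W2" "x0 \<in> W2" "W2 \<subseteq> V" "flat_section (W2 \<times> {b..c}) H U k s2"
        using trans(2) ac(2) \<open>0 \<le> b\<close> unfolding P_def by blast
      have b01: "b \<in> {0..1}" using trans ac by auto
      then obtain i where i: "H (x0, b) \<in> U i" using H(2) x0 cov by blast
      let ?W = "W1 \<inter> W2"
      have cs: "continuous_on ?W (\<lambda>x. H (x, b))"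
        using H(1) 1 b01 by (intro continuous_on_compose2[OF H(1)] continuous_intros) auto
      have "loc_const {x\<in>?W. H (x, b) \<in> U i} (\<lambda>x. s1 i (x, b))"
        using trans(3)
        by (intro loc_const_vimage[OF _ flat_section_loc_const[OF 1(4)], of _ "\<lambda>x. (x,b)"]) (auto intro!: continuous_intros)
      moreover have "loc_const {x\<in>?W. H (x, b) \<in> U i} (\<lambda>x. s2 i (x, b))"
        using trans(4)
        by (intro loc_const_vimage[OF _ flat_section_loc_const[OF 2(4)], of _ "\<lambda>x. (x,b)"]) (auto intro!: continuous_intros)
      ultimately have "loc_const {x\<in>?W. H (x, b) \<in> U i} (\<lambda>x. - s2 i (x, b) + s1 i (x, b))"
        using loc_const_comp2[where F="\<lambda>u v. - v + u"] by blast
      then obtain A where A: "open A" "x0 \<in> A" "\<And>y. y \<in> A \<Longrightarrow> y \<in> ?W \<Longrightarrow> H (y, b) \<in> U i \<Longrightarrow>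
          - s2 i (y, b) + s1 i (y, b) = - s2 i (x0, b) + s1 i (x0, b)"
        using loc_constE[of "{x\<in>?W. H (x, b) \<in> U i}" "\<lambda>x. - s2 i (x, b) + s1 i (x, b)" x0] 1(2) 2(2) i
        by (metis (mono_tags, lifting) IntI mem_Collect_eq)
      obtain B where B: "open B" "B \<inter> ?W = (\<lambda>x. H (x, b)) -` U i \<inter> ?W"
        using cs oU by (metis continuous_on_open_invariant)
      define W where "W = ?W \<inter> A \<inter> B"
      have W: "open W" "x0 \<in> W" "W \<subseteq> V" "W \<subseteq> W1" "W \<subseteq> W2"
        using 1 2 A B i by (auto simp: W_def)
      \<comment> \<open>The mismatch of the two pieces at time \<open>b\<close> is locally constant
        in \<open>x\<close> and does not depend on the chart. Hence its value at \<open>x0\<close>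
        repairs it on all of the shrunken neighbourhood \<open>W\<close>.\<close>
      define a0 where "a0 = - s2 i (x0, b) + s1 i (x0, b)"
      define s2' where "s2' = (\<lambda>j t. s2 j t + a0)"
      have f2: "flat_section (W \<times> {b..c}) H U k s2'"
        unfolding s2'_def using 2(4) W by (intro flat_section_add) (auto elim: flat_section_subset)
      have f1: "flat_section (W \<times> {a..b}) H U k s1"
        using 1(4) W by (auto elim: flat_section_subset)
      have eqi: "s1 i (x, b) = s2' i (x, b)" if "x \<in> W" for x
      proof -
        have "H (x, b) \<in> U i" using that B by (auto simp: W_def)
        then have "- s2 i (x, b) + s1 i (x, b) = a0"
          using A(3)[of x] that by (auto simp: W_def a0_def)
        then show ?thesis unfolding s2'_def by (metis add.assoc add.right_inverse add_0)
      qed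
      have eq: "s1 j (x, b) = s2' j (x, b)" if "x \<in> W" "H (x, b) \<in> U j" for x j
      proof -
        have "H (x, b) \<in> U i" using that B by (auto simp: W_def)
        then have "s1 j (x, b) = k j i (H (x,b)) + s1 i (x, b)"
            "s2' j (x, b) = k j i (H (x,b)) + s2' i (x, b)"
          using flat_sectionD[OF f1, of "(x,b)" j i] flat_sectionD[OF f2, of "(x,b)" j i] that trans(3,4) by auto
        then show ?thesis using eqi that by simp
      qed
      define s where "s = (\<lambda>j t. if snd t \<le> b then s1 j t else s2' j t)"
      have s1: "s j t = s1 j t" if "t \<in> W \<times> {a..b}" for j t
        using that by (auto simp: s_def)
      have s2: "s j t = s2' j t" if "t \<in> W \<times> {b..c}" "H t \<in> U j" for j t
      proof (cases "snd t = b")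
        case True then show ?thesis using eq[of "fst t" j] that by (cases t) (auto simp: s_def)
      next
        case False then show ?thesis using that by (auto simp: s_def)
      qed
      have "flat_section (W \<times> {a..c}) H U k s"
      proof (rule flat_sectionI)
        fix j
        have l1: "loc_const {t \<in> W \<times> {a..b}. H t \<in> U j} (s j)"
          using flat_section_loc_const[OF f1] by (subst loc_const_cong[of _ _ "s1 j"]) (auto simp: s1)
        have l2: "loc_const {t \<in> W \<times> {b..c}. H t \<in> U j} (s j)"
          using flat_section_loc_const[OF f2] by (subst loc_const_cong[of _ _ "s2' j"]) (auto simp: s2)
        have cl: "closed {t::'t \<times> real. snd t \<le> b}" "closed {t::'t \<times> real. b \<le> snd t}"
          by (auto intro!: closed_Collect_le continuous_intros)
        show "loc_const {t \<in> W \<times> {a..c}. H t \<in> U j} (s j)"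
          using trans(3,4) by (intro loc_const_Un_closed[OF l1 l2 cl]) auto
      next
        fix i j t assume t: "t \<in> W \<times> {a..c}" "H t \<in> U i" "H t \<in> U j"
        show "s i t = k i j (H t) + s j t"
        proof (cases "snd t \<le> b")
          case True
          then have "t \<in> W \<times> {a..b}" using t by auto
          then show ?thesis using flat_sectionD[OF f1 _ t(2,3)] s1 by metis
        next
          case False
          then have "t \<in> W \<times> {b..c}" using t by auto
          then show ?thesis using flat_sectionD[OF f2 _ t(2,3)] t s2 by metis
        qed
      qed
      then show "\<exists>W s. open W \<and> x0 \<in> W \<and> W \<subseteq> V \<and> flat_section (W \<times> {a..c}) H U k s"
        using W by blast
    qed
  next
    fix t :: real assume local: "0 \<le> t" "t \<le> 1"
    have t: "(x0, t) \<in> V \<times> {0..1}" using x0 local by auto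
    then obtain i where i: "H (x0, t) \<in> U i" using H(2) cov by blast
    obtain A where A: "open A" "A \<inter> (V \<times> {0..1}) = H -` U i \<inter> (V \<times> {0..1})"
      using H(1) oU by (metis continuous_on_open_invariant)
    have "(x0, t) \<in> A" using A(2) i t by blast
    then obtain W I where WI: "open W" "open I" "x0 \<in> W" "t \<in> I" "W \<times> I \<subseteq> A"
      using A(1) by (metis open_prod_elim mem_Times_iff fst_conv snd_conv)
    obtain d where d: "d > 0" "ball t d \<subseteq> I" using WI(2,4) open_contains_ball by blast
    show "\<exists>d>0. \<forall>a b. a \<le> t \<and> t \<le> b \<and> b - a < d \<longrightarrow> P a b"
    proof (intro exI[of _ d] conjI allI impI d)
      fix a b assume ab: "a \<le> t \<and> t \<le> b \<and> b - a < d"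
      then have "{a..b} \<subseteq> I" using d(2) by (auto simp: dist_real_def subset_iff)
      show "P a b" unfolding P_def
      proof (intro impI exI conjI)
        assume "0 \<le> a" "b \<le> 1"
        \<comment> \<open>Over a short time interval the homotopy stays in the single chart
          \<open>U i\<close>; this is the section whose value in chart \<open>i\<close> is
          0.\<close>
        let ?s = "\<lambda>j t. k j i (H t)"
        show "open (W \<inter> V)" "x0 \<in> W \<inter> V" "W \<inter> V \<subseteq> V" using WI V x0 by auto
        have sub: "H ` ((W \<inter> V) \<times> {a..b}) \<subseteq> U i"
        proof -
          have "(W \<inter> V) \<times> {a..b} \<subseteq> A \<inter> (V \<times> {0..1})"
            using WI(5) \<open>{a..b} \<subseteq> I\<close> \<open>0 \<le> a\<close> \<open>b \<le> 1\<close> by fastforce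
          then show ?thesis using A(2) by blast
        qed
        have cH: "continuous_on {t \<in> (W \<inter> V) \<times> {a..b}. H t \<in> U j} H" for j
          using \<open>0 \<le> a\<close> \<open>b \<le> 1\<close> by (intro continuous_on_subset[OF H(1)]) auto
        show "flat_section ((W \<inter> V) \<times> {a..b}) H U k ?s"
        proof (rule flat_sectionI)
          fix j
          show "loc_const {t \<in> (W \<inter> V) \<times> {a..b}. H t \<in> U j} (?s j)"
            by (rule loc_const_vimage[OF cH lc]) (use sub in blast)
        next
          fix j l t assume t: "t \<in> (W \<inter> V) \<times> {a..b}" "H t \<in> U j" "H t \<in> U l"
          then have "H t \<in> U j \<inter> U l \<inter> U i" using sub by blast
          then show "?s j t = k j l (H t) + ?s l t" by (rule cc)
        qed
      qed
    qed
  qed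
  then show ?thesis unfolding P_def by auto
qed

text \<open>The homotopy ends in one chart \<open>U i0\<close> for all points of \<open>V\<close>.
  Requiring the value 0 there at time 1 makes the local sections along the homotopy canonical, so
  their restrictions to time 0 agree and glue.\<close>

lemma flat_section_exists:
  fixes H :: "'a::topological_space \<times> real \<Rightarrow> 'a"
  assumes ls: "local_system Om U k" and V: "open V"
    and H: "continuous_on (V \<times> {0..1}) H" "H ` (V \<times> {0..1}) \<subseteq> Om"
    and H0: "\<And>x. x \<in> V \<Longrightarrow> H (x, 0) = x" and H1: "\<And>x. x \<in> V \<Longrightarrow> H (x, 1) \<in> U i0"
  obtains s where "flat_section V id U k s"
proof -
  have oU: "\<And>i. open (U i)" and cov: "Om = (\<Union>i. U i)"
    using ls unfolding local_system_def by blast+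
  have "\<exists>W s. open W \<and> x \<in> W \<and> W \<subseteq> V \<and> flat_section (W \<times> {0..1}) H U k s \<and>
      (\<forall>y\<in>W. s i0 (y, 1) = 0)" if x: "x \<in> V" for x
  proof -
    obtain W s where W: "open W" "x \<in> W" "W \<subseteq> V" "flat_section (W \<times> {0..1}) H U k s"
      using flat_section_along_homotopy[OF ls V H x] by blast
    have "loc_const W (\<lambda>y. s i0 (y, 1))"
      using W(3) H1
      by (intro loc_const_vimage[OF _ flat_section_loc_const[OF W(4)], of _ "\<lambda>y. (y, 1)"])
         (auto intro!: continuous_intros)
    then obtain A where A: "open A" "x \<in> A" "\<And>y. y \<in> A \<Longrightarrow> y \<in> W \<Longrightarrow> s i0 (y, 1) = s i0 (x, 1)"
      using loc_constE[OF _ W(2), of "\<lambda>y. s i0 (y, 1)"] by metis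
    have "flat_section ((W \<inter> A) \<times> {0..1}) H U k (\<lambda>i t. s i t + (- s i0 (x, 1)))"
      using W(4) by (intro flat_section_add) (auto elim: flat_section_subset)
    moreover have "s i0 (y, 1) + - s i0 (x, 1) = 0" if "y \<in> W \<inter> A" for y
      using A(3)[of y] that by (metis IntD1 IntD2 add.right_inverse)
    moreover have "open (W \<inter> A)" "x \<in> W \<inter> A" "W \<inter> A \<subseteq> V" using W(1-3) A(1,2) by auto
    ultimately show ?thesis by (metis (no_types, lifting))
  qed
  then obtain W s where W: "\<And>x. x \<in> V \<Longrightarrow> open (W x)" "\<And>x. x \<in> V \<Longrightarrow> x \<in> W x"
      "\<And>x. x \<in> V \<Longrightarrow> W x \<subseteq> V" "\<And>x. x \<in> V \<Longrightarrow> flat_section (W x \<times> {0..1}) H U k (s x)"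
      "\<And>x y. x \<in> V \<Longrightarrow> y \<in> W x \<Longrightarrow> s x i0 (y, 1) = 0"
    by metis
  define \<sigma> where "\<sigma> = (\<lambda>i x. s x i (x, 0))"
  have eq: "s x i (y, 0) = \<sigma> i y" if "x \<in> V" "y \<in> W x" "y \<in> U i" for x y i
  proof -
    have y: "y \<in> V" using that W by blast
    show ?thesis unfolding \<sigma>_def
    proof (rule flat_section_unique[of "{y} \<times> {0..1}" H U k])
      show "flat_section ({y} \<times> {0..1}) H U k (s x)" "flat_section ({y} \<times> {0..1}) H U k (s y)"
        using W(4)[of x] W(4)[of y] W(2)[of y] that y by (auto elim!: flat_section_subset)
      show "connected ({y} \<times> {0..1::real})" by (intro connected_Times) auto
      show "continuous_on ({y} \<times> {0..1}) H" using y by (auto intro: continuous_on_subset[OF H(1)])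
      show "H ` ({y} \<times> {0..1}) \<subseteq> (\<Union>i. U i)" using y H(2) cov by blast
      show "(y, 1) \<in> {y} \<times> {0..1::real}" "(y, 0) \<in> {y} \<times> {0..1::real}" by auto
      show "H (y, 1) \<in> U i0" using H1 y by blast
      show "s x i0 (y, 1) = s y i0 (y, 1)" using W(5)[of x y] W(5)[of y y] W(2) that y by simp
      show "H (y, 0) \<in> U i" using H0 y that by simp
    qed (use oU in auto)
  qed
  have "flat_section V id U k \<sigma>"
  proof (rule flat_sectionI)
    fix i
    show "loc_const {t \<in> V. id t \<in> U i} (\<sigma> i)"
    proof (rule loc_constI)
      fix x assume x: "x \<in> {t \<in> V. id t \<in> U i}"
      have "loc_const {t \<in> W x. t \<in> U i} (\<lambda>y. s x i (y, 0))"
        using W(3)[of x] x H0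
        by (intro loc_const_vimage[OF _ flat_section_loc_const[OF W(4)], of _ "\<lambda>y. (y, 0)"])
           (auto intro!: continuous_intros)
      moreover have "x \<in> {t \<in> W x. t \<in> U i}" using x W by auto
      ultimately obtain A where A: "open A" "x \<in> A"
          "\<And>y. y \<in> A \<Longrightarrow> y \<in> {t \<in> W x. t \<in> U i} \<Longrightarrow> s x i (y, 0) = s x i (x, 0)"
        using loc_constE[of "{t \<in> W x. t \<in> U i}" "\<lambda>y. s x i (y, 0)" x] by metis
      have "x \<in> V" "x \<in> U i" using x by auto
      then have "\<sigma> i y = \<sigma> i x" if "y \<in> A \<inter> W x" "y \<in> U i" for y
        using A(3)[of y] that eq[of x y i] eq[of x x i] W(2)[of x] by (metis (mono_tags, lifting) IntD1 IntD2 mem_Collect_eq)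
      moreover have "open (A \<inter> W x)" "x \<in> A \<inter> W x" using A W \<open>x \<in> V\<close> by auto
      ultimately show "\<exists>W. open W \<and> x \<in> W \<and> (\<forall>y\<in>W \<inter> {t \<in> V. id t \<in> U i}. \<sigma> i y = \<sigma> i x)"
        by (metis (mono_tags, lifting) IntD1 IntD2 id_apply mem_Collect_eq)
    qed
  next
    fix i j x assume x: "x \<in> V" "id x \<in> U i" "id x \<in> U j"
    then have "(x, 0) \<in> W x \<times> {0..1::real}" "H (x, 0) \<in> U i" "H (x, 0) \<in> U j" using W H0 by auto
    from flat_sectionD[OF W(4)[OF x(1)] this] show "\<sigma> i x = k i j (id x) + \<sigma> j x"
      unfolding \<sigma>_def H0[OF x(1)] by simp
  qed
  then show ?thesis using that by blast
qed

lemma local_system_transfer: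
  assumes "local_system Om U k" "homeomorphism UNIV UNIV f g"
  shows "local_system (f ` Om) (\<lambda>i. f ` U i) (\<lambda>i j x. k i j (g x))"
  unfolding local_system_def
proof (intro conjI allI impI)
  have gf: "\<And>x. g (f x) = x" "\<And>x. f (g x) = x" using assms(2) by (auto simp: homeomorphism_def)
  have fU: "f ` A = g -` A" for A using gf by (auto simp: image_iff) metis
  have cg: "continuous_on UNIV g" using assms(2) by (auto simp: homeomorphism_def)
  fix i show "open (f ` U i)" unfolding fU
    using assms(1) cg by (auto simp: local_system_def intro: open_vimage)
  show "f ` Om = (\<Union>i. f ` U i)" using assms(1) by (auto simp: local_system_def)
  fix j show "loc_const (f ` U i \<inter> f ` U j) (\<lambda>x. k i j (g x))"
    using assms(1) unfolding local_system_def fU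
    by (intro loc_const_vimage[of _ g "U i \<inter> U j"] continuous_on_subset[OF cg]) auto
  fix l x assume "x \<in> f ` U i \<inter> f ` U j \<inter> f ` U l"
  then show "k i l (g x) = k i j (g x) + k j l (g x)"
    using assms(1) unfolding local_system_def fU by blast
qed

section \<open>The geometry of a link in regular position\<close>

definition cross :: "plane \<Rightarrow> plane \<Rightarrow> real" where
  "cross u w = fst u * snd w - snd u * fst w"

lemma left_of_cross: "left_of u w \<longleftrightarrow> cross u w > 0"
  and right_of_cross: "right_of u w \<longleftrightarrow> cross u w < 0"
  by (simp_all add: left_of_def right_of_def cross_def)

lemma cross_diff: "cross u (v - w) = cross u v - cross u w"
  and cross_add: "cross u (v + w) = cross u v + cross u w"
  and cross_scaleR: "cross u (c *\<^sub>R w) = c * cross u w" "cross (c *\<^sub>R u) w = c * cross u w"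
  and cross_self [simp]: "cross u u = 0" and cross_zero [simp]: "cross u 0 = 0" "cross 0 u = 0"
  and cross_minus: "cross u (- w) = - cross u w"
  and cross_commute: "cross w u = - cross u w"
  by (simp_all add: cross_def algebra_simps)

lemma continuous_on_cross [continuous_intros]:
  "continuous_on S f \<Longrightarrow> continuous_on S g \<Longrightarrow> continuous_on S (\<lambda>x. cross (f x) (g x))"
  unfolding cross_def by (intro continuous_intros)

lemma cross_sgn: "cross (sgn u) w = cross u w / norm u" 
  by (simp add: sgn_div_norm cross_scaleR divide_inverse mult.commute)

lemma cross_eq_0_imp:
  assumes "cross d w = 0" "d \<noteq> 0"
  shows "w = ((w \<bullet> d) / (d \<bullet> d)) *\<^sub>R d"
proof -
  obtain d1 d2 w1 w2 where [simp]: "d = (d1, d2)" "w = (w1, w2)" by (cases d, cases w)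
  have nz: "d1 * d1 + d2 * d2 \<noteq> 0"
    using assms(2) by (auto simp: sum_squares_eq_zero_iff zero_prod_def)
  have c: "d1 * w2 = d2 * w1" using assms(1) by (simp add: cross_def)
  have "w1 * (d1 * d1 + d2 * d2) = (w1 * d1 + w2 * d2) * d1"
    "w2 * (d1 * d1 + d2 * d2) = (w1 * d1 + w2 * d2) * d2"
    using c by algebra+
  then show ?thesis using nz by (simp add: inner_prod_def field_simps)
qed

lemma cross_basis:
  assumes "cross u v \<noteq> 0"
  shows "w = (cross w v / cross u v) *\<^sub>R u + (cross u w / cross u v) *\<^sub>R v"
proof -
  obtain a b where [simp]: "u = (a, b)" by (cases u)
  obtain c d where [simp]: "v = (c, d)" by (cases v)
  obtain e f where [simp]: "w = (e, f)" by (cases w)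
  define k where "k = a * d - b * c"
  have k: "k \<noteq> 0" using assms by (simp add: cross_def k_def)
  have "e * k = (e * d - f * c) * a + (a * f - b * e) * c"
    "f * k = (e * d - f * c) * b + (a * f - b * e) * d"
    unfolding k_def by algebra+
  then have "e = ((e * d - f * c) * a + (a * f - b * e) * c) / k"
    "f = ((e * d - f * c) * b + (a * f - b * e) * d) / k"
    using k by (simp_all add: eq_divide_eq)
  then show ?thesis by (simp add: cross_def flip: k_def) (simp add: add_divide_distrib)
qed

lemma underlying_curve_projection: "underlying_curve (projection L) = fst ` support L"
  unfolding underlying_curve_def projection_def support_def by (force simp: image_iff)

lemma compact_support: "oriented_link L \<Longrightarrow> compact (support L)"
  unfolding oriented_link_def support_def by (auto intro!: compact_UN)

lemma compact_curve: "oriented_link L \<Longrightarrow> compact (fst ` support L)"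
  by (intro compact_continuous_image continuous_intros compact_support)

section \<open>The space above and below the link\<close>

definition above :: "directed_edges \<Rightarrow> space set" where
  "above L = {X. \<forall>Y\<in>support L. fst Y = fst X \<longrightarrow> snd Y < snd X}"

definition below :: "directed_edges \<Rightarrow> space set" where
  "below L = {X. \<forall>Y\<in>support L. fst Y = fst X \<longrightarrow> snd X < snd Y}"

text \<open>The complement is the sum of the compact support and a closed vertical ray, and a sum of
  a compact and a closed set is closed.\<close>

lemma open_above:
  assumes "oriented_link L"
  shows "open (above L)"
proof -
  have "- above L = (\<Union>Y\<in>support L. \<Union>Z\<in>{0} \<times> {..0}. {Y + Z})"
  proof (intro set_eqI iffI)
    fix X assume "X \<in> - above L"
    then obtain Y where Y: "Y \<in> support L" "fst Y = fst X" "snd X \<le> snd Y"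
      by (auto simp: above_def not_less)
    then show "X \<in> (\<Union>Y\<in>support L. \<Union>Z\<in>{0} \<times> {..0}. {Y + Z})"
      using Y by (intro UN_I[of Y] UN_I[of "(0, snd X - snd Y)"]) (auto simp: prod_eq_iff)
  qed (force simp: above_def not_less)
  moreover have "closed (\<Union>Y\<in>support L. \<Union>Z\<in>{0} \<times> {..0}. {Y + Z})"
    using compact_closed_sums[OF compact_support[OF assms], of "{0} \<times> {..0}"]
    by (simp add: closed_Times)
  ultimately show ?thesis by (simp add: open_closed)
qed

lemma open_below:
  assumes "oriented_link L"
  shows "open (below L)"
proof -
  have "- below L = (\<Union>Y\<in>support L. \<Union>Z\<in>{0} \<times> {0..}. {Y + Z})"
  proof (intro set_eqI iffI)
    fix X assume "X \<in> - below L"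
    then obtain Y where Y: "Y \<in> support L" "fst Y = fst X" "snd Y \<le> snd X"
      by (auto simp: below_def not_less)
    then show "X \<in> (\<Union>Y\<in>support L. \<Union>Z\<in>{0} \<times> {0..}. {Y + Z})"
      using Y by (intro UN_I[of Y] UN_I[of "(0, snd X - snd Y)"]) (auto simp: prod_eq_iff)
  qed (force simp: below_def not_less)
  moreover have "closed (\<Union>Y\<in>support L. \<Union>Z\<in>{0} \<times> {0..}. {Y + Z})"
    using compact_closed_sums[OF compact_support[OF assms], of "{0} \<times> {0..}"]
    by (simp add: closed_Times)
  ultimately show ?thesis by (simp add: open_closed)
qed

lemma above_Int_below: "X \<in> above L \<and> X \<in> below L \<longleftrightarrow> fst X \<notin> fst ` support L"
proof
  assume "X \<in> above L \<and> X \<in> below L"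
  then show "fst X \<notin> fst ` support L"
    unfolding above_def below_def image_iff by (metis (mono_tags, lifting) less_asym mem_Collect_eq)
next
  assume "fst X \<notin> fst ` support L"
  then show "X \<in> above L \<and> X \<in> below L"
    unfolding above_def below_def image_iff by simp metis
qed

lemma above_notin_support: "X \<in> above L \<Longrightarrow> X \<notin> support L"
  and below_notin_support: "X \<in> below L \<Longrightarrow> X \<notin> support L"
  by (auto simp: above_def below_def)

section \<open>Local shape of the link over a point of the plane\<close>

lemma regular_position_vertex:
  "regular_position L \<Longrightarrow> v \<in> vertices L \<Longrightarrow> Y \<in> support L \<Longrightarrow> fst Y = fst v \<Longrightarrow> Y = v"
  unfolding regular_position_def by blast

lemma edge_in_support: "(P, Q) \<in> L \<Longrightarrow> Y \<in> closed_segment P Q \<Longrightarrow> Y \<in> support L"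
  unfolding support_def by blast

lemma edge_vertices: "(P, Q) \<in> L \<Longrightarrow> P \<in> vertices L" "(P, Q) \<in> L \<Longrightarrow> Q \<in> vertices L"
  unfolding vertices_def by (force)+

lemma edges_meet_in_vertices:
  assumes "oriented_link L" "(P, Q) \<in> L" "(P', Q') \<in> L" "(P, Q) \<noteq> (P', Q')"
  shows "closed_segment P Q \<inter> closed_segment P' Q' \<subseteq> {P, Q} \<inter> {P', Q'}"
proof -
  have "\<forall>(P, Q)\<in>L. \<forall>(P', Q')\<in>L. (P, Q) \<noteq> (P', Q') \<longrightarrow>
        closed_segment P Q \<inter> closed_segment P' Q' \<subseteq> {P, Q} \<inter> {P', Q'}"
    using assms(1) by (simp add: oriented_link_def)
  from bspec[OF bspec[OF this assms(2), simplified prod.case] assms(3)] show ?thesis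
    using assms(4) by simp
qed

lemma regular_edge_not_vertical:
  assumes "oriented_link L" "regular_position L" "(P, Q) \<in> L"
  shows "fst P \<noteq> fst Q"
proof
  assume "fst P = fst Q"
  then have "P = Q"
    using regular_position_vertex[OF assms(2) edge_vertices(2)[OF assms(3)]
        edge_in_support[OF assms(3)]] by simp
  then show False using assms(1,3) unfolding oriented_link_def by blast
qed

text \<open>The height over \<open>q\<close> of the line through \<open>P\<close>, \<open>Q\<close>, extended constantly in the
  direction perpendicular to its projection.\<close>

definition edge_height :: "space \<Rightarrow> space \<Rightarrow> plane \<Rightarrow> real" where
  "edge_height P Q q = snd P + (snd Q - snd P) *
     (((q - fst P) \<bullet> (fst Q - fst P)) / ((fst Q - fst P) \<bullet> (fst Q - fst P)))"

lemma edge_height_line: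
  assumes "fst P \<noteq> fst Q" "Y = (1 - t) *\<^sub>R P + t *\<^sub>R Q"
  shows "snd Y = edge_height P Q (fst Y)" "cross (fst Q - fst P) (fst Y - fst P) = 0"
proof -
  have d: "fst Y - fst P = t *\<^sub>R (fst Q - fst P)"
    unfolding assms(2) by (simp add: algebra_simps)
  show "cross (fst Q - fst P) (fst Y - fst P) = 0" unfolding d by (simp add: cross_scaleR)
  show "snd Y = edge_height P Q (fst Y)"
  proof -
    have "(t *\<^sub>R (fst Q - fst P)) \<bullet> (fst Q - fst P) / ((fst Q - fst P) \<bullet> (fst Q - fst P)) = t"
      using assms(1) by simp
    then show ?thesis unfolding edge_height_def d by (simp add: assms(2) algebra_simps)
  qed
qed

lemma continuous_on_edge_height [continuous_intros]:
  "continuous_on S f \<Longrightarrow> continuous_on S (\<lambda>x. edge_height P Q (f x))"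
  unfolding edge_height_def divide_inverse by (intro continuous_intros)

text \<open>Over a disc of this radius the segment parameter changes by less than
  \<open>min t (1 - t)\<close>, so the ends of the edge are out of reach and only the equations of
  the line remain.\<close>

lemma edge_cylinder:
  assumes PQ: "fst P \<noteq> fst Q" and Y: "Y \<in> open_segment P Q"
  shows "\<exists>r>0. \<forall>X. fst X \<in> ball (fst Y) r \<longrightarrow>
    (X \<in> closed_segment P Q \<longleftrightarrow>
      cross (fst Q - fst P) (fst X - fst Y) = 0 \<and> snd X = edge_height P Q (fst X))"
proof -
  define d where "d = fst Q - fst P"
  have d: "d \<noteq> 0" using PQ by (simp add: d_def)
  obtain t where t: "0 < t" "t < 1" "Y = (1 - t) *\<^sub>R P + t *\<^sub>R Q"
    using Y by (auto simp: in_segment)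
  have Yd: "fst Y - fst P = t *\<^sub>R d" unfolding t(3) d_def by (simp add: algebra_simps)
  define r where "r = min t (1 - t) * norm d"
  have "r > 0" using t d by (simp add: r_def)
  moreover have "X \<in> closed_segment P Q \<longleftrightarrow>
      cross d (fst X - fst Y) = 0 \<and> snd X = edge_height P Q (fst X)"
    if X: "fst X \<in> ball (fst Y) r" for X
  proof
    assume "X \<in> closed_segment P Q"
    then obtain s where "X = (1 - s) *\<^sub>R P + s *\<^sub>R Q" by (auto simp: in_segment)
    note s = edge_height_line[OF PQ this] 
    have "cross d (fst X - fst P) - cross d (fst Y - fst P) = 0"
      using s(2) edge_height_line(2)[OF PQ t(3)] by (simp add: d_def)
    then show "cross d (fst X - fst Y) = 0 \<and> snd X = edge_height P Q (fst X)"
      using s(1) by (simp add: cross_diff)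
  next
    assume X': "cross d (fst X - fst Y) = 0 \<and> snd X = edge_height P Q (fst X)"
    define c where "c = ((fst X - fst Y) \<bullet> d) / (d \<bullet> d)"
    have c: "fst X - fst Y = c *\<^sub>R d" unfolding c_def using cross_eq_0_imp d X' by blast
    have "norm (fst X - fst Y) < min t (1 - t) * norm d"
      using X by (simp add: r_def dist_norm norm_minus_commute)
    then have "\<bar>c\<bar> < min t (1 - t)" using d by (simp add: c)
    then have tc: "0 \<le> t + c" "t + c \<le> 1" by auto
    define Z where "Z = (1 - (t + c)) *\<^sub>R P + (t + c) *\<^sub>R Q"
    have "fst X - fst P = (t + c) *\<^sub>R d"
      using c Yd by (simp add: algebra_simps)
    then have "fst Z = fst X" unfolding Z_def d_def by (simp add: algebra_simps)
    moreover have "snd Z = snd X"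
      using edge_height_line(1)[OF PQ Z_def] X' calculation by simp
    ultimately have "Z = X" by (simp add: prod_eq_iff)
    then show "X \<in> closed_segment P Q" using tc Z_def by (auto simp: in_segment)
  qed
  ultimately show ?thesis unfolding d_def by blast
qed

text \<open>The finitely many projected edges that miss \<open>p\<close> form a compact set, which
  has positive distance from \<open>p\<close>.\<close>

lemma support_over_small_ball:
  assumes "oriented_link L"
  shows "\<exists>r>0. \<forall>X\<in>support L. fst X \<in> ball p r \<longrightarrow>
    (\<exists>(P, Q)\<in>L. X \<in> closed_segment P Q \<and> p \<in> fst ` closed_segment P Q)"
proof -
  define K where "K = (\<Union>(P, Q)\<in>{e\<in>L. p \<notin> fst ` closed_segment (fst e) (snd e)}. fst ` closed_segment P Q)"
  have fin: "finite L" using assms by (simp add: oriented_link_def)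
  have "compact K" unfolding K_def using fin
    by (auto intro!: compact_UN compact_continuous_image continuous_intros)
  then have "open (- K)" by (simp add: compact_imp_closed open_Compl)
  moreover have "p \<in> - K" unfolding K_def by auto
  ultimately obtain r where r: "r > 0" "ball p r \<subseteq> - K" using open_contains_ball by blast
  have "\<exists>(P, Q)\<in>L. X \<in> closed_segment P Q \<and> p \<in> fst ` closed_segment P Q"
    if X: "X \<in> support L" "fst X \<in> ball p r" for X
  proof -
    obtain P Q where PQ: "(P, Q) \<in> L" "X \<in> closed_segment P Q"
      using X(1) by (auto simp: support_def)
    have "fst X \<notin> K" using X(2) r by auto
    then have "p \<in> fst ` closed_segment P Q" unfolding K_def using PQ by fastforce
    then show ?thesis using PQ by blast
  qed
  then show ?thesis using r(1) by blast
qed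

text \<open>Two projected segments with two common points overlap in a segment whose ends are
  projected vertices; in regular position these vertices would be common to both edges.\<close>

lemma projected_edges_meet_once:
  assumes L: "oriented_link L" "regular_position L"
    and e: "(P, Q) \<in> L" "(P', Q') \<in> L" "(P, Q) \<noteq> (P', Q')"
    and p: "p \<in> fst ` closed_segment P Q" "p \<in> fst ` closed_segment P' Q'"
    and q: "q \<in> fst ` closed_segment P Q" "q \<in> fst ` closed_segment P' Q'"
  shows "p = q"
proof (rule ccontr)
  assume "p \<noteq> q"
  \<comment> \<open>A linear coordinate along the line through \<open>p\<close> and
    \<open>q\<close>. All four end points project onto this line, and \<open>l\<close> orders
    them.\<close>
  define l where "l x = x \<bullet> (q - p)" for x :: plane
  have lin: "l ((1 - t) *\<^sub>R x + t *\<^sub>R y) = (1 - t) * l x + t * l y" for t x y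
    by (simp add: l_def inner_add_left)
  have pq: "l p < l q" using \<open>p \<noteq> q\<close> inner_gt_zero_iff[of "q - p"]
    by (simp add: l_def inner_diff_right inner_diff_left inner_commute)
  have on_line: "a = p + ((l a - l p) / (l q - l p)) *\<^sub>R (q - p)"
    if that: "a \<in> {fst A, fst B}" and pA: "p \<in> closed_segment (fst A) (fst B)" and qA: "q \<in> closed_segment (fst A) (fst B)"
    for a and A B :: space
  proof -
    obtain s where s: "p = (1 - s) *\<^sub>R fst A + s *\<^sub>R fst B" using pA by (auto simp: in_segment)
    obtain t where t: "q = (1 - t) *\<^sub>R fst A + t *\<^sub>R fst B" using qA by (auto simp: in_segment)
    have d: "q - p = (t - s) *\<^sub>R (fst B - fst A)" unfolding s t by (simp add: algebra_simps)
    have ts: "t - s \<noteq> 0" using d \<open>p \<noteq> q\<close> by auto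
    have BA: "fst B - fst A = (1 / (t - s)) *\<^sub>R (q - p)" using d ts by simp
    have "\<exists>c. a - p = c *\<^sub>R (fst B - fst A)"
      using that s by (auto simp: algebra_simps intro: exI[of _ "- s"] exI[of _ "1 - s"])
    then obtain c where "a - p = c *\<^sub>R (q - p)" using BA by (metis scaleR_scaleR)
    moreover have "l a - l p = c * (l q - l p)"
      using arg_cong[OF calculation, of l] by (simp add: l_def inner_diff_left)
    moreover have "c = (l a - l p) / (l q - l p)" using calculation(2) pq by simp
    ultimately show ?thesis by (metis add_diff_cancel_left' diff_add_cancel add.commute)
  qed
  have img: "fst ` closed_segment A B = closed_segment (fst A) (fst B)" for A B :: space
    by (simp add: closed_segment_linear_image bounded_linear.linear[OF bounded_linear_fst])
  have order: "\<exists>A' B'. closed_segment A B = closed_segment A' B' \<and> {A', B'} = {A, B} \<and>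
      l (fst A') \<le> l p \<and> l q \<le> l (fst B')"
    if "p \<in> closed_segment (fst A) (fst B)" "q \<in> closed_segment (fst A) (fst B)" for A B :: space
  proof (cases "l (fst A) \<le> l (fst B)")
    have bnd: "min (l (fst A)) (l (fst B)) \<le> l x \<and> l x \<le> max (l (fst A)) (l (fst B))"
      if x: "x \<in> closed_segment (fst A) (fst B)" for x
    proof -
      obtain t where t: "0 \<le> t" "t \<le> 1" "x = (1 - t) *\<^sub>R fst A + t *\<^sub>R fst B"
        using x by (auto simp: in_segment)
      have "l x \<in> closed_segment (l (fst A)) (l (fst B))"
        unfolding in_segment using t lin by auto
      then show ?thesis by (auto simp: closed_segment_eq_real_ivl split: if_splits)
    qed
    case True
    then show ?thesis using bnd[OF that(1)] bnd[OF that(2)] by (intro exI[of _ A] exI[of _ B]) auto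
  next
    have bnd: "min (l (fst A)) (l (fst B)) \<le> l x \<and> l x \<le> max (l (fst A)) (l (fst B))"
      if x: "x \<in> closed_segment (fst A) (fst B)" for x
    proof -
      obtain t where t: "0 \<le> t" "t \<le> 1" "x = (1 - t) *\<^sub>R fst A + t *\<^sub>R fst B"
        using x by (auto simp: in_segment)
      have "l x \<in> closed_segment (l (fst A)) (l (fst B))"
        unfolding in_segment using t lin by auto
      then show ?thesis by (auto simp: closed_segment_eq_real_ivl split: if_splits)
    qed
    case False
    then show ?thesis using bnd[OF that(1)] bnd[OF that(2)]
      by (intro exI[of _ B] exI[of _ A]) (auto simp: closed_segment_commute)
  qed
  have p': "p \<in> closed_segment (fst P) (fst Q)" "p \<in> closed_segment (fst P') (fst Q')"
    and q': "q \<in> closed_segment (fst P) (fst Q)" "q \<in> closed_segment (fst P') (fst Q')"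
    using p q unfolding img by auto
  obtain A B where AB: "closed_segment P Q = closed_segment A B" "{A, B} = {P, Q}"
      "l (fst A) \<le> l p" "l q \<le> l (fst B)" using order[OF p'(1) q'(1)] by metis
  obtain C D where CD: "closed_segment P' Q' = closed_segment C D" "{C, D} = {P', Q'}"
      "l (fst C) \<le> l p" "l q \<le> l (fst D)" using order[OF p'(2) q'(2)] by metis
  have pAB: "p \<in> closed_segment (fst A) (fst B)" "q \<in> closed_segment (fst A) (fst B)"
    using p(1) q(1) unfolding AB(1) img by auto
  have pCD: "p \<in> closed_segment (fst C) (fst D)" "q \<in> closed_segment (fst C) (fst D)"
    using p(2) q(2) unfolding CD(1) img by auto
  have verts: "{A, B, C, D} \<subseteq> vertices L" 
  proof -
    have "{A, B} \<subseteq> vertices L" "{C, D} \<subseteq> vertices L"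
      unfolding AB(2) CD(2) using edge_vertices[OF e(1)] edge_vertices[OF e(2)] by auto
    then show ?thesis by auto
  qed
  have between: "x \<in> closed_segment (fst A) (fst B)"
    if "x = p + ((l x - l p) / (l q - l p)) *\<^sub>R (q - p)" "l (fst A) \<le> l x" "l x \<le> l (fst B)"
      "p \<in> closed_segment (fst A) (fst B)" "q \<in> closed_segment (fst A) (fst B)" "l p < l q"
      "l (fst A) \<le> l p" "l q \<le> l (fst B)"
    for x and A B :: space
  proof -
    define t where "t = (l x - l (fst A)) / (l (fst B) - l (fst A))"
    have ab: "l (fst A) < l (fst B)" using that by linarith
    have t: "0 \<le> t" "t \<le> 1" using that ab by (auto simp: t_def)
    have A: "fst A = p + ((l (fst A) - l p) / (l q - l p)) *\<^sub>R (q - p)"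
      and B: "fst B = p + ((l (fst B) - l p) / (l q - l p)) *\<^sub>R (q - p)"
      using on_line[of "fst A" A B] on_line[of "fst B" A B] that by auto
    have lx: "l x = (1 - t) * l (fst A) + t * l (fst B)"
    proof -
      have "t * (l (fst B) - l (fst A)) = l x - l (fst A)" using ab by (simp add: t_def)
      then show ?thesis by (simp add: algebra_simps)
    qed
    have "(1 - t) *\<^sub>R fst A + t *\<^sub>R fst B =
      p + (((1 - t) * (l (fst A) - l p) + t * (l (fst B) - l p)) / (l q - l p)) *\<^sub>R (q - p)"
      by (subst A, subst B) (simp add: algebra_simps add_divide_distrib diff_divide_distrib)
    also have "(1 - t) * (l (fst A) - l p) + t * (l (fst B) - l p) = l x - l p"
      unfolding lx by (simp add: algebra_simps)
    finally have "(1 - t) *\<^sub>R fst A + t *\<^sub>R fst B = x" using that(1) by simp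
    then show ?thesis using t by (auto simp: in_segment)
  qed
  \<comment> \<open>Regular position leaves no second point over a vertex, so a vertex that projects
    into both segments lies on both edges.\<close>
  have both: "\<exists>X\<in>closed_segment A B \<inter> closed_segment C D. fst X = fst V"
    if V: "V \<in> vertices L" "fst V \<in> closed_segment (fst A) (fst B)" "fst V \<in> closed_segment (fst C) (fst D)" for V
  proof -
    obtain X where X: "X \<in> closed_segment A B" "fst X = fst V"
      using V(2) unfolding img[symmetric] by auto
    obtain X' where X': "X' \<in> closed_segment C D" "fst X' = fst V"
      using V(3) unfolding img[symmetric] by auto
    have "X = V" "X' = V"
      using regular_position_vertex[OF L(2) V(1)] edge_in_support e X X' AB(1) CD(1) by metis+
    then show ?thesis using X X' by blast
  qed
  \<comment> \<open>Of the two starting points \<open>A\<close> and \<open>C\<close>, the one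
    further along the line is not beyond \<open>p\<close> and projects into both segments. The
    mirror argument for the ends follows.\<close>
  have "\<exists>X\<in>closed_segment A B \<inter> closed_segment C D. l (fst X) \<le> l p"
  proof (cases "l (fst A) \<le> l (fst C)")
    case True
    then have "fst C \<in> closed_segment (fst A) (fst B)"
      using between[of "fst C" A B] on_line[of "fst C" C D] pAB pCD AB CD pq by auto
    then show ?thesis using both[of C] verts CD(3) by (metis ends_in_segment insert_subset)
  next
    case False
    then have "fst A \<in> closed_segment (fst C) (fst D)"
      using between[of "fst A" C D] on_line[of "fst A" A B] pAB pCD AB CD pq by auto
    then show ?thesis using both[of A] verts AB(3) by (metis ends_in_segment insert_subset)
  qed
  then obtain X where X: "X \<in> closed_segment A B" "X \<in> closed_segment C D" "l (fst X) \<le> l p" by blast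
  have "\<exists>X\<in>closed_segment A B \<inter> closed_segment C D. l q \<le> l (fst X)"
  proof (cases "l (fst D) \<le> l (fst B)")
    case True
    then have "fst D \<in> closed_segment (fst A) (fst B)"
      using between[of "fst D" A B] on_line[of "fst D" C D] pAB pCD AB CD pq by auto
    then show ?thesis using both[of D] verts CD(4) by (metis ends_in_segment insert_subset)
  next
    case False
    then have "fst B \<in> closed_segment (fst C) (fst D)"
      using between[of "fst B" C D] on_line[of "fst B" A B] pAB pCD AB CD pq by auto
    then show ?thesis using both[of B] verts AB(4) by (metis ends_in_segment insert_subset)
  qed
  then obtain X' where X': "X' \<in> closed_segment A B" "X' \<in> closed_segment C D" "l q \<le> l (fst X')" by blast
  have "X \<noteq> X'" using X X' pq by auto
  have "closed_segment X X' \<subseteq> closed_segment A B \<inter> closed_segment C D"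
    using X X' by (simp add: closed_segment_subset)
  also have "\<dots> \<subseteq> {P, Q} \<inter> {P', Q'}"
    using edges_meet_in_vertices[OF L(1) e] unfolding AB(1) CD(1) .
  finally have "finite (closed_segment X X')" by (meson finite.simps finite_Int finite_subset)
  then show False using \<open>X \<noteq> X'\<close> by (simp add: finite_closed_segment)
qed

text \<open>The sheet of \<open>N\<close> separates the strands of the crossing \<open>x\<close>: it lies below the over-strand
  and above the under-strand.\<close>

definition crossing_box ::
  "directed_edges \<Rightarrow> plane \<times> plane \<times> plane \<Rightarrow> real \<times> space set \<Rightarrow> bool" where
  "crossing_box L = (\<lambda>(p, u, v) (r, N).
     r > 0 \<and> open N \<and> convex N \<and> N \<inter> support L = {} \<and> fst ` N \<subseteq> ball p r \<and>
     (\<forall>X. fst X = p \<and> X \<notin> above L \<and> X \<notin> below L \<and> X \<notin> support L \<longrightarrow> X \<in> N) \<and>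
     (\<exists>z. (p, z) \<in> N) \<and>
     (\<forall>X\<in>N. X \<in> above L \<longleftrightarrow> cross u (fst X - p) \<noteq> 0) \<and>
     (\<forall>X\<in>N. X \<in> below L \<longleftrightarrow> cross v (fst X - p) \<noteq> 0) \<and>
     (\<forall>q\<in>ball p r. cross u (q - p) \<noteq> 0 \<longrightarrow> cross v (q - p) \<noteq> 0 \<longrightarrow> q \<notin> fst ` support L) \<and>
     cross u v \<noteq> 0 \<and>
     (\<forall>x'\<in>crossings (projection L). fst x' \<in> ball p (2 * r) \<longrightarrow> x' = (p, u, v)))"

lemma mem_crossings:
  "x \<in> crossings (projection L) \<longleftrightarrow> (\<exists>Y Y' P Q P' Q'. (P, Q) \<in> L \<and> (P', Q') \<in> L \<and>
     Y \<in> closed_segment P Q \<and> Y' \<in> closed_segment P' Q' \<and> fst Y = fst Y' \<and> snd Y > snd Y' \<and>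
     x = (fst Y, direction (P, Q), direction (P', Q')))"
  unfolding projection_def by (simp only: oriented_diagram.simps mem_Collect_eq) metis

text \<open>No vertex is a double point, so a double point is interior to its edge, and two edges
  cannot share it. An edge is not vertical, hence has only one point over each point of the
  plane.\<close>

lemma regular_double_point:
  assumes L: "oriented_link L" "regular_position L"
    and Y: "Y \<in> support L" "Y' \<in> support L" "Y \<noteq> Y'" "fst Y = fst Y'"
    and e: "(P, Q) \<in> L" "Y \<in> closed_segment P Q"
  shows "Y \<in> open_segment P Q" "Y' \<notin> closed_segment P Q"
    and "(R, S) \<in> L \<Longrightarrow> Y \<in> closed_segment R S \<Longrightarrow> (R, S) = (P, Q)"
proof -
  have v: "Y \<notin> vertices L" using regular_position_vertex[OF L(2) _ Y(2), of Y] Y(3,4) by metis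
  then show "Y \<in> open_segment P Q"
    using e edge_vertices[OF e(1)] by (auto simp: open_segment_def)
  have nv: "fst P \<noteq> fst Q" using regular_edge_not_vertical[OF L e(1)] .
  show "Y' \<notin> closed_segment P Q"
  proof
    assume "Y' \<in> closed_segment P Q"
    then obtain s where s: "Y' = (1 - s) *\<^sub>R P + s *\<^sub>R Q" by (auto simp: in_segment)
    obtain t where t: "Y = (1 - t) *\<^sub>R P + t *\<^sub>R Q" using e(2) by (auto simp: in_segment)
    show False
      using edge_height_line(1)[OF nv s] edge_height_line(1)[OF nv t] Y(3,4) by (simp add: prod_eq_iff)
  qed
  assume RS: "(R, S) \<in> L" "Y \<in> closed_segment R S"
  show "(R, S) = (P, Q)"
  proof (rule ccontr)
    assume "(R, S) \<noteq> (P, Q)"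
    then have "closed_segment P Q \<inter> closed_segment R S \<subseteq> {P, Q}"
      using edges_meet_in_vertices[OF L(1) e(1) RS(1)] by blast
    then show False using e RS v edge_vertices[OF e(1)] by blast
  qed
qed

lemma support_over_crossing:
  assumes L: "oriented_link L" "regular_position L"
    and e: "(P, Q) \<in> L" "(P', Q') \<in> L"
    and Y: "Y \<in> closed_segment P Q" "Y' \<in> closed_segment P' Q'" "fst Y = fst Y'" "Y \<noteq> Y'"
  shows "\<exists>r>0. \<forall>X. fst X \<in> ball (fst Y) r \<longrightarrow> (X \<in> support L \<longleftrightarrow>
     cross (fst Q - fst P) (fst X - fst Y) = 0 \<and> snd X = edge_height P Q (fst X) \<or>
     cross (fst Q' - fst P') (fst X - fst Y) = 0 \<and> snd X = edge_height P' Q' (fst X))"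
proof -
  have Ys: "Y \<in> support L" "Y' \<in> support L" using edge_in_support e Y by blast+
  note Yd = regular_double_point[OF L Ys Y(4,3) e(1) Y(1)]
  note Yd' = regular_double_point[OF L Ys(2,1) Y(4)[symmetric] Y(3)[symmetric] e(2) Y(2)]
  obtain r1 where r1: "r1 > 0" "\<And>X. fst X \<in> ball (fst Y) r1 \<Longrightarrow> X \<in> closed_segment P Q \<longleftrightarrow>
      cross (fst Q - fst P) (fst X - fst Y) = 0 \<and> snd X = edge_height P Q (fst X)"
    using edge_cylinder[OF regular_edge_not_vertical[OF L e(1)] Yd(1)] by blast
  obtain r2 where r2: "r2 > 0" "\<And>X. fst X \<in> ball (fst Y) r2 \<Longrightarrow> X \<in> closed_segment P' Q' \<longleftrightarrow>
      cross (fst Q' - fst P') (fst X - fst Y) = 0 \<and> snd X = edge_height P' Q' (fst X)"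
    using edge_cylinder[OF regular_edge_not_vertical[OF L e(2)] Yd'(1)] Y(3) by metis
  obtain r3 where r3: "r3 > 0" "\<And>X. X \<in> support L \<Longrightarrow> fst X \<in> ball (fst Y) r3 \<Longrightarrow>
      \<exists>(R, S)\<in>L. X \<in> closed_segment R S \<and> fst Y \<in> fst ` closed_segment R S"
    using support_over_small_ball[OF L(1), of "fst Y"] by meson
  have two: "(R, S) = (P, Q) \<or> (R, S) = (P', Q')"
    if RS: "(R, S) \<in> L" "fst Y \<in> fst ` closed_segment R S" for R S
  proof -
    obtain Z where Z: "Z \<in> closed_segment R S" "fst Z = fst Y" using RS(2) by auto
    then have "Z = Y \<or> Z = Y'"
      using L(2) Ys Y(3,4) edge_in_support[OF RS(1) Z(1)] unfolding regular_position_def by metis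
    then show ?thesis using Yd(3) Yd'(3) RS(1) Z(1) by blast
  qed
  have "X \<in> support L \<longleftrightarrow>
     cross (fst Q - fst P) (fst X - fst Y) = 0 \<and> snd X = edge_height P Q (fst X) \<or>
     cross (fst Q' - fst P') (fst X - fst Y) = 0 \<and> snd X = edge_height P' Q' (fst X)"
    if X: "fst X \<in> ball (fst Y) (min r1 (min r2 r3))" for X
  proof -
    have X': "fst X \<in> ball (fst Y) r1" "fst X \<in> ball (fst Y) r2" "fst X \<in> ball (fst Y) r3"
      using X by auto
    have "X \<in> support L \<longleftrightarrow> X \<in> closed_segment P Q \<or> X \<in> closed_segment P' Q'"
      using r3(2)[OF _ X'(3)] two edge_in_support e by blast
    then show ?thesis using r1(2)[OF X'(1)] r2(2)[OF X'(2)] by blast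
  qed
  then show ?thesis using r1(1) r2(1) r3(1) by (intro exI[of _ "min r1 (min r2 r3)"]) auto
qed

text \<open>The height function is affine, so comparing heights with it cuts out a half-space; this
  is how the box between two strands is seen to be convex.\<close>

lemma edge_height_halfspace:
  "\<exists>a b. \<forall>X. snd X - edge_height P Q (fst X) = a \<bullet> X - b"
proof -
  define d where "d = fst Q - fst P"
  define c where "c = (snd Q - snd P) / (d \<bullet> d)"
  have eh: "edge_height P Q (fst X) = snd P + c * (fst X \<bullet> d - fst P \<bullet> d)" for X
    by (simp add: edge_height_def c_def inner_diff_left flip: d_def)
  have "snd X - edge_height P Q (fst X) = ((- c) *\<^sub>R d, 1) \<bullet> X - (snd P - c * (fst P \<bullet> d))" for X
    unfolding eh by (simp add: inner_prod_def algebra_simps)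
  then show ?thesis by blast
qed

text \<open>Near the crossing each edge is a full piece of its line. If the directions were
  parallel, the projections would share a second point \<open>q\<close>, at a distance below both
  cylinder radii.\<close>

lemma crossing_nonparallel:
  assumes L: "oriented_link L" "regular_position L"
    and e: "(P, Q) \<in> L" "(P', Q') \<in> L"
    and Y: "Y \<in> closed_segment P Q" "Y' \<in> closed_segment P' Q'" "fst Y = fst Y'" "Y \<noteq> Y'"
  shows "cross (fst Q - fst P) (fst Q' - fst P') \<noteq> 0"
proof
  let ?d = "fst Q - fst P" let ?d' = "fst Q' - fst P'"
  assume par: "cross ?d ?d' = 0"
  have Ys: "Y \<in> support L" "Y' \<in> support L" using edge_in_support e Y by blast+
  note Yd = regular_double_point[OF L Ys Y(4,3) e(1) Y(1)]
  note Yd' = regular_double_point[OF L Ys(2,1) Y(4)[symmetric] Y(3)[symmetric] e(2) Y(2)]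
  have nv: "fst P \<noteq> fst Q" "fst P' \<noteq> fst Q'" using regular_edge_not_vertical[OF L] e by auto
  have ne: "(P, Q) \<noteq> (P', Q')" using Yd(2) Y(2) by auto
  obtain r1 where r1: "r1 > 0" "\<And>X. fst X \<in> ball (fst Y) r1 \<Longrightarrow> X \<in> closed_segment P Q \<longleftrightarrow>
      cross ?d (fst X - fst Y) = 0 \<and> snd X = edge_height P Q (fst X)"
    using edge_cylinder[OF nv(1) Yd(1)] by blast
  obtain r2 where r2: "r2 > 0" "\<And>X. fst X \<in> ball (fst Y) r2 \<Longrightarrow> X \<in> closed_segment P' Q' \<longleftrightarrow>
      cross ?d' (fst X - fst Y) = 0 \<and> snd X = edge_height P' Q' (fst X)"
    using edge_cylinder[OF nv(2) Yd'(1)] Y(3) by metis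
  define c where "c = min r1 r2 / (2 * norm ?d)"
  have c: "c > 0" "c * norm ?d < r1" "c * norm ?d < r2" using r1(1) r2(1) nv by (auto simp: c_def)
  define q where "q = fst Y + c *\<^sub>R ?d"
  have q: "q \<in> ball (fst Y) r1" "q \<in> ball (fst Y) r2"
    using c by (auto simp: q_def dist_norm)
  have "cross ?d (q - fst Y) = 0" "cross ?d' (q - fst Y) = 0"
    using par by (simp_all add: q_def cross_scaleR cross_commute[of ?d' ?d])
  then have "(q, edge_height P Q q) \<in> closed_segment P Q" "(q, edge_height P' Q' q) \<in> closed_segment P' Q'"
    using r1(2)[of "(q, edge_height P Q q)"] r2(2)[of "(q, edge_height P' Q' q)"] q by auto
  then have "q \<in> fst ` closed_segment P Q" "q \<in> fst ` closed_segment P' Q'" by force+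
  moreover have "fst Y \<in> fst ` closed_segment P Q" "fst Y \<in> fst ` closed_segment P' Q'"
    using Y by (auto simp: image_iff) metis
  ultimately have "fst Y = q" using projected_edges_meet_once[OF L e ne] by blast
  then show False using c nv by (simp add: q_def)
qed

lemma crossing_box_exists:
  assumes L: "oriented_link L" "regular_position L" and x: "x \<in> crossings (projection L)"
  shows "\<exists>rN. crossing_box L x rN"
proof -
  obtain Y Y' P Q P' Q' where e: "(P, Q) \<in> L" "(P', Q') \<in> L"
    and Y: "Y \<in> closed_segment P Q" "Y' \<in> closed_segment P' Q'" "fst Y = fst Y'" "snd Y > snd Y'"
    and x: "x = (fst Y, direction (P, Q), direction (P', Q'))"
    using x unfolding mem_crossings by blast
  define p where "p = fst Y"
  define d where "d = fst Q - fst P"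
  define d' where "d' = fst Q' - fst P'"
  have ne: "Y \<noteq> Y'" using Y(4) by auto
  have nv: "fst P \<noteq> fst Q" "fst P' \<noteq> fst Q'" using regular_edge_not_vertical[OF L] e by auto
  have dd: "cross d d' \<noteq> 0" unfolding d_def d'_def using crossing_nonparallel[OF L e Y(1-3) ne] .
  have d0: "d \<noteq> 0" "d' \<noteq> 0" using nv by (auto simp: d_def d'_def)
  define h where "h = edge_height P Q"
  define h' where "h' = edge_height P' Q'"
  have Ys: "Y \<in> support L" "Y' \<in> support L" using edge_in_support e Y by blast+
  obtain t where t: "Y = (1 - t) *\<^sub>R P + t *\<^sub>R Q" using Y(1) by (auto simp: in_segment)
  obtain t' where t': "Y' = (1 - t') *\<^sub>R P' + t' *\<^sub>R Q'" using Y(2) by (auto simp: in_segment)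
  have hY: "h p = snd Y" "h' p = snd Y'"
    using edge_height_line(1)[OF nv(1) t] edge_height_line(1)[OF nv(2) t'] Y(3)
    by (simp_all add: h_def h'_def p_def)
  obtain r1 where r1: "r1 > 0" and supp: "\<And>X. fst X \<in> ball p r1 \<Longrightarrow> X \<in> support L \<longleftrightarrow>
     cross d (fst X - p) = 0 \<and> snd X = h (fst X) \<or> cross d' (fst X - p) = 0 \<and> snd X = h' (fst X)"
    using support_over_crossing[OF L e Y(1-3) ne] unfolding d_def d'_def h_def h'_def p_def by blast
  have "open {q. h' q < h q}" unfolding h_def h'_def by (intro open_Collect_less continuous_intros)
  moreover have "p \<in> {q. h' q < h q}" using hY Y(4) by simp
  ultimately obtain r2 where r2: "r2 > 0" "ball p r2 \<subseteq> {q. h' q < h q}"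
    using open_contains_ball by blast
  \<comment> \<open>Half of the good radius is held in reserve: no other crossing lies in the disc
    of radius \<open>2 * r\<close>, which makes the boxes of different crossings disjoint.\<close>
  define r where "r = min r1 r2 / 2"
  have r: "r > 0" "2 * r \<le> r1" "2 * r \<le> r2" using r1 r2 by (auto simp: r_def)
  have rr: "q \<in> ball p r \<Longrightarrow> q \<in> ball p r1 \<and> q \<in> ball p r2" for q using r by auto
  \<comment> \<open>The open slab between the two strands, both extended across the disc. It is
    convex, hence contractible, and so is each half cut off by the line of a strand.\<close>
  define N where "N = {X. fst X \<in> ball p r \<and> h' (fst X) < snd X \<and> snd X < h (fst X)}"
  have N1: "X \<in> above L \<longleftrightarrow> cross d (fst X - p) \<noteq> 0" if "X \<in> N" for X
  proof -
    have X: "fst X \<in> ball p r" "h' (fst X) < snd X" "snd X < h (fst X)" using that by (auto simp: N_def)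
    have s: "(fst X, z) \<in> support L \<longleftrightarrow>
        cross d (fst X - p) = 0 \<and> z = h (fst X) \<or> cross d' (fst X - p) = 0 \<and> z = h' (fst X)" for z
      using supp[of "(fst X, z)"] rr[OF X(1)] by simp
    have "X \<in> above L \<longleftrightarrow> (\<forall>z. (fst X, z) \<in> support L \<longrightarrow> z < snd X)"
      unfolding above_def by auto
    then show ?thesis unfolding s using X by auto
  qed
  have N2: "X \<in> below L \<longleftrightarrow> cross d' (fst X - p) \<noteq> 0" if "X \<in> N" for X
  proof -
    have X: "fst X \<in> ball p r" "h' (fst X) < snd X" "snd X < h (fst X)" using that by (auto simp: N_def)
    have s: "(fst X, z) \<in> support L \<longleftrightarrow>
        cross d (fst X - p) = 0 \<and> z = h (fst X) \<or> cross d' (fst X - p) = 0 \<and> z = h' (fst X)" for z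
      using supp[of "(fst X, z)"] rr[OF X(1)] by simp
    have "X \<in> below L \<longleftrightarrow> (\<forall>z. (fst X, z) \<in> support L \<longrightarrow> snd X < z)"
      unfolding below_def by auto
    then show ?thesis unfolding s using X by auto
  qed
  obtain a b where ab: "\<And>X. snd X - h (fst X) = a \<bullet> X - b" unfolding h_def using edge_height_halfspace by blast
  obtain a' b' where ab': "\<And>X. snd X - h' (fst X) = a' \<bullet> X - b'" unfolding h'_def using edge_height_halfspace by blast
  have N_eq: "N = fst -` ball p r \<inter> {X. a' \<bullet> X > b'} \<inter> {X. a \<bullet> X < b}"
    unfolding N_def using ab ab' by (auto; smt (verit))
  have uv: "direction (P, Q) = sgn d" "direction (P', Q') = sgn d'"
    by (simp_all add: direction_def d_def d'_def)
  have cr: "cross (sgn d) w = 0 \<longleftrightarrow> cross d w = 0" "cross (sgn d') w = 0 \<longleftrightarrow> cross d' w = 0" for w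
    using d0 by (simp_all add: cross_sgn)
  have "cross (sgn d) (sgn d') \<noteq> 0"
    using dd d0 by (simp add: cross_sgn sgn_div_norm cross_scaleR)
  moreover have "open N" "convex N" unfolding N_eq
    by (intro open_Int open_vimage_fst open_halfspace_gt open_halfspace_lt open_ball,
        intro convex_Int convex_halfspace_gt convex_halfspace_lt convex_linear_vimage convex_ball
          bounded_linear.linear[OF bounded_linear_fst])
  moreover have "N \<inter> support L = {}"
    using supp rr by (auto simp: N_def)
  moreover have "X \<in> N" if "fst X = p" "X \<notin> above L" "X \<notin> below L" "X \<notin> support L" for X
  proof -
    have "Z = Y \<or> Z = Y'" if "Z \<in> support L" "fst Z = p" for Z
      using L(2) Ys Y(3) ne that unfolding regular_position_def p_def by metis
    then have "snd X \<le> snd Y" "snd Y' \<le> snd X"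
      using that(1-3) Y(3,4) unfolding above_def below_def by fastforce+
    moreover have "snd X \<noteq> snd Y" "snd X \<noteq> snd Y'"
      using that(1,4) Ys Y(3) unfolding p_def by (metis prod.collapse)+
    ultimately show ?thesis unfolding N_def mem_Collect_eq that(1) hY using r(1) by simp
  qed
  moreover have "\<exists>z. (p, z) \<in> N"
    by (rule exI[of _ "(h p + h' p) / 2"]) (use hY Y(4) r in \<open>simp add: N_def\<close>)
  moreover have "(p, (h p + h' p) / 2) \<in> N" using hY Y(4) r by (simp add: N_def)
  moreover have "q \<notin> fst ` support L" if "q \<in> ball p r" "cross d (q - p) \<noteq> 0" "cross d' (q - p) \<noteq> 0" for q
    using supp rr[OF that(1)] that by auto
  moreover have "x' = x" if x': "x' \<in> crossings (projection L)" "fst x' \<in> ball p (2 * r)" for x'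
  proof -
    obtain Z Z' R S R' S' where e': "(R, S) \<in> L" "(R', S') \<in> L"
      and Z: "Z \<in> closed_segment R S" "Z' \<in> closed_segment R' S'" "fst Z = fst Z'" "snd Z > snd Z'"
      and x'_eq: "x' = (fst Z, direction (R, S), direction (R', S'))"
      using x'(1) unfolding mem_crossings by blast
    have q: "fst Z \<in> ball p r1" using x'(2) r unfolding x'_eq by auto
    have Zs: "Z \<in> support L" "Z' \<in> support L" using edge_in_support e' Z by blast+
    have "cross d (fst Z - p) = 0" "cross d' (fst Z - p) = 0"
      using supp[of Z] supp[of Z'] q Zs Z(3,4) by auto
    then have "fst Z = p"
      using cross_basis[OF dd, of "fst Z - p"] cross_commute[of d'] by simp
    then have "Z = Y \<or> Z = Y'" "Z' = Y \<or> Z' = Y'"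
      using L(2) Ys Zs Z(3) Y(3) ne unfolding regular_position_def p_def by metis+
    then have "Z = Y" "Z' = Y'" using Z(4) Y(4) by auto
    moreover have "(R, S) = (P, Q)"
      using regular_double_point(3)[OF L Ys ne Y(3) e(1) Y(1) e'(1)] Z(1) \<open>Z = Y\<close> by simp
    moreover have "(R', S') = (P', Q')"
      using regular_double_point(3)[OF L Ys(2,1) ne[symmetric] Y(3)[symmetric] e(2) Y(2) e'(2)] Z(2) \<open>Z' = Y'\<close> by simp
    ultimately show ?thesis unfolding x x'_eq by simp
  qed
  ultimately have "crossing_box L x (r, N)"
    unfolding crossing_box_def x uv prod.case p_def[symmetric] cr using r(1) N1 N2 by (intro conjI) (auto simp: N_def)
  then show ?thesis by blast
qed

section \<open>Colourings of diagrams and holonomy\<close>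

text \<open>A colouring of the regions by the elements of a group. It is best thought of as recording
  the holonomies along vertical lines, from above to below the link, of a flat bundle on the link
  complement; the crossing condition compares the two ways of passing the over-strand.\<close>

definition dehn_coloring :: "directed_edges \<Rightarrow> (plane \<Rightarrow> 'g::group_add) \<Rightarrow> bool" where
  "dehn_coloring L c \<longleftrightarrow> loc_const (- fst ` support L) c \<and>
     (\<forall>(p, u, v)\<in>crossings (projection L). \<exists>r>0. \<forall>qa\<in>ball p r. \<forall>qb\<in>ball p r. \<forall>qc\<in>ball p r. \<forall>qd\<in>ball p r.
        left_of u (qa - p) \<and> right_of v (qa - p) \<and> left_of u (qb - p) \<and> left_of v (qb - p) \<and>
        right_of u (qc - p) \<and> left_of v (qc - p) \<and> right_of u (qd - p) \<and> right_of v (qd - p) \<longrightarrow>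
        c qa - c qd = c qb - c qc)"

lemma dehn_coloring_loc_const: "dehn_coloring L c \<Longrightarrow> loc_const (- fst ` support L) c"
  unfolding dehn_coloring_def by (rule conjunct1)

datatype chart = Top | Bot | Mid "plane \<times> plane \<times> plane"

definition xbox :: "directed_edges \<Rightarrow> plane \<times> plane \<times> plane \<Rightarrow> real \<times> space set" where
  "xbox L x = (SOME rN. crossing_box L x rN)"

definition chart_set :: "directed_edges \<Rightarrow> chart \<Rightarrow> space set" where
  "chart_set L i = (case i of Top \<Rightarrow> above L | Bot \<Rightarrow> below L
     | Mid x \<Rightarrow> if x \<in> crossings (projection L) then snd (xbox L x) else {})"

lemma chart_set_simps [simp]:
  "chart_set L Top = above L" "chart_set L Bot = below L"
  "x \<in> crossings (projection L) \<Longrightarrow> chart_set L (Mid x) = snd (xbox L x)"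
  by (simp_all add: chart_set_def)

lemma crossing_box_xbox:
  assumes "oriented_link L" "regular_position L" "x \<in> crossings (projection L)"
  shows "crossing_box L x (xbox L x)"
  using someI_ex[OF crossing_box_exists[OF assms]] by (simp add: xbox_def)

text \<open>The signs \<open>s\<close> and \<open>t\<close> select the side of the over-strand and
  of the under-strand, positive meaning left. The corners called a, b, c, d have the signs (1,-1),
  (1,1), (-1,1), (-1,-1).\<close>

definition corner :: "directed_edges \<Rightarrow> plane \<times> plane \<times> plane \<Rightarrow> real \<Rightarrow> real \<Rightarrow> plane set" where
  "corner L x s t = (case x of (p, u, v) \<Rightarrow>
     {q \<in> ball p (fst (xbox L x)). s * cross u (q - p) > 0 \<and> t * cross v (q - p) > 0})"

text \<open>Prescribing both cross products is a nonsingular linear system with solution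
  \<open>w\<close>; the factor \<open>c\<close> shrinks it into the disc.\<close>

lemma corner_direction_exists:
  assumes "cross u v \<noteq> 0" "r > 0"
  shows "\<exists>q\<in>ball p r. \<exists>c>0. cross u (q - p) = c * s \<and> cross v (q - p) = c * t"
proof -
  define w where "w = (- t / cross u v) *\<^sub>R u + (s / cross u v) *\<^sub>R v"
  have w: "cross u w = s" "cross v w = t"
    using assms(1) unfolding w_def cross_add cross_scaleR cross_commute[of v u] by simp_all
  define n where "n = norm w + 1"
  have n: "n > 0" "norm w < n" unfolding n_def using norm_ge_zero[of w] by linarith+
  define c where "c = r / n"
  have c: "c > 0" using assms(2) n by (simp add: c_def)
  have "c * norm w < c * n" using c n by simp
  also have "c * n = r" using n by (simp add: c_def)
  finally have "c * norm w < r" .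
  then have "p + c *\<^sub>R w \<in> ball p r" using c by (simp add: dist_norm)
  moreover have "cross u (p + c *\<^sub>R w - p) = c * s" "cross v (p + c *\<^sub>R w - p) = c * t"
    using w by (simp_all add: cross_scaleR)
  ultimately show ?thesis using c by blast
qed

lemma convex_cross_halfplane: "convex {q. s * cross u (q - p) > 0}"
proof -
  have "{q. s * cross u (q - p) > 0} = {q. (s *\<^sub>R (- snd u, fst u)) \<bullet> q > s * cross u p}"
    by (auto simp: cross_def inner_prod_def algebra_simps)
  then show ?thesis by (simp add: convex_halfspace_gt)
qed

lemma convex_corner: "convex (corner L x s t)"
proof -
  obtain p u v where x: "x = (p, u, v)" by (cases x)
  have "corner L x s t = ball p (fst (xbox L x)) \<inter> {q. s * cross u (q - p) > 0} \<inter> {q. t * cross v (q - p) > 0}"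
    by (auto simp: corner_def x)
  then show ?thesis by (simp add: convex_Int convex_cross_halfplane)
qed

definition corner_point :: "directed_edges \<Rightarrow> plane \<times> plane \<times> plane \<Rightarrow> real \<Rightarrow> real \<Rightarrow> plane" where
  "corner_point L x s t = (SOME q. q \<in> corner L x s t)"

text \<open>In the four corners of a crossing a colouring is the sum of a jump at the over-strand and a
  value that depends on the side of the under-strand.\<close>

definition over_value ::
  "directed_edges \<Rightarrow> (plane \<Rightarrow> 'g::group_add) \<Rightarrow> plane \<times> plane \<times> plane \<Rightarrow> plane \<Rightarrow> 'g" where
  "over_value L c x q = (if left_of (fst (snd x)) (q - fst x)
     then c (corner_point L x 1 (-1)) - c (corner_point L x (-1) (-1)) else 0)"

definition under_value ::
  "directed_edges \<Rightarrow> (plane \<Rightarrow> 'g::group_add) \<Rightarrow> plane \<times> plane \<times> plane \<Rightarrow> plane \<Rightarrow> 'g" where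
  "under_value L c x q = (if left_of (snd (snd x)) (q - fst x)
     then c (corner_point L x (-1) 1) else c (corner_point L x (-1) (-1)))"

context
  fixes L :: directed_edges
  assumes L: "oriented_link L" "regular_position L"
begin

lemma crossing_boxD:
  assumes "(p, u, v) \<in> crossings (projection L)"
  defines "r \<equiv> fst (xbox L (p, u, v))" and "N \<equiv> snd (xbox L (p, u, v))"
  shows "r > 0" "open N" "convex N" "N \<inter> support L = {}" "fst ` N \<subseteq> ball p r"
    "\<And>X. fst X = p \<Longrightarrow> X \<notin> above L \<Longrightarrow> X \<notin> below L \<Longrightarrow> X \<notin> support L \<Longrightarrow> X \<in> N"
    "\<exists>z. (p, z) \<in> N"
    "\<And>X. X \<in> N \<Longrightarrow> X \<in> above L \<longleftrightarrow> cross u (fst X - p) \<noteq> 0"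
    "\<And>X. X \<in> N \<Longrightarrow> X \<in> below L \<longleftrightarrow> cross v (fst X - p) \<noteq> 0"
    "\<And>q. q \<in> ball p r \<Longrightarrow> cross u (q - p) \<noteq> 0 \<Longrightarrow> cross v (q - p) \<noteq> 0 \<Longrightarrow> q \<notin> fst ` support L"
    "cross u v \<noteq> 0"
    "\<And>x'. x' \<in> crossings (projection L) \<Longrightarrow> fst x' \<in> ball p (2 * r) \<Longrightarrow> x' = (p, u, v)"
proof -
  obtain r' N' where rN: "xbox L (p, u, v) = (r', N')" by (cases "xbox L (p, u, v)")
  note B = crossing_box_xbox[OF L assms(1), unfolded rN crossing_box_def prod.case]
  have rN': "r = r'" "N = N'" by (simp_all add: r_def N_def rN)
  show "r > 0" "open N" "convex N" "N \<inter> support L = {}" "fst ` N \<subseteq> ball p r" "\<exists>z. (p, z) \<in> N"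
    "cross u v \<noteq> 0"
    unfolding rN' using B by - (elim conjE, assumption)+
  show "\<And>X. fst X = p \<Longrightarrow> X \<notin> above L \<Longrightarrow> X \<notin> below L \<Longrightarrow> X \<notin> support L \<Longrightarrow> X \<in> N"
    using B unfolding rN' by blast
  show "\<And>X. X \<in> N \<Longrightarrow> X \<in> above L \<longleftrightarrow> cross u (fst X - p) \<noteq> 0"
    using B unfolding rN' by blast
  show "\<And>X. X \<in> N \<Longrightarrow> X \<in> below L \<longleftrightarrow> cross v (fst X - p) \<noteq> 0"
    using B unfolding rN' by blast
  show "\<And>q. q \<in> ball p r \<Longrightarrow> cross u (q - p) \<noteq> 0 \<Longrightarrow> cross v (q - p) \<noteq> 0 \<Longrightarrow> q \<notin> fst ` support L"
    using B unfolding rN' by blast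
  show "\<And>x'. x' \<in> crossings (projection L) \<Longrightarrow> fst x' \<in> ball p (2 * r) \<Longrightarrow> x' = (p, u, v)"
    using B unfolding rN' by blast
qed

text \<open>Discs with a common point have centres closer than twice the larger radius, so one of
  the crossings lies in the reserved double disc of the other.\<close>

lemma crossing_boxes_disjoint:
  assumes "x \<in> crossings (projection L)" "x' \<in> crossings (projection L)"
    and "q \<in> ball (fst x) (fst (xbox L x))" "q \<in> ball (fst x') (fst (xbox L x'))"
  shows "x = x'"
proof -
  obtain p u v p' u' v' where x: "x = (p, u, v)" "x' = (p', u', v')" by (cases x, cases x')
  have "dist p p' < fst (xbox L x) + fst (xbox L x')"
    using assms(3,4) dist_triangle_less_add[of p q _ p'] unfolding x by (simp add: dist_commute)
  then consider "dist p p' < 2 * fst (xbox L x)" | "dist p p' < 2 * fst (xbox L x')" by linarith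
  then show ?thesis
  proof cases
    case 1
    then show ?thesis
      using crossing_boxD(12)[of p u v x'] assms(1,2) unfolding x by (auto simp: dist_commute)
  next
    case 2
    then show ?thesis
      using crossing_boxD(12)[of p' u' v' x] assms(1,2) unfolding x by (auto simp: dist_commute)
  qed
qed

lemma corner_nonempty:
  assumes x: "x \<in> crossings (projection L)" and st: "s \<noteq> 0" "t \<noteq> 0"
  shows "corner_point L x s t \<in> corner L x s t"
proof -
  obtain p u v where x': "x = (p, u, v)" by (cases x)
  note b = crossing_boxD[OF x[unfolded x']]
  obtain q c where "q \<in> ball p (fst (xbox L (p, u, v)))" "c > 0" "cross u (q - p) = c * s"
      "cross v (q - p) = c * t"
    using corner_direction_exists[OF b(11,1)] by metis
  moreover have "s * (c * s) > 0" "t * (c * t) > 0" if "c > 0" for c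
    using that st by (simp_all add: zero_less_mult_iff mult_less_0_iff) (auto simp: neq_iff)
  ultimately have "q \<in> corner L x s t" unfolding corner_def x' by auto
  then show ?thesis unfolding corner_point_def by (rule someI)
qed

lemma corner_subset:
  assumes x: "x \<in> crossings (projection L)"
  shows "corner L x s t \<subseteq> - fst ` support L"
proof
  obtain p u v where x': "x = (p, u, v)" by (cases x)
  fix q assume "q \<in> corner L x s t"
  then have "q \<in> ball p (fst (xbox L (p, u, v)))" "cross u (q - p) \<noteq> 0" "cross v (q - p) \<noteq> 0"
    unfolding corner_def x' by auto
  from crossing_boxD(10)[OF x[unfolded x'] this] show "q \<in> - fst ` support L" by simp
qed

lemma coloring_constant_on_corner:
  assumes "loc_const (- fst ` support L) c" "x \<in> crossings (projection L)"
    and "q \<in> corner L x s t" "q' \<in> corner L x s t"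
  shows "c q = c q'"
  using loc_const_connected[OF loc_const_subset[OF assms(1) corner_subset[OF assms(2)]]
      convex_connected[OF convex_corner] assms(3,4)] .

lemma coloring_over_crossing:
  fixes c :: "plane \<Rightarrow> 'g::group_add"
  assumes c: "dehn_coloring L c" and x: "(p, u, v) \<in> crossings (projection L)"
    and q: "q \<in> ball p (fst (xbox L (p, u, v)))" "cross u (q - p) \<noteq> 0" "cross v (q - p) \<noteq> 0"
  shows "c q = over_value L c (p, u, v) q + under_value L c (p, u, v) q"
proof -
  let ?x = "(p, u, v)" let ?r = "fst (xbox L ?x)"
  have lc: "loc_const (- fst ` support L) c" by (rule dehn_coloring_loc_const[OF c])
  note b = crossing_boxD[OF x]
  note const = coloring_constant_on_corner[OF lc x]
  obtain r where r: "r > 0" and rel: "\<And>qa qb qc qd. qa \<in> ball p r \<Longrightarrow> qb \<in> ball p r \<Longrightarrow> qc \<in> ball p r \<Longrightarrow> qd \<in> ball p r \<Longrightarrow>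
        left_of u (qa - p) \<and> right_of v (qa - p) \<and> left_of u (qb - p) \<and> left_of v (qb - p) \<and>
        right_of u (qc - p) \<and> left_of v (qc - p) \<and> right_of u (qd - p) \<and> right_of v (qd - p) \<Longrightarrow>
        c qa - c qd = c qb - c qc"
    using c x unfolding dehn_coloring_def by fast
  have near: "\<exists>q\<in>ball p r. q \<in> corner L ?x s t" if "s * s = 1" "t * t = 1" for s t
  proof -
    obtain q k where q: "q \<in> ball p (min r ?r)" "k > 0" "cross u (q - p) = k * s" "cross v (q - p) = k * t"
      using corner_direction_exists[OF b(11), of "min r ?r"] b(1) r by (metis min_less_iff_conj)
    have "s * (k * s) = k" "t * (k * t) = k"
      using that by (metis mult.assoc mult.commute mult.right_neutral)+
    then have "s * (k * s) > 0" "t * (k * t) > 0" using q(2) by (simp_all only:)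
    then show ?thesis using q unfolding corner_def by (intro bexI[of _ q]) simp_all
  qed
  obtain qa where qa: "qa \<in> ball p r" "qa \<in> corner L ?x 1 (-1)" using near[of 1 "-1"] by auto
  obtain qb where qb: "qb \<in> ball p r" "qb \<in> corner L ?x 1 1" using near[of 1 1] by auto
  obtain qc where qc: "qc \<in> ball p r" "qc \<in> corner L ?x (-1) 1" using near[of "-1" 1] by auto
  obtain qd where qd: "qd \<in> ball p r" "qd \<in> corner L ?x (-1) (-1)" using near[of "-1" "-1"] by auto
  have "c qa - c qd = c qb - c qc"
    using rel[OF qa(1) qb(1) qc(1) qd(1)] qa(2) qb(2) qc(2) qd(2)
    unfolding corner_def left_of_cross right_of_cross by auto
  \<comment> \<open>The jump at the over-strand stands on the left of the remaining value, the order
    in which the two strands are met on the way down. This is the splitting into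
    \<open>over_value\<close> and \<open>under_value\<close>.\<close>
  then have b_eq: "c qb = c qa - c qd + c qc" by (metis diff_add_cancel)
  note cn = corner_nonempty[OF x]
  have E: "c (corner_point L ?x 1 (-1)) = c qa" "c (corner_point L ?x (-1) 1) = c qc"
    "c (corner_point L ?x (-1) (-1)) = c qd"
    using const[OF qa(2) cn] const[OF qc(2) cn] const[OF qd(2) cn] by simp_all
  consider "q \<in> corner L ?x 1 (-1)" | "q \<in> corner L ?x 1 1" | "q \<in> corner L ?x (-1) 1" | "q \<in> corner L ?x (-1) (-1)"
    using q unfolding corner_def by (auto simp: neq_iff)
  then show ?thesis
  proof cases
    case 1
    then have "c q = c qa" "left_of u (q - p)" "\<not> left_of v (q - p)"
      using const[OF 1 qa(2)] by (auto simp: corner_def left_of_cross)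
    then show ?thesis by (simp add: over_value_def under_value_def E)
  next
    case 2
    then have "c q = c qb" "left_of u (q - p)" "left_of v (q - p)"
      using const[OF 2 qb(2)] by (auto simp: corner_def left_of_cross)
    then show ?thesis by (simp add: over_value_def under_value_def E b_eq)
  next
    case 3
    then have "c q = c qc" "\<not> left_of u (q - p)" "left_of v (q - p)"
      using const[OF 3 qc(2)] by (auto simp: corner_def left_of_cross)
    then show ?thesis by (simp add: over_value_def under_value_def E)
  next
    case 4
    then have "c q = c qd" "\<not> left_of u (q - p)" "\<not> left_of v (q - p)"
      using const[OF 4 qd(2)] by (auto simp: corner_def left_of_cross)
    then show ?thesis by (simp add: over_value_def under_value_def E)
  qed
qed

end

text \<open>The charts \<open>above L\<close>, \<open>below L\<close> and the boxes between the two strands of the crossings cover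
  the link complement. The bundle with holonomy \<open>c\<close> is glued from trivial bundles along
  differences of the following potentials.\<close>

definition potential :: "directed_edges \<Rightarrow> (plane \<Rightarrow> 'g::group_add) \<Rightarrow> chart \<Rightarrow> space \<Rightarrow> 'g" where
  "potential L c i X = (case i of Top \<Rightarrow> 0 | Mid x \<Rightarrow> over_value L c x (fst X)
    | Bot \<Rightarrow> if fst X \<in> fst ` support L \<and>
          (\<exists>x\<in>crossings (projection L). fst X \<in> ball (fst x) (fst (xbox L x)))
        then let x = (THE x. x \<in> crossings (projection L) \<and> fst X \<in> ball (fst x) (fst (xbox L x)))
          in over_value L c x (fst X) + under_value L c x (fst X)
        else c (fst X))"

definition transition :: "directed_edges \<Rightarrow> (plane \<Rightarrow> 'g::group_add) \<Rightarrow> chart \<Rightarrow> chart \<Rightarrow> space \<Rightarrow> 'g" where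
  "transition L c i j X = - potential L c i X + potential L c j X"

lemma transition_refl [simp]: "transition L c i i X = 0"
  by (simp add: transition_def)

text \<open>The cocycle law is automatic for differences of potentials. The bundle may still be
  nontrivial, since the potentials need not be locally constant; local constancy of their
  differences is the real content.\<close>

lemma transition_cocycle: "transition L c i l X = transition L c i j X + transition L c j l X"
proof -
  have "transition L c i j X + transition L c j l X =
      - potential L c i X + (potential L c j X + - potential L c j X) + potential L c l X"
    by (simp only: transition_def add.assoc)
  then show ?thesis by (simp add: transition_def)
qed

lemma transition_commute: "transition L c j i X = - transition L c i j X"
  by (simp add: transition_def minus_add)

lemma transition_Top_Bot:
  "X \<in> above L \<Longrightarrow> X \<in> below L \<Longrightarrow> transition L c Top Bot X = c (fst X)"
  using above_Int_below[of X L] by (simp add: transition_def potential_def)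

lemma transition_Top_Mid: "transition L c Top (Mid x) X = over_value L c x (fst X)"
  by (simp add: transition_def potential_def)

text \<open>Beneath the over-strand the box meets \<open>below L\<close> at points that project onto
  the curve, where a colouring carries no information. There the \<open>Bot\<close> potential is the
  sum of the two values by definition; off the curve this sum is the colour itself by
  \<open>coloring_over_crossing\<close>.\<close>

lemma transition_Mid_Bot:
  assumes L: "oriented_link L" "regular_position L" and c: "dehn_coloring L c"
    and x: "x \<in> crossings (projection L)" and X: "X \<in> snd (xbox L x)" "X \<in> below L"
  shows "transition L c (Mid x) Bot X = under_value L c x (fst X)"
proof -
  obtain p u v where x': "x = (p, u, v)" by (cases x)
  note b = crossing_boxD[OF L x[unfolded x']]
  have q: "fst X \<in> ball (fst x) (fst (xbox L x))" using b(5) X(1) unfolding x' by auto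
  have v: "cross v (fst X - p) \<noteq> 0" using b(9)[of X] X unfolding x' by auto
  have "potential L c Bot X = over_value L c x (fst X) + under_value L c x (fst X)"
  proof (cases "fst X \<in> fst ` support L")
    case True
    have "(THE x. x \<in> crossings (projection L) \<and> fst X \<in> ball (fst x) (fst (xbox L x))) = x"
      using crossing_boxes_disjoint[OF L] x q by (intro the_equality) blast+
    then show ?thesis using True x q unfolding potential_def by (auto simp: Let_def)
  next
    case False
    then have "X \<in> above L" using above_Int_below by blast
    then have u: "cross u (fst X - p) \<noteq> 0" using b(8)[of X] X unfolding x' by auto
    then show ?thesis
      using coloring_over_crossing[OF L c x[unfolded x'] _ u v] q False
      unfolding potential_def x' by simp
  qed
  then show ?thesis by (simp add: transition_def potential_def minus_add_cancel)
qed

lemma loc_const_under_value: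
  "(\<And>X. X \<in> S \<Longrightarrow> cross v (fst X - p) \<noteq> 0) \<Longrightarrow> loc_const S (\<lambda>X. under_value L c (p, u, v) (fst X))"
  unfolding under_value_def left_of_cross fst_conv snd_conv
  by (rule loc_const_sign) (auto intro!: continuous_intros)

lemma loc_const_over_value:
  "(\<And>X. X \<in> S \<Longrightarrow> cross u (fst X - p) \<noteq> 0) \<Longrightarrow> loc_const S (\<lambda>X. over_value L c (p, u, v) (fst X))"
  unfolding over_value_def left_of_cross fst_conv snd_conv
  by (rule loc_const_sign) (auto intro!: continuous_intros)

text \<open>A point off the link that is neither above nor below it has link points over and under
  it. These two form a crossing, and the box of that crossing contains the whole gap between
  them.\<close>

lemma support_cover:
  assumes L: "oriented_link L" "regular_position L"
  shows "- support L = (\<Union>i. chart_set L i)"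
proof (intro equalityI subsetI)
  fix X assume X: "X \<in> - support L"
  show "X \<in> (\<Union>i. chart_set L i)"
  proof (cases "X \<in> above L \<or> X \<in> below L")
    case True
    then show ?thesis by (metis UN_I UNIV_I chart_set_simps(1,2))
  next
    case False
    then obtain Y Y' where Y: "Y \<in> support L" "fst Y = fst X" "snd Y \<ge> snd X"
        and Y': "Y' \<in> support L" "fst Y' = fst X" "snd Y' \<le> snd X"
      unfolding above_def below_def by (auto simp: not_less)
    have "Y \<noteq> X" "Y' \<noteq> X" using X Y(1) Y'(1) by auto
    then have less: "snd Y' < snd Y" using Y Y' by (metis order_less_le prod_eq_iff order_trans order_antisym)
    obtain P Q where PQ: "(P, Q) \<in> L" "Y \<in> closed_segment P Q" using Y(1) by (auto simp: support_def)
    obtain P' Q' where PQ': "(P', Q') \<in> L" "Y' \<in> closed_segment P' Q'" using Y'(1) by (auto simp: support_def)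
    have x: "(fst X, direction (P, Q), direction (P', Q')) \<in> crossings (projection L)"
      unfolding mem_crossings using PQ PQ' Y(2) Y'(2) less by metis
    then have "X \<in> chart_set L (Mid (fst X, direction (P, Q), direction (P', Q')))"
      using crossing_boxD(6)[OF L x, of X] False X by simp
    then show ?thesis by blast
  qed
next
  fix X assume "X \<in> (\<Union>i. chart_set L i)"
  then obtain i where "X \<in> chart_set L i" by blast
  then show "X \<in> - support L"
  proof (cases i)
    case (Mid x)
    then have "x \<in> crossings (projection L)" "X \<in> snd (xbox L x)"
      using \<open>X \<in> chart_set L i\<close> by (auto simp: chart_set_def split: if_splits)
    then show ?thesis
      using crossing_boxD(4)[OF L, of "fst x" "fst (snd x)" "snd (snd x)"] by auto
  qed (use above_notin_support below_notin_support \<open>X \<in> chart_set L i\<close> in auto)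
qed

lemma local_system_transition:
  assumes L: "oriented_link L" "regular_position L" and c: "dehn_coloring L c"
  shows "local_system (- support L) (chart_set L) (transition L c)"
  unfolding local_system_def
proof (intro conjI allI impI)
  fix i show "open (chart_set L i)"
    using open_above[OF L(1)] open_below[OF L(1)] crossing_boxD(2)[OF L]
    by (cases i) (auto simp: chart_set_def)
next
  show "- support L = (\<Union>i. chart_set L i)" by (rule support_cover[OF L])
next
  fix i j l X show "transition L c i l X = transition L c i j X + transition L c j l X"
    by (rule transition_cocycle)
next
  fix i j
  have sym: "loc_const (chart_set L j \<inter> chart_set L i) (transition L c j i)"
    if "loc_const (chart_set L i \<inter> chart_set L j) (transition L c i j)" for i j
  proof -
    have "transition L c j i = (\<lambda>X. - transition L c i j X)"
      by (rule ext) (rule transition_commute)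
    then show ?thesis using loc_const_comp[OF that, of uminus] by (simp add: Int_commute)
  qed
  have TB: "loc_const (chart_set L Top \<inter> chart_set L Bot) (transition L c Top Bot)"
  proof (subst loc_const_cong)
    show "transition L c Top Bot X = c (fst X)" if "X \<in> chart_set L Top \<inter> chart_set L Bot" for X
      using that transition_Top_Bot[of X L c] by simp
    show "loc_const (chart_set L Top \<inter> chart_set L Bot) (\<lambda>X. c (fst X))"
    proof (rule loc_const_vimage[where \<gamma> = fst and c = c, OF continuous_on_fst[OF continuous_on_id] dehn_coloring_loc_const[OF c]])
      show "fst ` (chart_set L Top \<inter> chart_set L Bot) \<subseteq> - fst ` support L"
        by (rule image_subsetI) (use above_Int_below in \<open>simp only: chart_set_simps Int_iff Compl_iff not_False_eq_True\<close>)
    qed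
  qed
  have TM: "loc_const (chart_set L Top \<inter> chart_set L (Mid x)) (transition L c Top (Mid x))" for x
  proof (cases "x \<in> crossings (projection L)")
    case True
    obtain p u v where x: "x = (p, u, v)" by (cases x)
    have "loc_const (chart_set L Top \<inter> chart_set L (Mid x)) (\<lambda>X. over_value L c (p, u, v) (fst X))"
      using crossing_boxD(8)[OF L True[unfolded x]] True x by (intro loc_const_over_value) auto
    then show ?thesis unfolding transition_Top_Mid[abs_def] x .
  qed (simp add: chart_set_def loc_const_def)
  have MB: "loc_const (chart_set L (Mid x) \<inter> chart_set L Bot) (transition L c (Mid x) Bot)" for x
  proof (cases "x \<in> crossings (projection L)")
    case True
    obtain p u v where x: "x = (p, u, v)" by (cases x)
    have "loc_const (chart_set L (Mid x) \<inter> chart_set L Bot) (\<lambda>X. under_value L c (p, u, v) (fst X))"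
      using crossing_boxD(9)[OF L True[unfolded x]] True x by (intro loc_const_under_value) auto
    then show ?thesis
      using transition_Mid_Bot[OF L c True] True x by (subst loc_const_cong) auto
  qed (simp add: chart_set_def loc_const_def)
  have MM: "loc_const (chart_set L (Mid x) \<inter> chart_set L (Mid y)) (transition L c (Mid x) (Mid y))" for x y
  proof (cases "x = y")
    case True
    have "transition L c (Mid y) (Mid y) = (\<lambda>X. 0)" by (rule ext) simp
    then show ?thesis using True by simp
  next
    case False
    have "chart_set L (Mid x) \<inter> chart_set L (Mid y) = {}"
    proof (cases "x \<in> crossings (projection L) \<and> y \<in> crossings (projection L)")
      case True
      have "fst X \<in> ball (fst z) (fst (xbox L z))" if "X \<in> snd (xbox L z)" "z \<in> crossings (projection L)" for X z
        using crossing_boxD(5)[OF L, of "fst z" "fst (snd z)" "snd (snd z)"] that by auto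
      then have "x = y" if "X \<in> snd (xbox L x)" "X \<in> snd (xbox L y)" for X
        using crossing_boxes_disjoint[OF L, of x y "fst X"] that True by blast
      then show ?thesis using True False by (simp only: chart_set_simps) blast
    qed (auto simp: chart_set_def)
    then show ?thesis by (simp add: loc_const_def)
  qed
  have II: "loc_const (chart_set L i \<inter> chart_set L i) (transition L c i i)" for i
  proof -
    have "transition L c i i = (\<lambda>X. 0)" by (rule ext) simp
    then show ?thesis by simp
  qed
  show "loc_const (chart_set L i \<inter> chart_set L j) (transition L c i j)"
    using TB TM MB MM II sym by (cases i; cases j) metis+
qed

section \<open>Holonomy from the top to the bottom of a framed local system\<close>

definition framed ::
  "directed_edges \<Rightarrow> real \<Rightarrow> (chart \<Rightarrow> space set) \<Rightarrow> (chart \<Rightarrow> chart \<Rightarrow> space \<Rightarrow> 'g::group_add) \<Rightarrow> bool" where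
  "framed L Z U k \<longleftrightarrow> local_system (- support L) U k \<and> (\<forall>X. Z < snd X \<longrightarrow> X \<in> U Top) \<and>
     (\<forall>X. snd X < - Z \<longrightarrow> X \<in> U Bot) \<and> (\<forall>Y\<in>support L. \<bar>snd Y\<bar> \<le> Z)"

text \<open>\<open>sA\<close> continues the trivialisation far above through \<open>above L\<close>,
  and \<open>sB\<close> the one far below through \<open>below L\<close>. The vanishing conditions
  use up the freedom of right translation.\<close>

definition holonomy_sections ::
  "directed_edges \<Rightarrow> (chart \<Rightarrow> space set) \<Rightarrow> (chart \<Rightarrow> chart \<Rightarrow> space \<Rightarrow> 'g::group_add) \<Rightarrow>
    (chart \<Rightarrow> space \<Rightarrow> 'g) \<Rightarrow> (chart \<Rightarrow> space \<Rightarrow> 'g) \<Rightarrow> bool" where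
  "holonomy_sections L U k sA sB \<longleftrightarrow>
     flat_section (above L) id U k sA \<and> flat_section (below L) id U k sB \<and>
     (\<exists>Z. framed L Z U k \<and> (\<forall>X. Z < snd X \<longrightarrow> sA Top X = 0) \<and> (\<forall>X. snd X < - Z \<longrightarrow> sB Bot X = 0))"

definition holonomy_of ::
  "directed_edges \<Rightarrow> (chart \<Rightarrow> space set) \<Rightarrow> (chart \<Rightarrow> space \<Rightarrow> 'g::group_add) \<Rightarrow> (chart \<Rightarrow> space \<Rightarrow> 'g) \<Rightarrow>
    (plane \<Rightarrow> 'g) \<Rightarrow> bool" where
  "holonomy_of L U sA sB c \<longleftrightarrow>
     (\<forall>X i. X \<in> above L \<longrightarrow> X \<in> below L \<longrightarrow> X \<in> U i \<longrightarrow> c (fst X) = - sA i X + sB i X)"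

definition holonomy ::
  "directed_edges \<Rightarrow> (chart \<Rightarrow> space set) \<Rightarrow> (chart \<Rightarrow> chart \<Rightarrow> space \<Rightarrow> 'g::group_add) \<Rightarrow>
    (plane \<Rightarrow> 'g) \<Rightarrow> bool" where
  "holonomy L U k c \<longleftrightarrow> (\<exists>sA sB. holonomy_sections L U k sA sB \<and> holonomy_of L U sA sB c)"

lemma framed_local_system: "framed L Z U k \<Longrightarrow> local_system (- support L) U k"
  unfolding framed_def by blast

lemma framed_mono: "framed L Z U k \<Longrightarrow> Z \<le> Z' \<Longrightarrow> framed L Z' U k"
  unfolding framed_def by force

lemma holonomy_sections_local_system:
  "holonomy_sections L U k sA sB \<Longrightarrow> local_system (- support L) U k"
  unfolding holonomy_sections_def using framed_local_system by blast

lemma local_system_open: "local_system Om U k \<Longrightarrow> open (U i)"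
  and local_system_Union: "local_system Om U k \<Longrightarrow> (\<Union>i. U i) = Om"
  unfolding local_system_def by blast+

lemma above_upward: "X \<in> above L \<Longrightarrow> fst X' = fst X \<Longrightarrow> snd X \<le> snd X' \<Longrightarrow> X' \<in> above L"
  unfolding above_def by fastforce

lemma below_downward: "X \<in> below L \<Longrightarrow> fst X' = fst X \<Longrightarrow> snd X' \<le> snd X \<Longrightarrow> X' \<in> below L"
  unfolding below_def by fastforce

lemma framed_above: "framed L Z U k \<Longrightarrow> Z < snd X \<Longrightarrow> X \<in> above L"
  and framed_below: "framed L Z U k \<Longrightarrow> snd X < - Z \<Longrightarrow> X \<in> below L"
  unfolding framed_def above_def below_def by force+

lemma section_above_exists:
  assumes L: "oriented_link L" and fr: "framed L Z U k"
  obtains s where "flat_section (above L) id U k s" "\<And>X. Z < snd X \<Longrightarrow> s Top X = 0"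
proof -
  note ls = framed_local_system[OF fr]
  \<comment> \<open>A vertical lift. Its length exceeds
    \<open>\<bar>snd X\<bar> + \<bar>Z\<bar>\<close>, so the final height is above \<open>Z\<close>
    whatever the start.\<close>
  let ?H = "\<lambda>(X, t). (fst X, snd X + t * (\<bar>snd X\<bar> + \<bar>Z\<bar> + 1))"
  have up: "?H (X, t) \<in> above L" if "X \<in> above L" "t \<ge> 0" for X t
    using that by (auto intro!: above_upward[of X])
  have cH: "continuous_on (above L \<times> {0..1}) ?H"
    unfolding split_beta by (intro continuous_intros)
  have HV: "?H ` (above L \<times> {0..1}) \<subseteq> - support L"
    using up above_notin_support by force
  have H0: "?H (X, 0) = X" for X by simp
  have H1: "?H (X, 1) \<in> U Top" for X
  proof -
    have "Z < snd (?H (X, 1))" by simp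
    then show ?thesis using fr unfolding framed_def by blast
  qed
  obtain s where s: "flat_section (above L) id U k s"
    using flat_section_exists[OF ls open_above[OF L] cH HV H0 H1] by blast
  define T where "T = {X :: space. Z < snd X}"
  have T: "connected T"
  proof -
    have "T = fst -` UNIV \<inter> {X. (0, 1) \<bullet> X > Z}" by (auto simp: T_def)
    then show ?thesis by (simp add: convex_connected convex_halfspace_gt)
  qed
  have "T \<subseteq> {t \<in> above L. id t \<in> U Top}"
    using framed_above[OF fr] fr unfolding T_def framed_def by auto
  then have lc: "loc_const T (s Top)"
    by (rule loc_const_subset[OF flat_section_loc_const[OF s]])
  define a where "a = s Top (0, Z + 1)"
  have "s Top X = a" if "Z < snd X" for X
    unfolding a_def by (rule loc_const_connected[OF lc T]) (use that in \<open>auto simp: T_def\<close>)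
  then show ?thesis
    by (intro that[of "\<lambda>i X. s i X + (- a)"] flat_section_add[OF s]) simp
qed

lemma section_below_exists:
  assumes L: "oriented_link L" and fr: "framed L Z U k"
  obtains s where "flat_section (below L) id U k s" "\<And>X. snd X < - Z \<Longrightarrow> s Bot X = 0"
proof -
  note ls = framed_local_system[OF fr]
  let ?H = "\<lambda>(X, t). (fst X, snd X - t * (\<bar>snd X\<bar> + \<bar>Z\<bar> + 1))"
  have down: "?H (X, t) \<in> below L" if "X \<in> below L" "t \<ge> 0" for X t
    using that by (auto intro!: below_downward[of X])
  have cH: "continuous_on (below L \<times> {0..1}) ?H"
    unfolding split_beta by (intro continuous_intros)
  have HV: "?H ` (below L \<times> {0..1}) \<subseteq> - support L"
    using down below_notin_support by force
  have H0: "?H (X, 0) = X" for X by simp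
  have H1: "?H (X, 1) \<in> U Bot" for X
  proof -
    have "snd (?H (X, 1)) < - Z" by simp
    then show ?thesis using fr unfolding framed_def by blast
  qed
  obtain s where s: "flat_section (below L) id U k s"
    using flat_section_exists[OF ls open_below[OF L] cH HV H0 H1] by blast
  define T where "T = {X :: space. snd X < - Z}"
  have T: "connected T"
  proof -
    have "T = fst -` UNIV \<inter> {X. (0, 1) \<bullet> X < - Z}" by (auto simp: T_def)
    then show ?thesis by (simp add: convex_connected convex_halfspace_lt)
  qed
  have "T \<subseteq> {t \<in> below L. id t \<in> U Bot}"
    using framed_below[OF fr] fr unfolding T_def framed_def by auto
  then have lc: "loc_const T (s Bot)"
    by (rule loc_const_subset[OF flat_section_loc_const[OF s]])
  define a where "a = s Bot (0, - Z - 1)"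
  have "s Bot X = a" if "snd X < - Z" for X
    unfolding a_def by (rule loc_const_connected[OF lc T]) (use that in \<open>auto simp: T_def\<close>)
  then show ?thesis
    by (intro that[of "\<lambda>i X. s i X + (- a)"] flat_section_add[OF s]) simp
qed

lemma sections_difference:
  assumes ls: "local_system (- support L) U k" and V: "V \<subseteq> V1" "V \<subseteq> V2" "V \<inter> support L = {}"
    and s: "flat_section V1 id U k s1" "flat_section V2 id U k s2"
  obtains d where "loc_const V d" "\<And>X i. X \<in> V \<Longrightarrow> X \<in> U i \<Longrightarrow> d X = - s1 i X + s2 i X"
proof -
  have s': "flat_section V id U k s1" "flat_section V id U k s2"
    using s V by (auto elim: flat_section_subset)
  have cov: "id ` V \<subseteq> (\<Union>i. U i)" using V(3) unfolding local_system_Union[OF ls] by auto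
  define d where "d X = (let i = SOME i. X \<in> U i in - s1 i X + s2 i X)" for X
  have d: "d X = - s1 i X + s2 i X" if "X \<in> V" "id X \<in> U i" for X i
  proof -
    have "id X \<in> U (SOME i. X \<in> U i)" using that(2) by (auto intro: someI)
    then show ?thesis
      using flat_section_diff[OF s' that(1) _ that(2)] by (simp add: d_def Let_def)
  qed
  have "loc_const V d"
    by (rule flat_section_diff_loc_const[OF s' continuous_on_id' _ cov d])
       (auto intro: local_system_open[OF ls])
  then show ?thesis using that d by simp
qed

text \<open>A vertical line off the projection lies entirely in \<open>above L\<close> and
  \<open>below L\<close>. The comparison of the two sections is constant along it and can be read at
  height 0.\<close>

lemma holonomy_of_exists:
  assumes hs: "holonomy_sections L U k sA sB"
  obtains c where "holonomy_of L U sA sB c"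
proof -
  note ls = holonomy_sections_local_system[OF hs]
  obtain d where d: "loc_const (above L \<inter> below L) d"
      "\<And>X i. X \<in> above L \<inter> below L \<Longrightarrow> X \<in> U i \<Longrightarrow> d X = - sA i X + sB i X"
    using sections_difference[OF ls, of "above L \<inter> below L" "above L" "below L" sA sB] hs
      above_notin_support unfolding holonomy_sections_def by blast
  have "d X = d (fst X, 0)" if X: "X \<in> above L" "X \<in> below L" for X
  proof -
    have nc: "fst X \<notin> fst ` support L" using X above_Int_below by blast
    have "{fst X} \<times> UNIV \<subseteq> above L \<inter> below L"
    proof
      fix Y :: space assume "Y \<in> {fst X} \<times> UNIV"
      then have "fst Y = fst X" by auto
      then show "Y \<in> above L \<inter> below L" using nc above_Int_below[of Y L] by simp
    qed
    then have "loc_const ({fst X} \<times> UNIV) d" by (rule loc_const_subset[OF d(1)])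
    moreover have "connected ({fst X} \<times> (UNIV::real set))" by (intro connected_Times) auto
    ultimately show ?thesis by (rule loc_const_connected) (auto simp: mem_Times_iff)
  qed
  then have "holonomy_of L U sA sB (\<lambda>q. d (q, 0))"
    unfolding holonomy_of_def using d(2) by (metis IntI)
  then show ?thesis using that by blast
qed

lemma holonomy_exists:
  assumes L: "oriented_link L" and fr: "framed L Z U k"
  obtains c where "holonomy L U k c"
proof -
  obtain sA where "flat_section (above L) id U k sA" "\<And>X. Z < snd X \<Longrightarrow> sA Top X = 0"
    using section_above_exists[OF L fr] by blast
  moreover obtain sB where "flat_section (below L) id U k sB" "\<And>X. snd X < - Z \<Longrightarrow> sB Bot X = 0"
    using section_below_exists[OF L fr] by blast
  ultimately have "holonomy_sections L U k sA sB"
    unfolding holonomy_sections_def using fr by blast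
  then show ?thesis using holonomy_of_exists that unfolding holonomy_def by metis
qed

lemma holonomy_loc_const:
  assumes hs: "holonomy_sections L U k sA sB" and c: "holonomy_of L U sA sB c"
  shows "loc_const (- fst ` support L) c"
proof -
  note ls = holonomy_sections_local_system[OF hs]
  obtain d where d: "loc_const (above L \<inter> below L) d"
      "\<And>X i. X \<in> above L \<inter> below L \<Longrightarrow> X \<in> U i \<Longrightarrow> d X = - sA i X + sB i X"
    using sections_difference[OF ls, of "above L \<inter> below L" "above L" "below L" sA sB] hs
      above_notin_support unfolding holonomy_sections_def by blast
  have mem: "(q, 0) \<in> above L \<inter> below L" if "q \<in> - fst ` support L" for q
    using that above_Int_below[of "(q, 0)" L] by simp
  have "c q = d (q, 0)" if "q \<in> - fst ` support L" for q
  proof -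
    note m = mem[OF that]
    then have "(q, 0) \<in> (\<Union>i. U i)"
      using above_notin_support unfolding local_system_Union[OF ls] by blast
    then obtain i where "(q, 0) \<in> U i" by blast
    then show ?thesis using c d(2)[OF m] m unfolding holonomy_of_def by fastforce
  qed
  moreover have "loc_const (- fst ` support L) (\<lambda>q. d (q, 0))"
    by (rule loc_const_vimage[OF _ d(1)]) (use mem in \<open>auto intro!: continuous_intros\<close>)
  ultimately show ?thesis by (subst loc_const_cong) auto
qed

lemma convex_half_box:
  fixes N :: "space set"
  assumes "convex N"
  shows "convex {X \<in> N. s * cross u (fst X - p) > 0}"
proof -
  have "convex (N \<inter> fst -` {q. s * cross u (q - p) > 0})"
    by (rule convex_Int[OF assms
          convex_linear_vimage[OF bounded_linear.linear[OF bounded_linear_fst] convex_cross_halfplane]])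
  also have "N \<inter> fst -` {q. s * cross u (q - p) > 0} = {X \<in> N. s * cross u (fst X - p) > 0}" by auto
  finally show ?thesis .
qed

lemma constant_on_half_box:
  fixes N :: "space set"
  assumes "convex N" "loc_const S d" "\<And>X. X \<in> N \<Longrightarrow> cross u (fst X - p) \<noteq> 0 \<Longrightarrow> X \<in> S"
  obtains a b where "\<And>X. X \<in> N \<Longrightarrow> cross u (fst X - p) \<noteq> 0 \<Longrightarrow> d X = (if left_of u (fst X - p) then a else b)"
proof -
  have "\<exists>a. \<forall>X\<in>{X \<in> N. s * cross u (fst X - p) > 0}. d X = a" for s
  proof -
    have "loc_const {X \<in> N. s * cross u (fst X - p) > 0} d"
    proof (rule loc_const_subset[OF assms(2)], rule subsetI)
      fix X assume "X \<in> {X \<in> N. s * cross u (fst X - p) > 0}"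
      then have "X \<in> N" "cross u (fst X - p) \<noteq> 0" by auto
      then show "X \<in> S" by (rule assms(3))
    qed
    note eq = loc_const_connected[OF this convex_connected[OF convex_half_box[OF assms(1)]]]
    show ?thesis
    proof (cases "{X \<in> N. s * cross u (fst X - p) > 0} = {}")
      case False
      then obtain X0 where "X0 \<in> {X \<in> N. s * cross u (fst X - p) > 0}" by blast
      then show ?thesis by (intro exI[of _ "d X0"] ballI) (rule eq)
    next
      case True
      then show ?thesis by (intro exI ballI) (metis empty_iff)
    qed
  qed
  then obtain a where a: "\<And>s X. X \<in> N \<Longrightarrow> s * cross u (fst X - p) > 0 \<Longrightarrow> d X = a s" by (auto, metis)
  show ?thesis
    by (rule that[of "a 1" "a (-1)"]) (use a[of _ 1] a[of _ "-1"] in \<open>auto simp: left_of_cross\<close>)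
qed

text \<open>The convex box carries a section, whose difference to \<open>sA\<close> is constant on
  either side of the over-strand. Right translation by \<open>- b0\<close> makes the constant on the
  right 0, the normalisation built into \<open>over_value\<close>.\<close>

lemma middle_section_raw:
  assumes L: "oriented_link L" "regular_position L" and hs: "holonomy_sections L U k sA sB"
    and x: "(p, u, v) \<in> crossings (projection L)"
  obtains t J E1 E2 where "flat_section (snd (xbox L (p, u, v))) id U k t"
    "\<And>X i. X \<in> snd (xbox L (p, u, v)) \<Longrightarrow> X \<in> above L \<Longrightarrow> X \<in> U i \<Longrightarrow>
       - sA i X + t i X = (if left_of u (fst X - p) then J else 0)"
    "\<And>X i. X \<in> snd (xbox L (p, u, v)) \<Longrightarrow> X \<in> below L \<Longrightarrow> X \<in> U i \<Longrightarrow>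
       - t i X + sB i X = (if left_of v (fst X - p) then E1 else E2)"
proof -
  note ls = holonomy_sections_local_system[OF hs]
  note b = crossing_boxD[OF L x]
  let ?N = "snd (xbox L (p, u, v))"
  obtain z where z: "(p, z) \<in> ?N" using b(7) by blast
  then have "(p, z) \<in> (\<Union>i. U i)" unfolding local_system_Union[OF ls] using b(4) by auto
  then obtain i0 where i0: "(p, z) \<in> U i0" by blast
  let ?H = "\<lambda>(X, t). (1 - t) *\<^sub>R X + t *\<^sub>R (p, z)"
  have cH: "continuous_on (?N \<times> {0..1}) ?H"
    unfolding split_beta by (intro continuous_intros)
  have HN: "?H ` (?N \<times> {0..1}) \<subseteq> - support L"
  proof (rule image_subsetI)
    fix y :: "space \<times> real" assume "y \<in> ?N \<times> {0..1}"
    then obtain X t where y: "y = (X, t)" "X \<in> ?N" "0 \<le> t" "t \<le> 1" by (auto simp del: split_paired_Ex)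
    have "?H y \<in> ?N"
      using convexD_alt[OF b(3) y(2) z y(3,4)] unfolding y(1) by simp
    then show "?H y \<in> - support L" using b(4) by blast
  qed
  have H0: "?H (X, 0) = X" and H1: "?H (X, 1) \<in> U i0" for X
    using i0 by (simp_all flip: zero_prod_def)
  obtain t0 where t0: "flat_section ?N id U k t0"
    using flat_section_exists[OF ls b(2) cH HN H0 H1] by blast
  have sA: "flat_section (above L) id U k sA" and sB: "flat_section (below L) id U k sB"
    using hs unfolding holonomy_sections_def by blast+
  obtain d where d: "loc_const (?N \<inter> above L) d"
      "\<And>X i. X \<in> ?N \<inter> above L \<Longrightarrow> X \<in> U i \<Longrightarrow> d X = - sA i X + t0 i X"
    using sections_difference[OF ls _ _ _ sA t0, of "?N \<inter> above L"] b(4) by blast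
  obtain a0 b0 where ab: "\<And>X. X \<in> ?N \<Longrightarrow> cross u (fst X - p) \<noteq> 0 \<Longrightarrow> d X = (if left_of u (fst X - p) then a0 else b0)"
    using constant_on_half_box[OF b(3) d(1)] b(8) by blast
  define t where "t = (\<lambda>i X. t0 i X + (- b0))"
  have t: "flat_section ?N id U k t" unfolding t_def by (rule flat_section_add[OF t0])
  obtain e where e: "loc_const (?N \<inter> below L) e"
      "\<And>X i. X \<in> ?N \<inter> below L \<Longrightarrow> X \<in> U i \<Longrightarrow> e X = - t i X + sB i X"
    using sections_difference[OF ls _ _ _ t sB, of "?N \<inter> below L"] b(4) by blast
  obtain E1 E2 where E: "\<And>X. X \<in> ?N \<Longrightarrow> cross v (fst X - p) \<noteq> 0 \<Longrightarrow> e X = (if left_of v (fst X - p) then E1 else E2)"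
    using constant_on_half_box[OF b(3) e(1)] b(9) by blast
  show ?thesis
  proof (rule that[OF t])
    fix X i assume X: "X \<in> ?N" "X \<in> above L" "X \<in> U i"
    have "- sA i X + t i X = d X + - b0"
      using d(2)[of X i] X unfolding t_def by (metis IntI add.assoc)
    also have "\<dots> = (if left_of u (fst X - p) then a0 + - b0 else 0)"
      using ab[OF X(1)] b(8)[OF X(1)] X(2) by simp
    finally show "- sA i X + t i X = (if left_of u (fst X - p) then a0 + - b0 else 0)" .
  next
    fix X i assume X: "X \<in> ?N" "X \<in> below L" "X \<in> U i"
    show "- t i X + sB i X = (if left_of v (fst X - p) then E1 else E2)"
      using e(2)[of X i] E[OF X(1)] b(9)[OF X(1)] X by simp
  qed
qed

lemma near_crossing:
  assumes L: "oriented_link L" "regular_position L" and x: "(p, u, v) \<in> crossings (projection L)"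
  obtains r z where "r > 0" "r \<le> fst (xbox L (p, u, v))" "\<And>q. q \<in> ball p r \<Longrightarrow> (q, z) \<in> snd (xbox L (p, u, v))"
proof -
  note b = crossing_boxD[OF L x]
  obtain z where z: "(p, z) \<in> snd (xbox L (p, u, v))" using b(7) by blast
  have "open ((\<lambda>q. (q, z)) -` snd (xbox L (p, u, v)))"
    by (rule open_vimage[OF b(2)]) (intro continuous_intros)
  then obtain r where r: "r > 0" "ball p r \<subseteq> (\<lambda>q. (q, z)) -` snd (xbox L (p, u, v))"
    using z unfolding open_contains_ball by (metis vimageI)
  show ?thesis
    by (rule that[of "min r (fst (xbox L (p, u, v)))" z]) (use r b(1) in auto)
qed

text \<open>On a horizontal slice of the box, \<open>- sA + sB\<close> is
  \<open>(- sA + t) + (- t + sB)\<close>. The first summand sees only the side of the over-strand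
  and the second only the side of the under-strand; the crossing condition on colours comes from
  this.\<close>

lemma holonomy_near_crossing:
  assumes L: "oriented_link L" "regular_position L" and hs: "holonomy_sections L U k sA sB"
    and c: "holonomy_of L U sA sB c" and x: "(p, u, v) \<in> crossings (projection L)"
  obtains t J E1 E2 r where "flat_section (snd (xbox L (p, u, v))) id U k t"
    "\<And>X i. X \<in> snd (xbox L (p, u, v)) \<Longrightarrow> X \<in> above L \<Longrightarrow> X \<in> U i \<Longrightarrow>
       - sA i X + t i X = (if left_of u (fst X - p) then J else 0)"
    "\<And>X i. X \<in> snd (xbox L (p, u, v)) \<Longrightarrow> X \<in> below L \<Longrightarrow> X \<in> U i \<Longrightarrow>
       - t i X + sB i X = (if left_of v (fst X - p) then E1 else E2)"
    "r > 0" "r \<le> fst (xbox L (p, u, v))"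
    "\<And>q. q \<in> ball p r \<Longrightarrow> cross u (q - p) \<noteq> 0 \<Longrightarrow> cross v (q - p) \<noteq> 0 \<Longrightarrow>
       c q = (if left_of u (q - p) then J else 0) + (if left_of v (q - p) then E1 else E2)"
proof -
  note ls = holonomy_sections_local_system[OF hs]
  note b = crossing_boxD[OF L x]
  obtain t J E1 E2 where t: "flat_section (snd (xbox L (p, u, v))) id U k t"
    "\<And>X i. X \<in> snd (xbox L (p, u, v)) \<Longrightarrow> X \<in> above L \<Longrightarrow> X \<in> U i \<Longrightarrow>
       - sA i X + t i X = (if left_of u (fst X - p) then J else 0)"
    "\<And>X i. X \<in> snd (xbox L (p, u, v)) \<Longrightarrow> X \<in> below L \<Longrightarrow> X \<in> U i \<Longrightarrow>
       - t i X + sB i X = (if left_of v (fst X - p) then E1 else E2)"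
    using middle_section_raw[OF L hs x] by blast
  obtain r z where r: "r > 0" "r \<le> fst (xbox L (p, u, v))" "\<And>q. q \<in> ball p r \<Longrightarrow> (q, z) \<in> snd (xbox L (p, u, v))"
    using near_crossing[OF L x] by blast
  have "c q = (if left_of u (q - p) then J else 0) + (if left_of v (q - p) then E1 else E2)"
    if q: "q \<in> ball p r" "cross u (q - p) \<noteq> 0" "cross v (q - p) \<noteq> 0" for q
  proof -
    let ?X = "(q, z)"
    have N: "?X \<in> snd (xbox L (p, u, v))" by (rule r(3)[OF q(1)])
    have X: "?X \<in> above L" "?X \<in> below L" using b(8,9)[OF N] q by auto
    have "?X \<in> (\<Union>i. U i)" unfolding local_system_Union[OF ls] using above_notin_support[OF X(1)] by simp
    then obtain i where i: "?X \<in> U i" by blast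
    have "c q = - sA i ?X + sB i ?X" using c X i unfolding holonomy_of_def by fastforce
    also have "\<dots> = - sA i ?X + (t i ?X + - t i ?X) + sB i ?X" by simp
    also have "\<dots> = (- sA i ?X + t i ?X) + (- t i ?X + sB i ?X)" by (simp only: add.assoc)
    finally show ?thesis using t(2)[OF N X(1) i] t(3)[OF N X(2) i] by simp
  qed
  then show ?thesis using that[OF t r(1,2)] by blast
qed

lemma holonomy_dehn_coloring:
  assumes L: "oriented_link L" "regular_position L" and c: "holonomy L U k c"
  shows "dehn_coloring L c"
  unfolding dehn_coloring_def
proof (intro conjI ballI)
  obtain sA sB where hs: "holonomy_sections L U k sA sB" "holonomy_of L U sA sB c"
    using c unfolding holonomy_def by blast
  show "loc_const (- fst ` support L) c" by (rule holonomy_loc_const[OF hs])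
  fix x assume "x \<in> crossings (projection L)"
  moreover obtain p u v where xe: "x = (p, u, v)" by (cases x)
  ultimately have x: "(p, u, v) \<in> crossings (projection L)" by simp
  obtain J E1 E2 r where r: "r > 0" and cq: "\<And>q. q \<in> ball p r \<Longrightarrow> cross u (q - p) \<noteq> 0 \<Longrightarrow> cross v (q - p) \<noteq> 0 \<Longrightarrow>
       c q = (if left_of u (q - p) then J else 0) + (if left_of v (q - p) then E1 else E2)"
    using holonomy_near_crossing[OF L hs x] by metis
  have "c qa - c qd = c qb - c qc"
    if "qa \<in> ball p r" "qb \<in> ball p r" "qc \<in> ball p r" "qd \<in> ball p r"
      "left_of u (qa - p) \<and> right_of v (qa - p) \<and> left_of u (qb - p) \<and> left_of v (qb - p) \<and>
        right_of u (qc - p) \<and> left_of v (qc - p) \<and> right_of u (qd - p) \<and> right_of v (qd - p)" for qa qb qc qd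
  proof -
    have "c qa = J + E2" "c qb = J + E1" "c qc = E1" "c qd = E2"
      using that cq[of qa] cq[of qb] cq[of qc] cq[of qd]
      unfolding left_of_cross right_of_cross by auto
    then show ?thesis by simp
  qed
  then show "case x of (p, u, v) \<Rightarrow> \<exists>r>0. \<forall>qa\<in>ball p r. \<forall>qb\<in>ball p r. \<forall>qc\<in>ball p r. \<forall>qd\<in>ball p r.
        left_of u (qa - p) \<and> right_of v (qa - p) \<and> left_of u (qb - p) \<and> left_of v (qb - p) \<and>
        right_of u (qc - p) \<and> left_of v (qc - p) \<and> right_of u (qd - p) \<and> right_of v (qd - p) \<longrightarrow>
        c qa - c qd = c qb - c qc"
    unfolding xe prod.case using r by blast
qed

text \<open>Evaluating the holonomy in the corners identifies the unknown constants
  \<open>J\<close>, \<open>E1\<close>, \<open>E2\<close> with those in \<open>over_value\<close> and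
  \<open>under_value\<close>. Thus \<open>t\<close> plays the role of the \<open>Mid\<close> chart
  of the bundle glued from \<open>c\<close>.\<close>

lemma middle_section:
  assumes L: "oriented_link L" "regular_position L" and hs: "holonomy_sections L U k sA sB"
    and c: "holonomy_of L U sA sB c" and x: "x \<in> crossings (projection L)"
  obtains t where "flat_section (snd (xbox L x)) id U k t"
    "\<And>X i. X \<in> snd (xbox L x) \<Longrightarrow> X \<in> above L \<Longrightarrow> X \<in> U i \<Longrightarrow> - sA i X + t i X = over_value L c x (fst X)"
    "\<And>X i. X \<in> snd (xbox L x) \<Longrightarrow> X \<in> below L \<Longrightarrow> X \<in> U i \<Longrightarrow> - t i X + sB i X = under_value L c x (fst X)"
proof -
  obtain p u v where xe: "x = (p, u, v)" by (cases x)
  note x = x[unfolded xe]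
  note b = crossing_boxD[OF L x]
  have lc: "loc_const (- fst ` support L) c" by (rule holonomy_loc_const[OF hs c])
  obtain t J E1 E2 r where t: "flat_section (snd (xbox L (p, u, v))) id U k t"
    "\<And>X i. X \<in> snd (xbox L (p, u, v)) \<Longrightarrow> X \<in> above L \<Longrightarrow> X \<in> U i \<Longrightarrow>
       - sA i X + t i X = (if left_of u (fst X - p) then J else 0)"
    "\<And>X i. X \<in> snd (xbox L (p, u, v)) \<Longrightarrow> X \<in> below L \<Longrightarrow> X \<in> U i \<Longrightarrow>
       - t i X + sB i X = (if left_of v (fst X - p) then E1 else E2)"
    "r > 0" "r \<le> fst (xbox L (p, u, v))"
    and cq: "\<And>q. q \<in> ball p r \<Longrightarrow> cross u (q - p) \<noteq> 0 \<Longrightarrow> cross v (q - p) \<noteq> 0 \<Longrightarrow>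
       c q = (if left_of u (q - p) then J else 0) + (if left_of v (q - p) then E1 else E2)"
    by (rule holonomy_near_crossing[OF L hs c x]) (rule that; assumption)
  have cp: "c (corner_point L (p, u, v) s s') = (if s > 0 then J else 0) + (if s' > 0 then E1 else E2)"
    if "s \<noteq> 0" "s' \<noteq> 0" for s s'
  proof -
    obtain q k where q: "q \<in> ball p r" "k > 0" "cross u (q - p) = k * s" "cross v (q - p) = k * s'"
      using corner_direction_exists[OF b(11) t(4), where s = s and t = s' and p = p] by blast
    have "s * (k * s) = k * (s * s)" "s' * (k * s') = k * (s' * s')" by (simp_all add: algebra_simps)
    moreover have "s * s > 0" "s' * s' > 0" using that by (simp_all add: zero_less_mult_iff) (auto simp: neq_iff)
    ultimately have "s * (k * s) > 0" "s' * (k * s') > 0" using q(2) by (simp_all only: zero_less_mult_iff) auto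
    then have "q \<in> corner L (p, u, v) s s'"
      using q t(5) unfolding corner_def by auto
    then have "c (corner_point L (p, u, v) s s') = c q"
      by (rule coloring_constant_on_corner[OF L lc x corner_nonempty[OF L x that]])
    also have "\<dots> = (if s > 0 then J else 0) + (if s' > 0 then E1 else E2)"
      using cq[OF q(1)] q(2-4) that by (auto simp: left_of_cross zero_less_mult_iff)
    finally show ?thesis .
  qed
  have "over_value L c (p, u, v) q = (if left_of u (q - p) then J else 0)"
    "under_value L c (p, u, v) q = (if left_of v (q - p) then E1 else E2)" for q
    using cp[of 1 "-1"] cp[of "-1" "-1"] cp[of "-1" 1]
    by (simp_all add: over_value_def under_value_def)
  then show ?thesis using that[of t] t(1-3) unfolding xe by simp
qed

text \<open>Along one vertical line the sections over \<open>above L\<close> are pinned at a large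
  height and those over \<open>below L\<close> at a large depth, so rigidity of flat sections on the
  line applies to both.\<close>

lemma holonomy_unique:
  assumes L: "oriented_link L" and c: "holonomy L U k c" "holonomy L U k c'"
    and q: "q \<notin> fst ` support L"
  shows "c q = c' q"
proof -
  obtain sA sB where hs: "holonomy_sections L U k sA sB" "holonomy_of L U sA sB c"
    using c(1) unfolding holonomy_def by blast
  obtain sA' sB' where hs': "holonomy_sections L U k sA' sB'" "holonomy_of L U sA' sB' c'"
    using c(2) unfolding holonomy_def by blast
  note ls = holonomy_sections_local_system[OF hs(1)]
  obtain Z1 where Z1: "framed L Z1 U k" "\<And>X. Z1 < snd X \<Longrightarrow> sA Top X = 0" "\<And>X. snd X < - Z1 \<Longrightarrow> sB Bot X = 0"
    using hs(1) unfolding holonomy_sections_def by blast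
  obtain Z2 where Z2: "framed L Z2 U k" "\<And>X. Z2 < snd X \<Longrightarrow> sA' Top X = 0" "\<And>X. snd X < - Z2 \<Longrightarrow> sB' Bot X = 0"
    using hs'(1) unfolding holonomy_sections_def by blast
  define Z where "Z = max Z1 Z2 + 1"
  have Z: "Z1 < Z" "Z2 < Z" by (auto simp: Z_def)
  define \<gamma> where "\<gamma> = (\<lambda>z::real. (q, z))"
  have ab: "\<gamma> z \<in> above L" "\<gamma> z \<in> below L" for z using q above_Int_below[of "(q, z)" L] by (auto simp: \<gamma>_def)
  have cov: "\<gamma> ` UNIV \<subseteq> (\<Union>i. U i)"
    unfolding local_system_Union[OF ls] using above_notin_support ab by blast
  have cont: "continuous_on UNIV \<gamma>" unfolding \<gamma>_def by (intro continuous_intros)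
  have pull: "flat_section UNIV \<gamma> U k (\<lambda>i z. s i (\<gamma> z))" if "flat_section V id U k s" "range \<gamma> \<subseteq> V" for V s
  proof (rule flat_sectionI)
    show "loc_const {t \<in> UNIV. \<gamma> t \<in> U i} (\<lambda>z. s i (\<gamma> z))" for i
      by (rule loc_const_vimage[OF continuous_on_subset[OF cont] flat_section_loc_const[OF that(1)]])
         (use that(2) in auto)
    show "s i (\<gamma> t) = k i j (\<gamma> t) + s j (\<gamma> t)" if "\<gamma> t \<in> U i" "\<gamma> t \<in> U j" for i j t
      using flat_sectionD[OF \<open>flat_section V id U k s\<close>, of "\<gamma> t" i j] that \<open>range \<gamma> \<subseteq> V\<close> by auto
  qed
  have fs: "flat_section (above L) id U k sA" "flat_section (above L) id U k sA'"
    "flat_section (below L) id U k sB" "flat_section (below L) id U k sB'"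
    using hs(1) hs'(1) unfolding holonomy_sections_def by blast+
  have rg: "range \<gamma> \<subseteq> above L" "range \<gamma> \<subseteq> below L" using ab by blast+
  obtain i where i: "\<gamma> 0 \<in> U i" using cov by blast
  have top: "\<gamma> Z \<in> U Top" using Z1(1) Z(1) unfolding framed_def \<gamma>_def by (metis minus_less_iff minus_minus neg_less_iff_less snd_conv)
  have bot: "\<gamma> (- Z) \<in> U Bot" using Z1(1) Z(1) unfolding framed_def \<gamma>_def by (metis minus_less_iff minus_minus neg_less_iff_less snd_conv)
  have "sA i (\<gamma> 0) = sA' i (\<gamma> 0)"
    using flat_section_unique[OF pull[OF fs(1) rg(1)] pull[OF fs(2) rg(1)] connected_UNIV cont
        local_system_open[OF ls] cov UNIV_I top _ UNIV_I i] ab Z1(2)[of "\<gamma> Z"] Z2(2)[of "\<gamma> Z"] Z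
    by (auto simp: \<gamma>_def)
  moreover have "sB i (\<gamma> 0) = sB' i (\<gamma> 0)"
    using flat_section_unique[OF pull[OF fs(3) rg(2)] pull[OF fs(4) rg(2)] connected_UNIV cont
        local_system_open[OF ls] cov UNIV_I bot _ UNIV_I i] ab Z1(3)[of "\<gamma> (- Z)"] Z2(3)[of "\<gamma> (- Z)"] Z
    by (auto simp: \<gamma>_def)
  moreover have "c (fst (\<gamma> 0)) = - sA i (\<gamma> 0) + sB i (\<gamma> 0)" "c' (fst (\<gamma> 0)) = - sA' i (\<gamma> 0) + sB' i (\<gamma> 0)"
    using hs(2) hs'(2) ab i unfolding holonomy_of_def by blast+
  ultimately show ?thesis by (simp add: \<gamma>_def)
qed

section \<open>Transport of colourings along a homeomorphism\<close>

definition link_homeo :: "directed_edges \<Rightarrow> directed_edges \<Rightarrow> (space \<Rightarrow> space) \<Rightarrow> (space \<Rightarrow> space) \<Rightarrow> bool" where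
  "link_homeo L L' f g \<longleftrightarrow> homeomorphism UNIV UNIV f g \<and> f ` support L = support L' \<and>
     (\<exists>Z. \<forall>X. \<bar>snd X\<bar> > Z \<longrightarrow> f X = X)"

lemma link_homeo_inverse:
  assumes "link_homeo L L' f g" shows "g (f X) = X" "f (g X) = X"
  using assms unfolding link_homeo_def homeomorphism_def by blast+

lemma link_homeo_sym:
  assumes "link_homeo L L' f g" shows "link_homeo L' L g f"
proof -
  note gf = link_homeo_inverse[OF assms]
  obtain Z where Z: "\<And>X. \<bar>snd X\<bar> > Z \<Longrightarrow> f X = X" using assms unfolding link_homeo_def by blast
  have "homeomorphism UNIV UNIV g f" using assms unfolding link_homeo_def by (blast dest: homeomorphism_symD)
  moreover have "g ` support L' = support L"
  proof -
    have "f ` support L = support L'" using assms unfolding link_homeo_def by blast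
    then have "g ` support L' = (\<lambda>X. g (f X)) ` support L" by (metis image_image)
    then show ?thesis by (simp only: gf image_ident)
  qed
  moreover have "g X = X" if "\<bar>snd X\<bar> > Z" for X using gf(1)[of X] Z[OF that] by simp
  ultimately show ?thesis unfolding link_homeo_def by blast
qed

definition transported ::
  "(space \<Rightarrow> space) \<Rightarrow> (space \<Rightarrow> space) \<Rightarrow> directed_edges \<Rightarrow> directed_edges \<Rightarrow>
    (plane \<Rightarrow> 'g::group_add) \<Rightarrow> (plane \<Rightarrow> 'g) \<Rightarrow> bool" where
  "transported f g L L' c c' \<longleftrightarrow>
     holonomy L' (\<lambda>i. f ` chart_set L i) (\<lambda>i j X. transition L c i j (g X)) c'"

lemma support_bounded_height:
  assumes "oriented_link L"
  obtains Z where "\<And>Y. Y \<in> support L \<Longrightarrow> \<bar>snd Y\<bar> \<le> Z"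
proof -
  have "bounded (snd ` support L)"
    by (intro compact_imp_bounded compact_continuous_image compact_support assms continuous_intros)
  then obtain Z where "\<forall>z\<in>snd ` support L. \<bar>z\<bar> \<le> Z" by (auto simp: bounded_iff)
  then show ?thesis using that by blast
qed

text \<open>At large height \<open>f\<close> is the identity, so the images of the
  \<open>Top\<close> and \<open>Bot\<close> charts still contain everything far above and far below.
  The old normalisations remain meaningful for the new link.\<close>

lemma framed_transported:
  assumes L: "oriented_link L" "regular_position L" "oriented_link L'"
    and f: "link_homeo L L' f g" and c: "dehn_coloring L c"
  obtains Z where "framed L' Z (\<lambda>i. f ` chart_set L i) (\<lambda>i j X. transition L c i j (g X))"
    "\<And>X. \<bar>snd X\<bar> > Z \<Longrightarrow> f X = X"
proof -
  note gf = link_homeo_inverse[OF f]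
  obtain Z1 where Z1: "\<And>X. \<bar>snd X\<bar> > Z1 \<Longrightarrow> f X = X" using f unfolding link_homeo_def by blast
  obtain Z2 where Z2: "\<And>Y. Y \<in> support L \<Longrightarrow> \<bar>snd Y\<bar> \<le> Z2" using support_bounded_height[OF L(1)] by metis
  obtain Z3 where Z3: "\<And>Y. Y \<in> support L' \<Longrightarrow> \<bar>snd Y\<bar> \<le> Z3" using support_bounded_height[OF L(3)] by metis
  define Z where "Z = max \<bar>Z1\<bar> (max \<bar>Z2\<bar> \<bar>Z3\<bar>)"
  have fi: "f X = X" if "\<bar>snd X\<bar> > Z" for X 
    by (rule Z1) (use that in \<open>unfold Z_def, linarith\<close>)
  have hom: "homeomorphism UNIV UNIV f g" using f by (simp add: link_homeo_def)
  have "f ` (- support L) = - support L'"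
  proof -
    have "bij f" using gf by (metis bijI')
    then show ?thesis using f by (simp add: bij_image_Compl_eq link_homeo_def)
  qed
  then have ls: "local_system (- support L') (\<lambda>i. f ` chart_set L i) (\<lambda>i j X. transition L c i j (g X))"
    using local_system_transfer[OF local_system_transition[OF L(1,2) c] hom] by simp
  have "X \<in> f ` chart_set L Top" if "Z < snd X" for X
  proof -
    have "X \<in> above L" unfolding above_def using Z2 that by (fastforce simp: Z_def)
    moreover have "f X = X" using that by (intro fi) simp
    ultimately show ?thesis by (metis chart_set_simps(1) imageI)
  qed
  moreover have "X \<in> f ` chart_set L Bot" if "snd X < - Z" for X
  proof -
    have "X \<in> below L" unfolding below_def using Z2 that by (fastforce simp: Z_def)
    moreover have "f X = X" using that by (intro fi) simp
    ultimately show ?thesis by (metis chart_set_simps(2) imageI)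
  qed
  moreover have "\<bar>snd Y\<bar> \<le> Z" if "Y \<in> support L'" for Y using Z3[OF that] by (simp add: Z_def)
  ultimately have "framed L' Z (\<lambda>i. f ` chart_set L i) (\<lambda>i j X. transition L c i j (g X))"
    unfolding framed_def using ls by blast
  then show ?thesis using that fi by blast
qed

lemma transported_exists:
  assumes "oriented_link L" "regular_position L" "oriented_link L'" "link_homeo L L' f g" "dehn_coloring L c"
  obtains c' where "transported f g L L' c c'"
  using framed_transported[OF assms] holonomy_exists[OF assms(3)] unfolding transported_def by metis

lemma transported_dehn_coloring:
  "oriented_link L' \<Longrightarrow> regular_position L' \<Longrightarrow> transported f g L L' c c' \<Longrightarrow> dehn_coloring L' c'"
  unfolding transported_def by (rule holonomy_dehn_coloring)

lemma transported_unique: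
  "oriented_link L' \<Longrightarrow> transported f g L L' c c' \<Longrightarrow> transported f g L L' c c'' \<Longrightarrow>
     q \<notin> fst ` support L' \<Longrightarrow> c' q = c'' q"
  unfolding transported_def by (rule holonomy_unique)

text \<open>The sections over the charts of \<open>L'\<close> of the transported bundle identify it with the bundle
  glued from the new colouring; read over the charts of \<open>L\<close>, they are the
  sections that compute the holonomy in the reverse direction.\<close>

lemma transported_sym:
  fixes c :: "plane \<Rightarrow> 'g::group_add"
  assumes L: "oriented_link L" "regular_position L" and L': "oriented_link L'" "regular_position L'"
    and f: "link_homeo L L' f g" and c: "dehn_coloring L c" and c': "transported f g L L' c c'"
  shows "transported g f L' L c' c"
proof -
  note gf = link_homeo_inverse[OF f]
  let ?U = "\<lambda>i. f ` chart_set L i" let ?k = "\<lambda>i j X. transition L c i j (g X)"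
  obtain sA sB where hs: "holonomy_sections L' ?U ?k sA sB" "holonomy_of L' ?U sA sB c'"
    using c' unfolding transported_def holonomy_def by blast
  note ls = holonomy_sections_local_system[OF hs(1)]
  have sA: "flat_section (above L') id ?U ?k sA" and sB: "flat_section (below L') id ?U ?k sB"
    using hs(1) unfolding holonomy_sections_def by blast+
  obtain Z1 where Z1: "framed L' Z1 ?U ?k" "\<And>X. Z1 < snd X \<Longrightarrow> sA Top X = 0" "\<And>X. snd X < - Z1 \<Longrightarrow> sB Bot X = 0"
    using hs(1) unfolding holonomy_sections_def by blast
  have dc': "dehn_coloring L' c'" by (rule transported_dehn_coloring[OF L' c'])
  obtain Z2 where Z2: "framed L Z2 (\<lambda>i. g ` chart_set L' i) (\<lambda>i j X. transition L' c' i j (f X))"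
      "\<And>X. \<bar>snd X\<bar> > Z2 \<Longrightarrow> g X = X"
    by (rule framed_transported[OF L' L(1) link_homeo_sym[OF f] dc']) (rule that; assumption)
  have "\<forall>x\<in>crossings (projection L'). \<exists>t. flat_section (snd (xbox L' x)) id ?U ?k t \<and>
    (\<forall>X i. X \<in> snd (xbox L' x) \<longrightarrow> X \<in> above L' \<longrightarrow> X \<in> ?U i \<longrightarrow> - sA i X + t i X = over_value L' c' x (fst X)) \<and>
    (\<forall>X i. X \<in> snd (xbox L' x) \<longrightarrow> X \<in> below L' \<longrightarrow> X \<in> ?U i \<longrightarrow> - t i X + sB i X = under_value L' c' x (fst X))"
    using middle_section[OF L' hs] by metis
  from bchoice[OF this] obtain tM where tM0: "\<forall>x\<in>crossings (projection L'). flat_section (snd (xbox L' x)) id ?U ?k (tM x) \<and>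
    (\<forall>X i. X \<in> snd (xbox L' x) \<longrightarrow> X \<in> above L' \<longrightarrow> X \<in> ?U i \<longrightarrow> - sA i X + tM x i X = over_value L' c' x (fst X)) \<and>
    (\<forall>X i. X \<in> snd (xbox L' x) \<longrightarrow> X \<in> below L' \<longrightarrow> X \<in> ?U i \<longrightarrow> - tM x i X + sB i X = under_value L' c' x (fst X))"
    by (elim exE)
  have tM: "\<And>x. x \<in> crossings (projection L') \<Longrightarrow> flat_section (snd (xbox L' x)) id ?U ?k (tM x)"
    "\<And>x X i. x \<in> crossings (projection L') \<Longrightarrow> X \<in> snd (xbox L' x) \<Longrightarrow> X \<in> above L' \<Longrightarrow> X \<in> ?U i \<Longrightarrow>
       - sA i X + tM x i X = over_value L' c' x (fst X)"
    "\<And>x X i. x \<in> crossings (projection L') \<Longrightarrow> X \<in> snd (xbox L' x) \<Longrightarrow> X \<in> below L' \<Longrightarrow> X \<in> ?U i \<Longrightarrow>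
       - tM x i X + sB i X = under_value L' c' x (fst X)"
    using tM0 by blast+
  define t where "t b = (case b of Top \<Rightarrow> sA | Bot \<Rightarrow> sB | Mid x \<Rightarrow> tM x)" for b
  have in_mid: "x \<in> crossings (projection L') \<and> Y \<in> snd (xbox L' x)" if "Y \<in> chart_set L' (Mid x)" for x Y
    using that by (auto simp: chart_set_def split: if_splits)
  have t: "flat_section (chart_set L' b) id ?U ?k (t b)" for b
  proof (cases b)
    case (Mid x)
    then show ?thesis using tM(1)[of x]
      by (cases "x \<in> crossings (projection L')") (auto simp: t_def chart_set_def flat_section_def loc_const_def)
  qed (use sA sB in \<open>simp_all add: t_def\<close>)
  \<comment> \<open>Checked chart by chart: the definition of \<open>c'\<close> gives the pair
    \<open>Top\<close>, \<open>Bot\<close>, and \<open>middle_section\<close> the pairs with a box.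
    Different boxes do not meet.\<close>
  have tt: "- t a i Y + t b i Y = transition L' c' a b Y"
    if "Y \<in> chart_set L' a" "Y \<in> chart_set L' b" "Y \<in> ?U i" for a b i Y
  proof -
    have flip: "- t b i Y + t a i Y = transition L' c' b a Y"
      if "- t a i Y + t b i Y = transition L' c' a b Y" for a b
    proof -
      have "- t b i Y + t a i Y = - (- t a i Y + t b i Y)" by (simp add: minus_add)
      then show ?thesis using that transition_commute[of L' c' b a Y] by simp
    qed
    have TB: "- t Top i Y + t Bot i Y = transition L' c' Top Bot Y" if "Y \<in> above L'" "Y \<in> below L'"
    proof -
      have "c' (fst Y) = - sA i Y + sB i Y" using hs(2) \<open>Y \<in> ?U i\<close> that unfolding holonomy_of_def by blast
      then show ?thesis using transition_Top_Bot[OF that, of c'] by (simp add: t_def)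
    qed
    have TM: "- t Top i Y + t (Mid x) i Y = transition L' c' Top (Mid x) Y"
      if "Y \<in> above L'" "Y \<in> chart_set L' (Mid x)" for x
      using tM(2)[of x Y i] in_mid[OF that(2)] that(1) \<open>Y \<in> ?U i\<close> by (simp add: t_def transition_Top_Mid)
    have MB: "- t (Mid x) i Y + t Bot i Y = transition L' c' (Mid x) Bot Y"
      if "Y \<in> below L'" "Y \<in> chart_set L' (Mid x)" for x
      using tM(3)[of x Y i] in_mid[OF that(2)] that(1) \<open>Y \<in> ?U i\<close>
      by (simp add: t_def transition_Mid_Bot[OF L' dc'])
    have MM: "x = y" if "Y \<in> chart_set L' (Mid x)" "Y \<in> chart_set L' (Mid y)" for x y
    proof -
      have "fst Y \<in> ball (fst z) (fst (xbox L' z))" if "Y \<in> chart_set L' (Mid z)" for z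
        using crossing_boxD(5)[OF L', of "fst z" "fst (snd z)" "snd (snd z)"] in_mid[OF that] by auto
      then show ?thesis using crossing_boxes_disjoint[OF L'] in_mid that by blast
    qed
    note Y = that(1,2)
    show ?thesis
    proof (cases a)
      case Top
      then show ?thesis using Y TB TM by (cases b) simp_all
    next
      case Bot
      then show ?thesis using Y flip[OF TB] flip[OF MB] by (cases b) simp_all
    next
      case (Mid x)
      show ?thesis
      proof (cases b)
        case (Mid y)
        then have "x = y" using MM Y \<open>a = Mid x\<close> by simp
        then show ?thesis using Mid \<open>a = Mid x\<close> by simp
      qed (use Mid Y flip[OF TM] MB in simp_all)
    qed
  qed
  \<comment> \<open>Indexed by a chart \<open>b\<close> of \<open>L'\<close> and a chart
    \<open>a\<close> of \<open>L\<close>, \<open>t\<close> is the matrix of an isomorphism of the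
    two bundles. Negation inverts it and so exchanges the roles of the two covers.\<close>
  define \<sigma> where "\<sigma> a b X = - t b a (f X)" for a b X
  have cf: "continuous_on S f" for S
    using f unfolding link_homeo_def homeomorphism_def by (meson continuous_on_subset subset_UNIV)
  have gU: "X \<in> g ` chart_set L' b \<longleftrightarrow> f X \<in> chart_set L' b" for X b using gf by (metis imageE imageI)
  have fU: "f X \<in> ?U a \<longleftrightarrow> X \<in> chart_set L a" for X a using gf(1) by (metis imageE imageI)
  have \<sigma>: "flat_section (chart_set L a) id (\<lambda>b. g ` chart_set L' b) (\<lambda>i j X. transition L' c' i j (f X)) (\<sigma> a)" for a
  proof (rule flat_sectionI)
    fix b
    have "loc_const {X \<in> chart_set L a. id X \<in> g ` chart_set L' b} (\<lambda>X. t b a (f X))"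
      by (rule loc_const_vimage[OF cf flat_section_loc_const[OF t, where i = a]]) (use gU fU in auto)
    then show "loc_const {X \<in> chart_set L a. id X \<in> g ` chart_set L' b} (\<sigma> a b)"
      unfolding \<sigma>_def by (rule loc_const_comp[where F = uminus])
  next
    fix b b' X assume X: "X \<in> chart_set L a" "id X \<in> g ` chart_set L' b" "id X \<in> g ` chart_set L' b'"
    then have "- t b a (f X) + t b' a (f X) = transition L' c' b b' (f X)"
      using gU fU by (intro tt) auto
    then show "\<sigma> a b X = transition L' c' b b' (f (id X)) + \<sigma> a b' X"
      unfolding \<sigma>_def by (metis add.assoc add.right_inverse add.right_neutral id_apply)
  qed
  have "holonomy_sections L (\<lambda>i. g ` chart_set L' i) (\<lambda>i j X. transition L' c' i j (f X)) (\<sigma> Top) (\<sigma> Bot)"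
    unfolding holonomy_sections_def
  proof (intro conjI exI)
    define Z where "Z = max \<bar>Z1\<bar> \<bar>Z2\<bar>"
    show "framed L Z (\<lambda>i. g ` chart_set L' i) (\<lambda>i j X. transition L' c' i j (f X))"
      by (rule framed_mono[OF Z2(1)]) (simp add: Z_def)
    have fi: "f X = X" if "\<bar>snd X\<bar> > Z" for X
    proof -
      have "\<bar>snd X\<bar> > Z2" using that unfolding Z_def by linarith
      then show ?thesis using Z2(2)[of X] gf(2)[of X] by simp
    qed
    show "\<forall>X. Z < snd X \<longrightarrow> \<sigma> Top Top X = 0"
    proof (intro allI impI)
      fix X :: space assume X: "Z < snd X"
      then have "\<bar>snd X\<bar> > Z" "Z1 < snd X" unfolding Z_def by linarith+
      then show "\<sigma> Top Top X = 0" using fi[of X] Z1(2)[of X] by (simp add: \<sigma>_def t_def)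
    qed
    show "\<forall>X. snd X < - Z \<longrightarrow> \<sigma> Bot Bot X = 0"
    proof (intro allI impI)
      fix X :: space assume X: "snd X < - Z"
      then have "\<bar>snd X\<bar> > Z" "snd X < - Z1" unfolding Z_def by linarith+
      then show "\<sigma> Bot Bot X = 0" using fi[of X] Z1(3)[of X] by (simp add: \<sigma>_def t_def)
    qed
    show "flat_section (above L) id (\<lambda>i. g ` chart_set L' i) (\<lambda>i j X. transition L' c' i j (f X)) (\<sigma> Top)"
      using \<sigma>[of Top] by simp
    show "flat_section (below L) id (\<lambda>i. g ` chart_set L' i) (\<lambda>i j X. transition L' c' i j (f X)) (\<sigma> Bot)"
      using \<sigma>[of Bot] by simp
  qed
  moreover have "holonomy_of L (\<lambda>i. g ` chart_set L' i) (\<sigma> Top) (\<sigma> Bot) c"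
    unfolding holonomy_of_def
  proof (intro allI impI)
    fix X b assume X: "X \<in> above L" "X \<in> below L" "X \<in> g ` chart_set L' b"
    have "t b Top (f X) = transition L c Top Bot (g (f X)) + t b Bot (f X)"
      using flat_sectionD[OF t, of "f X" b Top Bot] X gU fU by auto
    then have "t b Top (f X) = c (fst X) + t b Bot (f X)"
      using transition_Top_Bot[OF X(1,2), of c] by (simp add: gf)
    then show "c (fst X) = - \<sigma> Top b X + \<sigma> Bot b X" by (simp add: \<sigma>_def add.assoc)
  qed
  ultimately show ?thesis unfolding transported_def holonomy_def by blast
qed

text \<open>Potentials consist of sums and differences of colours, so \<open>\<phi>\<close> can be
  applied to transitions and sections alike. The later uses are the projections of product
  groups.\<close>

lemma transported_additive:
  fixes \<phi> :: "'g::group_add \<Rightarrow> 'h::group_add"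
  assumes \<phi>: "\<And>a b. \<phi> (a + b) = \<phi> a + \<phi> b" and c: "transported f g L L' c c'"
  shows "transported f g L L' (\<lambda>q. \<phi> (c q)) (\<lambda>q. \<phi> (c' q))"
proof -
  have "\<phi> 0 + 0 = \<phi> 0 + \<phi> 0" using \<phi>[of 0 0] by simp
  then have z: "\<phi> 0 = 0" by (metis add_left_cancel)
  have m: "\<phi> (- a) = - \<phi> a" for a using \<phi>[of "- a" a] z by (simp add: eq_neg_iff_add_eq_0)
  have d: "\<phi> (a - b) = \<phi> a - \<phi> b" for a b using \<phi>[of a "- b"] m by simp
  have pot: "potential L (\<lambda>q. \<phi> (c q)) i X = \<phi> (potential L c i X)" for i X
    unfolding potential_def over_value_def under_value_def by (cases i) (auto simp: Let_def z \<phi> d)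
  have tr: "transition L (\<lambda>q. \<phi> (c q)) i j X = \<phi> (transition L c i j X)" for i j X
    unfolding transition_def pot by (simp add: \<phi> m)
  have fs: "flat_section V id U (\<lambda>i j X. \<phi> (k i j X)) (\<lambda>i X. \<phi> (s i X))"
    if s: "flat_section V id U k s" for V U k and s :: "chart \<Rightarrow> space \<Rightarrow> 'g"
  proof (rule flat_sectionI)
    show "loc_const {X \<in> V. id X \<in> U i} (\<lambda>X. \<phi> (s i X))" for i
      by (rule loc_const_comp[where F = \<phi>, OF flat_section_loc_const[OF s]])
    show "\<phi> (s i X) = \<phi> (k i j (id X)) + \<phi> (s j X)" if "X \<in> V" "id X \<in> U i" "id X \<in> U j" for i j X
      using flat_sectionD[OF s that] by (metis \<phi>)
  qed
  have ls: "local_system Om U (\<lambda>i j X. \<phi> (k i j X))" if l: "local_system Om U k"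
    for Om and U :: "chart \<Rightarrow> space set" and k
    unfolding local_system_def
  proof (intro conjI allI impI)
    show "loc_const (U i \<inter> U j) (\<lambda>X. \<phi> (k i j X))" for i j
      by (rule loc_const_comp[where F = \<phi>]) (use l in \<open>unfold local_system_def, blast\<close>)
    show "\<phi> (k i l x) = \<phi> (k i j x) + \<phi> (k j l x)" if "x \<in> U i \<inter> U j \<inter> U l" for i j l x
    proof -
      have "x \<in> U i" "x \<in> U j" "x \<in> U l" using that by auto
      from local_system_cocycle[OF \<open>local_system Om U k\<close> this] show ?thesis by (simp only: \<phi>)
    qed
    show "open (U i)" for i by (rule local_system_open[OF l])
    show "Om = (\<Union>i. U i)" by (rule local_system_Union[OF l, symmetric])
  qed
  obtain sA sB where hs: "holonomy_sections L' (\<lambda>i. f ` chart_set L i) (\<lambda>i j X. transition L c i j (g X)) sA sB"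
      "holonomy_of L' (\<lambda>i. f ` chart_set L i) sA sB c'"
    using c unfolding transported_def holonomy_def by blast
  have "holonomy_sections L' (\<lambda>i. f ` chart_set L i) (\<lambda>i j X. transition L (\<lambda>q. \<phi> (c q)) i j (g X))
      (\<lambda>i X. \<phi> (sA i X)) (\<lambda>i X. \<phi> (sB i X))"
  proof -
    obtain Z where Z: "framed L' Z (\<lambda>i. f ` chart_set L i) (\<lambda>i j X. transition L c i j (g X))"
        "\<forall>X. Z < snd X \<longrightarrow> sA Top X = 0" "\<forall>X. snd X < - Z \<longrightarrow> sB Bot X = 0"
      using hs(1) unfolding holonomy_sections_def by blast
    have "framed L' Z (\<lambda>i. f ` chart_set L i) (\<lambda>i j X. transition L (\<lambda>q. \<phi> (c q)) i j (g X))"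
      unfolding framed_def tr
    proof (intro conjI)
      show "local_system (- support L') (\<lambda>i. f ` chart_set L i) (\<lambda>i j X. \<phi> (transition L c i j (g X)))"
        by (rule ls[OF framed_local_system[OF Z(1)]])
    qed (use Z(1) in \<open>unfold framed_def, blast+\<close>)
    moreover have "\<forall>X. Z < snd X \<longrightarrow> \<phi> (sA Top X) = 0" "\<forall>X. snd X < - Z \<longrightarrow> \<phi> (sB Bot X) = 0"
      using Z(2,3) z by metis+
    moreover have "flat_section (above L') id (\<lambda>i. f ` chart_set L i) (\<lambda>i j X. transition L (\<lambda>q. \<phi> (c q)) i j (g X)) (\<lambda>i X. \<phi> (sA i X))"
      "flat_section (below L') id (\<lambda>i. f ` chart_set L i) (\<lambda>i j X. transition L (\<lambda>q. \<phi> (c q)) i j (g X)) (\<lambda>i X. \<phi> (sB i X))"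
      unfolding tr using hs(1) fs unfolding holonomy_sections_def by blast+
    ultimately show ?thesis unfolding holonomy_sections_def by blast
  qed
  moreover have "holonomy_of L' (\<lambda>i. f ` chart_set L i) (\<lambda>i X. \<phi> (sA i X)) (\<lambda>i X. \<phi> (sB i X)) (\<lambda>q. \<phi> (c' q))"
    using hs(2) unfolding holonomy_of_def by (simp add: \<phi> m)
  ultimately show ?thesis unfolding transported_def holonomy_def by blast
qed

text \<open>The new colours are alternating words \<open>h\<^sub>1 - h\<^sub>2 + h\<^sub>3 - \<dots> + h\<^sub>n\<close> in the old ones.\<close>

lemma transported_heap:
  fixes c :: "plane \<Rightarrow> 'g::group_add"
  assumes L: "oriented_link L" "regular_position L" and L': "oriented_link L'"
    and f: "link_homeo L L' f g" and c: "dehn_coloring L c" and c': "transported f g L L' c c'"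
    and H: "\<And>a b d. a \<in> H \<Longrightarrow> b \<in> H \<Longrightarrow> d \<in> H \<Longrightarrow> a - b + d \<in> H"
    and cH: "\<And>q. q \<notin> fst ` support L \<Longrightarrow> c q \<in> H"
    and q: "q \<notin> fst ` support L'"
  shows "c' q \<in> H"
proof -
  let ?U = "\<lambda>i. f ` chart_set L i" let ?k = "\<lambda>i j X. transition L c i j (g X)"
  note gf = link_homeo_inverse[OF f]
  obtain sA sB where hs: "holonomy_sections L' ?U ?k sA sB" "holonomy_of L' ?U sA sB c'"
    using c' unfolding transported_def holonomy_def by blast
  note ls = holonomy_sections_local_system[OF hs(1)]
  have sA: "flat_section (above L') id ?U ?k sA" and sB: "flat_section (below L') id ?U ?k sB"
    using hs(1) unfolding holonomy_sections_def by blast+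
  obtain Z where Z: "framed L' Z ?U ?k" "\<And>X. Z < snd X \<Longrightarrow> sA Top X = 0" "\<And>X. snd X < - Z \<Longrightarrow> sB Bot X = 0"
    using hs(1) unfolding holonomy_sections_def by blast
  \<comment> \<open>A point off the bounded projection provides an element of \<open>H\<close>, and
    with it 0 in both sets of differences below.\<close>
  have "bounded (fst ` support L)" by (intro compact_imp_bounded compact_curve L)
  then have "fst ` support L \<noteq> UNIV" using not_bounded_UNIV by metis
  then obtain q0 where q0: "q0 \<notin> fst ` support L" by blast
  \<comment> \<open>\<open>G\<close> acts on \<open>H\<close> from the left and \<open>K\<close>
    from the right. Transitions among \<open>Top\<close> and \<open>Mid\<close> charts lie in
    \<open>G\<close>, and those from such a chart to \<open>Bot\<close> in \<open>H\<close>.\<close>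
  define G where "G = {a - b | a b. a \<in> H \<and> b \<in> H}"
  define K where "K = {- a + b | a b. a \<in> H \<and> b \<in> H}"
  have G0: "0 \<in> G" unfolding G_def using cH[OF q0] by force
  have K0: "0 \<in> K" unfolding K_def using cH[OF q0] by (force intro: exI[of _ "c q0"])
  have GH: "a + b \<in> H" if "a \<in> G" "b \<in> H" for a b
    using that H unfolding G_def by blast
  have GG: "a + b \<in> G" if a: "a \<in> G" and b: "b \<in> G" for a b
  proof -
    obtain h h' where "b = h - h'" "h \<in> H" "h' \<in> H" using b unfolding G_def by blast
    moreover have "a + h \<in> H" using GH a calculation(2) by blast
    ultimately show ?thesis unfolding G_def by (metis (mono_tags, lifting) add_diff_eq mem_Collect_eq)
  qed
  have Gm: "- a \<in> G" if "a \<in> G" for a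
    using that unfolding G_def by (smt (verit) mem_Collect_eq minus_diff_eq)
  have HK: "a + b \<in> H" if a: "a \<in> H" and b: "b \<in> K" for a b
  proof -
    obtain h h' where "b = - h + h'" "h \<in> H" "h' \<in> H" using b unfolding K_def by blast
    then have "a + b = a - h + h'" by (simp add: add.assoc flip: add_uminus_conv_diff)
    then show ?thesis using H a \<open>h \<in> H\<close> \<open>h' \<in> H\<close> by simp
  qed
  have over: "over_value L c x p \<in> G" if "x \<in> crossings (projection L)" for x p
  proof -
    have "corner_point L x s t \<notin> fst ` support L" if "s \<noteq> 0" "t \<noteq> 0" for s t
      using corner_subset[OF L \<open>x \<in> _\<close>] corner_nonempty[OF L \<open>x \<in> _\<close> that] by blast
    then have "c (corner_point L x 1 (-1)) \<in> H" "c (corner_point L x (-1) (-1)) \<in> H" using cH by auto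
    then show ?thesis using G0 unfolding over_value_def by (auto simp: G_def)
  qed
  have under: "under_value L c x p \<in> H" if "x \<in> crossings (projection L)" for x p
  proof -
    have "corner_point L x s t \<notin> fst ` support L" if "s \<noteq> 0" "t \<noteq> 0" for s t
      using corner_subset[OF L \<open>x \<in> _\<close>] corner_nonempty[OF L \<open>x \<in> _\<close> that] by blast
    then have "c (corner_point L x (-1) 1) \<in> H" "c (corner_point L x (-1) (-1)) \<in> H" using cH by auto
    then show ?thesis unfolding under_value_def by auto
  qed
  have BB: "transition L c Bot Bot X = 0" for X by simp
  have XX: "transition L c i j X \<in> G" if "i \<noteq> Bot" "j \<noteq> Bot" "X \<in> chart_set L i" "X \<in> chart_set L j" for i j X
  proof -
    have p: "potential L c i X \<in> G" if "i \<noteq> Bot" "X \<in> chart_set L i" for i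
      using that over G0 unfolding potential_def by (cases i) (auto simp: chart_set_def split: if_splits)
    show ?thesis unfolding transition_def by (intro GG Gm p that)
  qed
  have XB: "transition L c i Bot X \<in> H" if "i \<noteq> Bot" "X \<in> chart_set L i" "X \<in> chart_set L Bot" for i X
  proof (cases i)
    case Top
    then show ?thesis using that transition_Top_Bot[of X L c] cH above_Int_below[of X L] by simp
  next
    case (Mid x)
    then have "x \<in> crossings (projection L)" "X \<in> snd (xbox L x)"
      using that by (auto simp: chart_set_def split: if_splits)
    then show ?thesis using Mid that transition_Mid_Bot[OF L c] under by simp
  qed (use that in simp)
  have BX: "- transition L c Bot i X \<in> H" if "i \<noteq> Bot" "X \<in> chart_set L i" "X \<in> chart_set L Bot" for i X
    using XB[OF that] transition_commute[of L c Bot i X] by simp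
  have fU: "Y \<in> ?U a \<longleftrightarrow> g Y \<in> chart_set L a" for Y a using gf by (metis imageE imageI)
  \<comment> \<open>\<open>PA\<close> holds at the start value 0 of \<open>sA\<close> in
    \<open>Top\<close>, and \<open>PB\<close> below at the start value 0 of \<open>sB\<close> in
    \<open>Bot\<close>; both survive transitions. In every chart they put \<open>- sA + sB\<close>
    into \<open>H\<close>.\<close>
  define PA where "PA i h \<longleftrightarrow> (if i = Bot then - h \<in> H else h \<in> G)" for i h
  have PA: "PA i (transition L c i j (g X) + h)" if "X \<in> ?U i" "X \<in> ?U j" "PA j h" for i j X h
  proof -
    note X = that(1,2)[unfolded fU]
    consider "i = Bot" "j = Bot" | "i = Bot" "j \<noteq> Bot" | "i \<noteq> Bot" "j = Bot" | "i \<noteq> Bot" "j \<noteq> Bot" by blast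
    then show ?thesis
    proof cases
      case 1 then show ?thesis using that(3) BB by (simp add: PA_def)
    next
      case 2
      then have "h \<in> G" "- transition L c Bot j (g X) \<in> H"
        using that(3) BX[of j "g X"] X by (simp_all add: PA_def)
      then have "- h + - transition L c Bot j (g X) \<in> H" by (intro GH Gm)
      then show ?thesis using 2 unfolding PA_def minus_add by simp
    next
      case 3
      then have "transition L c i Bot (g X) - (- h) \<in> G"
        using that(3) XB[of i "g X"] X unfolding PA_def G_def
        by (intro CollectI exI[of _ "transition L c i Bot (g X)"] exI[of _ "- h"] conjI refl) simp_all
      then show ?thesis using 3 by (simp add: PA_def)
    next
      case 4
      then show ?thesis using that(3) XX[of i j "g X"] X GG by (simp add: PA_def)
    qed
  qed
  define PB where "PB i h \<longleftrightarrow> (if i = Bot then h \<in> K else h \<in> H)" for i h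
  have PB: "PB i (transition L c i j (g X) + h)" if "X \<in> ?U i" "X \<in> ?U j" "PB j h" for i j X h
  proof -
    note X = that(1,2)[unfolded fU]
    consider "i = Bot" "j = Bot" | "i = Bot" "j \<noteq> Bot" | "i \<noteq> Bot" "j = Bot" | "i \<noteq> Bot" "j \<noteq> Bot" by blast
    then show ?thesis
    proof cases
      case 1 then show ?thesis using that(3) BB by (simp add: PB_def)
    next
      case 2
      then have "- (- transition L c Bot j (g X)) + h \<in> K"
        using that(3) BX[of j "g X"] X unfolding PB_def K_def by (simp only: if_False) blast
      then show ?thesis using 2 unfolding PB_def by simp
    next
      case 3
      then show ?thesis using that(3) XB[of i "g X"] X HK by (simp add: PB_def)
    next
      case 4
      then show ?thesis using that(3) XX[of i j "g X"] X GH by (simp add: PB_def)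
    qed
  qed
  define \<gamma> where "\<gamma> = (\<lambda>z::real. (q, z))"
  have ab: "\<gamma> z \<in> above L'" "\<gamma> z \<in> below L'" for z using q above_Int_below[of "(q, z)" L'] by (auto simp: \<gamma>_def)
  have rg: "range \<gamma> \<subseteq> above L'" "range \<gamma> \<subseteq> below L'" using ab by blast+
  have cov: "\<gamma> ` UNIV \<subseteq> (\<Union>i. ?U i)"
    unfolding local_system_Union[OF ls] using above_notin_support ab by blast
  have cont: "continuous_on UNIV \<gamma>" unfolding \<gamma>_def by (intro continuous_intros)
  have pull: "flat_section UNIV \<gamma> ?U ?k (\<lambda>i z. s i (\<gamma> z))" if s: "flat_section V id ?U ?k s" and V: "range \<gamma> \<subseteq> V" for V s
  proof (rule flat_sectionI)
    show "loc_const {t \<in> UNIV. \<gamma> t \<in> ?U i} (\<lambda>z. s i (\<gamma> z))" for i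
      by (rule loc_const_vimage[OF continuous_on_subset[OF cont] flat_section_loc_const[OF s]])
         (use V in auto)
    show "s i (\<gamma> t) = ?k i j (\<gamma> t) + s j (\<gamma> t)" if "\<gamma> t \<in> ?U i" "\<gamma> t \<in> ?U j" for i j t
      using flat_sectionD[OF s, of "\<gamma> t" i j] that V by auto
  qed
  have top: "\<gamma> (Z + 1) \<in> ?U Top" and bot: "\<gamma> (- Z - 1) \<in> ?U Bot"
    using Z(1) unfolding framed_def \<gamma>_def by (metis less_add_one snd_conv, metis diff_strict_left_mono snd_conv diff_0_right zero_less_one)
  obtain i where i: "\<gamma> 0 \<in> ?U i" using cov by blast
  have startA: "PA Top (sA Top (\<gamma> (Z + 1)))" using Z(2)[of "\<gamma> (Z + 1)"] G0 by (simp add: PA_def \<gamma>_def)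
  have startB: "PB Bot (sB Bot (\<gamma> (- Z - 1)))" using Z(3)[of "\<gamma> (- Z - 1)"] K0 by (simp add: PB_def \<gamma>_def)
  have A: "PA i (sA i (\<gamma> 0))"
    by (rule flat_section_invariant[OF pull[OF sA rg(1)] connected_UNIV cont local_system_open[OF ls] cov PA UNIV_I top startA UNIV_I i])
  have B: "PB i (sB i (\<gamma> 0))"
    by (rule flat_section_invariant[OF pull[OF sB rg(2)] connected_UNIV cont local_system_open[OF ls] cov PB UNIV_I bot startB UNIV_I i])
  have "c' (fst (\<gamma> 0)) = - sA i (\<gamma> 0) + sB i (\<gamma> 0)"
    using hs(2) ab i unfolding holonomy_of_def by blast
  also have "\<dots> \<in> H"
  proof (cases "i = Bot")
    case True then show ?thesis using A B HK by (simp add: PA_def PB_def)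
  next
    case False then show ?thesis using A B GH[OF Gm] by (simp add: PA_def PB_def)
  qed
  finally show ?thesis by (simp add: \<gamma>_def)
qed

section \<open>Linking structures\<close>

definition det3 :: "space \<Rightarrow> space \<Rightarrow> space \<Rightarrow> real" where
  "det3 a b c = fst (fst a) * (snd (fst b) * snd c - snd b * snd (fst c))
     - snd (fst a) * (fst (fst b) * snd c - snd b * fst (fst c))
     + snd a * (fst (fst b) * snd (fst c) - snd (fst b) * fst (fst c))"

text \<open>Up to a real factor, the coordinates of \<open>X\<close> with respect to \<open>r\<close>, \<open>s\<close> modulo the line
  spanned by \<open>d\<close>, as a complex number.\<close>

definition around :: "space \<Rightarrow> space \<Rightarrow> space \<Rightarrow> space \<Rightarrow> complex" where
  "around d r s X = Complex (det3 d X s) (det3 d X r)"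

text \<open>One branch of the angle of \<open>z\<close> per chart, with differences prescribed by
  the integers \<open>k\<close>. Its existence says that over \<open>W\<close> the system is the
  pull-back along \<open>z\<close> of the system of branches of the argument.\<close>

definition angle_section ::
  "('i \<Rightarrow> space set) \<Rightarrow> ('i \<Rightarrow> 'i \<Rightarrow> space \<Rightarrow> int) \<Rightarrow> space set \<Rightarrow> (space \<Rightarrow> complex) \<Rightarrow> ('i \<Rightarrow> space \<Rightarrow> real) \<Rightarrow> bool"
  where
  "angle_section U k W z \<theta> \<longleftrightarrow> open W \<and> (\<forall>i. continuous_on (W \<inter> U i) (\<theta> i)) \<and>
     (\<forall>i. \<forall>X\<in>W \<inter> U i. z X \<noteq> 0 \<and> cis (\<theta> i X) = sgn (z X)) \<and>
     (\<forall>i j. \<forall>X\<in>W \<inter> U i \<inter> U j. \<theta> i X - \<theta> j X = 2 * pi * of_int (k i j X))"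

text \<open>The integral local system \<open>(U, k)\<close> has monodromy \<open>1\<close> along a small positive loop around the
  edge through \<open>P\<close>: it is the system of branches of the angle (divided by \<open>2\<pi>\<close>) around that edge.\<close>

definition linked_at ::
  "directed_edges \<Rightarrow> ('i \<Rightarrow> space set) \<Rightarrow> ('i \<Rightarrow> 'i \<Rightarrow> space \<Rightarrow> int) \<Rightarrow> space \<Rightarrow> bool" where
  "linked_at L U k P \<longleftrightarrow> (\<exists>A B r s W \<theta>. (A, B) \<in> L \<and> P \<in> open_segment A B \<and> det3 (B - A) r s > 0 \<and>
     P \<in> W \<and> angle_section U k W (\<lambda>X. around (B - A) r s (X - P)) \<theta>)"

text \<open>Allowing finitely many exceptions removes the need to analyse vertices, points over
  crossings, and the point of an edge that a triangle move turns into a vertex.\<close>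

definition linking ::
  "directed_edges \<Rightarrow> ('i \<Rightarrow> space set) \<Rightarrow> ('i \<Rightarrow> 'i \<Rightarrow> space \<Rightarrow> int) \<Rightarrow> bool" where
  "linking L U k \<longleftrightarrow> finite {P \<in> support L. \<not> linked_at L U k P}"

text \<open>A quotient that avoids the nonpositive half-line has a continuous \<open>Arg\<close>.
  Adding it turns branches for \<open>z\<close> into branches for \<open>z'\<close> without changing
  their differences; the constant \<open>\<alpha>\<close> absorbs a rotation.\<close>

lemma angle_section_change:
  assumes a: "angle_section U k W z \<theta>" and W: "open W'" "W' \<subseteq> W"
    and c: "continuous_on W' z" "continuous_on W' z'"
    and al: "\<alpha> \<noteq> 0" and z': "\<And>X i. X \<in> W' \<Longrightarrow> X \<in> U i \<Longrightarrow> z' X / (\<alpha> * z X) \<notin> \<real>\<^sub>\<le>\<^sub>0"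
  shows "angle_section U k W' z' (\<lambda>i X. \<theta> i X + Arg \<alpha> + Arg (z' X / (\<alpha> * z X)))"
  unfolding angle_section_def
proof (intro conjI allI ballI)
  show "open W'" by fact
  fix i
  have nz: "z X \<noteq> 0" "cis (\<theta> i X) = sgn (z X)" if "X \<in> W' \<inter> U i" for X
    using a W(2) that unfolding angle_section_def by blast+
  have \<theta>: "continuous_on (W' \<inter> U i) (\<theta> i)"
    using a W(2) unfolding angle_section_def by (meson Int_mono continuous_on_subset order_refl)
  have c': "continuous_on (W' \<inter> U i) z" "continuous_on (W' \<inter> U i) z'"
    using c by (auto intro: continuous_on_subset)
  have "continuous_on (W' \<inter> U i) (\<lambda>X. Arg (z' X / (\<alpha> * z X)))"
    using c' nz al z' by (intro continuous_intros) auto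
  then show "continuous_on (W' \<inter> U i) (\<lambda>X. \<theta> i X + Arg \<alpha> + Arg (z' X / (\<alpha> * z X)))"
    by (intro continuous_on_add \<theta> continuous_on_const)
  fix X assume X: "X \<in> W' \<inter> U i"
  then have q: "z' X / (\<alpha> * z X) \<noteq> 0" using z'[of X i] by (metis Int_iff nonpos_Reals_zero_I)
  then show "z' X \<noteq> 0" by auto
  have "cis (\<theta> i X + Arg \<alpha> + Arg (z' X / (\<alpha> * z X))) = sgn (z X) * sgn \<alpha> * sgn (z' X / (\<alpha> * z X))"
    using nz[OF X] al q by (simp add: cis_Arg flip: cis_mult)
  also have "\<dots> = sgn (z X * \<alpha> * (z' X / (\<alpha> * z X)))" by (simp only: sgn_mult)
  also have "z X * \<alpha> * (z' X / (\<alpha> * z X)) = z' X" using nz[OF X] al by simp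
  finally show "cis (\<theta> i X + Arg \<alpha> + Arg (z' X / (\<alpha> * z X))) = sgn (z' X)" .
next
  fix i j X assume "X \<in> W' \<inter> U i \<inter> U j"
  then have "X \<in> W \<inter> U i \<inter> U j" using W(2) by blast
  then have "\<theta> i X - \<theta> j X = 2 * pi * of_int (k i j X)" using a unfolding angle_section_def by blast
  then show "\<theta> i X + Arg \<alpha> + Arg (z' X / (\<alpha> * z X)) - (\<theta> j X + Arg \<alpha> + Arg (z' X / (\<alpha> * z X))) =
      2 * pi * of_int (k i j X)" by simp
qed

lemma continuous_on_det3 [continuous_intros]:
  "continuous_on S f \<Longrightarrow> continuous_on S g \<Longrightarrow> continuous_on S h \<Longrightarrow> continuous_on S (\<lambda>x. det3 (f x) (g x) (h x))"
  unfolding det3_def by (intro continuous_intros)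

lemma continuous_on_around [continuous_intros]:
  assumes "continuous_on S h" shows "continuous_on S (\<lambda>x. around d r s (h x))"
proof -
  have "continuous_on S (\<lambda>x. of_real (det3 d (h x) s) + \<i> * of_real (det3 d (h x) r))"
    using assms by (intro continuous_intros)
  then show ?thesis by (simp add: around_def Complex_eq)
qed

text \<open>A real-linear map of the plane is \<open>\<alpha> * z + \<beta> * cnj z\<close>, with
  determinant \<open>(cmod \<alpha>)^2 - (cmod \<beta>)^2\<close>. If this is positive, the first
  term dominates, and the quotient by it has positive real part.\<close>

lemma real_linear_positive_det:
  fixes z :: complex
  assumes "a * e - b * c > 0" "z \<noteq> 0"
  defines "\<alpha> \<equiv> Complex ((a + e) / 2) ((c - b) / 2)"
  shows "\<alpha> \<noteq> 0" "Complex (a * Re z + b * Im z) (c * Re z + e * Im z) / (\<alpha> * z) \<notin> \<real>\<^sub>\<le>\<^sub>0"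
proof -
  define \<beta> where "\<beta> = Complex ((a - e) / 2) ((c + b) / 2)"
  have w: "Complex (a * Re z + b * Im z) (c * Re z + e * Im z) = \<alpha> * z + \<beta> * cnj z"
    unfolding \<alpha>_def \<beta>_def by (rule complex_eqI) (simp_all add: field_simps)
  have "(cmod \<alpha>)\<^sup>2 - (cmod \<beta>)\<^sup>2 = a * e - b * c"
    unfolding \<alpha>_def \<beta>_def cmod_power2 by (simp add: power2_eq_square field_simps)
  then have "(cmod \<beta>)\<^sup>2 < (cmod \<alpha>)\<^sup>2" using assms(1) by linarith
  then have lt: "cmod \<beta> < cmod \<alpha>" by (rule power_less_imp_less_base) simp
  then show \<alpha>: "\<alpha> \<noteq> 0" using norm_ge_zero[of \<beta>] by auto
  have "(\<alpha> * z + \<beta> * cnj z) / (\<alpha> * z) = 1 + \<beta> * cnj z / (\<alpha> * z)"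
    using \<alpha> assms(2) by (simp add: add_divide_distrib)
  moreover have "cmod (\<beta> * cnj z / (\<alpha> * z)) < 1"
    using lt \<alpha> assms(2) by (simp add: norm_mult norm_divide)
  then have "Re (\<beta> * cnj z / (\<alpha> * z)) > - 1"
    using abs_Re_le_cmod[of "\<beta> * cnj z / (\<alpha> * z)"] by linarith
  ultimately have "Re ((\<alpha> * z + \<beta> * cnj z) / (\<alpha> * z)) > 0" by simp
  then show "Complex (a * Re z + b * Im z) (c * Re z + e * Im z) / (\<alpha> * z) \<notin> \<real>\<^sub>\<le>\<^sub>0"
    unfolding w by (simp add: complex_nonpos_Reals_iff)
qed

text \<open>The Grassmann-Pluecker relation; it expresses the coordinates modulo \<open>d\<close> in
  one basis through those in another.\<close>

lemma det3_plucker: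
  "det3 d X s' * det3 d r s = det3 d X s * det3 d r s' - det3 d X r * det3 d s s'"
  unfolding det3_def by algebra

lemma det3_swap: "det3 d s r = - det3 d r s" "det3 d r r = 0"
  unfolding det3_def by algebra+

text \<open>Two bases modulo \<open>d\<close> of the same orientation differ by a real matrix of
  positive determinant, so the auxiliary vectors in \<open>linked_at\<close> may be replaced by any
  positive pair.\<close>

lemma angle_section_basis:
  assumes a: "angle_section U k W (\<lambda>X. around d r s (X - P)) \<theta>"
    and pos: "det3 d r s > 0" "det3 d r' s' > 0"
  shows "\<exists>\<theta>'. angle_section U k W (\<lambda>X. around d r' s' (X - P)) \<theta>'"
proof -
  define D where "D = det3 d r s"
  have D: "D > 0" using pos by (simp add: D_def)
  define a' b c e where abce: "a' = det3 d r s' / D" "b = - det3 d s s' / D" "c = det3 d r r' / D" "e = - det3 d s r' / D"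
  have X1: "det3 d X s' = a' * det3 d X s + b * det3 d X r" for X
    using det3_plucker[of d X s' r s] D by (simp add: abce D_def field_simps)
  have X2: "det3 d X r' = c * det3 d X s + e * det3 d X r" for X
    using det3_plucker[of d X r' r s] D by (simp add: abce D_def field_simps)
  have "det3 d r' s' * D = det3 d r' s * det3 d r s' - det3 d r' r * det3 d s s'"
    unfolding D_def by (rule det3_plucker)
  then have "a' * e - b * c = det3 d r' s' / D"
  proof -
    have "a' * e - b * c = (- det3 d r s' * det3 d s r' + det3 d s s' * det3 d r r') / (D * D)"
      unfolding abce by (simp add: add_divide_distrib diff_divide_distrib)
    also have "- det3 d r s' * det3 d s r' + det3 d s s' * det3 d r r' = det3 d r' s' * D"
      using \<open>det3 d r' s' * D = _\<close> unfolding det3_swap(1)[of d s r'] det3_swap(1)[of d r' r]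
      by (simp add: algebra_simps)
    finally show ?thesis using D by simp
  qed
  then have det: "a' * e - b * c > 0" using D pos by simp
  define \<alpha> where "\<alpha> = Complex ((a' + e) / 2) ((c - b) / 2)"
  have nz: "around d r s (X - P) \<noteq> 0" if "X \<in> W" "X \<in> U i" for X i
    using a that unfolding angle_section_def by blast
  have eq: "around d r' s' X = Complex (a' * Re (around d r s X) + b * Im (around d r s X))
      (c * Re (around d r s X) + e * Im (around d r s X))" for X
    by (simp add: around_def X1 X2)
  have "angle_section U k W (\<lambda>X. around d r' s' (X - P))
      (\<lambda>i X. \<theta> i X + Arg \<alpha> + Arg (around d r' s' (X - P) / (\<alpha> * around d r s (X - P))))"
  proof (rule angle_section_change[OF a])
    show "open W" using a unfolding angle_section_def by blast
    show "\<alpha> \<noteq> 0" unfolding \<alpha>_def by (rule real_linear_positive_det(1)[OF det, of 1]) simp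
    show "around d r' s' (X - P) / (\<alpha> * around d r s (X - P)) \<notin> \<real>\<^sub>\<le>\<^sub>0" if "X \<in> W" "X \<in> U i" for X i
      unfolding eq \<alpha>_def by (rule real_linear_positive_det(2)[OF det nz[OF that]])
  qed (auto intro!: continuous_intros)
  then show ?thesis by blast
qed

lemma angle_section_pullback:
  assumes a: "angle_section U k W z \<theta>" and h: "homeomorphism UNIV UNIV f g"
  shows "angle_section (\<lambda>i. f ` U i) (\<lambda>i j X. k i j (g X)) (f ` W) (\<lambda>X. z (g X)) (\<lambda>i X. \<theta> i (g X))"
proof -
  have gf: "g (f X) = X" "f (g X) = X" for X using h unfolding homeomorphism_def by blast+
  have img: "Y \<in> f ` S \<longleftrightarrow> g Y \<in> S" for Y S using gf by (metis imageE imageI)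
  have cg: "continuous_on S g" for S
    using h unfolding homeomorphism_def by (meson continuous_on_subset subset_UNIV)
  have fS: "f ` S = g -` S" for S using img by blast
  show ?thesis unfolding angle_section_def
  proof (intro conjI allI ballI)
    show "open (f ` W)" unfolding fS using a cg by (intro open_vimage) (auto simp: angle_section_def)
    show "continuous_on (f ` W \<inter> f ` U i) (\<lambda>X. \<theta> i (g X))" for i
    proof (rule continuous_on_compose2[OF _ cg])
      show "continuous_on (W \<inter> U i) (\<theta> i)" using a unfolding angle_section_def by blast
      show "g ` (f ` W \<inter> f ` U i) \<subseteq> W \<inter> U i" unfolding fS by blast
    qed
  next
    fix i X assume "X \<in> f ` W \<inter> f ` U i"
    then have "g X \<in> W \<inter> U i" using img by (metis IntD1 IntD2 IntI)
    then show "z (g X) \<noteq> 0" "cis (\<theta> i (g X)) = sgn (z (g X))"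
      using a unfolding angle_section_def by blast+
  next
    fix i j X assume "X \<in> f ` W \<inter> f ` U i \<inter> f ` U j"
    then have "g X \<in> W \<inter> U i \<inter> U j" using img by (metis IntD1 IntD2 IntI)
    then show "\<theta> i (g X) - \<theta> j (g X) = 2 * pi * of_int (k i j (g X))"
      using a unfolding angle_section_def by blast
  qed
qed

section \<open>Index colourings and the jump across an edge\<close>

definition simple_at :: "directed_edges \<Rightarrow> space \<Rightarrow> space \<Rightarrow> space \<Rightarrow> bool" where
  "simple_at L A B P \<longleftrightarrow> (A, B) \<in> L \<and> P \<in> open_segment A B \<and>
     (\<forall>(A', B')\<in>L. (A', B') \<noteq> (A, B) \<longrightarrow> fst P \<notin> fst ` closed_segment A' B')"

lemma simple_atD:
  assumes "simple_at L A B P" "(A', B') \<in> L" "fst P \<in> fst ` closed_segment A' B'"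
  shows "A' = A \<and> B' = B"
proof -
  have "\<forall>(A', B')\<in>L. (A', B') \<noteq> (A, B) \<longrightarrow> fst P \<notin> fst ` closed_segment A' B'"
    using assms(1) unfolding simple_at_def by (elim conjE)
  from bspec[OF this assms(2)] show ?thesis using assms(3) by simp
qed

definition edge_jump :: "directed_edges \<Rightarrow> (plane \<Rightarrow> int) \<Rightarrow> space \<Rightarrow> space \<Rightarrow> plane \<Rightarrow> bool" where
  "edge_jump L c A B p \<longleftrightarrow> (\<exists>r>0. \<forall>q\<in>ball p r. \<forall>q'\<in>ball p r.
     cross (fst B - fst A) (q - p) > 0 \<longrightarrow> cross (fst B - fst A) (q' - p) < 0 \<longrightarrow> c q = c q' + 1)"

text \<open>The exceptions mirror those of \<open>linking\<close>. An additive constant is left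
  free; the colourings on two diagrams therefore have to be related by transport and cannot be
  chosen independently.\<close>

definition index_coloring :: "directed_edges \<Rightarrow> (plane \<Rightarrow> int) \<Rightarrow> bool" where
  "index_coloring L c \<longleftrightarrow> loc_const (- fst ` support L) c \<and>
     (\<forall>(A, B)\<in>L. finite {P \<in> open_segment A B. \<not> edge_jump L c A B (fst P)})"

lemma inj_on_fst_edge:
  assumes "fst A \<noteq> fst (B::space)" shows "inj_on fst (closed_segment A B)"
proof (rule inj_onI)
  fix X Y assume X: "X \<in> closed_segment A B" and Y: "Y \<in> closed_segment A B" and e: "fst X = fst Y"
  obtain t where t: "X = (1 - t) *\<^sub>R A + t *\<^sub>R B" using X by (auto simp: in_segment)
  obtain u where u: "Y = (1 - u) *\<^sub>R A + u *\<^sub>R B" using Y by (auto simp: in_segment)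
  have "snd X = snd Y" using edge_height_line(1)[OF assms t] edge_height_line(1)[OF assms u] e by simp
  then show "X = Y" using e by (simp add: prod_eq_iff)
qed

text \<open>Each of the finitely many other edges meets this one at most once in projection, and the
  projection is injective on the edge.\<close>

lemma finite_non_simple:
  assumes L: "oriented_link L" "regular_position L" and e: "(A, B) \<in> L"
  shows "finite {P \<in> open_segment A B. \<not> simple_at L A B P}"
proof -
  have fin: "finite L" using L(1) by (simp add: oriented_link_def)
  define F where "F = (\<Union>e'\<in>L - {(A, B)}. fst ` closed_segment A B \<inter> fst ` closed_segment (fst e') (snd e'))"
  have "finite (fst ` closed_segment A B \<inter> fst ` closed_segment (fst e') (snd e'))" if "e' \<in> L - {(A, B)}" for e'
  proof -
    have "x = y" if "x \<in> fst ` closed_segment A B \<inter> fst ` closed_segment (fst e') (snd e')"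
        "y \<in> fst ` closed_segment A B \<inter> fst ` closed_segment (fst e') (snd e')" for x y
      using projected_edges_meet_once[OF L e, of "fst e'" "snd e'" x y] \<open>e' \<in> L - {(A, B)}\<close> that by auto
    then show ?thesis by (metis (no_types, lifting) finite.emptyI finite_insert finite_subset insertCI subsetI)
  qed
  then have "finite F" unfolding F_def using fin by blast
  then have "finite (fst -` F \<inter> closed_segment A B)"
    by (rule finite_vimage_IntI[OF _ inj_on_fst_edge[OF regular_edge_not_vertical[OF L e]]])
  moreover have "{P \<in> open_segment A B. \<not> simple_at L A B P} \<subseteq> fst -` F \<inter> closed_segment A B"
  proof
    fix P assume P: "P \<in> {P \<in> open_segment A B. \<not> simple_at L A B P}"
    then obtain A' B' where "(A', B') \<in> L" "(A', B') \<noteq> (A, B)" "fst P \<in> fst ` closed_segment A' B'"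
      using e unfolding simple_at_def by blast
    then have "(A', B') \<in> L - {(A, B)}" "fst P \<in> fst ` closed_segment (fst (A', B')) (snd (A', B'))" by auto
    moreover have "P \<in> closed_segment A B" using P by (simp add: open_segment_def)
    ultimately show "P \<in> fst -` F \<inter> closed_segment A B"
      unfolding F_def by (intro IntI vimageI2 UN_I) blast+
  qed
  ultimately show ?thesis by (rule rev_finite_subset)
qed

lemma simple_neighbourhood:
  assumes L: "oriented_link L" "regular_position L" and P: "simple_at L A B P"
  obtains r where "r > 0" "\<And>X. fst X \<in> ball (fst P) r \<Longrightarrow> X \<in> support L \<longleftrightarrow>
      cross (fst B - fst A) (fst X - fst P) = 0 \<and> snd X = edge_height A B (fst X)"
proof -
  have e: "(A, B) \<in> L" "P \<in> open_segment A B" using P unfolding simple_at_def by blast+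
  obtain r1 where r1: "r1 > 0" "\<And>X. fst X \<in> ball (fst P) r1 \<Longrightarrow> X \<in> closed_segment A B \<longleftrightarrow>
      cross (fst B - fst A) (fst X - fst P) = 0 \<and> snd X = edge_height A B (fst X)"
    using edge_cylinder[OF regular_edge_not_vertical[OF L e(1)] e(2)] by blast
  obtain r2 where r2: "r2 > 0" "\<forall>X\<in>support L. fst X \<in> ball (fst P) r2 \<longrightarrow>
      (\<exists>(R, S)\<in>L. X \<in> closed_segment R S \<and> fst P \<in> fst ` closed_segment R S)"
    using support_over_small_ball[OF L(1), of "fst P"] by (elim exE conjE) (rule that; assumption)
  have "X \<in> support L \<longleftrightarrow> X \<in> closed_segment A B" if X: "fst X \<in> ball (fst P) r2" for X
  proof
    assume "X \<in> support L"
    then obtain R S where "(R, S) \<in> L" "X \<in> closed_segment R S" "fst P \<in> fst ` closed_segment R S"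
      using r2(2) X by blast
    then show "X \<in> closed_segment A B" using simple_atD[OF P] by blast
  qed (rule edge_in_support[OF e(1)])
  then show ?thesis using that[of "min r1 r2"] r1 r2(1) by simp
qed

text \<open>The coordinates \<open>around (B - A) \<dots>\<close> adapted to the projection: the imaginary part measures the
  distance to the left of the projected edge, the real part the height above it.\<close>

definition up :: space where "up = (0, 1)"
definition across :: "space \<Rightarrow> space" where "across d = ((snd (fst d), - fst (fst d)), 0)"

lemma across_pos: "fst d \<noteq> 0 \<Longrightarrow> det3 d up (across d) > 0"
  by (cases d; cases "fst d") (auto simp: det3_def up_def across_def zero_prod_def
      sum_squares_gt_zero_iff simp flip: power2_eq_square intro: add_pos_nonneg add_nonneg_pos)

lemma Im_around: "Im (around d up (across d) X) = cross (fst d) (fst X)"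
  by (simp add: around_def det3_def up_def cross_def zero_prod_def)

lemma Re_around:
  assumes "fst A \<noteq> fst B" "P \<in> closed_segment A B"
  shows "Re (around (B - A) up (across (B - A)) (X - P)) =
    ((fst B - fst A) \<bullet> (fst B - fst A)) * (snd X - edge_height A B (fst X))"
proof -
  define d where "d = B - A"
  have nz: "fst d \<bullet> fst d \<noteq> 0" using assms(1) by (simp add: d_def)
  obtain t where t: "P = (1 - t) *\<^sub>R A + t *\<^sub>R B" using assms(2) by (auto simp: in_segment)
  have P: "P = A + t *\<^sub>R d" unfolding t d_def by (simp add: algebra_simps)
  have eh: "(fst d \<bullet> fst d) * edge_height A B (fst X) = (fst d \<bullet> fst d) * snd A + snd d * ((fst X - fst A) \<bullet> fst d)"
    using nz unfolding edge_height_def d_def by (simp add: distrib_left)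
  have "Re (around d up (across d) (X - P)) = (fst d \<bullet> fst d) * snd X - ((fst d \<bullet> fst d) * snd A + snd d * ((fst X - fst A) \<bullet> fst d))"
    unfolding P around_def det3_def across_def inner_prod_def by (simp add: algebra_simps)
  then have "Re (around d up (across d) (X - P)) = (fst d \<bullet> fst d) * (snd X - edge_height A B (fst X))"
    unfolding eh[symmetric] by (simp add: right_diff_distrib)
  then show ?thesis unfolding d_def by simp
qed

text \<open>In the adapted coordinate, the half-plane hanging from the edge is the nonpositive real
  axis. Thus \<open>above L\<close> is locally the domain of continuity of \<open>Arg z\<close>, and
  \<open>below L\<close> that of \<open>Arg (- z)\<close>.\<close>

lemma simple_ball:
  assumes L: "oriented_link L" "regular_position L" and P: "simple_at L A B P"
  defines "z \<equiv> \<lambda>X. around (B - A) up (across (B - A)) (X - P)"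
  obtains r where "r > 0"
    "\<And>X. fst X \<in> ball (fst P) r \<Longrightarrow> X \<in> above L \<longleftrightarrow> z X \<notin> \<real>\<^sub>\<le>\<^sub>0"
    "\<And>X. fst X \<in> ball (fst P) r \<Longrightarrow> X \<in> below L \<longleftrightarrow> - z X \<notin> \<real>\<^sub>\<le>\<^sub>0"
    "\<And>X. fst X \<in> ball (fst P) r \<Longrightarrow> X \<in> support L \<longleftrightarrow> z X = 0"
proof -
  have e: "(A, B) \<in> L" "P \<in> closed_segment A B" using P by (auto simp: simple_at_def open_segment_def)
  note nv = regular_edge_not_vertical[OF L e(1)]
  obtain r where r: "r > 0" and supp: "\<And>X. fst X \<in> ball (fst P) r \<Longrightarrow> X \<in> support L \<longleftrightarrow>
      cross (fst B - fst A) (fst X - fst P) = 0 \<and> snd X = edge_height A B (fst X)"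
    using simple_neighbourhood[OF L P] by blast
  define n where "n = (fst B - fst A) \<bullet> (fst B - fst A)"
  have n: "n > 0" using nv by (simp add: n_def)
  have Im: "Im (z X) = cross (fst B - fst A) (fst X - fst P)" for X
    unfolding z_def by (simp add: Im_around)
  have Re: "Re (z X) = n * (snd X - edge_height A B (fst X))" for X
    unfolding z_def n_def by (rule Re_around[OF nv e(2)])
  have sgnRe: "Re (z X) \<le> 0 \<longleftrightarrow> snd X \<le> edge_height A B (fst X)"
    "Re (z X) \<ge> 0 \<longleftrightarrow> snd X \<ge> edge_height A B (fst X)" for X
    unfolding Re using n by (auto simp: mult_le_0_iff zero_le_mult_iff)
  have s: "(fst X, h) \<in> support L \<longleftrightarrow> Im (z X) = 0 \<and> h = edge_height A B (fst X)" if "fst X \<in> ball (fst P) r" for X h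
    using supp[of "(fst X, h)"] that unfolding Im by simp
  have ab: "X \<in> above L \<longleftrightarrow> (\<forall>h. (fst X, h) \<in> support L \<longrightarrow> h < snd X)"
    "X \<in> below L \<longleftrightarrow> (\<forall>h. (fst X, h) \<in> support L \<longrightarrow> snd X < h)" for X
    unfolding above_def below_def by auto
  show ?thesis
  proof (rule that[OF r])
    fix X :: space assume X: "fst X \<in> ball (fst P) r"
    show "X \<in> above L \<longleftrightarrow> z X \<notin> \<real>\<^sub>\<le>\<^sub>0"
      unfolding ab(1) s[OF X] complex_nonpos_Reals_iff sgnRe(1) by auto
    show "X \<in> below L \<longleftrightarrow> - z X \<notin> \<real>\<^sub>\<le>\<^sub>0"
      unfolding ab(2) s[OF X] complex_nonpos_Reals_iff using sgnRe(2)[of X] by auto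
    show "X \<in> support L \<longleftrightarrow> z X = 0"
      using s[OF X, of "snd X"] sgnRe[of X] by (auto simp: complex_eq_iff)
  qed
qed

text \<open>The source of all index jumps: the two principal branches differ by \<open>pi\<close> on
  the left of the edge and by \<open>- pi\<close> on the right.\<close>

lemma Arg_diff_minus: "Im z > 0 \<Longrightarrow> Arg z - Arg (- z) = pi" "Im z < 0 \<Longrightarrow> Arg z - Arg (- z) = - pi"
proof -
  assume "Im z > 0"
  then have "z \<noteq> 0" "Arg z > 0" by (auto simp: Arg_pos_iff)
  then show "Arg z - Arg (- z) = pi" by (simp add: Arg_minus)
next
  assume "Im z < 0"
  then have "z \<noteq> 0" "Arg z < 0" by (auto simp: Arg_neg_iff)
  then show "Arg z - Arg (- z) = - pi" by (simp add: Arg_minus)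
qed

lemma loc_const_continuous:
  fixes c :: "'a::topological_space \<Rightarrow> 'b::topological_space"
  assumes "loc_const S c" shows "continuous_on S c"
  unfolding continuous_on_def
proof
  fix x assume "x \<in> S"
  then obtain W where W: "open W" "x \<in> W" "\<And>y. y \<in> W \<Longrightarrow> y \<in> S \<Longrightarrow> c y = c x"
    using loc_constE[OF assms] by metis
  have "eventually (\<lambda>y. c y = c x) (at x within S)"
    unfolding eventually_at_topological using W by metis
  then show "(c \<longlongrightarrow> c x) (at x within S)" by (rule tendsto_eventually)
qed

lemma continuous_integer_loc_const:
  fixes h :: "'a::topological_space \<Rightarrow> real"
  assumes "continuous_on S h" "\<And>x. x \<in> S \<Longrightarrow> h x = of_int (n x)"
  shows "loc_const S n"
proof (rule loc_constI)
  fix x assume x: "x \<in> S"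
  obtain A where A: "open A" "A \<inter> S = h -` ball (h x) 1 \<inter> S"
    using assms(1) by (metis continuous_on_open_invariant open_ball)
  have "n y = n x" if "y \<in> A \<inter> S" for y
  proof -
    have "\<bar>h x - h y\<bar> < 1" using that A(2) by (auto simp: dist_real_def)
    then show ?thesis using assms(2)[of x] assms(2)[of y] x that by auto
  qed
  moreover have "x \<in> A" using A(2) x by auto
  ultimately show "\<exists>W. open W \<and> x \<in> W \<and> (\<forall>y\<in>W \<inter> S. n y = n x)" using A(1) by blast
qed

lemma cis_eq_cis_int:
  assumes "cis x = cis y" obtains n :: int where "x - y = 2 * pi * of_int n"
proof -
  have "cis (x - y) = 1" using assms by (simp flip: cis_divide)
  then have "cos (x - y) = 1" by (metis cis.sel(1) one_complex.sel(1))
  then show ?thesis using that unfolding cos_one_2pi_int by (auto simp: mult.commute mult.left_commute)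
qed

text \<open>Away from the half-plane below (or above) the edge the angle has a continuous branch, so there
  the local system has a flat section.\<close>

lemma angle_flat_section:
  assumes a: "angle_section U k W z \<theta>" and V: "V \<subseteq> W"
    and c: "continuous_on V z" and \<alpha>: "cmod \<alpha> = 1"
    and nz: "\<And>X. X \<in> V \<Longrightarrow> \<alpha> * z X \<notin> \<real>\<^sub>\<le>\<^sub>0"
  obtains \<sigma> where "flat_section V id U k \<sigma>"
    "\<And>X i. X \<in> V \<Longrightarrow> X \<in> U i \<Longrightarrow> 2 * pi * of_int (\<sigma> i X) = \<theta> i X + Arg \<alpha> - Arg (\<alpha> * z X)"
proof -
  have ex: "\<exists>n::int. 2 * pi * of_int n = \<theta> i X + Arg \<alpha> - Arg (\<alpha> * z X)" if X: "X \<in> V" "X \<in> U i" for X i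
  proof -
    have zX: "z X \<noteq> 0" "cis (\<theta> i X) = sgn (z X)" using a V X unfolding angle_section_def by blast+
    have "\<alpha> \<noteq> 0" using \<alpha> by auto
    then have "cis (\<theta> i X + Arg \<alpha>) = cis (Arg (\<alpha> * z X))"
      using zX by (simp add: cis_Arg sgn_mult flip: cis_mult)
    then show ?thesis by (metis cis_eq_cis_int)
  qed
  define \<sigma> where "\<sigma> i X = (SOME n. 2 * pi * of_int n = \<theta> i X + Arg \<alpha> - Arg (\<alpha> * z X))" for i X
  have \<sigma>: "2 * pi * of_int (\<sigma> i X) = \<theta> i X + Arg \<alpha> - Arg (\<alpha> * z X)" if "X \<in> V" "X \<in> U i" for X i
    unfolding \<sigma>_def by (rule someI_ex[OF ex[OF that]])
  have "flat_section V id U k \<sigma>"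
  proof (rule flat_sectionI)
    fix i
    have "continuous_on {X \<in> V. id X \<in> U i} (\<theta> i)"
      using a V unfolding angle_section_def by (auto intro: continuous_on_subset)
    moreover have "continuous_on {X \<in> V. id X \<in> U i} (\<lambda>X. Arg (\<alpha> * z X))"
      using c nz by (intro continuous_intros) (auto intro: continuous_on_subset)
    ultimately have "continuous_on {X \<in> V. id X \<in> U i} (\<lambda>X. (\<theta> i X + Arg \<alpha> - Arg (\<alpha> * z X)) / (2 * pi))"
      by (intro continuous_on_divide continuous_on_diff continuous_on_add continuous_on_const) auto
    then show "loc_const {X \<in> V. id X \<in> U i} (\<sigma> i)"
      by (rule continuous_integer_loc_const) (use \<sigma>[of _ i] in \<open>auto simp: field_simps\<close>)
  next
    fix i j X assume X: "X \<in> V" "id X \<in> U i" "id X \<in> U j"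
    then have "X \<in> W \<inter> U i \<inter> U j" using V by auto
    then have "\<theta> i X - \<theta> j X = 2 * pi * of_int (k i j X)" using a unfolding angle_section_def by blast
    then have "2 * pi * of_int (\<sigma> i X) = 2 * pi * (of_int (k i j X + \<sigma> j X) :: real)"
      using \<sigma>[of X i] \<sigma>[of X j] X by (simp add: algebra_simps)
    then show "\<sigma> i X = k i j (id X) + \<sigma> j X" by simp
  qed
  then show ?thesis using that \<sigma> by blast
qed

text \<open>\<open>sA\<close> and \<open>sB\<close> are compared with the sections given by the
  branches \<open>Arg z\<close> and \<open>Arg (- z) - pi\<close>. Up to constants the holonomy is
  \<open>(pi + Arg z - Arg (- z)) / (2 * pi)\<close>, which is 1 on the left and 0 on the
  right.\<close>

lemma linking_holonomy_jump:
  assumes L: "oriented_link L" "regular_position L" and P: "simple_at L A B P" and l: "linked_at L U k P"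
    and hs: "holonomy_sections L U k sA sB" and c: "holonomy_of L U sA sB c"
  shows "edge_jump L c A B (fst P)"
proof -
  note ls = holonomy_sections_local_system[OF hs]
  have fA: "flat_section (above L) id U k sA" and fB: "flat_section (below L) id U k sB"
    using hs unfolding holonomy_sections_def by blast+
  have e: "(A, B) \<in> L" "P \<in> open_segment A B" using P unfolding simple_at_def by blast+
  note nv = regular_edge_not_vertical[OF L e(1)]
  obtain A' B' r s W \<theta>0 where l': "(A', B') \<in> L" "P \<in> open_segment A' B'" "det3 (B' - A') r s > 0" "P \<in> W"
      "angle_section U k W (\<lambda>X. around (B' - A') r s (X - P)) \<theta>0"
    using l unfolding linked_at_def by blast
  have "fst P \<in> fst ` closed_segment A' B'" using l'(2) by (auto simp: open_segment_def)
  then have AB: "A' = A" "B' = B" using simple_atD[OF P l'(1)] by simp_all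
  define z where "z = (\<lambda>X. around (B - A) up (across (B - A)) (X - P))"
  have "det3 (B - A) up (across (B - A)) > 0" by (rule across_pos) (use nv in simp)
  then obtain \<theta> where \<theta>: "angle_section U k W z \<theta>"
    using angle_section_basis[OF l'(5)[unfolded AB] l'(3)[unfolded AB]] unfolding z_def by blast
  obtain r0 where r0: "r0 > 0" "\<And>X. fst X \<in> ball (fst P) r0 \<Longrightarrow> X \<in> above L \<longleftrightarrow> z X \<notin> \<real>\<^sub>\<le>\<^sub>0"
    "\<And>X. fst X \<in> ball (fst P) r0 \<Longrightarrow> X \<in> below L \<longleftrightarrow> - z X \<notin> \<real>\<^sub>\<le>\<^sub>0"
    by (rule simple_ball[OF L P]) (rule that; simp only: z_def)
  have "open W" using \<theta> unfolding angle_section_def by blast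
  then obtain r1 where r1: "r1 > 0" "ball P r1 \<subseteq> W" using l'(4) open_contains_ball by blast
  define \<rho> where "\<rho> = min r0 r1"
  have \<rho>: "\<rho> > 0" using r0 r1 by (simp add: \<rho>_def)
  have bW: "ball P \<rho> \<subseteq> W" using r1(2) by (auto simp: \<rho>_def)
  have bf: "fst X \<in> ball (fst P) r0" if "X \<in> ball P \<rho>" for X
    using that dist_fst_le[of P X] by (auto simp: \<rho>_def)
  have zlin: "z ((1 - t) *\<^sub>R X + t *\<^sub>R Y) = of_real (1 - t) * z X + of_real t * z Y" for t X Y
    unfolding z_def around_def det3_def by (rule complex_eqI) (simp_all add: algebra_simps)
  have zcont: "continuous_on S z" for S unfolding z_def by (intro continuous_intros)
  have conn: "connected {X \<in> ball P \<rho>. of_real \<epsilon> * z X \<notin> \<real>\<^sub>\<le>\<^sub>0}" if \<epsilon>: "\<epsilon> * \<epsilon> = 1" for \<epsilon> :: real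
  proof -
    \<comment> \<open>The centre of a star-shaped set: half a radius straight above or below
      \<open>P\<close>, where \<open>\<epsilon> * z\<close> is a positive real.\<close>
    define Y where "Y = P + (\<epsilon> * \<rho> / 2) *\<^sub>R up"
    have "\<bar>\<epsilon>\<bar> = 1" using \<epsilon> by (metis abs_mult_self_eq abs_one abs_ge_zero mult_cancel_right1 mult_eq_0_iff abs_mult zero_neq_one abs_square_eq_1 power2_eq_square)
    then have Yb: "Y \<in> ball P \<rho>" using \<rho> by (auto simp: Y_def dist_norm up_def abs_mult)
    have "det3 (B - A) up (across (B - A)) > 0" by (rule across_pos) (use nv in simp)
    moreover have zY: "z Y = of_real (\<epsilon> * (\<rho> / 2) * det3 (B - A) up (across (B - A)))"
      unfolding z_def Y_def around_def det3_def up_def by (rule complex_eqI) (simp_all add: field_simps zero_prod_def)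
    have "of_real \<epsilon> * z Y = of_real ((\<epsilon> * \<epsilon>) * ((\<rho> / 2) * det3 (B - A) up (across (B - A))))"
      unfolding zY by (simp add: mult_ac)
    ultimately have zY': "of_real \<epsilon> * z Y = of_real ((\<rho> / 2) * det3 (B - A) up (across (B - A)))" "(\<rho> / 2) * det3 (B - A) up (across (B - A)) > 0"
      using \<rho> unfolding \<epsilon> by simp_all
    have "starlike {X \<in> ball P \<rho>. of_real \<epsilon> * z X \<notin> \<real>\<^sub>\<le>\<^sub>0}"
      unfolding starlike_def
    proof (intro bexI[of _ Y] ballI subsetI)
      show "Y \<in> {X \<in> ball P \<rho>. of_real \<epsilon> * z X \<notin> \<real>\<^sub>\<le>\<^sub>0}" using Yb zY'(2) by (simp only: mem_Collect_eq zY'(1) nonpos_Reals_of_real_iff not_le simp_thms)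
      fix X Z assume X: "X \<in> {X \<in> ball P \<rho>. of_real \<epsilon> * z X \<notin> \<real>\<^sub>\<le>\<^sub>0}" and "Z \<in> closed_segment Y X"
      then obtain t where t: "0 \<le> t" "t \<le> 1" "Z = (1 - t) *\<^sub>R Y + t *\<^sub>R X" by (auto simp: in_segment)
      have "Z \<in> ball P \<rho>" using convexD_alt[OF convex_ball Yb _ t(1,2), of X] X t(3) by simp
      moreover have "of_real \<epsilon> * z Z = of_real (1 - t) * (of_real \<epsilon> * z Y) + of_real t * (of_real \<epsilon> * z X)"
        unfolding t(3) zlin by (simp add: algebra_simps)
      moreover have "of_real (1 - t) * (of_real \<epsilon> * z Y) + of_real t * (of_real \<epsilon> * z X) \<notin> \<real>\<^sub>\<le>\<^sub>0"
      proof (cases "t = 0")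
        case False
        then show ?thesis using X zY'(2) t unfolding zY'(1) complex_nonpos_Reals_iff
          by (auto simp: not_le intro!: add_nonneg_pos)
      next
        case True
        then show ?thesis using zY'(2) unfolding zY'(1) by (simp del: of_real_mult of_real_divide)
      qed
      ultimately show "Z \<in> {X \<in> ball P \<rho>. of_real \<epsilon> * z X \<notin> \<real>\<^sub>\<le>\<^sub>0}" by simp
    qed
    then show ?thesis by (rule starlike_imp_connected)
  qed
  define VA where "VA = {X \<in> ball P \<rho>. of_real 1 * z X \<notin> \<real>\<^sub>\<le>\<^sub>0}"
  define VB where "VB = {X \<in> ball P \<rho>. of_real (-1) * z X \<notin> \<real>\<^sub>\<le>\<^sub>0}"
  have VA: "VA \<subseteq> above L" "VA \<subseteq> W" and VB: "VB \<subseteq> below L" "VB \<subseteq> W"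
    using r0 bf bW by (auto simp: VA_def VB_def)
  obtain \<sigma>A where \<sigma>A: "flat_section VA id U k \<sigma>A"
    "\<And>X i. X \<in> VA \<Longrightarrow> X \<in> U i \<Longrightarrow> 2 * pi * of_int (\<sigma>A i X) = \<theta> i X + Arg 1 - Arg (1 * z X)"
    by (rule angle_flat_section[OF \<theta> VA(2) zcont, of 1]) (auto simp: VA_def intro: that)
  obtain \<sigma>B where \<sigma>B: "flat_section VB id U k \<sigma>B"
    "\<And>X i. X \<in> VB \<Longrightarrow> X \<in> U i \<Longrightarrow> 2 * pi * of_int (\<sigma>B i X) = \<theta> i X + Arg (-1) - Arg (-1 * z X)"
    by (rule angle_flat_section[OF \<theta> VB(2) zcont, of "-1"]) (auto simp: VB_def intro: that)
  have VA_s: "VA \<inter> support L = {}" using VA(1) above_notin_support by blast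
  have VB_s: "VB \<inter> support L = {}" using VB(1) below_notin_support by blast
  obtain dA where dA: "loc_const VA dA" "\<And>X i. X \<in> VA \<Longrightarrow> X \<in> U i \<Longrightarrow> dA X = - sA i X + \<sigma>A i X"
    by (rule sections_difference[OF ls VA(1) order_refl VA_s fA \<sigma>A(1)]) (rule that; assumption)
  obtain dB where dB: "loc_const VB dB" "\<And>X i. X \<in> VB \<Longrightarrow> X \<in> U i \<Longrightarrow> dB X = - sB i X + \<sigma>B i X"
    by (rule sections_difference[OF ls VB(1) order_refl VB_s fB \<sigma>B(1)]) (rule that; assumption)
  have connA: "connected VA" and connB: "connected VB"
    unfolding VA_def VB_def by (rule conn, simp)+
  have side: "(q, snd P) \<in> VA \<and> (q, snd P) \<in> VB \<and> Im (z (q, snd P)) = cross (fst B - fst A) (q - fst P)"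
    if "q \<in> ball (fst P) \<rho>" "cross (fst B - fst A) (q - fst P) \<noteq> 0" for q
  proof -
    have Im: "Im (z (q, snd P)) = cross (fst B - fst A) (q - fst P)" unfolding z_def by (simp add: Im_around)
    have "dist P (q, snd P) = dist (fst P) q" by (simp add: dist_prod_def)
    then have "(q, snd P) \<in> ball P \<rho>" using that(1) by simp
    then show ?thesis using Im that(2) unfolding VA_def VB_def by (simp add: complex_nonpos_Reals_iff)
  qed
  have val: "2 * pi * of_int (c q) = 2 * pi * of_int (dB (q, snd P)) * -1 + 2 * pi * of_int (dA (q, snd P))
      + (pi - Arg (- z (q, snd P)) + Arg (z (q, snd P)))"
    if q: "q \<in> ball (fst P) \<rho>" "cross (fst B - fst A) (q - fst P) \<noteq> 0" for q
  proof -
    let ?X = "(q, snd P)"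
    have X: "?X \<in> VA" "?X \<in> VB" using side[OF q] by auto
    then have "?X \<in> (\<Union>i. U i)"
      unfolding local_system_Union[OF ls] using VA above_notin_support by blast
    then obtain i where i: "?X \<in> U i" by blast
    have "c (fst ?X) = - sA i ?X + sB i ?X"
      using c X VA VB i unfolding holonomy_of_def by blast
    then have "c q = dA ?X - \<sigma>A i ?X + \<sigma>B i ?X - dB ?X"
      using dA(2)[OF X(1) i] dB(2)[OF X(2) i] by simp
    then have "2 * pi * of_int (c q) = 2 * pi * of_int (dA ?X) - 2 * pi * of_int (\<sigma>A i ?X) + 2 * pi * of_int (\<sigma>B i ?X) - 2 * pi * of_int (dB ?X)"
      by (simp only: of_int_add of_int_diff) (simp add: algebra_simps)
    moreover have "Arg (- 1) = pi" by (simp add: Arg_eq_pi)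
    ultimately show ?thesis unfolding \<sigma>A(2)[OF X(1) i] \<sigma>B(2)[OF X(2) i] by simp
  qed
  show ?thesis unfolding edge_jump_def
  proof (intro exI[of _ \<rho>] conjI \<rho> ballI impI)
    fix q q' assume q: "q \<in> ball (fst P) \<rho>" "cross (fst B - fst A) (q - fst P) > 0"
      and q': "q' \<in> ball (fst P) \<rho>" "cross (fst B - fst A) (q' - fst P) < 0"
    note sq = side[of q] side[of q']
    have "dA (q, snd P) = dA (q', snd P)"
      by (rule loc_const_connected[OF dA(1) connA]) (use sq q q' in auto)
    moreover have "dB (q, snd P) = dB (q', snd P)"
      by (rule loc_const_connected[OF dB(1) connB]) (use sq q q' in auto)
    moreover have "Arg (z (q, snd P)) - Arg (- z (q, snd P)) = pi" "Arg (z (q', snd P)) - Arg (- z (q', snd P)) = - pi"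
      using sq q q' by (auto intro!: Arg_diff_minus)
    ultimately have "2 * pi * of_int (c q) = 2 * pi * (of_int (c q' + 1) :: real)"
      using val[of q] val[of q'] q q' by (simp add: algebra_simps)
    then show "c q = c q' + 1" by simp
  qed
qed

lemma holonomy_index_coloring:
  assumes L: "oriented_link L" "regular_position L" and l: "linking L U k"
    and c: "holonomy L U k c"
  shows "index_coloring L c"
  unfolding index_coloring_def
proof (intro conjI ballI)
  obtain sA sB where hs: "holonomy_sections L U k sA sB" "holonomy_of L U sA sB c"
    using c unfolding holonomy_def by blast
  show "loc_const (- fst ` support L) c" by (rule holonomy_loc_const[OF hs])
  fix e assume "e \<in> L"
  moreover obtain A B where [simp]: "e = (A, B)" by (cases e)
  ultimately have e: "(A, B) \<in> L" by simp
  have "{P \<in> open_segment A B. \<not> edge_jump L c A B (fst P)} \<subseteq>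
      {P \<in> open_segment A B. \<not> simple_at L A B P} \<union> {P \<in> support L. \<not> linked_at L U k P}"
  proof
    fix P assume P: "P \<in> {P \<in> open_segment A B. \<not> edge_jump L c A B (fst P)}"
    then have "P \<in> support L" using edge_in_support[OF e] by (simp add: open_segment_def)
    then show "P \<in> {P \<in> open_segment A B. \<not> simple_at L A B P} \<union> {P \<in> support L. \<not> linked_at L U k P}"
      using P linking_holonomy_jump[OF L _ _ hs] by blast
  qed
  moreover have "finite ({P \<in> open_segment A B. \<not> simple_at L A B P} \<union> {P \<in> support L. \<not> linked_at L U k P})"
    using finite_non_simple[OF L e] l unfolding linking_def by blast
  ultimately show "case e of (A, B) \<Rightarrow> finite {P \<in> open_segment A B. \<not> edge_jump L c A B (fst P)}"
    by (simp add: finite_subset)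
qed

lemma side_points:
  assumes "d \<noteq> 0" "r > 0"
  obtains q q' where "q \<in> ball m r" "q' \<in> ball m r" "cross d (q - m) > 0" "cross d (q' - m) < 0"
proof -
  define n where "n = (- snd d, fst d)"
  have pos: "cross d n > 0"
  proof -
    have "cross d n = d \<bullet> d" by (simp add: n_def cross_def inner_prod_def)
    then show ?thesis using assms(1) by simp
  qed
  have n: "n \<noteq> 0" using pos by auto
  define \<kappa> where "\<kappa> = r / (2 * norm n)"
  have \<kappa>: "\<kappa> > 0" "\<kappa> * norm n < r" using assms(2) n by (auto simp: \<kappa>_def)
  show ?thesis
    by (rule that[of "m + \<kappa> *\<^sub>R n" "m - \<kappa> *\<^sub>R n"])
       (use \<kappa> pos in \<open>simp_all add: dist_norm cross_scaleR cross_minus\<close>)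
qed

text \<open>The converse of \<open>linking_holonomy_jump\<close>: the known jump of the colours
  allows the two principal branches to be glued to an angle section of the bundle built from
  \<open>c\<close>.\<close>

lemma index_linked_at:
  assumes L: "oriented_link L" "regular_position L" and P: "simple_at L A B P"
    and j: "edge_jump L c A B (fst P)" and c: "dehn_coloring L c"
  shows "linked_at L (chart_set L) (transition L c) P"
proof -
  let ?U = "chart_set L" let ?k = "transition L c"
  note ls = local_system_transition[OF L c]
  have e: "(A, B) \<in> L" "P \<in> open_segment A B" using P unfolding simple_at_def by blast+
  note nv = regular_edge_not_vertical[OF L e(1)]
  define d where "d = fst B - fst A"
  have d: "d \<noteq> 0" using nv by (simp add: d_def)
  define z where "z = (\<lambda>X. around (B - A) up (across (B - A)) (X - P))"
  obtain r0 where r0: "r0 > 0" "\<And>X. fst X \<in> ball (fst P) r0 \<Longrightarrow> X \<in> above L \<longleftrightarrow> z X \<notin> \<real>\<^sub>\<le>\<^sub>0"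
    "\<And>X. fst X \<in> ball (fst P) r0 \<Longrightarrow> X \<in> below L \<longleftrightarrow> - z X \<notin> \<real>\<^sub>\<le>\<^sub>0"
    "\<And>X. fst X \<in> ball (fst P) r0 \<Longrightarrow> X \<in> support L \<longleftrightarrow> z X = 0"
    by (rule simple_ball[OF L P]) (rule that; simp only: z_def)
  obtain r1 where r1: "r1 > 0" "\<And>q q'. q \<in> ball (fst P) r1 \<Longrightarrow> q' \<in> ball (fst P) r1 \<Longrightarrow>
     cross d (q - fst P) > 0 \<Longrightarrow> cross d (q' - fst P) < 0 \<Longrightarrow> c q = c q' + 1"
    using j unfolding edge_jump_def d_def[symmetric] by (elim exE conjE) (rule that, assumption, blast)
  define r where "r = min r0 r1"
  have r: "r > 0" using r0 r1 by (simp add: r_def)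
  define W where "W = ball P r"
  have bf: "fst X \<in> ball (fst P) r0" "fst X \<in> ball (fst P) r1" if "X \<in> W" for X
    using that dist_fst_le[of P X] by (auto simp: W_def r_def)
  have zcont: "continuous_on S z" for S unfolding z_def by (intro continuous_intros)
  have Im: "Im (z X) = cross d (fst X - fst P)" for X unfolding z_def d_def by (simp add: Im_around)
  obtain qL qR where qLR: "qL \<in> ball (fst P) r1" "qR \<in> ball (fst P) r1" "cross d (qL - fst P) > 0" "cross d (qR - fst P) < 0"
    using side_points[OF d r1(1)] by metis
  define a where "a = c qR"
  have cl: "c q = a + 1" if "q \<in> ball (fst P) r1" "cross d (q - fst P) > 0" for q
    using r1(2)[OF that(1) qLR(2) that(2) qLR(4)] by (simp add: a_def)
  have cr: "c q = a" if "q \<in> ball (fst P) r1" "cross d (q - fst P) < 0" for q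
    using r1(2)[OF qLR(1) that(1) qLR(3) that(2)] cl[OF qLR(1,3)] by simp
  \<comment> \<open>The colour is \<open>a + 1\<close> on the left and \<open>a\<close> on the
    right. With this shift the branch below, carried by the transition from \<open>Top\<close> to
    \<open>Bot\<close>, equals \<open>Arg z\<close> on both sides: on the right \<open>Arg z\<close>
    is \<open>2 * pi\<close> less than \<open>Arg (- z) + pi\<close>, and the colour is one
    less.\<close>
  define \<theta>B where "\<theta>B X = Arg (- z X) + pi - 2 * pi * of_int (a + 1)" for X
  have AB: "Arg (z X) = \<theta>B X + 2 * pi * of_int (?k Top Bot X)" if X: "X \<in> W" "X \<in> above L" "X \<in> below L" for X
  proof -
    have k: "?k Top Bot X = c (fst X)" by (rule transition_Top_Bot[OF X(2,3)])
    have "Im (z X) \<noteq> 0"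
      using r0(2,3)[OF bf(1)[OF X(1)]] X(2,3) by (auto simp: complex_nonpos_Reals_iff)
    then consider "Im (z X) > 0" | "Im (z X) < 0" by linarith
    then show ?thesis
    proof cases
      case 1
      then show ?thesis using Arg_diff_minus(1)[OF 1] cl[OF bf(2)[OF X(1)]]
        unfolding k \<theta>B_def Im by (simp add: algebra_simps)
    next
      case 2
      then show ?thesis using Arg_diff_minus(2)[OF 2] cr[OF bf(2)[OF X(1)]]
        unfolding k \<theta>B_def Im by (simp add: algebra_simps)
    qed
  qed
  define \<theta> where "\<theta> i X = (if X \<in> above L then Arg (z X) + 2 * pi * of_int (?k i Top X)
      else \<theta>B X + 2 * pi * of_int (?k i Bot X))" for i X
  have \<theta>A: "\<theta> i X = Arg (z X) + 2 * pi * of_int (?k i Top X)" if "X \<in> above L" for i X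
    using that by (simp add: \<theta>_def)
  have \<theta>B: "\<theta> i X = \<theta>B X + 2 * pi * of_int (?k i Bot X)" if "X \<in> W" "X \<in> below L" for i X
    using AB[OF that(1) _ that(2)] transition_cocycle[of L c i Bot X Top]
    by (auto simp: \<theta>_def algebra_simps)
  have ab: "X \<in> above L \<or> X \<in> below L" if "X \<in> W" "X \<in> ?U i" for X i
  proof -
    have "X \<notin> support L" using local_system_Union[OF ls] that(2) by blast
    then have "z X \<noteq> 0" using r0(4)[OF bf(1)[OF that(1)]] by simp
    then show ?thesis using r0(2,3)[OF bf(1)[OF that(1)]]
      by (auto simp: complex_nonpos_Reals_iff complex_eq_iff)
  qed
  have "angle_section ?U ?k W z \<theta>"
    unfolding angle_section_def
  proof (intro conjI allI ballI)
    show "open W" by (simp add: W_def)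
    fix i
    have kc: "continuous_on (W \<inter> ?U i \<inter> ?U j) (\<lambda>X. of_int (?k i j X) :: real)" for j
    proof -
      have "loc_const (?U i \<inter> ?U j) (?k i j)" using ls unfolding local_system_def by blast
      then have "loc_const (?U i \<inter> ?U j) (\<lambda>X. of_int (?k i j X) :: real)"
        by (rule loc_const_comp[where F = "\<lambda>x. of_int x :: real"])
      then show ?thesis by (intro loc_const_continuous) (auto elim: loc_const_subset)
    qed
    have "continuous_on (W \<inter> ?U i \<inter> ?U Top) (\<lambda>X. Arg (z X) + 2 * pi * of_int (?k i Top X))"
      using r0(2)[OF bf(1)] by (intro continuous_intros zcont kc) auto
    then have 1: "continuous_on (W \<inter> ?U i \<inter> ?U Top) (\<theta> i)"
      by (rule continuous_on_eq) (use \<theta>A in simp)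
    have "continuous_on (W \<inter> ?U i \<inter> ?U Bot) (\<lambda>X. \<theta>B X + 2 * pi * of_int (?k i Bot X))"
      unfolding \<theta>B_def using r0(3)[OF bf(1)] by (intro continuous_intros zcont kc) auto
    then have 2: "continuous_on (W \<inter> ?U i \<inter> ?U Bot) (\<theta> i)"
      by (rule continuous_on_eq) (use \<theta>B in simp)
    have "W \<inter> ?U i = (W \<inter> ?U i \<inter> ?U Top) \<union> (W \<inter> ?U i \<inter> ?U Bot)"
      using ab by auto
    moreover have "open (W \<inter> ?U i \<inter> ?U j)" for j
      unfolding W_def by (intro open_Int open_ball local_system_open[OF ls])
    ultimately show "continuous_on (W \<inter> ?U i) (\<theta> i)" using continuous_on_open_Un 1 2 by metis
    fix X assume X: "X \<in> W \<inter> ?U i"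
    then consider "X \<in> above L" | "X \<in> below L" using ab by blast
    then have "z X \<noteq> 0 \<and> cis (\<theta> i X) = sgn (z X)"
    proof cases
      case 1
      then have "z X \<noteq> 0" using r0(2)[OF bf(1)] X by auto
      then show ?thesis using \<theta>A[OF 1] by (simp add: cis_Arg cis_multiple_2pi flip: cis_mult)
    next
      case 2
      then have "z X \<noteq> 0" using r0(3)[OF bf(1)] X by auto
      moreover have "\<theta> i X = Arg (- z X) + pi + 2 * pi * of_int (?k i Bot X - (a + 1))"
        using \<theta>B[OF _ 2] X by (simp add: \<theta>B_def algebra_simps)
      ultimately show ?thesis by (simp add: cis_Arg cis_multiple_2pi flip: cis_mult)
    qed
    then show "z X \<noteq> 0" "cis (\<theta> i X) = sgn (z X)" by auto
  next
    fix i j X assume X: "X \<in> W \<inter> ?U i \<inter> ?U j"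
    have k: "?k i l X = ?k i j X + ?k j l X" for l by (rule transition_cocycle)
    consider "X \<in> above L" | "X \<in> below L" using ab X by blast
    then show "\<theta> i X - \<theta> j X = 2 * pi * of_int (?k i j X)"
    proof cases
      case 1 then show ?thesis unfolding \<theta>A[OF 1] k[of Top] by (simp add: algebra_simps)
    next
      case 2 then show ?thesis using X \<theta>B[OF _ 2] unfolding k[of Bot] by (simp add: k[of Bot] algebra_simps)
    qed
  qed
  moreover have "det3 (B - A) up (across (B - A)) > 0" by (rule across_pos) (use d d_def in simp)
  moreover have "P \<in> W" using r by (simp add: W_def)
  ultimately show ?thesis unfolding linked_at_def z_def using e by blast
qed

lemma index_coloring_linking:
  assumes L: "oriented_link L" "regular_position L" and c: "index_coloring L c" "dehn_coloring L c"
  shows "linking L (chart_set L) (transition L c)"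
proof -
  have fin: "finite L" using L(1) by (simp add: oriented_link_def)
  define F where "F = (\<lambda>e. {P \<in> open_segment (fst e) (snd e). \<not> simple_at L (fst e) (snd e) P} \<union>
    {P \<in> open_segment (fst e) (snd e). \<not> edge_jump L c (fst e) (snd e) (fst P)})"
  have "finite (F e)" if "e \<in> L" for e
    using finite_non_simple[OF L, of "fst e" "snd e"] c(1) that
    unfolding F_def index_coloring_def by fastforce
  then have "finite (fst ` L \<union> snd ` L \<union> (\<Union>e\<in>L. F e))" using fin by blast
  moreover have "{P \<in> support L. \<not> linked_at L (chart_set L) (transition L c) P} \<subseteq> fst ` L \<union> snd ` L \<union> (\<Union>e\<in>L. F e)"
  proof
    fix P assume P: "P \<in> {P \<in> support L. \<not> linked_at L (chart_set L) (transition L c) P}"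
    then obtain A B where e: "(A, B) \<in> L" "P \<in> closed_segment A B" by (auto simp: support_def)
    show "P \<in> fst ` L \<union> snd ` L \<union> (\<Union>e\<in>L. F e)"
    proof (cases "P \<in> open_segment A B")
      case True
      then have "P \<in> F (A, B)"
        using P index_linked_at[OF L _ _ c(2), of A B P] unfolding F_def fst_conv snd_conv by blast
      then show ?thesis using e(1) by blast
    next
      case False
      then have "P = A \<or> P = B" using e(2) by (simp add: open_segment_def)
      then show ?thesis using e(1) by force
    qed
  qed
  ultimately show ?thesis unfolding linking_def by (rule rev_finite_subset)
qed

text \<open>At a crossing point itself the jump may fail. Sliding along the edge, to the prescribed
  side of the other strand, reaches a point where it holds and yields colours in two adjacent
  corners.\<close>

lemma index_jump_nearby:
  assumes c: "index_coloring L c" and e: "(A, B) \<in> L" "Y \<in> open_segment A B"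
    and w: "\<tau> * cross w (fst B - fst A) \<noteq> 0" and R: "R > 0"
  obtains q q' where "q \<in> ball (fst Y) R" "q' \<in> ball (fst Y) R"
    "cross (fst B - fst A) (q - fst Y) > 0" "cross (fst B - fst A) (q' - fst Y) < 0"
    "\<tau> * cross w (q - fst Y) > 0" "\<tau> * cross w (q' - fst Y) > 0" "c q = c q' + 1"
proof -
  define d where "d = fst B - fst A"
  have d: "d \<noteq> 0" using w by (auto simp: d_def)
  then have AB: "A \<noteq> B" by (auto simp: d_def)
  obtain t0 where t0: "0 < t0" "t0 < 1" "Y = (1 - t0) *\<^sub>R A + t0 *\<^sub>R B" using e(2) by (auto simp: in_segment)
  \<comment> \<open>The direction along the edge in which \<open>\<tau> * cross w\<close>
    increases.\<close>
  define \<epsilon> where "\<epsilon> = sgn (\<tau> * cross w d)"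
  have \<epsilon>: "\<epsilon> * (\<tau> * cross w d) > 0" "\<bar>\<epsilon>\<bar> = 1" 
  proof -
    have "sgn y * y > 0 \<and> \<bar>sgn y\<bar> = 1" if "y \<noteq> 0" for y :: real
      using that by (auto simp: sgn_real_def)
    then show "\<epsilon> * (\<tau> * cross w d) > 0" "\<bar>\<epsilon>\<bar> = 1" using w unfolding \<epsilon>_def d_def by blast+
  qed
  define \<delta> where "\<delta> = min (min t0 (1 - t0)) (R / norm d)"
  have \<delta>: "\<delta> > 0" using t0 R d by (simp add: \<delta>_def)
  define m where "m t = Y + (\<epsilon> * t) *\<^sub>R (B - A)" for t
  have m_open: "m t \<in> open_segment A B" if "t \<in> {0<..<\<delta>}" for t
  proof -
    have "m t = (1 - (t0 + \<epsilon> * t)) *\<^sub>R A + (t0 + \<epsilon> * t) *\<^sub>R B"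
      unfolding m_def t0(3) by (simp add: algebra_simps)
    moreover have "\<bar>\<epsilon> * t\<bar> < min t0 (1 - t0)" using that \<epsilon>(2) by (simp add: abs_mult \<delta>_def)
    then have "0 < t0 + \<epsilon> * t" "t0 + \<epsilon> * t < 1" by auto
    ultimately show ?thesis using AB by (auto simp: in_segment)
  qed
  have "inj_on m {0<..<\<delta>}" using AB \<epsilon>(2) by (auto simp: inj_on_def m_def)
  \<comment> \<open>Infinitely many candidates on the edge against finitely many exceptions.\<close>
  then have "infinite (m ` {0<..<\<delta>})" using \<delta> by (simp add: finite_image_iff)
  moreover have "finite {P \<in> open_segment A B. \<not> edge_jump L c A B (fst P)}"
    using c e(1) unfolding index_coloring_def by blast
  ultimately obtain t where t: "t \<in> {0<..<\<delta>}" "edge_jump L c A B (fst (m t))"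
    using m_open by (smt (verit, best) finite_subset image_subset_iff mem_Collect_eq subsetI)
  define p where "p = fst Y"
  define p' where "p' = fst (m t)"
  have p': "p' - p = (\<epsilon> * t) *\<^sub>R d" by (simp add: p'_def p_def m_def d_def)
  obtain r where r: "r > 0" "\<And>q q'. q \<in> ball p' r \<Longrightarrow> q' \<in> ball p' r \<Longrightarrow> cross d (q - p') > 0 \<Longrightarrow> cross d (q' - p') < 0 \<Longrightarrow> c q = c q' + 1"
    using t(2) unfolding edge_jump_def d_def[symmetric] p'_def[symmetric] by (elim exE conjE) (rule that, assumption, blast)
  have "norm (p' - p) < R"
  proof -
    have "\<bar>\<epsilon> * t\<bar> < R / norm d" using t(1) \<epsilon>(2) by (simp add: abs_mult \<delta>_def)
    then show ?thesis unfolding p' using d by (simp add: pos_less_divide_eq)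
  qed
  then have "p' \<in> ball p R" by (simp add: dist_norm norm_minus_commute)
  moreover have "\<tau> * cross w (p' - p) = t * (\<epsilon> * (\<tau> * cross w d))" unfolding p' by (simp add: cross_scaleR)
  then have "\<tau> * cross w (p' - p) > 0" using t(1) mult_pos_pos[OF _ \<epsilon>(1), of t] by (simp only: greaterThanLessThan_iff)
  moreover have "open (ball p R \<inter> {q. \<tau> * cross w (q - p) > 0})"
    by (intro open_Int open_ball open_Collect_less continuous_intros)
  ultimately obtain r' where r': "r' > 0" "ball p' r' \<subseteq> ball p R \<inter> {q. \<tau> * cross w (q - p) > 0}"
    using open_contains_ball by (metis (mono_tags, lifting) IntI mem_Collect_eq)
  have "min r r' > 0" using r r' by simp
  then obtain q q' where q: "q \<in> ball p' (min r r')" "q' \<in> ball p' (min r r')" "cross d (q - p') > 0" "cross d (q' - p') < 0"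
    using side_points[OF d] by metis
  have sh: "cross d (x - p) = cross d (x - p')" for x
  proof -
    have "cross d (x - p) = cross d (x - p') + cross d (p' - p)"
      by (simp add: cross_def algebra_simps)
    then show ?thesis unfolding p' by (simp only: cross_scaleR cross_self mult_zero_right diff_0_right add_0_right)
  qed
  show ?thesis
  proof (rule that[of q q'])
    have "q \<in> ball p R \<inter> {q. \<tau> * cross w (q - p) > 0}" "q' \<in> ball p R \<inter> {q. \<tau> * cross w (q - p) > 0}"
      using r'(2) q(1,2) by auto
    then show "q \<in> ball (fst Y) R" "q' \<in> ball (fst Y) R" "\<tau> * cross w (q - fst Y) > 0" "\<tau> * cross w (q' - fst Y) > 0"
      unfolding p_def by auto
    show "cross (fst B - fst A) (q - fst Y) > 0" "cross (fst B - fst A) (q' - fst Y) < 0"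
      using q(3,4) sh unfolding d_def p_def by auto
    show "c q = c q' + 1" using r(2)[of q q'] q by simp
  qed
qed

lemma index_coloring_corners:
  assumes L: "oriented_link L" "regular_position L" and c: "index_coloring L c"
    and x: "x \<in> crossings (projection L)"
  shows "s * s = 1 \<Longrightarrow> q \<in> corner L x 1 s \<Longrightarrow> q' \<in> corner L x (-1) s \<Longrightarrow> c q = c q' + 1"
    and "s * s = 1 \<Longrightarrow> q \<in> corner L x s 1 \<Longrightarrow> q' \<in> corner L x s (-1) \<Longrightarrow> c q = c q' + 1"
proof -
  obtain Y Y' P Q P' Q' where e: "(P, Q) \<in> L" "(P', Q') \<in> L"
    and Y: "Y \<in> closed_segment P Q" "Y' \<in> closed_segment P' Q'" "fst Y = fst Y'" "snd Y > snd Y'"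
    and xe: "x = (fst Y, direction (P, Q), direction (P', Q'))"
    using x unfolding mem_crossings by blast
  define d where "d = fst Q - fst P"
  define d' where "d' = fst Q' - fst P'"
  have ne: "Y \<noteq> Y'" using Y(4) by auto
  have nv: "d \<noteq> 0" "d' \<noteq> 0" using regular_edge_not_vertical[OF L e(1)] regular_edge_not_vertical[OF L e(2)] by (auto simp: d_def d'_def)
  have dd: "cross d d' \<noteq> 0" unfolding d_def d'_def by (rule crossing_nonparallel[OF L e Y(1-3) ne])
  have Ys: "Y \<in> support L" "Y' \<in> support L" using edge_in_support e Y by blast+
  have Yo: "Y \<in> open_segment P Q" "Y' \<in> open_segment P' Q'"
    using regular_double_point(1)[OF L Ys ne Y(3) e(1) Y(1)]
      regular_double_point(1)[OF L Ys(2,1) ne[symmetric] Y(3)[symmetric] e(2) Y(2)] by auto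
  have uv: "direction (P, Q) = sgn d" "direction (P', Q') = sgn d'" by (simp_all add: direction_def d_def d'_def)
  have R: "fst (xbox L x) > 0" using crossing_boxD(1)[OF L x[unfolded xe]] xe by simp
  have lc: "loc_const (- fst ` support L) c" using c unfolding index_coloring_def by blast
  note const = coloring_constant_on_corner[OF L lc x]
  have mem: "q \<in> corner L x s t \<longleftrightarrow> q \<in> ball (fst Y) (fst (xbox L x)) \<and> s * cross d (q - fst Y) > 0 \<and> t * cross d' (q - fst Y) > 0" for q s t
    unfolding corner_def xe prod.case uv cross_sgn using nv by (auto simp: zero_less_mult_iff zero_less_divide_iff divide_less_0_iff)
  show "c q = c q' + 1" if "s * s = 1" "q \<in> corner L x 1 s" "q' \<in> corner L x (-1) s"
  proof -
    have "s * cross d' d \<noteq> 0" using dd that(1) cross_commute[of d' d] by auto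
    then obtain q1 q2 where q12: "q1 \<in> ball (fst Y) (fst (xbox L x))" "q2 \<in> ball (fst Y) (fst (xbox L x))"
      "cross d (q1 - fst Y) > 0" "cross d (q2 - fst Y) < 0" "s * cross d' (q1 - fst Y) > 0" "s * cross d' (q2 - fst Y) > 0" "c q1 = c q2 + 1"
      using index_jump_nearby[OF c e(1) Yo(1), of s d' "fst (xbox L x)"] R unfolding d_def by metis
    then have "q1 \<in> corner L x 1 s" "q2 \<in> corner L x (-1) s" unfolding mem by auto
    then show ?thesis using const[OF that(2), of q1] const[OF that(3), of q2] q12(7) by simp
  qed
  show "c q = c q' + 1" if "s * s = 1" "q \<in> corner L x s 1" "q' \<in> corner L x s (-1)"
  proof -
    have "s * cross d d' \<noteq> 0" using dd that(1) by auto
    then obtain q1 q2 where q12: "q1 \<in> ball (fst Y) (fst (xbox L x))" "q2 \<in> ball (fst Y) (fst (xbox L x))"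
      "cross d' (q1 - fst Y) > 0" "cross d' (q2 - fst Y) < 0" "s * cross d (q1 - fst Y) > 0" "s * cross d (q2 - fst Y) > 0" "c q1 = c q2 + 1"
      using index_jump_nearby[OF c e(2) Yo(2), of s d "fst (xbox L x)"] R unfolding d'_def Y(3) by metis
    then have "q1 \<in> corner L x s 1" "q2 \<in> corner L x s (-1)" unfolding mem by auto
    then show ?thesis using const[OF that(2), of q1] const[OF that(3), of q2] q12(7) by simp
  qed
qed

text \<open>An index colouring exists: the winding numbers of the projected link, computed as sums of the
  angles under which the edges are seen.\<close>

definition edge_ratio :: "space \<times> space \<Rightarrow> plane \<Rightarrow> complex" where
  "edge_ratio e q = Complex (fst (fst (snd e) - q)) (snd (fst (snd e) - q)) /
     Complex (fst (fst (fst e) - q)) (snd (fst (fst e) - q))"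

lemma edge_ratio_nonpos:
  assumes "edge_ratio (A, B) q \<in> \<real>\<^sub>\<le>\<^sub>0" "q \<noteq> fst A"
  shows "q \<in> fst ` closed_segment A B"
proof -
  let ?a = "Complex (fst (fst A - q)) (snd (fst A - q))" let ?b = "Complex (fst (fst B - q)) (snd (fst B - q))"
  have a: "?a \<noteq> 0" using assms(2) by (auto simp: complex_eq_iff prod_eq_iff)
  obtain l where l: "l \<le> 0" "edge_ratio (A, B) q = of_real l" using assms(1) by (auto elim: nonpos_Reals_cases)
  then have "?b = of_real l * ?a" using a unfolding edge_ratio_def by (simp add: field_simps)
  then have bl: "fst B - q = l *\<^sub>R (fst A - q)" by (simp add: complex_eq_iff prod_eq_iff)
  \<comment> \<open>Solving \<open>fst B - q = l * (fst A - q)\<close> for \<open>q\<close> gives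
    weights \<open>- l / (1 - l)\<close> and \<open>1 / (1 - l)\<close>, a convex combination
    because \<open>l\<close> is nonpositive.\<close>
  define t where "t = 1 / (1 - l)"
  have l1: "1 - l > 0" using l(1) by simp
  have t: "0 \<le> t" "t \<le> 1" "1 - t = - l * t" using l(1) by (auto simp: t_def field_simps)
  have "(1 - l) *\<^sub>R q = (- l) *\<^sub>R fst A + fst B" using bl by (simp add: algebra_simps)
  then have "t *\<^sub>R ((1 - l) *\<^sub>R q) = t *\<^sub>R ((- l) *\<^sub>R fst A + fst B)" by simp
  moreover have "t *\<^sub>R ((1 - l) *\<^sub>R q) = q" using l1 by (simp add: t_def)
  moreover have "t *\<^sub>R ((- l) *\<^sub>R fst A + fst B) = (1 - t) *\<^sub>R fst A + t *\<^sub>R fst B"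
    unfolding t(3) by (simp add: algebra_simps)
  ultimately have "q = (1 - t) *\<^sub>R fst A + t *\<^sub>R fst B" by simp
  then have "q = fst ((1 - t) *\<^sub>R A + t *\<^sub>R B)" by simp
  moreover have "(1 - t) *\<^sub>R A + t *\<^sub>R B \<in> closed_segment A B" using t by (auto simp: in_segment)
  ultimately show ?thesis by blast
qed

lemma isCont_edge_ratio: "q \<noteq> fst (fst e) \<Longrightarrow> isCont (edge_ratio e) q"
proof -
  assume "q \<noteq> fst (fst e)"
  then have "Complex (fst (fst (fst e) - q)) (snd (fst (fst e) - q)) \<noteq> 0"
    by (auto simp: complex_eq_iff prod_eq_iff)
  then show ?thesis unfolding edge_ratio_def Complex_eq by (intro continuous_intros) auto
qed

lemma Im_edge_ratio:
  assumes "q \<noteq> fst A"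
  shows "Im (edge_ratio (A, B) q) > 0 \<longleftrightarrow> cross (fst B - fst A) (q - fst A) > 0"
    "Im (edge_ratio (A, B) q) < 0 \<longleftrightarrow> cross (fst B - fst A) (q - fst A) < 0"
proof -
  let ?a = "Complex (fst (fst A - q)) (snd (fst A - q))"
  have a: "(cmod ?a)\<^sup>2 > 0" using assms by (auto simp: complex_eq_iff prod_eq_iff)
  have "Im (edge_ratio (A, B) q) = cross (fst B - fst A) (q - fst A) / (cmod ?a)\<^sup>2"
    unfolding edge_ratio_def Im_divide by (simp add: cross_def cmod_power2 algebra_simps)
  then show "Im (edge_ratio (A, B) q) > 0 \<longleftrightarrow> cross (fst B - fst A) (q - fst A) > 0"
    "Im (edge_ratio (A, B) q) < 0 \<longleftrightarrow> cross (fst B - fst A) (q - fst A) < 0"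
    using a by (simp_all add: zero_less_divide_iff divide_less_0_iff)
qed

lemma isCont_Arg_edge_ratio:
  assumes "q \<noteq> fst (fst e)" "edge_ratio e q \<notin> \<real>\<^sub>\<le>\<^sub>0"
  shows "isCont (\<lambda>q. Arg (edge_ratio e q)) q"
  by (rule isCont_o2[OF isCont_edge_ratio[OF assms(1)] continuous_at_Arg[OF assms(2)]])

text \<open>The product of the ratios telescopes to 1, because every vertex is the head of exactly
  one edge and the tail of exactly one.\<close>

lemma angle_sum_integer:
  assumes L: "oriented_link L" and q: "q \<notin> fst ` support L"
  shows "\<exists>n::int. (\<Sum>e\<in>L. Arg (edge_ratio e q)) = 2 * pi * of_int n"
proof -
  have fin: "finite L" and inj: "inj_on fst L" "inj_on snd L" and eq: "fst ` L = snd ` L"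
    using L by (auto simp: oriented_link_def)
  define h where "h v = sgn (Complex (fst (fst v - q)) (snd (fst v - q)))" for v :: space
  have off: "q \<noteq> fst v" if "v \<in> fst ` L \<union> snd ` L" for v
    using that q edge_in_support by (metis (no_types, opaque_lifting) UnE ends_in_segment image_iff prod.collapse)
  then have hnz: "h v \<noteq> 0" if "v \<in> fst ` L" for v
    using that by (force simp: h_def sgn_zero_iff complex_eq_iff prod_eq_iff)
  have cis_sum: "cis (\<Sum>e\<in>M. f e) = (\<Prod>e\<in>M. cis (f e))" if "finite M" for M and f :: "space \<times> space \<Rightarrow> real"
    using that by induction (simp_all flip: cis_mult)
  have "cis (\<Sum>e\<in>L. Arg (edge_ratio e q)) = (\<Prod>e\<in>L. h (snd e) / h (fst e))"
    unfolding cis_sum[OF fin]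
  proof (rule prod.cong)
    fix e assume e: "e \<in> L"
    have "Complex (fst (fst v - q)) (snd (fst v - q)) \<noteq> 0" if "v \<in> {fst e, snd e}" for v
    proof -
      have "v \<in> fst ` L \<union> snd ` L" using that e by blast
      then show ?thesis using off[of v] by (auto simp: complex_eq_iff prod_eq_iff)
    qed
    then have "edge_ratio e q \<noteq> 0" unfolding edge_ratio_def by (simp only: divide_eq_0_iff) blast
    then show "cis (Arg (edge_ratio e q)) = h (snd e) / h (fst e)"
      by (simp add: cis_Arg edge_ratio_def h_def sgn_divide)
  qed simp
  also have "\<dots> = (\<Prod>e\<in>L. h (snd e)) / (\<Prod>e\<in>L. h (fst e))" by (rule prod_dividef)
  also have "(\<Prod>e\<in>L. h (snd e)) = (\<Prod>v\<in>snd ` L. h v)" by (simp add: prod.reindex[OF inj(2)])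
  also have "(\<Prod>e\<in>L. h (fst e)) = (\<Prod>v\<in>snd ` L. h v)" by (simp add: prod.reindex[OF inj(1)] flip: eq)
  also have "(\<Prod>v\<in>snd ` L. h v) / (\<Prod>v\<in>snd ` L. h v) = 1"
    using hnz fin by (simp add: eq[symmetric])
  finally have "cis (\<Sum>e\<in>L. Arg (edge_ratio e q)) = cis 0" by simp
  then show ?thesis by (rule cis_eq_cis_int) auto
qed

lemma index_coloring_exists:
  assumes L: "oriented_link L" "regular_position L"
  obtains c where "index_coloring L c"
proof -
  have fin: "finite L" using L(1) by (simp add: oriented_link_def)
  define T where "T q = (\<Sum>e\<in>L. Arg (edge_ratio e q))" for q
  define c where "c q = (SOME n::int. T q = 2 * pi * of_int n)" for q
  have c: "T q = 2 * pi * of_int (c q)" if "q \<notin> fst ` support L" for q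
    unfolding c_def by (rule someI_ex) (use angle_sum_integer[OF L(1) that] in \<open>simp add: T_def\<close>)
  have off: "q \<noteq> fst (fst e) \<and> edge_ratio e q \<notin> \<real>\<^sub>\<le>\<^sub>0" if "q \<notin> fst ` closed_segment (fst e) (snd e)" for e q
    using that edge_ratio_nonpos[of "fst e" "snd e" q] by fastforce
  have off_curve: "q \<notin> fst ` closed_segment (fst e) (snd e)" if "q \<notin> fst ` support L" "e \<in> L" for q e
    using that edge_in_support[of "fst e" "snd e" L] by auto
  have lc: "loc_const (- fst ` support L) c"
  proof (rule continuous_integer_loc_const)
    have "isCont T q" if "q \<notin> fst ` support L" for q
      unfolding T_def using off[OF off_curve[OF that]] by (intro continuous_sum isCont_Arg_edge_ratio) auto
    then show "continuous_on (- fst ` support L) (\<lambda>q. T q / (2 * pi))"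
      by (intro continuous_intros continuous_at_imp_continuous_on) auto
  qed (use c in auto)
  have jump: "edge_jump L c A B (fst P)" if P: "simple_at L A B P" for A B P
  proof -
    have e: "(A, B) \<in> L" "P \<in> open_segment A B" using P unfolding simple_at_def by blast+
    note nv = regular_edge_not_vertical[OF L e(1)]
    define p where "p = fst P"
    define d where "d = fst B - fst A"
    obtain t where t: "0 < t" "t < 1" "P = (1 - t) *\<^sub>R A + t *\<^sub>R B" using e(2) by (auto simp: in_segment)
    have pA: "fst A - p = (- t) *\<^sub>R d" and pB: "fst B - p = (1 - t) *\<^sub>R d"
      unfolding p_def t(3) d_def by (simp_all add: algebra_simps)
    have d: "d \<noteq> 0" using nv by (simp add: d_def)
    have pA': "p \<noteq> fst A" using pA t d by auto
    \<comment> \<open>For the edge through \<open>P\<close> the ratio is a negative real at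
      \<open>p\<close>. Passing to its negative makes the sum continuous there, at the price of
      \<open>pi\<close> on the left and \<open>- pi\<close> on the right.\<close>
    define G where "G q = (\<Sum>e\<in>L - {(A, B)}. Arg (edge_ratio e q)) + Arg (- edge_ratio (A, B) q)" for q
    have "isCont (\<lambda>q. \<Sum>e\<in>L - {(A, B)}. Arg (edge_ratio e q)) p"
    proof (intro continuous_sum isCont_Arg_edge_ratio)
      fix e assume "e \<in> L - {(A, B)}"
      then have "p \<notin> fst ` closed_segment (fst e) (snd e)"
        using simple_atD[OF P, of "fst e" "snd e"] unfolding p_def by (metis Diff_iff insertI1 prod.collapse)
      then show "p \<noteq> fst (fst e)" "edge_ratio e p \<notin> \<real>\<^sub>\<le>\<^sub>0" using off by auto
    qed
    moreover have "isCont (\<lambda>q. Arg (- edge_ratio (A, B) q)) p"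
    proof (rule isCont_o2[of p "\<lambda>q. - edge_ratio (A, B) q" Arg])
      show "isCont (\<lambda>q. - edge_ratio (A, B) q) p" using isCont_edge_ratio[of p "(A, B)"] pA' by (intro continuous_intros) auto
      have "Complex (fst ((1 - t) *\<^sub>R d)) (snd ((1 - t) *\<^sub>R d)) = of_real (1 - t) * Complex (fst d) (snd d)"
        "Complex (fst ((- t) *\<^sub>R d)) (snd ((- t) *\<^sub>R d)) = of_real (- t) * Complex (fst d) (snd d)"
        by (simp_all add: complex_eq_iff)
      moreover have "Complex (fst d) (snd d) \<noteq> 0" using d by (auto simp: complex_eq_iff prod_eq_iff)
      ultimately have "- edge_ratio (A, B) p = of_real ((1 - t) / t)"
        unfolding edge_ratio_def fst_conv snd_conv pA pB using t by (simp add: field_simps)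
      moreover have "(1 - t) / t > 0" using t by simp
      ultimately show "isCont Arg (- edge_ratio (A, B) p)"
        by (intro continuous_at_Arg) (simp only: nonpos_Reals_of_real_iff not_le)
    qed
    ultimately have "isCont G p" unfolding G_def by (rule continuous_add)
    then obtain r1 where r1: "r1 > 0" "\<And>q. dist q p < r1 \<Longrightarrow> dist (G q) (G p) < 1"
      unfolding continuous_at_eps_delta by (metis zero_less_one)
    obtain r2 where r2: "r2 > 0" "\<And>X. fst X \<in> ball (fst P) r2 \<Longrightarrow> X \<in> support L \<Longrightarrow> cross (fst B - fst A) (fst X - fst P) = 0"
      using simple_neighbourhood[OF L P] by metis
    define r where "r = min r1 (min r2 (dist p (fst A)))"
    have r: "r > 0" using r1 r2 pA' by (simp add: r_def)
    have main: "T q = G q + \<epsilon> * pi \<and> T q = 2 * pi * of_int (c q) \<and> \<bar>G q - G p\<bar> < 1"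
      if q: "q \<in> ball p r" and s: "cross d (q - p) > 0 \<and> \<epsilon> = 1 \<or> cross d (q - p) < 0 \<and> \<epsilon> = - 1" for q \<epsilon>
    proof (intro conjI)
      have "q \<notin> fst ` support L"
        using r2(2) q s by (auto simp: r_def p_def d_def)
      then show "T q = 2 * pi * of_int (c q)" by (rule c)
      have "dist q p < r1" "q \<noteq> fst A" using q by (auto simp: r_def dist_commute)
      then show "\<bar>G q - G p\<bar> < 1" using r1(2) by (simp add: dist_real_def)
      have "cross d (q - fst A) = cross d (q - p)"
      proof -
        have "cross d (q - fst A) = cross d (q - p) - cross d (fst A - p)"
          by (simp add: cross_def algebra_simps)
        then show ?thesis unfolding pA by (simp only: cross_scaleR cross_self mult_zero_right diff_0_right add_0_right)
      qed
      then have "Arg (edge_ratio (A, B) q) = Arg (- edge_ratio (A, B) q) + \<epsilon> * pi"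
        using s Im_edge_ratio[OF \<open>q \<noteq> fst A\<close>, of B] Arg_diff_minus[of "edge_ratio (A, B) q"] unfolding d_def by auto
      moreover have "T q = (\<Sum>e\<in>L - {(A, B)}. Arg (edge_ratio e q)) + Arg (edge_ratio (A, B) q)"
        unfolding T_def using sum.remove[OF fin e(1), of "\<lambda>e. Arg (edge_ratio e q)"] by simp
      ultimately show "T q = G q + \<epsilon> * pi" unfolding G_def by simp
    qed
    show ?thesis unfolding edge_jump_def
    proof (intro exI[of _ r] conjI r ballI impI)
      fix q q' assume q: "q \<in> ball (fst P) r" "cross (fst B - fst A) (q - fst P) > 0"
        and q': "q' \<in> ball (fst P) r" "cross (fst B - fst A) (q' - fst P) < 0"
      have 1: "T q = G q + 1 * pi \<and> T q = 2 * pi * of_int (c q) \<and> \<bar>G q - G p\<bar> < 1"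
        by (rule main) (use q in \<open>auto simp: p_def d_def\<close>)
      have 2: "T q' = G q' + (-1) * pi \<and> T q' = 2 * pi * of_int (c q') \<and> \<bar>G q' - G p\<bar> < 1"
        by (rule main) (use q' in \<open>auto simp: p_def d_def\<close>)
      \<comment> \<open>The excess of the jump over 1. \<open>G\<close> oscillates by less than 2
        near \<open>p\<close> and \<open>2 * pi\<close> exceeds 2, so this integer vanishes.\<close>
      define n where "n = c q - c q' - 1"
      have "2 * pi * of_int n = 2 * pi * of_int (c q) - 2 * pi * of_int (c q') - 2 * pi" by (simp add: n_def algebra_simps)
      then have "2 * pi * of_int n = G q - G q'" using 1 2 by simp
      then have "\<bar>2 * pi * of_int n\<bar> < 2" using 1 2 by linarith
      then have "pi * \<bar>of_int n\<bar> < 1" by (simp add: abs_mult)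
      moreover have "1 * \<bar>of_int n\<bar> \<le> pi * \<bar>of_int n :: real\<bar>" using pi_gt3 by (intro mult_right_mono) auto
      ultimately have "\<bar>of_int n :: real\<bar> < 1" by linarith
      then have "n = 0" by linarith
      then show "c q = c q' + 1" by (simp add: n_def)
    qed
  qed
  have "index_coloring L c" unfolding index_coloring_def
  proof (intro conjI lc ballI)
    fix e assume "e \<in> L"
    moreover obtain A B where [simp]: "e = (A, B)" by (cases e)
    ultimately have e: "(A, B) \<in> L" by simp
    have "finite {P \<in> open_segment A B. \<not> edge_jump L c A B (fst P)}"
      by (rule finite_subset[OF _ finite_non_simple[OF L e]]) (use jump in blast)
    then show "case e of (A, B) \<Rightarrow> finite {P \<in> open_segment A B. \<not> edge_jump L c A B (fst P)}" by simp
  qed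
  then show ?thesis by (rule that)
qed

section \<open>The homeomorphism of a triangle move\<close>

text \<open>\<open>h\<close> maps the edge through \<open>P\<close> to an edge through \<open>h P\<close>, up to homotopy compatibly with the angles
  around these edges.\<close>

definition edge_match ::
  "(space \<Rightarrow> space) \<Rightarrow> directed_edges \<Rightarrow> directed_edges \<Rightarrow> space \<Rightarrow> bool" where
  "edge_match h L L' P \<longleftrightarrow> (\<exists>A B r s A' B' r' s' V.
     (A, B) \<in> L \<and> P \<in> open_segment A B \<and> det3 (B - A) r s > 0 \<and>
     (A', B') \<in> L' \<and> h P \<in> open_segment A' B' \<and> det3 (B' - A') r' s' > 0 \<and> open V \<and> P \<in> V \<and>
     (\<forall>X\<in>V. (around (B - A) r s (X - P) = 0 \<longleftrightarrow> around (B' - A') r' s' (h X - h P) = 0) \<and>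
        (around (B - A) r s (X - P) \<noteq> 0 \<longrightarrow>
          around (B' - A') r' s' (h X - h P) / around (B - A) r s (X - P) \<notin> \<real>\<^sub>\<le>\<^sub>0)))"

lemma edge_match_sym:
  assumes m: "edge_match h L L' P" and h: "homeomorphism UNIV UNIV h h'"
  shows "edge_match h' L' L (h P)"
proof -
  have hh: "\<And>X. h' (h X) = X" "\<And>X. h (h' X) = X" using h unfolding homeomorphism_def by blast+
  have c: "continuous_on UNIV h'" using h unfolding homeomorphism_def by blast
  obtain A B r s A' B' r' s' V where e: "(A, B) \<in> L" "P \<in> open_segment A B" "det3 (B - A) r s > 0"
    and e': "(A', B') \<in> L'" "h P \<in> open_segment A' B'" "det3 (B' - A') r' s' > 0" and V: "open V" "P \<in> V"
    and VV: "\<And>X. X \<in> V \<Longrightarrow> (around (B - A) r s (X - P) = 0 \<longleftrightarrow> around (B' - A') r' s' (h X - h P) = 0) \<and>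
        (around (B - A) r s (X - P) \<noteq> 0 \<longrightarrow>
          around (B' - A') r' s' (h X - h P) / around (B - A) r s (X - P) \<notin> \<real>\<^sub>\<le>\<^sub>0)"
    using m unfolding edge_match_def by blast
  have inv: "a / b \<notin> \<real>\<^sub>\<le>\<^sub>0" if "b / a \<notin> \<real>\<^sub>\<le>\<^sub>0" for a b :: complex
    using that nonpos_Reals_inverse_iff[of "b / a"] by simp
  have "(around (B' - A') r' s' (Y - h P) = 0 \<longleftrightarrow> around (B - A) r s (h' Y - h' (h P)) = 0) \<and>
      (around (B' - A') r' s' (Y - h P) \<noteq> 0 \<longrightarrow>
        around (B - A) r s (h' Y - h' (h P)) / around (B' - A') r' s' (Y - h P) \<notin> \<real>\<^sub>\<le>\<^sub>0)"
    if "Y \<in> h' -` V" for Y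
    using VV[of "h' Y"] that inv unfolding hh by blast
  moreover have "open (h' -` V)" by (rule open_vimage[OF V(1) c])
  moreover have "h P \<in> h' -` V" "h' (h P) \<in> open_segment A B" using V e hh by auto
  ultimately show ?thesis unfolding edge_match_def using e(1,3) e' by blast
qed

text \<open>The ratio condition in \<open>edge_match\<close> is what
  \<open>angle_section_change\<close> needs, with \<open>\<alpha> = 1\<close>, after the angle
  section has been carried along \<open>h\<close>.\<close>

lemma linked_at_transfer:
  assumes L: "oriented_link L" and m: "edge_match h L L' P" and h: "homeomorphism UNIV UNIV h h'"
    and l: "linked_at L U k P"
  shows "linked_at L' (\<lambda>i. h ` U i) (\<lambda>i j X. k i j (h' X)) (h P)"
proof -
  have hh: "\<And>X. h' (h X) = X" "\<And>X. h (h' X) = X" using h unfolding homeomorphism_def by blast+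
  have img: "Y \<in> h ` S \<longleftrightarrow> h' Y \<in> S" for Y S using hh by (metis imageE imageI)
  have c: "continuous_on S h'" for S
    using h unfolding homeomorphism_def by (meson continuous_on_subset subset_UNIV)
  obtain A B r s A' B' r' s' V where e: "(A, B) \<in> L" "P \<in> open_segment A B" "det3 (B - A) r s > 0"
    and e': "(A', B') \<in> L'" "h P \<in> open_segment A' B'" "det3 (B' - A') r' s' > 0" and V: "open V" "P \<in> V"
    and VV: "\<And>X. X \<in> V \<Longrightarrow> (around (B - A) r s (X - P) = 0 \<longleftrightarrow> around (B' - A') r' s' (h X - h P) = 0) \<and>
        (around (B - A) r s (X - P) \<noteq> 0 \<longrightarrow>
          around (B' - A') r' s' (h X - h P) / around (B - A) r s (X - P) \<notin> \<real>\<^sub>\<le>\<^sub>0)"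
    using m unfolding edge_match_def by blast
  obtain A1 B1 r1 s1 W \<theta>1 where l1: "(A1, B1) \<in> L" "P \<in> open_segment A1 B1" "det3 (B1 - A1) r1 s1 > 0" "P \<in> W"
      "angle_section U k W (\<lambda>X. around (B1 - A1) r1 s1 (X - P)) \<theta>1"
    using l unfolding linked_at_def by blast
  have "(A1, B1) = (A, B)"
  proof (rule ccontr)
    assume "(A1, B1) \<noteq> (A, B)"
    from edges_meet_in_vertices[OF L l1(1) e(1) this] have "P \<in> {A, B}"
      using l1(2) e(2) unfolding open_segment_def by blast
    then show False using e(2) unfolding open_segment_def by blast
  qed
  then obtain \<theta> where \<theta>: "angle_section U k W (\<lambda>X. around (B - A) r s (X - P)) \<theta>"
    using angle_section_basis[OF l1(5) l1(3), of r s] e(3) by auto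
  have oW: "open W" using \<theta> unfolding angle_section_def by blast
  have nz: "around (B - A) r s (X - P) \<noteq> 0" if "X \<in> W" "X \<in> U i" for X i
    using \<theta> that unfolding angle_section_def by blast
  define W' where "W' = h' -` (W \<inter> V)"
  have "angle_section (\<lambda>i. h ` U i) (\<lambda>i j X. k i j (h' X)) W' (\<lambda>X. around (B' - A') r' s' (X - h P))
      (\<lambda>i X. \<theta> i (h' X) + Arg 1 + Arg (around (B' - A') r' s' (X - h P) / (1 * around (B - A) r s (h' X - P))))"
  proof (rule angle_section_change[OF angle_section_pullback[OF \<theta> h]])
    show "open W'" unfolding W'_def by (rule open_vimage[OF open_Int[OF oW V(1)] c])
    show "W' \<subseteq> h ` W" unfolding W'_def using img by blast
    show "around (B' - A') r' s' (Y - h P) / (1 * around (B - A) r s (h' Y - P)) \<notin> \<real>\<^sub>\<le>\<^sub>0"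
      if Y: "Y \<in> W'" "Y \<in> h ` U i" for Y i
    proof -
      have "h' Y \<in> W" "h' Y \<in> V" "h' Y \<in> U i" using Y unfolding W'_def img by auto
      then show ?thesis using VV[of "h' Y"] nz unfolding hh by simp
    qed
  qed (auto intro!: continuous_intros c)
  moreover have "h P \<in> W'" using l1(4) V(2) by (simp add: W'_def hh)
  ultimately show ?thesis unfolding linked_at_def using e' by blast
qed

text \<open>Preservation of \<open>linking\<close> is required in the direction of \<open>f\<close>
  only, which makes composition immediate. Inverse moves are covered because each move is shown to
  give an equivalence in both directions.\<close>

definition link_equiv :: "directed_edges \<Rightarrow> directed_edges \<Rightarrow> (space \<Rightarrow> space) \<Rightarrow> (space \<Rightarrow> space) \<Rightarrow> bool" where
  "link_equiv L L' f g \<longleftrightarrow> link_homeo L L' f g \<and>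
     (\<forall>U :: chart \<Rightarrow> space set. \<forall>k. linking L U k \<longrightarrow> linking L' (\<lambda>i. f ` U i) (\<lambda>i j X. k i j (g X)))"

lemma link_equivI:
  assumes L: "oriented_link L" and f: "link_homeo L L' f g"
    and m: "finite {P \<in> support L. \<not> edge_match f L L' P}"
  shows "link_equiv L L' f g"
  unfolding link_equiv_def
proof (intro conjI f allI impI)
  fix U :: "chart \<Rightarrow> space set" and k assume l: "linking L U k"
  have h: "homeomorphism UNIV UNIV f g" and s: "f ` support L = support L'"
    using f unfolding link_homeo_def by blast+
  have "{Q \<in> support L'. \<not> linked_at L' (\<lambda>i. f ` U i) (\<lambda>i j X. k i j (g X)) Q} \<subseteq>
      f ` ({P \<in> support L. \<not> edge_match f L L' P} \<union> {P \<in> support L. \<not> linked_at L U k P})"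
  proof
    fix Q assume Q: "Q \<in> {Q \<in> support L'. \<not> linked_at L' (\<lambda>i. f ` U i) (\<lambda>i j X. k i j (g X)) Q}"
    then obtain P where "P \<in> support L" "Q = f P" using s by blast
    then show "Q \<in> f ` ({P \<in> support L. \<not> edge_match f L L' P} \<union> {P \<in> support L. \<not> linked_at L U k P})"
      using Q linked_at_transfer[OF L _ h] by blast
  qed
  moreover have "finite (f ` ({P \<in> support L. \<not> edge_match f L L' P} \<union> {P \<in> support L. \<not> linked_at L U k P}))"
    using m l unfolding linking_def by blast
  ultimately show "linking L' (\<lambda>i. f ` U i) (\<lambda>i j X. k i j (g X))"
    unfolding linking_def by (rule finite_subset)
qed

lemma link_equiv_both:
  assumes L: "oriented_link L" "oriented_link L'" and f: "link_homeo L L' f g"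
    and m: "finite {P \<in> support L. \<not> edge_match f L L' P}"
  shows "link_equiv L L' f g" "link_equiv L' L g f"
proof -
  show "link_equiv L L' f g" by (rule link_equivI[OF L(1) f m])
  have h: "homeomorphism UNIV UNIV f g" and s: "f ` support L = support L'"
    using f unfolding link_homeo_def by blast+
  have "{Q \<in> support L'. \<not> edge_match g L' L Q} \<subseteq> f ` {P \<in> support L. \<not> edge_match f L L' P}"
  proof
    fix Q assume Q: "Q \<in> {Q \<in> support L'. \<not> edge_match g L' L Q}"
    then obtain P where "P \<in> support L" "Q = f P" using s by blast
    then show "Q \<in> f ` {P \<in> support L. \<not> edge_match f L L' P}"
      using Q edge_match_sym[OF _ h] by blast
  qed
  then have "finite {Q \<in> support L'. \<not> edge_match g L' L Q}" by (rule finite_subset) (use m in blast)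
  then show "link_equiv L' L g f" by (rule link_equivI[OF L(2) link_homeo_sym[OF f]])
qed

lemma link_equiv_trans:
  assumes 1: "link_equiv L L' f g" and 2: "link_equiv L' L'' f' g'"
  shows "link_equiv L L'' (f' \<circ> f) (g \<circ> g')"
proof -
  have h: "homeomorphism UNIV UNIV f g" "homeomorphism UNIV UNIV f' g'"
    and s: "f ` support L = support L'" "f' ` support L' = support L''"
    using 1 2 unfolding link_equiv_def link_homeo_def by blast+
  obtain Z where Z: "\<And>X. Z < \<bar>snd X\<bar> \<Longrightarrow> f X = X"
    using 1 unfolding link_equiv_def link_homeo_def by blast
  obtain Z' where Z': "\<And>X. Z' < \<bar>snd X\<bar> \<Longrightarrow> f' X = X"
    using 2 unfolding link_equiv_def link_homeo_def by blast
  have "link_homeo L L'' (f' \<circ> f) (g \<circ> g')"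
    unfolding link_homeo_def
  proof (intro conjI exI allI impI)
    show "homeomorphism UNIV UNIV (f' \<circ> f) (g \<circ> g')" by (rule homeomorphism_compose[OF h])
    show "(f' \<circ> f) ` support L = support L''" by (simp only: image_comp[symmetric] s)
    show "(f' \<circ> f) X = X" if "max Z Z' < \<bar>snd X\<bar>" for X using Z[of X] Z'[of X] that by simp
  qed
  moreover have "linking L'' (\<lambda>i. (f' \<circ> f) ` U i) (\<lambda>i j X. k i j ((g \<circ> g') X))" if "linking L U k"
    for U :: "chart \<Rightarrow> space set" and k
  proof -
    have "linking L' (\<lambda>i. f ` U i) (\<lambda>i j X. k i j (g X))" using 1 that unfolding link_equiv_def by blast
    then have "linking L'' (\<lambda>i. f' ` (f ` U i)) (\<lambda>i j X. k i j (g (g' X)))"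
      using 2 unfolding link_equiv_def by blast
    then show ?thesis by (simp add: image_comp)
  qed
  ultimately show ?thesis unfolding link_equiv_def by blast
qed

lemma basis_exists: "d \<noteq> 0 \<Longrightarrow> \<exists>r s. det3 d r s > 0"
proof (cases "fst d = 0")
  case True
  assume "d \<noteq> 0"
  then have "snd d \<noteq> 0" using True by (simp add: prod_eq_iff)
  then have "det3 d ((1, 0), 0) ((0, snd d), 0) > 0"
    using True by (simp add: det3_def) (metis not_real_square_gt_zero)
  then show ?thesis by blast
qed (use across_pos in blast)

lemma around_scale:
  "around (c *\<^sub>R d) r s X = of_real c * around d r s X" "det3 (c *\<^sub>R d) r s = c * det3 d r s"
  unfolding around_def det3_def by (auto simp: complex_eq_iff algebra_simps)

text \<open>Treats edges away from the move and the two parts of a subdivided edge: \<open>h\<close>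
  is locally the identity, so the ratio of the angle coordinates is the positive constant
  \<open>c\<close>.\<close>

lemma edge_match_parallel:
  assumes e: "(A, B) \<in> L" "P \<in> open_segment A B" "(A', B') \<in> L'" "h P \<in> open_segment A' B'"
    and V: "open V" "P \<in> V" "\<And>X. X \<in> V \<Longrightarrow> h X = X" and c: "B' - A' = c *\<^sub>R (B - A)" "c > 0"
  shows "edge_match h L L' P"
proof -
  have "B - A \<noteq> 0" using e(2) by auto
  then obtain r s where rs: "det3 (B - A) r s > 0" using basis_exists by blast
  have "h P = P" using V by blast
  have "(around (B - A) r s (X - P) = 0 \<longleftrightarrow> around (B' - A') r s (h X - h P) = 0) \<and>
      (around (B - A) r s (X - P) \<noteq> 0 \<longrightarrow>
        around (B' - A') r s (h X - h P) / around (B - A) r s (X - P) \<notin> \<real>\<^sub>\<le>\<^sub>0)" if "X \<in> V" for X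
    unfolding V(3)[OF that] \<open>h P = P\<close> c(1) around_scale using c(2) by simp
  moreover have "det3 (B' - A') r s > 0" unfolding c(1) around_scale using rs c(2) by simp
  ultimately show ?thesis unfolding edge_match_def using e rs V(1,2) by blast
qed

section \<open>A piecewise linear map of the line and the push along one direction\<close>

definition bend :: "real \<Rightarrow> real \<Rightarrow> real \<Rightarrow> real" where
  "bend \<kappa> r v = max v (min (r + \<kappa> * v) (r + v / \<kappa>))"

text \<open>The inverse of \<open>bend\<close>: inverting a maximum of increasing bijections gives
  the minimum of the inverses, and dually.\<close>

definition unbend :: "real \<Rightarrow> real \<Rightarrow> real \<Rightarrow> real" where
  "unbend \<kappa> r y = min y (max ((y - r) / \<kappa>) (\<kappa> * (y - r)))"

lemma scaled_compare:
  fixes \<kappa> v :: real assumes "\<kappa> > 1"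
  shows "v \<ge> 0 \<Longrightarrow> v / \<kappa> \<le> v \<and> v \<le> \<kappa> * v \<and> 0 \<le> v / \<kappa>" "v \<le> 0 \<Longrightarrow> \<kappa> * v \<le> v \<and> v \<le> v / \<kappa> \<and> v / \<kappa> \<le> 0"
proof -
  have "1 * w \<le> \<kappa> * w" if "w \<ge> 0" for w using assms that by (intro mult_right_mono) auto
  note m = this
  show "v / \<kappa> \<le> v \<and> v \<le> \<kappa> * v \<and> 0 \<le> v / \<kappa>" if "v \<ge> 0"
    using m[OF that] assms that by (auto simp: divide_le_eq mult.commute)
  show "\<kappa> * v \<le> v \<and> v \<le> v / \<kappa> \<and> v / \<kappa> \<le> 0" if "v \<le> 0"
    using m[of "- v"] assms that by (auto simp: le_divide_eq mult.commute divide_le_0_iff)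
qed

lemma bend_eq:
  assumes "\<kappa> > 1"
  shows "v \<ge> 0 \<Longrightarrow> bend \<kappa> r v = max v (r + v / \<kappa>)" "v \<le> 0 \<Longrightarrow> bend \<kappa> r v = max v (r + \<kappa> * v)"
    and "y \<ge> r \<Longrightarrow> unbend \<kappa> r y = min y (\<kappa> * (y - r))" "y \<le> r \<Longrightarrow> unbend \<kappa> r y = min y ((y - r) / \<kappa>)"
  using scaled_compare[OF assms, of v] scaled_compare[OF assms, of "y - r"]
  unfolding bend_def unbend_def by auto

lemma unbend_bend:
  assumes \<kappa>: "\<kappa> > 1" and r: "r \<ge> 0" shows "unbend \<kappa> r (bend \<kappa> r v) = v"
proof (cases "v \<ge> 0")
  case True
  note b = bend_eq(1)[OF \<kappa> True, of r] and sc = scaled_compare(1)[OF \<kappa> True]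
  show ?thesis
  proof (cases "v \<le> r + v / \<kappa>")
    case le: True
    then have "bend \<kappa> r v = r + v / \<kappa>" "r \<le> bend \<kappa> r v" using b sc by auto
    then show ?thesis using bend_eq(3)[OF \<kappa>, of r "bend \<kappa> r v"] le \<kappa> by simp
  next
    case False
    then have "bend \<kappa> r v = v" "r \<le> v" using b sc by auto
    moreover have "v \<le> \<kappa> * (v - r)" using False \<kappa> by (simp add: field_simps)
    ultimately show ?thesis using bend_eq(3)[OF \<kappa>, of r v] by simp
  qed
next
  case False
  then have v: "v \<le> 0" by simp
  note b = bend_eq(2)[OF \<kappa> v, of r] and sc = scaled_compare(2)[OF \<kappa> v]
  show ?thesis
  proof (cases "v \<le> r + \<kappa> * v")
    case le: True
    then have "bend \<kappa> r v = r + \<kappa> * v" "bend \<kappa> r v \<le> r" using b sc v by auto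
    then show ?thesis using bend_eq(4)[OF \<kappa>, of "bend \<kappa> r v" r] le \<kappa> by simp
  next
    case False
    then have "bend \<kappa> r v = v" "v \<le> r" using b v r by auto
    moreover have "v \<le> (v - r) / \<kappa>" using False \<kappa> by (simp add: field_simps)
    ultimately show ?thesis using bend_eq(4)[OF \<kappa>, of v r] by simp
  qed
qed

lemma bend_unbend:
  assumes \<kappa>: "\<kappa> > 1" and r: "r \<ge> 0" shows "bend \<kappa> r (unbend \<kappa> r y) = y"
proof (cases "y \<ge> r")
  case True
  note b = bend_eq(3)[OF \<kappa> True]
  have "0 \<le> \<kappa> * (y - r)" using \<kappa> True by simp
  then have u: "unbend \<kappa> r y \<ge> 0" using b True r by simp
  show ?thesis
  proof (cases "y \<le> \<kappa> * (y - r)")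
    case le: True
    then have "unbend \<kappa> r y = y" using b by simp
    moreover have "r + y / \<kappa> \<le> y" using le \<kappa> by (simp add: field_simps)
    ultimately show ?thesis using bend_eq(1)[OF \<kappa> u, of r] by simp
  next
    case False
    then have "unbend \<kappa> r y = \<kappa> * (y - r)" using b by simp
    then show ?thesis using bend_eq(1)[OF \<kappa> u, of r] False \<kappa> by simp
  qed
next
  case False
  then have y: "y \<le> r" by simp
  note b = bend_eq(4)[OF \<kappa> y]
  have "(y - r) / \<kappa> \<le> 0" using \<kappa> y by (simp add: divide_le_0_iff)
  then have u: "unbend \<kappa> r y \<le> 0" using b by simp
  show ?thesis
  proof (cases "y \<le> (y - r) / \<kappa>")
    case le: True
    then have "unbend \<kappa> r y = y" using b by simp
    moreover have "r + \<kappa> * y \<le> y" using le \<kappa> by (simp add: field_simps)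
    ultimately show ?thesis using bend_eq(2)[OF \<kappa> u, of r] by simp
  next
    case False
    then have "unbend \<kappa> r y = (y - r) / \<kappa>" using b by simp
    then show ?thesis using bend_eq(2)[OF \<kappa> u, of r] False \<kappa> by simp
  qed
qed

lemma bend_sign:
  assumes \<kappa>: "\<kappa> > 1" and r: "r \<ge> 0"
  shows "bend \<kappa> r 0 = r" "v \<noteq> 0 \<Longrightarrow> (bend \<kappa> r v - r) * v > 0"
proof -
  show "bend \<kappa> r 0 = r" using r by (simp add: bend_def)
  assume v: "v \<noteq> 0"
  show "(bend \<kappa> r v - r) * v > 0"
  proof (cases "v > 0")
    case True
    then have "v / \<kappa> > 0" using \<kappa> by simp
    then have "bend \<kappa> r v > r" using bend_eq(1)[OF \<kappa>, of v r] True by simp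
    then show ?thesis using True by simp
  next
    case False
    then have "v < 0" "\<kappa> * v < 0" using v \<kappa> by (auto simp: mult_less_0_iff)
    then have "bend \<kappa> r v < r" using bend_eq(2)[OF \<kappa>, of v r] r by simp
    then show ?thesis using \<open>v < 0\<close> by (simp add: mult_neg_neg)
  qed
qed

text \<open>For \<open>\<kappa> = 1 + 1 / \<delta>\<close> the two lines through
  \<open>(0, r)\<close> meet the diagonal at \<open>- \<delta> * r\<close> and
  \<open>(1 + \<delta>) * r\<close>. Between these fixed points the part below 0 is stretched and
  the part above 0 compressed, so that 0 goes to \<open>r\<close>.\<close>

lemma bend_trivial:
  assumes \<delta>: "\<delta> > 0" and r: "r \<ge> 0" and v: "v < - (\<delta> * r) \<or> v > (1 + \<delta>) * r \<or> r = 0"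
  shows "bend (1 + 1 / \<delta>) r v = v"
proof -
  have \<kappa>: "1 + 1 / \<delta> > 1" using \<delta> by simp
  have "v / (1 + 1 / \<delta>) = v - v / (1 + \<delta>)" using \<delta> by (simp add: field_simps)
  then have 1: "r + v / (1 + 1 / \<delta>) \<le> v \<longleftrightarrow> (1 + \<delta>) * r \<le> v" using \<delta> by (simp add: pos_le_divide_eq mult.commute)
  have "(1 + 1 / \<delta>) * v = v + v / \<delta>" using \<delta> by (simp add: field_simps)
  then have 2: "r + (1 + 1 / \<delta>) * v \<le> v \<longleftrightarrow> v \<le> - (\<delta> * r)" using \<delta> by (simp add: field_simps) linarith
  show ?thesis
  proof (cases "v \<ge> 0")
    case True
    have "\<delta> * r \<ge> 0" using \<delta> r by simp
    then have "(1 + \<delta>) * r \<le> v" using v True by auto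
    then show ?thesis using bend_eq(1)[OF \<kappa> True, of r] 1 by simp
  next
    case False
    have "(1 + \<delta>) * r \<ge> 0" using \<delta> r by simp
    then have "v \<le> - (\<delta> * r)" using v False by auto
    then show ?thesis using bend_eq(2)[OF \<kappa>, of v r] 2 False by simp
  qed
qed

text \<open>Coordinates: the triangle has the vertices \<open>M - a\<close>, \<open>M + a\<close>, \<open>M + e\<close>, and \<open>n\<close> is transverse to
  it.\<close>

definition cu where "cu M a n e X = det3 (X - M) n e / det3 a n e"
definition cw where "cw M a n e X = det3 a (X - M) e / det3 a n e"
definition cv where "cv M a n e X = det3 a n (X - M) / det3 a n e"

lemma coords:
  assumes "det3 a n e \<noteq> 0"
  shows "cu M a n e (M + x *\<^sub>R a + y *\<^sub>R n + z *\<^sub>R e) = x" "cw M a n e (M + x *\<^sub>R a + y *\<^sub>R n + z *\<^sub>R e) = y"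
    "cv M a n e (M + x *\<^sub>R a + y *\<^sub>R n + z *\<^sub>R e) = z"
    "X = M + cu M a n e X *\<^sub>R a + cw M a n e X *\<^sub>R n + cv M a n e X *\<^sub>R e"
proof -
  have "det3 (x *\<^sub>R a + y *\<^sub>R n + z *\<^sub>R e) n e = x * det3 a n e" "det3 a (x *\<^sub>R a + y *\<^sub>R n + z *\<^sub>R e) e = y * det3 a n e"
    "det3 a n (x *\<^sub>R a + y *\<^sub>R n + z *\<^sub>R e) = z * det3 a n e"
    unfolding det3_def by (simp_all add: algebra_simps)
  moreover have "M + x *\<^sub>R a + y *\<^sub>R n + z *\<^sub>R e - M = x *\<^sub>R a + y *\<^sub>R n + z *\<^sub>R e" by simp
  ultimately show "cu M a n e (M + x *\<^sub>R a + y *\<^sub>R n + z *\<^sub>R e) = x" "cw M a n e (M + x *\<^sub>R a + y *\<^sub>R n + z *\<^sub>R e) = y"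
    "cv M a n e (M + x *\<^sub>R a + y *\<^sub>R n + z *\<^sub>R e) = z"
    unfolding cu_def cw_def cv_def using assms by simp_all
  define Y where "Y = X - M"
  have "det3 Y n e *\<^sub>R a + det3 a Y e *\<^sub>R n + det3 a n Y *\<^sub>R e = det3 a n e *\<^sub>R Y"
    unfolding det3_def prod_eq_iff by (simp; algebra)
  then have "(1 / det3 a n e) *\<^sub>R (det3 Y n e *\<^sub>R a + det3 a Y e *\<^sub>R n + det3 a n Y *\<^sub>R e) = Y" using assms by simp
  then have "cu M a n e X *\<^sub>R a + cw M a n e X *\<^sub>R n + cv M a n e X *\<^sub>R e = Y"
    unfolding cu_def cw_def cv_def Y_def[symmetric] by (simp add: scaleR_add_right divide_inverse mult.commute)
  then show "X = M + cu M a n e X *\<^sub>R a + cw M a n e X *\<^sub>R n + cv M a n e X *\<^sub>R e"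
    unfolding Y_def by (simp add: algebra_simps)
qed

lemma coords_shift:
  assumes "det3 a n e \<noteq> 0"
  shows "cu M a n e (X + c *\<^sub>R e) = cu M a n e X" "cw M a n e (X + c *\<^sub>R e) = cw M a n e X"
    "cv M a n e (X + c *\<^sub>R e) = cv M a n e X + c"
proof -
  have "det3 (X + c *\<^sub>R e - M) n e = det3 (X - M) n e" "det3 a (X + c *\<^sub>R e - M) e = det3 a (X - M) e"
    "det3 a n (X + c *\<^sub>R e - M) = det3 a n (X - M) + c * det3 a n e"
    unfolding det3_def by (simp_all add: algebra_simps)
  then show "cu M a n e (X + c *\<^sub>R e) = cu M a n e X" "cw M a n e (X + c *\<^sub>R e) = cw M a n e X"
    "cv M a n e (X + c *\<^sub>R e) = cv M a n e X + c"
    unfolding cu_def cw_def cv_def using assms by (simp_all add: add_divide_distrib)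
qed

lemma continuous_on_coords [continuous_intros]:
  "continuous_on S (cu M a n e)" "continuous_on S (cw M a n e)" "continuous_on S (cv M a n e)"
  unfolding cu_def cw_def cv_def divide_inverse by (intro continuous_intros)+

text \<open>In the plane of the triangle this is \<open>1 - \<bar>u\<bar>\<close>, the extent of the
  triangle in direction \<open>e\<close> over the point \<open>u\<close> of its base. Transversally
  it decreases with slope \<open>1 / \<delta>\<close>.\<close>

definition width where "width M a n e \<delta> X = 1 - \<bar>cu M a n e X\<bar> - \<bar>cw M a n e X\<bar> / \<delta>"

text \<open>A double pyramid around the triangle, outside of which the homeomorphism is the identity.\<close>

definition bipyramid where
  "bipyramid M a n e \<delta> = {X. width M a n e \<delta> X \<ge> 0 \<and> - (\<delta> * width M a n e \<delta> X) \<le> cv M a n e X \<and>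
     cv M a n e X \<le> (1 + \<delta>) * width M a n e \<delta> X}"

text \<open>Points move along \<open>e\<close> only, and the width is constant in that direction, so
  on each line parallel to \<open>e\<close> this is one instance of \<open>bend\<close>. The base
  goes to the other two sides of the triangle; a nonpositive width gives the identity.\<close>

definition push where
  "push M a n e \<delta> X = X + (bend (1 + 1 / \<delta>) (max 0 (width M a n e \<delta> X)) (cv M a n e X) - cv M a n e X) *\<^sub>R e"

definition pull where
  "pull M a n e \<delta> X = X + (unbend (1 + 1 / \<delta>) (max 0 (width M a n e \<delta> X)) (cv M a n e X) - cv M a n e X) *\<^sub>R e"

lemma continuous_on_width [continuous_intros]: "continuous_on S (width M a n e \<delta>)"
  unfolding width_def[abs_def] divide_inverse by (intro continuous_intros)

lemma closed_bipyramid: "closed (bipyramid M a n e \<delta>)"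
  unfolding bipyramid_def by (intro closed_Collect_conj closed_Collect_le continuous_intros)

lemma push_homeomorphism:
  assumes J: "det3 a n e \<noteq> 0" and \<delta>: "\<delta> > 0"
  shows "homeomorphism UNIV UNIV (push M a n e \<delta>) (pull M a n e \<delta>)"
proof -
  have \<kappa>: "1 + 1 / \<delta> > 1" using \<delta> by simp
  have w: "width M a n e \<delta> (X + c *\<^sub>R e) = width M a n e \<delta> X" for X c
    unfolding width_def coords_shift[OF J] ..
  have "pull M a n e \<delta> (push M a n e \<delta> X) = X" for X
    unfolding pull_def push_def w coords_shift[OF J]
    using unbend_bend[OF \<kappa>, of "max 0 (width M a n e \<delta> X)"] by (simp flip: scaleR_add_left)
  moreover have "push M a n e \<delta> (pull M a n e \<delta> X) = X" for X
    unfolding pull_def push_def w coords_shift[OF J]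
    using bend_unbend[OF \<kappa>, of "max 0 (width M a n e \<delta> X)"] by (simp flip: scaleR_add_left)
  moreover have "continuous_on UNIV (push M a n e \<delta>)" "continuous_on UNIV (pull M a n e \<delta>)"
    unfolding push_def[abs_def] pull_def[abs_def] bend_def unbend_def divide_inverse by (intro continuous_intros)+
  ultimately show ?thesis unfolding homeomorphism_def by (metis UNIV_I surjI)
qed

lemma push_trivial:
  assumes \<delta>: "\<delta> > 0" and X: "X \<notin> bipyramid M a n e \<delta>"
  shows "push M a n e \<delta> X = X"
proof -
  let ?w = "width M a n e \<delta> X" let ?v = "cv M a n e X"
  have "?v < - (\<delta> * max 0 ?w) \<or> ?v > (1 + \<delta>) * max 0 ?w \<or> max 0 ?w = 0"
    using X unfolding bipyramid_def by (cases "?w \<ge> 0") auto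
  then have "bend (1 + 1 / \<delta>) (max 0 ?w) ?v = ?v" by (intro bend_trivial \<delta>) auto
  then show ?thesis by (simp add: push_def)
qed

lemma bipyramid_bounded:
  assumes J: "det3 a n e \<noteq> 0" and \<delta>: "\<delta> > 0" and X: "X \<in> bipyramid M a n e \<delta>"
  shows "\<bar>snd X\<bar> \<le> norm M + norm a + \<delta> * norm n + (1 + \<delta>) * norm e"
proof -
  let ?u = "cu M a n e X" let ?w = "cw M a n e X" let ?v = "cv M a n e X" let ?r = "width M a n e \<delta> X"
  have h: "?r \<ge> 0" "- (\<delta> * ?r) \<le> ?v" "?v \<le> (1 + \<delta>) * ?r" using X by (auto simp: bipyramid_def)
  have "0 \<le> \<bar>?w\<bar> / \<delta>" using \<delta> by simp
  then have 1: "\<bar>?u\<bar> \<le> 1" "\<bar>?w\<bar> / \<delta> \<le> 1" "?r \<le> 1" using h(1) unfolding width_def by linarith+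
  have w: "\<bar>?w\<bar> \<le> \<delta>" using 1(2) \<delta> by (simp add: divide_le_eq)
  have "(1 + \<delta>) * ?r \<le> (1 + \<delta>) * 1" "\<delta> * ?r \<le> \<delta> * 1" using 1(3) \<delta> by (auto intro: mult_left_mono)
  then have v: "\<bar>?v\<bar> \<le> 1 + \<delta>" using h by auto
  have "norm X \<le> norm M + norm (?u *\<^sub>R a) + norm (?w *\<^sub>R n) + norm (?v *\<^sub>R e)"
    by (subst coords(4)[OF J, of X M]) (intro norm_triangle_le add_right_mono order_refl)
  also have "\<dots> \<le> norm M + 1 * norm a + \<delta> * norm n + (1 + \<delta>) * norm e"
    unfolding norm_scaleR using 1(1) w v by (intro add_mono mult_right_mono) auto
  finally show ?thesis using norm_snd_le[of "snd X" "fst X"] by simp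
qed

section \<open>Keeping the other edges out of the bipyramid\<close>

lemma in_triangle:
  assumes "0 \<le> v" "v \<le> 1 - \<bar>u\<bar>"
  shows "M + u *\<^sub>R a + v *\<^sub>R e \<in> convex hull {M - a, M + a, M + (e::space)}"
  unfolding convex_hull_3
proof (intro CollectI exI conjI)
  show "M + u *\<^sub>R a + v *\<^sub>R e = ((1 - v - u) / 2) *\<^sub>R (M - a) + ((1 - v + u) / 2) *\<^sub>R (M + a) + v *\<^sub>R (M + e)"
    by (simp add: prod_eq_iff field_simps)
qed (use assms in \<open>auto simp: field_simps\<close>)

text \<open>Compactness fails here, since the edge touches the triangle. Near the vertex the
  bipyramids are cones shrinking to the cone of the triangle, and a direction inside the latter
  would bring an initial piece of the edge into the triangle.\<close>

lemma edge_from_vertex_avoids_bipyramid: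
  assumes J: "det3 a n e \<noteq> 0" and Z: "Z \<noteq> M - a"
    and tri: "closed_segment (M - a) Z \<inter> convex hull {M - a, M + a, M + e} \<subseteq> {M - a, M + a}"
  shows "\<exists>c>0. \<forall>\<delta>. 0 < \<delta> \<longrightarrow> \<delta> < c \<longrightarrow> closed_segment (M - a) Z \<inter> bipyramid M a n e \<delta> \<subseteq> {M - a}"
proof -
  let ?A = "M - a"
  define x y z where "x = cu M a n e Z + 1" and "y = cw M a n e Z" and "z = cv M a n e Z"
  have Zc: "Z = ?A + x *\<^sub>R a + y *\<^sub>R n + z *\<^sub>R e"
    by (subst coords(4)[OF J, of Z M]) (simp add: x_def y_def z_def algebra_simps)
  have pt: "(1 - t) *\<^sub>R ?A + t *\<^sub>R Z = M + (t * x - 1) *\<^sub>R a + (t * y) *\<^sub>R n + (t * z) *\<^sub>R e" for t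
    unfolding Zc by (simp add: algebra_simps)
  \<comment> \<open>The direction leaves the plane of the triangle, lies on the other side of the
    base, or passes beyond the side towards \<open>M + e\<close>. The last value serves directions
    into the triangle, which are contradictory for every \<open>\<delta>\<close>. Adding 1 to
    \<open>\<bar>x\<bar>\<close> keeps the denominators positive.\<close>
  define c where "c = (if y \<noteq> 0 then \<bar>y\<bar> / (\<bar>x\<bar> + 1) else if z < 0 then - z / (\<bar>x\<bar> + 1) else if z > x then (z - x) / (\<bar>x\<bar> + 1) else 1)"
  have xp: "\<bar>x\<bar> + 1 > 0" by linarith
  have c: "c > 0" using xp by (auto simp: c_def zero_less_divide_iff divide_less_0_iff)
  have False if \<delta>: "0 < \<delta>" "\<delta> < c" and t: "0 \<le> t" "t \<le> 1" "t \<noteq> 0" and h: "(1 - t) *\<^sub>R ?A + t *\<^sub>R Z \<in> bipyramid M a n e \<delta>" for \<delta> t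
  proof -
    define r where "r = 1 - \<bar>t * x - 1\<bar> - \<bar>t * y\<bar> / \<delta>"
    have h': "r \<ge> 0" "- (\<delta> * r) \<le> t * z" "t * z \<le> (1 + \<delta>) * r"
      using h unfolding bipyramid_def width_def pt coords[OF J] mem_Collect_eq r_def by auto
    have t0: "t > 0" using t by simp
    \<comment> \<open>The width at parameter \<open>t\<close> is at most \<open>t * m\<close>, so
      the inequalities of the bipyramid can be divided by \<open>t\<close> and constrain the
      direction alone.\<close>
    define m where "m = x - \<bar>y\<bar> / \<delta>"
    have "\<bar>t * y\<bar> / \<delta> = t * (\<bar>y\<bar> / \<delta>)" using t0 by (simp add: abs_mult)
    then have "r \<le> t * x - t * (\<bar>y\<bar> / \<delta>)" unfolding r_def by linarith
    then have rm: "r \<le> t * m" unfolding m_def by (simp only: right_diff_distrib)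
    then have m0: "m \<ge> 0" using h'(1) t0 by (meson dual_order.trans zero_le_mult_iff not_le linorder_not_less order_less_imp_le mult_pos_neg)
    have "\<delta> * r \<le> \<delta> * (t * m)" using rm \<delta> by simp
    then have "- (\<delta> * m) * t \<le> z * t" using h'(2) by (simp add: mult_ac)
    then have z1: "- (\<delta> * m) \<le> z" using t0 by (simp only: mult_le_cancel_right_pos)
    have "(1 + \<delta>) * r \<le> (1 + \<delta>) * (t * m)" using rm \<delta> by simp
    then have "z * t \<le> ((1 + \<delta>) * m) * t" using h'(3) by (simp add: mult_ac)
    then have z2: "z \<le> (1 + \<delta>) * m" using t0 by (simp only: mult_le_cancel_right_pos)
    show False
    proof (cases "y = 0")
      case False
      then have "\<delta> * (\<bar>x\<bar> + 1) < \<bar>y\<bar>" using \<delta> xp by (simp add: c_def pos_less_divide_eq)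
      then have "\<bar>x\<bar> + 1 < \<bar>y\<bar> / \<delta>" using \<delta> by (simp add: pos_less_divide_eq mult.commute)
      then show False using m0 unfolding m_def by linarith
    next
      case True
      then have mx: "m = x" "x \<ge> 0" using m0 by (auto simp: m_def)
      consider "z < 0" | "z \<ge> 0" "z > x" | "0 \<le> z" "z \<le> x" by linarith
      then show False
      proof cases
        case 1
        then have "c = (- z) / (\<bar>x\<bar> + 1)" using True by (simp add: c_def)
          then have "\<delta> * (\<bar>x\<bar> + 1) < - z" using \<delta>(2) by (simp only: pos_less_divide_eq[OF xp])
        then show False using z1 mx \<delta> by (simp add: distrib_left)
      next
        case 2
        then have "\<delta> * (\<bar>x\<bar> + 1) < z - x" using \<delta> xp True by (simp add: c_def pos_less_divide_eq)
        then show False using z2 mx \<delta> by (simp add: algebra_simps)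
      next
        case 3
        have "x > 0"
        proof (rule ccontr)
          assume "\<not> x > 0"
          then have "x = 0" "z = 0" using 3 by auto
          then show False using Z Zc True by simp
        qed
        \<comment> \<open>With \<open>s * x\<close> at most 1/2 the point stays over the first
          quarter of the base: it lies in the triangle but is neither end of the base.\<close>
        define s where "s = min 1 (1 / (2 * x))"
        have s: "0 < s" "s \<le> 1" "s * x \<le> 1 / 2" using \<open>x > 0\<close> by (auto simp: s_def min_def field_simps)
        have "s * z \<le> s * x" using 3 s by simp
        then have "M + (s * x - 1) *\<^sub>R a + (s * z) *\<^sub>R e \<in> convex hull {?A, M + a, M + e}"
          using 3 s by (intro in_triangle) auto
        then have "(1 - s) *\<^sub>R ?A + s *\<^sub>R Z \<in> convex hull {?A, M + a, M + e}"
          unfolding pt using True by simp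
        moreover have "(1 - s) *\<^sub>R ?A + s *\<^sub>R Z \<in> closed_segment ?A Z" using s unfolding in_segment by (intro exI[of _ s]) auto
        ultimately have "(1 - s) *\<^sub>R ?A + s *\<^sub>R Z \<in> {?A, M + a}" using tri by blast
        moreover have "cu M a n e ?A = - 1" "cu M a n e (M + a) = 1"
          using coords(1)[OF J, of M "-1" 0 0] coords(1)[OF J, of M 1 0 0] by simp_all
        moreover have "cu M a n e ((1 - s) *\<^sub>R ?A + s *\<^sub>R Z) = s * x - 1" unfolding pt coords[OF J] ..
        moreover have "s * x > 0" using s \<open>x > 0\<close> by simp
        ultimately show False using s(3) by auto
      qed
    qed
  qed
  then have "closed_segment ?A Z \<inter> bipyramid M a n e \<delta> \<subseteq> {?A}" if "0 < \<delta>" "\<delta> < c" for \<delta>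
    using that by (force simp: in_segment)
  then show ?thesis using c by blast
qed

text \<open>\<open>\<phi>\<close> is nonpositive only on the triangle and at most
  \<open>\<delta>\<close> on the bipyramid. Its minimum over the compact edge is positive and serves
  as the bound.\<close>

lemma disjoint_edge_avoids_bipyramid:
  assumes J: "det3 a n e \<noteq> 0"
    and tri: "closed_segment P Q \<inter> convex hull {M - a, M + a, M + e} = {}"
  shows "\<exists>c>0. \<forall>\<delta>. 0 < \<delta> \<longrightarrow> \<delta> < c \<longrightarrow> closed_segment P Q \<inter> bipyramid M a n e \<delta> = {}"
proof -
  define \<phi> where "\<phi> X = max \<bar>cw M a n e X\<bar> (max (- cv M a n e X) (cv M a n e X - (1 - \<bar>cu M a n e X\<bar>)))" for X
  have "continuous_on (closed_segment P Q) \<phi>" unfolding \<phi>_def[abs_def] by (intro continuous_intros)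
  then obtain X0 where X0: "X0 \<in> closed_segment P Q" "\<And>X. X \<in> closed_segment P Q \<Longrightarrow> \<phi> X0 \<le> \<phi> X"
    using continuous_attains_inf[of "closed_segment P Q" \<phi>] by auto
  have "\<phi> X0 > 0"
  proof (rule ccontr)
    assume "\<not> \<phi> X0 > 0"
    then have "cw M a n e X0 = 0" "0 \<le> cv M a n e X0" "cv M a n e X0 \<le> 1 - \<bar>cu M a n e X0\<bar>"
      unfolding \<phi>_def by auto
    then have "M + cu M a n e X0 *\<^sub>R a + cw M a n e X0 *\<^sub>R n + cv M a n e X0 *\<^sub>R e \<in> convex hull {M - a, M + a, M + e}"
      using in_triangle[of "cv M a n e X0" "cu M a n e X0" M a e] by simp
    then show False using tri X0(1) unfolding coords(4)[OF J, symmetric] by blast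
  qed
  moreover have "closed_segment P Q \<inter> bipyramid M a n e \<delta> = {}" if \<delta>: "0 < \<delta>" "\<delta> < \<phi> X0" for \<delta>
  proof (rule ccontr)
    assume "closed_segment P Q \<inter> bipyramid M a n e \<delta> \<noteq> {}"
    then obtain X where X: "X \<in> closed_segment P Q" "X \<in> bipyramid M a n e \<delta>" by blast
    let ?u = "cu M a n e X" let ?w = "cw M a n e X" let ?v = "cv M a n e X" let ?r = "width M a n e \<delta> X"
    have h: "?r \<ge> 0" "- (\<delta> * ?r) \<le> ?v" "?v \<le> (1 + \<delta>) * ?r" using X(2) by (auto simp: bipyramid_def)
    have p: "0 \<le> \<bar>?w\<bar> / \<delta>" using \<delta> by simp
    then have 1: "\<bar>?w\<bar> / \<delta> \<le> 1" "?r \<le> 1" "?r \<le> 1 - \<bar>?u\<bar>" using h(1) unfolding width_def by linarith+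
    have w: "\<bar>?w\<bar> \<le> \<delta>" using 1(1) \<delta> by (simp add: divide_le_eq)
    have "\<delta> * ?r \<le> \<delta> * 1" using 1(2) \<delta> by (intro mult_left_mono) auto
    then have "\<phi> X \<le> \<delta>" using w h 1(3) unfolding \<phi>_def by (simp add: distrib_right)
    then show False using X0(2)[OF X(1)] \<delta>(2) by linarith
  qed
  ultimately show ?thesis by blast
qed

text \<open>The reflection exchanges the ends of the base, so the lemma about edges leaving
  \<open>M - a\<close> also serves those leaving \<open>M + a\<close>.\<close>

lemma bipyramid_minus: "bipyramid M (- a) n e \<delta> = bipyramid M a n e \<delta>"
proof -
  have d: "det3 (- a) Y Y' = - det3 a Y Y'" for Y Y' unfolding det3_def by simp
  have "width M (- a) n e \<delta> X = width M a n e \<delta> X" "cv M (- a) n e X = cv M a n e X" for X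
    unfolding width_def cu_def cw_def cv_def d by (simp_all add: abs_divide)
  then show ?thesis unfolding bipyramid_def by simp
qed

lemma edges_avoid_bipyramid:
  assumes L: "oriented_link L" and e: "(M - a, M + a) \<in> L" and J: "det3 a n e \<noteq> 0"
    and tri: "convex hull {M - a, M + a, M + e} \<inter> support L = closed_segment (M - a) (M + a)"
  obtains \<delta> where "\<delta> > 0"
    "\<And>P Q. (P, Q) \<in> L \<Longrightarrow> (P, Q) \<noteq> (M - a, M + a) \<Longrightarrow> closed_segment P Q \<inter> bipyramid M a n e \<delta> \<subseteq> {M - a, M + a}"
proof -
  have fin: "finite L" and ne: "\<And>P Q. (P, Q) \<in> L \<Longrightarrow> P \<noteq> Q" using L by (auto simp: oriented_link_def)
  have one: "\<exists>c>0. \<forall>\<delta>. 0 < \<delta> \<longrightarrow> \<delta> < c \<longrightarrow> closed_segment P Q \<inter> bipyramid M a n e \<delta> \<subseteq> {M - a, M + a}"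
    if PQ: "(P, Q) \<in> L" "(P, Q) \<noteq> (M - a, M + a)" for P Q
  proof -
    let ?S = "closed_segment P Q"
    have m: "?S \<inter> closed_segment (M - a) (M + a) \<subseteq> {P, Q} \<inter> {M - a, M + a}"
      using edges_meet_in_vertices[OF L PQ(1) e PQ(2)] .
    moreover have "?S \<subseteq> support L" using edge_in_support[OF PQ(1)] by blast
    ultimately have t: "?S \<inter> convex hull {M - a, M + a, M + e} \<subseteq> {P, Q} \<inter> {M - a, M + a}" using tri by blast
    consider "M - a \<in> ?S" | "M + a \<in> ?S" | "M - a \<notin> ?S" "M + a \<notin> ?S" by blast
    then show ?thesis
    proof cases
      case 1
      then have "M - a \<in> {P, Q}" using m ends_in_segment(1)[of "M - a" "M + a"] by blast
      then obtain Z where Z: "?S = closed_segment (M - a) Z" "Z \<noteq> M - a"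
        using ne[OF PQ(1)] closed_segment_commute[of P Q] by blast
      then have "closed_segment (M - a) Z \<inter> convex hull {M - a, M + a, M + e} \<subseteq> {M - a, M + a}"
        using t by blast
      from edge_from_vertex_avoids_bipyramid[OF J Z(2) this] show ?thesis unfolding Z(1) by blast
    next
      case 2
      then have "M + a \<in> {P, Q}" using m ends_in_segment(2)[of "M + a" "M - a"] by blast
      then obtain Z where Z: "?S = closed_segment (M + a) Z" "Z \<noteq> M + a"
        using ne[OF PQ(1)] closed_segment_commute[of P Q] by blast
      have J': "det3 (- a) n e \<noteq> 0" using J unfolding det3_def by (simp add: algebra_simps)
      have "closed_segment (M - - a) Z \<inter> convex hull {M - - a, M + - a, M + e} \<subseteq> {M - - a, M + - a}"
        using t Z(1) by (simp add: insert_commute)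
      from edge_from_vertex_avoids_bipyramid[OF J' _ this] Z(2) show ?thesis
        unfolding Z(1) bipyramid_minus by auto
    next
      case 3
      then have "?S \<inter> convex hull {M - a, M + a, M + e} = {}" using t by blast
      from disjoint_edge_avoids_bipyramid[OF J this] show ?thesis by blast
    qed
  qed
  then have "\<forall>p\<in>L - {(M - a, M + a)}. \<exists>c>0. \<forall>\<delta>. 0 < \<delta> \<longrightarrow> \<delta> < c \<longrightarrow>
      closed_segment (fst p) (snd p) \<inter> bipyramid M a n e \<delta> \<subseteq> {M - a, M + a}"
    by (intro ballI one) (simp_all only: prod.collapse Diff_iff singleton_iff simp_thms)
  then obtain c where c: "\<And>p. p \<in> L - {(M - a, M + a)} \<Longrightarrow> c p > 0 \<and> (\<forall>\<delta>. 0 < \<delta> \<longrightarrow> \<delta> < c p \<longrightarrow>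
      closed_segment (fst p) (snd p) \<inter> bipyramid M a n e \<delta> \<subseteq> {M - a, M + a})" by metis
  define m where "m = Min (insert 1 (c ` (L - {(M - a, M + a)})))"
  have fin': "finite (insert 1 (c ` (L - {(M - a, M + a)})))" using fin by blast
  have m: "m > 0" unfolding m_def using fin' c by (subst Min_gr_iff) auto
  show ?thesis
  proof (rule that[of "m / 2"])
    show "m / 2 > 0" using m by simp
    fix P Q assume PQ: "(P, Q) \<in> L" "(P, Q) \<noteq> (M - a, M + a)"
    then have p: "(P, Q) \<in> L - {(M - a, M + a)}" by blast
    then have "m \<le> c (P, Q)" unfolding m_def by (intro Min_le fin') blast
    then show "closed_segment P Q \<inter> bipyramid M a n e (m / 2) \<subseteq> {M - a, M + a}"
      using c[OF p] m by simp
  qed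
qed

lemma triangle_segments:
  fixes M a e :: space
  shows "closed_segment (M - a) (M + a) = (\<lambda>u. M + u *\<^sub>R a) ` {-1..1}"
    "closed_segment (M - a) (M + e) = (\<lambda>u. M + u *\<^sub>R a + (1 - \<bar>u\<bar>) *\<^sub>R e) ` {-1..0}"
    "closed_segment (M + e) (M + a) = (\<lambda>u. M + u *\<^sub>R a + (1 - \<bar>u\<bar>) *\<^sub>R e) ` {0..1}"
proof -
  have 1: "(\<lambda>u. 2 * u - 1) ` {0..1::real} = {-1..1}"
  proof (rule set_eqI, rule iffI)
    fix x :: real assume "x \<in> {-1..1}"
    then show "x \<in> (\<lambda>u. 2 * u - 1) ` {0..1}" by (intro image_eqI[of _ _ "(x + 1) / 2"]) (auto simp: field_simps)
  qed auto
  have 2: "(\<lambda>u. u - 1) ` {0..1::real} = {-1..0}"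
  proof (rule set_eqI, rule iffI)
    fix x :: real assume "x \<in> {-1..0}"
    then show "x \<in> (\<lambda>u. u - 1) ` {0..1}" by (intro image_eqI[of _ _ "x + 1"]) auto
  qed auto
  show "closed_segment (M - a) (M + a) = (\<lambda>u. M + u *\<^sub>R a) ` {-1..1}"
    unfolding closed_segment_image_interval 1[symmetric] image_image
    by (intro image_cong refl) (simp add: algebra_simps flip: scaleR_2)
  show "closed_segment (M - a) (M + e) = (\<lambda>u. M + u *\<^sub>R a + (1 - \<bar>u\<bar>) *\<^sub>R e) ` {-1..0}"
    unfolding closed_segment_image_interval 2[symmetric] image_image
    by (intro image_cong refl) (simp add: algebra_simps)
  show "closed_segment (M + e) (M + a) = (\<lambda>u. M + u *\<^sub>R a + (1 - \<bar>u\<bar>) *\<^sub>R e) ` {0..1}"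
    unfolding closed_segment_image_interval
    by (intro image_cong refl) (simp add: algebra_simps)
qed

text \<open>The factor 2 comes from the old edge having direction \<open>2 *\<^sub>R a\<close>. For
  \<open>w\<close> nonzero the real parts have equal signs, which excludes a nonpositive quotient;
  for \<open>w = 0\<close> the imaginary parts have to agree in sign.\<close>

lemma complex_ratio:
  assumes J: "J > 0" and c: "w \<noteq> 0 \<or> v' * v > 0 \<or> v = 0 \<and> v' = 0"
  shows "(Complex (2 * J * w) (2 * J * v) = 0 \<longleftrightarrow> Complex (J * w) (J * v') = 0) \<and>
    (Complex (2 * J * w) (2 * J * v) \<noteq> 0 \<longrightarrow> Complex (J * w) (J * v') / Complex (2 * J * w) (2 * J * v) \<notin> \<real>\<^sub>\<le>\<^sub>0)"
proof (intro conjI impI notI)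
  show "Complex (2 * J * w) (2 * J * v) = 0 \<longleftrightarrow> Complex (J * w) (J * v') = 0"
    using J c by (auto simp: complex_eq_iff)
  assume nz: "Complex (2 * J * w) (2 * J * v) \<noteq> 0"
    and "Complex (J * w) (J * v') / Complex (2 * J * w) (2 * J * v) \<in> \<real>\<^sub>\<le>\<^sub>0"
  then obtain l where l: "l \<le> 0" "Complex (J * w) (J * v') / Complex (2 * J * w) (2 * J * v) = of_real l"
    by (auto elim: nonpos_Reals_cases)
  then have "Complex (J * w) (J * v') = of_real l * Complex (2 * J * w) (2 * J * v)"
    using nz by (simp add: divide_eq_eq)
  then have "J * w = J * (l * 2 * w)" "J * v' = J * (l * 2 * v)" by (auto simp: complex_eq_iff)
  then have wv: "w = l * 2 * w" "v' = l * 2 * v" using J by auto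
  have "w = 0"
  proof (rule ccontr)
    assume "w \<noteq> 0"
    then have "l * 2 = 1" using wv(1) by simp
    then show False using l(1) by simp
  qed
  moreover have "v' * v = l * (2 * (v * v))" using arg_cong[OF wv(2), of "\<lambda>x. x * v"] by (simp only: mult_ac)
  moreover have "l * (2 * (v * v)) \<le> 0" by (intro mult_nonpos_nonneg l(1)) simp
  ultimately show False using c nz by (auto simp: complex_eq_iff)
qed

lemma open_segment_point:
  "A \<noteq> B \<Longrightarrow> 0 < t \<Longrightarrow> t < 1 \<Longrightarrow> X = (1 - t) *\<^sub>R A + t *\<^sub>R B \<Longrightarrow> X \<in> open_segment A B"
  by (auto simp: in_segment)

lemma around_bent_edge:
  "det3 (e + a) Y e = det3 a Y e" "det3 (e + a) n (x *\<^sub>R a + y *\<^sub>R n + z *\<^sub>R e) = (z - x) * det3 a n e"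
  "det3 (a - e) Y e = det3 a Y e" "det3 (a - e) n (x *\<^sub>R a + y *\<^sub>R n + z *\<^sub>R e) = (z + x) * det3 a n e"
  unfolding det3_def by (simp_all add: algebra_simps)

text \<open>The push keeps the transverse coordinate, and in the plane of the triangle it keeps
  points on their side of the edge, so angle coordinates are never reversed. The point
  \<open>M\<close>, where \<open>u = 0\<close>, becomes the new vertex and is excluded.\<close>

lemma edge_match_bent:
  assumes J: "det3 a n e > 0" and \<delta>: "\<delta> > 0" and u: "\<bar>u\<bar> < 1" "u \<noteq> 0"
    and L: "(M - a, M + a) \<in> L" "(M - a, M + e) \<in> L'" "(M + e, M + a) \<in> L'"
  shows "edge_match (push M a n e \<delta>) L L' (M + u *\<^sub>R a)"
proof -
  define J where "J = det3 a n e"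
  have J0: "J > 0" "det3 a n e \<noteq> 0" using J by (auto simp: J_def)
  have \<kappa>: "1 + 1 / \<delta> > 1" using \<delta> by simp
  let ?f = "push M a n e \<delta>" let ?P = "M + u *\<^sub>R a"
  have fP: "?f ?P = M + u *\<^sub>R a + (1 - \<bar>u\<bar>) *\<^sub>R e"
    using coords(1,2,3)[OF J0(2), of M u 0 0] u bend_sign(1)[OF \<kappa>, of "1 - \<bar>u\<bar>"] by (simp add: push_def width_def)
  define A' B' where "A' = (if u < 0 then M - a else M + e)" and "B' = (if u < 0 then M + e else M + a)"
  have e': "(A', B') \<in> L'" using L by (simp add: A'_def B'_def)
  have P: "?P \<in> open_segment (M - a) (M + a)"
  proof -
    have "a \<noteq> 0" using J by (auto simp: det3_def)
    then have "M - a \<noteq> M + a" by (auto simp: prod_eq_iff)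
    moreover have "?P = (1 - (1 + u) / 2) *\<^sub>R (M - a) + ((1 + u) / 2) *\<^sub>R (M + a)" by (simp add: prod_eq_iff field_simps)
    ultimately show ?thesis using u by (intro open_segment_point[where t="(1 + u) / 2"]) auto
  qed
  have fP': "?f ?P \<in> open_segment A' B'"
  proof (cases "u < 0")
    case True
    have "a + e \<noteq> 0"
    proof
      assume "a + e = 0" then have "a = - e" by (simp add: eq_neg_iff_add_eq_0)
      then show False using J by (simp add: det3_def algebra_simps)
    qed
    moreover have "?f ?P = (1 - (1 + u)) *\<^sub>R (M - a) + (1 + u) *\<^sub>R (M + e)" unfolding fP using True by (simp add: algebra_simps)
    ultimately show ?thesis unfolding A'_def B'_def using u True
      by (intro open_segment_point[where t="1 + u"]) (auto simp: algebra_simps)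
  next
    case False
    have "a \<noteq> e"
    proof
      assume "a = e"
      then show False using J by (simp add: det3_def algebra_simps)
    qed
    moreover have "?f ?P = (1 - u) *\<^sub>R (M + e) + u *\<^sub>R (M + a)" unfolding fP using False by (simp add: algebra_simps)
    ultimately show ?thesis unfolding A'_def B'_def using u False
      by (intro open_segment_point[where t="u"]) auto
  qed
  have dd: "det3 (B' - A') n e = J"
    unfolding A'_def B'_def J_def by (simp add: det3_def algebra_simps)
  \<comment> \<open>A constant sign of the first coordinate selects one of the two new sides; the
    bound by 1 makes the width equal to \<open>1 - \<bar>x\<bar>\<close> where the transverse
    coordinate is 0.\<close>
  define V where "V = {X. cu M a n e X * u > 0} \<inter> {X. \<bar>cu M a n e X\<bar> < 1}"
  have oV: "open V" unfolding V_def by (intro open_Int open_Collect_less continuous_intros)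
  have PV: "?P \<in> V" using coords(1)[OF J0(2), of M u 0 0] u by (auto simp: V_def zero_less_mult_iff)
  have d2: "(M + a) - (M - a) = 2 *\<^sub>R a" by (simp add: scaleR_2)
  have key: "(around (M + a - (M - a)) n e (X - ?P) = 0 \<longleftrightarrow> around (B' - A') n e (?f X - ?f ?P) = 0) \<and>
        (around (M + a - (M - a)) n e (X - ?P) \<noteq> 0 \<longrightarrow>
          around (B' - A') n e (?f X - ?f ?P) / around (M + a - (M - a)) n e (X - ?P) \<notin> \<real>\<^sub>\<le>\<^sub>0)"
    if X: "X \<in> V" for X
  proof -
    define x w v where "x = cu M a n e X" and "w = cw M a n e X" and "v = cv M a n e X"
    define r where "r = max 0 (1 - \<bar>x\<bar> - \<bar>w\<bar> / \<delta>)"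
    \<comment> \<open>The displacement along \<open>e\<close> from the bent line; by
      \<open>bend_sign\<close> it has the sign of \<open>v\<close> when
      \<open>w = 0\<close>.\<close>
    define v' where "v' = bend (1 + 1 / \<delta>) r v - (1 - \<bar>x\<bar>)"
    have Xc: "X = M + x *\<^sub>R a + w *\<^sub>R n + v *\<^sub>R e" unfolding x_def w_def v_def by (rule coords(4)[OF J0(2)])
    have XP: "X - ?P = (x - u) *\<^sub>R a + w *\<^sub>R n + v *\<^sub>R e" by (subst Xc) (simp add: algebra_simps)
    have a1: "around (2 *\<^sub>R a) n e (X - ?P) = Complex (2 * J * w) (2 * J * (- v))"
      unfolding around_scale around_def XP J_def by (simp add: det3_def complex_eq_iff algebra_simps)
    have "?f X = M + x *\<^sub>R a + w *\<^sub>R n + bend (1 + 1 / \<delta>) r v *\<^sub>R e"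
      by (subst Xc) (simp add: push_def width_def coords(1-3)[OF J0(2)] r_def scaleR_diff_left)
    then have Y: "?f X - ?f ?P = (x - u) *\<^sub>R a + w *\<^sub>R n + (bend (1 + 1 / \<delta>) r v - (1 - \<bar>u\<bar>)) *\<^sub>R e"
      unfolding fP by (simp add: algebra_simps)
    have re: "det3 a (?f X - ?f ?P) e = J * w" unfolding Y J_def by (simp add: det3_def algebra_simps)
    have a2: "around (B' - A') n e (?f X - ?f ?P) = Complex (J * w) (J * (- v'))"
    proof (cases "u < 0")
      case True
      then have d: "B' - A' = e + a" by (simp add: A'_def B'_def)
      have "x < 0" using X True unfolding V_def x_def by (auto simp: zero_less_mult_iff)
      have "det3 (e + a) n (?f X - ?f ?P) = J * v'"
        unfolding Y around_bent_edge v'_def J_def using True \<open>x < 0\<close> by (simp add: algebra_simps)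
      then show ?thesis unfolding around_def d around_bent_edge(1) re det3_swap(1)[of _ _ n] by simp
    next
      case False
      then have d: "B' - A' = a - e" by (simp add: A'_def B'_def)
      have "x > 0" "u > 0" using X False u unfolding V_def x_def by (auto simp: zero_less_mult_iff)
      then have "det3 (a - e) n (?f X - ?f ?P) = J * v'"
        unfolding Y around_bent_edge v'_def J_def by (simp add: algebra_simps)
      then show ?thesis unfolding around_def d around_bent_edge(3) re det3_swap(1)[of _ _ n] by simp
    qed
    have "w \<noteq> 0 \<or> v' * v > 0 \<or> v = 0 \<and> v' = 0"
    proof (cases "w = 0")
      case True
      have "\<bar>x\<bar> < 1" using X by (simp add: V_def x_def)
      then have r: "r = 1 - \<bar>x\<bar>" "r \<ge> 0" using True by (auto simp: r_def)
      show ?thesis using bend_sign(1)[OF \<kappa> r(2)] bend_sign(2)[OF \<kappa> r(2), of v] unfolding v'_def r(1)[symmetric] by auto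
    qed simp
    then have "w \<noteq> 0 \<or> - v' * - v > 0 \<or> - v = 0 \<and> - v' = 0" by simp
    then show ?thesis unfolding d2 a1 a2 by (rule complex_ratio[OF J0(1)])
  qed
  have "det3 (M + a - (M - a)) n e > 0" unfolding d2 around_scale using J by simp
  moreover have "det3 (B' - A') n e > 0" unfolding dd by (rule J0(1))
  ultimately show ?thesis unfolding edge_match_def using L(1) P e' fP' oV PV key by blast
qed

lemma support_Un: "support (L \<union> L') = support L \<union> support L'" by (simp add: support_def)

lemma off_vertices:
  assumes "P \<in> support L" "P \<notin> vertices L"
  obtains A B where "(A, B) \<in> L" "P \<in> open_segment A B"
proof -
  obtain A B where AB: "(A, B) \<in> L" "P \<in> closed_segment A B" using assms(1) unfolding support_def by blast
  then have "A \<in> vertices L" "B \<in> vertices L" by (force simp: vertices_def)+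
  then show ?thesis using that[OF AB(1)] AB(2) assms(2) unfolding open_segment_def by blast
qed

lemma bent_triangle_move:
  assumes L: "oriented_link L" "oriented_link L'" and AB: "(M - a, M + a) \<in> L" and J: "det3 a n e > 0"
    and tri: "convex hull {M - a, M + a, M + e} \<inter> support L = closed_segment (M - a) (M + a)"
    and L': "L' = (L - {(M - a, M + a)}) \<union> {(M - a, M + e), (M + e, M + a)}"
  shows "\<exists>f g. link_equiv L L' f g \<and> link_equiv L' L g f"
proof -
  have J0: "det3 a n e \<noteq> 0" using J by simp
  obtain \<delta> where \<delta>: "\<delta> > 0"
    "\<And>P Q. (P, Q) \<in> L \<Longrightarrow> (P, Q) \<noteq> (M - a, M + a) \<Longrightarrow> closed_segment P Q \<inter> bipyramid M a n e \<delta> \<subseteq> {M - a, M + a}"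
    using edges_avoid_bipyramid[OF L(1) AB J0 tri] by blast
  have \<kappa>: "1 + 1 / \<delta> > 1" using \<delta> by simp
  let ?f = "push M a n e \<delta>" let ?g = "pull M a n e \<delta>"
  have fu: "?f (M + u *\<^sub>R a) = M + u *\<^sub>R a + (1 - \<bar>u\<bar>) *\<^sub>R e" if "\<bar>u\<bar> \<le> 1" for u
    using coords(1,2,3)[OF J0, of M u 0 0] that bend_sign(1)[OF \<kappa>, of "1 - \<bar>u\<bar>"] by (simp add: push_def width_def)
  have fV: "?f (M - a) = M - a" "?f (M + a) = M + a" using fu[of "-1"] fu[of 1] by simp_all
  have fO: "?f X = X" if X: "X \<in> support (L - {(M - a, M + a)})" for X
  proof -
    obtain P Q where PQ: "(P, Q) \<in> L" "(P, Q) \<noteq> (M - a, M + a)" "X \<in> closed_segment P Q"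
      using X unfolding support_def by blast
    show ?thesis
    proof (cases "X \<in> bipyramid M a n e \<delta>")
      case True
      then have "X = M - a \<or> X = M + a" using \<delta>(2)[OF PQ(1,2)] PQ(3) by blast
      then show ?thesis using fV by metis
    qed (rule push_trivial[OF \<delta>(1)])
  qed
  have bent: "?f ` closed_segment (M - a) (M + a) = closed_segment (M - a) (M + e) \<union> closed_segment (M + e) (M + a)"
  proof -
    have "?f ` closed_segment (M - a) (M + a) = (\<lambda>u. M + u *\<^sub>R a + (1 - \<bar>u\<bar>) *\<^sub>R e) ` {-1..1}"
      unfolding triangle_segments(1) image_image by (intro image_cong refl fu) auto
    moreover have "{-1..1::real} = {-1..0} \<union> {0..1}" by auto
    ultimately show ?thesis unfolding triangle_segments(2,3) by (simp add: image_Un)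
  qed
  have "link_homeo L L' ?f ?g" unfolding link_homeo_def
  proof (intro conjI)
    show "homeomorphism UNIV UNIV ?f ?g" by (rule push_homeomorphism[OF J0 \<delta>(1)])
    have "support L = support (L - {(M - a, M + a)}) \<union> closed_segment (M - a) (M + a)"
      using AB by (auto simp: support_def)
    moreover have "support L' = support (L - {(M - a, M + a)}) \<union> (closed_segment (M - a) (M + e) \<union> closed_segment (M + e) (M + a))"
      unfolding L' support_Un by (simp add: support_def)
    moreover have "?f ` support (L - {(M - a, M + a)}) = support (L - {(M - a, M + a)})" using fO by (force simp: image_iff)
    ultimately show "?f ` support L = support L'" by (simp only: image_Un bent)
    show "\<exists>Z. \<forall>X. Z < \<bar>snd X\<bar> \<longrightarrow> ?f X = X"
    proof (intro exI allI impI)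
      fix X :: space assume "norm M + norm a + \<delta> * norm n + (1 + \<delta>) * norm e < \<bar>snd X\<bar>"
      then show "?f X = X" using push_trivial[OF \<delta>(1)] bipyramid_bounded[OF J0 \<delta>(1)] by (meson not_le)
    qed
  qed
  moreover have "finite {P \<in> support L. \<not> edge_match ?f L L' P}"
  proof (rule finite_subset)
    show "finite (insert M (vertices L))" using L(1) by (auto simp: oriented_link_def vertices_def)
    show "{P \<in> support L. \<not> edge_match ?f L L' P} \<subseteq> insert M (vertices L)"
    proof (rule subsetI, rule ccontr)
      fix P assume P: "P \<in> {P \<in> support L. \<not> edge_match ?f L L' P}" "P \<notin> insert M (vertices L)"
      then obtain A B where e: "(A, B) \<in> L" "P \<in> open_segment A B" using off_vertices[of P L] by blast
      have PV: "P \<noteq> M - a" "P \<noteq> M + a" using P(2) AB by (force simp: vertices_def)+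
      have "edge_match ?f L L' P"
      proof (cases "(A, B) = (M - a, M + a)")
        case True
        then have "P \<in> closed_segment (M - a) (M + a)" using e(2) unfolding open_segment_def by blast
        then obtain u where u: "P = M + u *\<^sub>R a" "u \<in> {-1..1}" unfolding triangle_segments(1) by blast
        have "u \<noteq> 0" "u \<noteq> 1" "u \<noteq> - 1" using u(1) P(2) PV by auto
        then have "\<bar>u\<bar> < 1" using u(2) by auto
        then show ?thesis unfolding u(1) using \<open>u \<noteq> 0\<close> by (intro edge_match_bent[OF J \<delta>(1)] AB) (auto simp: L')
      next
        case False
        have "P \<notin> bipyramid M a n e \<delta>"
          using \<delta>(2)[OF e(1) False] e(2) PV unfolding open_segment_def by blast
        moreover have "?f X = X" if "X \<in> - bipyramid M a n e \<delta>" for X using push_trivial[OF \<delta>(1)] that by blast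
        ultimately show ?thesis using e False closed_bipyramid[of M a n e \<delta>]
          by (intro edge_match_parallel[OF e, of A B _ _ "- bipyramid M a n e \<delta>" 1]) (auto simp: L')
      qed
      then show False using P(1) by blast
    qed
  qed
  ultimately show ?thesis using link_equiv_both[OF L] by blast
qed

lemma subdivision_move:
  assumes L: "oriented_link L" "oriented_link L'" and AB: "(A, B) \<in> L" and C: "C \<in> closed_segment A B"
    and L': "L' = (L - {(A, B)}) \<union> {(A, C), (C, B)}"
  shows "link_equiv L L' id id \<and> link_equiv L' L id id"
proof -
  have "link_homeo L L' id id" unfolding link_homeo_def
  proof (intro conjI)
    have "support L = support (L - {(A, B)}) \<union> closed_segment A B" using AB by (auto simp: support_def)
    also have "\<dots> = support L'" unfolding L' support_Un by (simp add: support_def Un_closed_segment[OF C])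
    finally show "id ` support L = support L'" by simp
  qed (auto simp: homeomorphism_def)
  moreover have "finite {P \<in> support L. \<not> edge_match id L L' P}"
  proof (rule finite_subset)
    show "finite (insert C (vertices L))" using L(1) by (auto simp: oriented_link_def vertices_def)
    show "{P \<in> support L. \<not> edge_match id L L' P} \<subseteq> insert C (vertices L)"
    proof (rule subsetI, rule ccontr)
      fix P assume P: "P \<in> {P \<in> support L. \<not> edge_match id L L' P}" "P \<notin> insert C (vertices L)"
      then obtain A1 B1 where e: "(A1, B1) \<in> L" "P \<in> open_segment A1 B1" using off_vertices[of P L] by blast
      have "edge_match id L L' P"
      proof (cases "(A1, B1) = (A, B)")
        case True
        have ne: "A \<noteq> C" "C \<noteq> B" using L(2) by (auto simp: L' oriented_link_def)
        obtain t where t: "0 \<le> t" "t \<le> 1" "C = (1 - t) *\<^sub>R A + t *\<^sub>R B" using C by (auto simp: in_segment)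
        then have t': "t > 0" "1 - t > 0" using ne by (auto simp: order_less_le)
        have d: "C - A = t *\<^sub>R (B - A)" "B - C = (1 - t) *\<^sub>R (B - A)" unfolding t(3) by (simp_all add: algebra_simps)
        have "P \<in> closed_segment A C \<union> closed_segment C B"
          using e(2) True unfolding Un_closed_segment[OF C] open_segment_def by simp
        moreover have "P \<notin> {A, B, C}" using P(2) e True unfolding open_segment_def by blast
        ultimately consider "P \<in> open_segment A C" | "P \<in> open_segment C B" unfolding open_segment_def by blast
        then show ?thesis
        proof cases
          case 1
          show ?thesis by (rule edge_match_parallel[OF e, of A C _ _ UNIV t]) (use True 1 d t' L' in auto)
        next
          case 2
          show ?thesis by (rule edge_match_parallel[OF e, of C B _ _ UNIV "1 - t"]) (use True 2 d t' L' in auto)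
        qed
      next
        case False
        show ?thesis by (rule edge_match_parallel[OF e, of A1 B1 _ _ UNIV 1]) (use False e L' in auto)
      qed
      then show False using P(1) by blast
    qed
  qed
  ultimately show ?thesis using link_equiv_both[OF L] by blast
qed

lemma det3_degenerate:
  assumes "a \<noteq> 0" "\<And>n. det3 a n e = 0" shows "\<exists>\<tau>. e = \<tau> *\<^sub>R a"
proof -
  have eqs: "snd (fst a) * snd e = snd a * snd (fst e)" "fst (fst a) * snd e = snd a * fst (fst e)"
    "fst (fst a) * snd (fst e) = snd (fst a) * fst (fst e)"
    using assms(2)[of "((1, 0), 0)"] assms(2)[of "((0, 1), 0)"] assms(2)[of "((0, 0), 1)"]
    by (auto simp: det3_def)
  consider "fst (fst a) \<noteq> 0" | "snd (fst a) \<noteq> 0" | "snd a \<noteq> 0" using assms(1) by (auto simp: prod_eq_iff)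
  then show ?thesis
  proof cases
    case 1 then show ?thesis using eqs by (intro exI[of _ "fst (fst e) / fst (fst a)"]) (auto simp: prod_eq_iff field_simps)
  next
    case 2 then show ?thesis using eqs by (intro exI[of _ "snd (fst e) / snd (fst a)"]) (auto simp: prod_eq_iff field_simps)
  next
    case 3 then show ?thesis using eqs by (intro exI[of _ "snd e / snd a"]) (auto simp: prod_eq_iff field_simps)
  qed
qed

lemma triangle_move_equiv:
  assumes "triangle_move L L'"
  shows "\<exists>f g. link_equiv L L' f g \<and> link_equiv L' L g f"
proof -
  obtain A B C where L: "oriented_link L" "oriented_link L'" and AB: "(A, B) \<in> L"
    and tri: "convex hull {A, B, C} \<inter> support L = closed_segment A B"
    and L': "L' = (L - {(A, B)}) \<union> {(A, C), (C, B)}"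
    using assms unfolding triangle_move_def by blast
  define M a e where "M = (1 / 2) *\<^sub>R (A + B)" and "a = (1 / 2) *\<^sub>R (B - A)" and "e = C - M"
  have ABC: "A = M - a" "B = M + a" "C = M + e" by (simp_all add: M_def a_def e_def prod_eq_iff field_simps)
  have neq: "A \<noteq> B" "A \<noteq> C" "C \<noteq> B" using L AB by (auto simp: L' oriented_link_def)
  then have a0: "a \<noteq> 0" using ABC by auto
  show ?thesis
  proof (cases "\<exists>n. det3 a n e > 0")
    case True
    then obtain n where n: "det3 a n e > 0" by blast
    show ?thesis by (rule bent_triangle_move[OF L _ n]) (use AB tri L' in \<open>simp_all only: ABC\<close>)
  next
    case False
    \<comment> \<open>Replacing \<open>n\<close> by its negative reverses the sign, so if no
      \<open>n\<close> gives a positive determinant all of them vanish and the triangle is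
      degenerate.\<close>
    have "det3 a n e = 0" for n
    proof -
      have "det3 a (- n) e = - det3 a n e" unfolding det3_def by (simp add: algebra_simps)
      then show ?thesis using False by (metis linorder_neqE_linordered_idom neg_0_less_iff_less)
    qed
    then obtain \<tau> where \<tau>: "e = \<tau> *\<^sub>R a" using det3_degenerate[OF a0] by blast
    have AC: "closed_segment A C \<inter> closed_segment C B \<subseteq> {A, C} \<inter> {C, B}"
      by (rule edges_meet_in_vertices[OF L(2)]) (use neq L' in auto)
    \<comment> \<open>If \<open>C\<close> lay on the line beyond an end of \<open>AB\<close>, the
      new edges would overlap: \<open>B\<close> would be on \<open>AC\<close> or \<open>A\<close> on
      \<open>CB\<close>.\<close>
    have "\<bar>\<tau>\<bar> \<le> 1"
    proof (rule ccontr)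
      assume "\<not> \<bar>\<tau>\<bar> \<le> 1"
      then consider "\<tau> > 1" | "\<tau> < - 1" by linarith
      then show False
      proof cases
        case 1
        have "B = (1 - 2 / (1 + \<tau>)) *\<^sub>R A + (2 / (1 + \<tau>)) *\<^sub>R C"
        proof -
          define s where "s = 2 / (1 + \<tau>)"
          have "1 + \<tau> \<noteq> 0" using 1 by linarith
          then have "s * (1 + \<tau>) = 2" using nonzero_eq_divide_eq[of "1 + \<tau>" s 2] s_def by blast
          then have "M + a = M + (s * (1 + \<tau>) - 1) *\<^sub>R a" by simp
          then show ?thesis unfolding ABC \<tau> s_def[symmetric] by (simp add: algebra_simps)
        qed
        moreover have "0 \<le> 2 / (1 + \<tau>)" "2 / (1 + \<tau>) \<le> 1" using 1 by auto
        ultimately have "B \<in> closed_segment A C" unfolding in_segment by blast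
        then show False using AC neq by auto
      next
        case 2
        have "A = (1 - (- 1 - \<tau>) / (1 - \<tau>)) *\<^sub>R C + ((- 1 - \<tau>) / (1 - \<tau>)) *\<^sub>R B"
        proof -
          define s where "s = (- 1 - \<tau>) / (1 - \<tau>)"
          have "s * (1 - \<tau>) = - 1 - \<tau>" using 2 by (simp add: s_def)
          then have "M - a = M + (\<tau> + s * (1 - \<tau>)) *\<^sub>R a" by simp
          then show ?thesis unfolding ABC \<tau> s_def[symmetric] by (simp add: algebra_simps)
        qed
        moreover have "0 \<le> (- 1 - \<tau>) / (1 - \<tau>)" "(- 1 - \<tau>) / (1 - \<tau>) \<le> 1" using 2 by auto
        ultimately have "A \<in> closed_segment C B" unfolding in_segment by blast
        then show False using AC neq by auto
      qed
    qed
    then have "C \<in> closed_segment A B" unfolding ABC triangle_segments(1) \<tau> by (auto simp: abs_le_iff)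
    then show ?thesis using subdivision_move[OF L AB _ L'] by blast
  qed
qed

lemma equivclp_link_equiv:
  assumes "equivclp triangle_move L L'"
  shows "\<exists>f g. link_equiv L L' f g"
  using assms
proof (induction rule: equivclp_induct)
  case base
  have "link_equiv L L id id"
    by (auto simp: link_equiv_def link_homeo_def homeomorphism_def)
  then show ?case by blast
next
  case (step L1 L2)
  then have "\<exists>f g. link_equiv L1 L2 f g" using triangle_move_equiv by blast
  then show ?case using step.IH link_equiv_trans by blast
qed

section \<open>The ternary operations of a linear tridle\<close>

text \<open>The power \<open>(-x)^n\<close>; with the signs included, all four operations take one
  common form.\<close>

definition nx :: "int \<Rightarrow> 's::field laurent" where "nx n = Poly_Mapping.single (n, 0) (power_int (-1) n)"
definition ny :: "int \<Rightarrow> 's::field laurent" where "ny n = Poly_Mapping.single (0, n) (power_int (-1) n)"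

lemma nx_add: "nx (m + n) = nx m * nx n" and ny_add: "ny (m + n) = ny m * ny n"
  by (simp_all add: nx_def ny_def mult_single power_int_add)

lemma nx_simps: "nx 0 = 1" "nx 1 = - x_var" "nx (-1) = - x_inv"
  and ny_simps: "ny 0 = 1" "ny 1 = - y_var" "ny (-1) = - y_inv"
  by (simp_all add: nx_def ny_def x_var_def x_inv_def y_var_def y_inv_def single_uminus power_int_minus
      flip: zero_prod_def)

lemma nx_inverse: "nx (- n) * nx n = 1" "nx n * nx (- n) = 1"
  and ny_inverse: "ny (- n) * ny n = 1" "ny n * ny (- n) = 1"
  by (simp_all add: nx_simps ny_simps flip: nx_add ny_add)

lemma nx_ny_inverse:
  "nx n * ny n * (nx (- n) * ny (- n)) = 1" "nx (- n) * ny (- n) * (nx n * ny n) = 1"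
proof -
  have "nx n * ny n * (nx (- n) * ny (- n)) = (nx n * nx (- n)) * (ny n * ny (- n))" by (simp only: mult_ac)
  then show "nx n * ny n * (nx (- n) * ny (- n)) = 1" by (simp only: nx_inverse ny_inverse mult_1)
  then show "nx (- n) * ny (- n) * (nx n * ny n) = 1" by (simp only: mult.commute)
qed

text \<open>Exponents \<open>1\<close> and \<open>-1\<close> give the four operations up to the
  order of arguments. General exponents occur because alternating words combine regions of arbitrary
  index differences.\<close>

definition tern :: "int \<Rightarrow> int \<Rightarrow> ('g, 's::field) free_mod \<Rightarrow> ('g, 's) free_mod \<Rightarrow> ('g, 's) free_mod \<Rightarrow> ('g, 's) free_mod"
  where "tern j k a b c = nx j *\<^sub>L (a - ny k *\<^sub>L b) + ny k *\<^sub>L c"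

lemmas free_algebra = free.scale_right_distrib free.scale_right_diff_distrib free.scale_left_distrib
  free.scale_scale free.scale_minus_left free.scale_minus_right

lemma tern_F_op:
  fixes a b c :: "('g, 's::field) free_mod"
  shows "tern 1 1 a b c = F_op 1 a b c" "tern (-1) 1 a b c = F_op 2 c b a"
  "tern 1 (-1) a b c = F_op 4 c b a" "tern (-1) (-1) a b c = F_op 3 a b c"
proof -
  have x: "x_inv * (x_var * z) = z" "y_inv * (y_var * z) = z" "x_var * (x_inv * z) = z" "y_var * (y_inv * z) = z" for z :: "'s laurent"
    using x_mult_inv[where 's='s] y_mult_inv[where 's='s] by (metis mult.assoc mult.commute mult_1)+
  have c: "x_var * x_inv = (1::'s laurent)" "y_var * y_inv = (1::'s laurent)" "x_inv * x_var = (1::'s laurent)" "y_inv * y_var = (1::'s laurent)"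
    using x_mult_inv[where 's='s] y_mult_inv[where 's='s] by (simp_all add: mult.commute)
  show "tern 1 1 a b c = F_op 1 a b c" "tern (-1) 1 a b c = F_op 2 c b a"
    "tern 1 (-1) a b c = F_op 4 c b a" "tern (-1) (-1) a b c = F_op 3 a b c"
    unfolding tern_def F_op_def nx_simps ny_simps
    by (simp_all add: free_algebra x c mult_ac)
qed

text \<open>The auxiliary element \<open>u\<close> cancels, so exponents add under composition.
  Every \<open>tern j k\<close> is thereby a composite of the four operations.\<close>

lemma tern_compose:
  "tern (j + j') k a b v = tern j k (tern j' k a b u) u v"
  "tern j (k + k') v b c = tern j k v u (tern j k' u b c)"
  unfolding tern_def by (simp_all add: free_algebra nx_add ny_add mult_ac)

lemma tern_closed:
  assumes F: "\<And>k a b c. k \<in> {1, 2, 3, 4} \<Longrightarrow> a \<in> H \<Longrightarrow> b \<in> H \<Longrightarrow> c \<in> H \<Longrightarrow> F_op k a b c \<in> H"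
    and abc: "a \<in> H" "b \<in> H" "c \<in> H"
  shows "tern j k a b c \<in> H"
proof -
  have all: "\<forall>n::int. P n" if "P 1" "P (-1)" "\<And>m n. P m \<Longrightarrow> P n \<Longrightarrow> P (m + n)" for P
  proof
    \<comment> \<open>Exponent 0 is obtained as \<open>1 + (-1)\<close>; it is not among the given
      operations.\<close>
    have "P 0" using that(3)[OF that(1,2)] by simp
    then show "P n" for n
      by (induction n rule: int_induct[of _ 0]) (use that(3)[OF _ that(1)] that(3)[OF _ that(2)] in auto)
  qed
  define P where "P j k \<longleftrightarrow> (\<forall>a\<in>H. \<forall>b\<in>H. \<forall>c\<in>H. tern j k a b c \<in> H)" for j k
  have b: "P 1 1" "P (-1) 1" "P 1 (-1)" "P (-1) (-1)" unfolding P_def tern_F_op by (auto intro: F)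
  have 1: "P (j + j') k" if "P j k" "P j' k" for j j' k
    unfolding P_def
  proof (intro ballI)
    fix a b c assume "a \<in> H" "b \<in> H" "c \<in> H"
    then show "tern (j + j') k a b c \<in> H"
      using that unfolding P_def tern_compose(1)[of j j' k a b c a] by blast
  qed
  have 2: "P j (k + k')" if "P j k" "P j k'" for j k k'
    unfolding P_def
  proof (intro ballI)
    fix a b c assume "a \<in> H" "b \<in> H" "c \<in> H"
    then show "tern j (k + k') a b c \<in> H"
      using that unfolding P_def tern_compose(2)[of j k k' a b c a] by blast
  qed
  have "\<forall>j. P j 1" by (rule all) (use b 1 in blast)+
  moreover have "\<forall>j. P j (-1)" by (rule all) (use b 1 in blast)+
  ultimately have "\<forall>k. P j k" by (intro all) (use 2 in blast)+
  then show ?thesis using abc unfolding P_def by blast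
qed

section \<open>A group encoding the quotient module\<close>

text \<open>Colours must come from a type of class \<open>group_add\<close>; permutations provide
  one into which the affine group of every quotient embeds.\<close>

typedef 'a bijection = "{f :: 'a \<Rightarrow> 'a. bij f}"
  by (rule exI[of _ id]) simp

setup_lifting type_definition_bijection

instantiation bijection :: (type) group_add
begin

lift_definition zero_bijection :: "'a bijection" is id by simp
lift_definition plus_bijection :: "'a bijection \<Rightarrow> 'a bijection \<Rightarrow> 'a bijection" is "(\<circ>)"
  by (rule bij_comp)
lift_definition uminus_bijection :: "'a bijection \<Rightarrow> 'a bijection" is inv by (rule bij_imp_bij_inv)
definition minus_bijection :: "'a bijection \<Rightarrow> 'a bijection \<Rightarrow> 'a bijection" where
  "minus_bijection a b = a + - b"

instance
proof
  fix a b c :: "'a bijection"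
  show "a + b + c = a + (b + c)" by transfer (simp add: comp_assoc)
  show "0 + a = a" "a + 0 = a" by (transfer; simp)+
  show "- a + a = 0" by transfer (simp add: bij_is_inj)
  show "a + - b = a - b" by (simp add: minus_bijection_def)
qed

end

definition cosets :: "('g, 's::field) free_mod set \<Rightarrow> ('g, 's) free_mod set set" where
  "cosets K = range (\<lambda>v. (+) v ` K)"

text \<open>The affine maps \<open>v \<mapsto> m + (xy)\<^sup>n v\<close> of the quotient by \<open>K\<close>. Sets that are not cosets are left
  fixed, so that these maps are permutations of a type that does not depend on \<open>K\<close>.\<close>

definition affine_fun ::
  "('g, 's::field) free_mod set \<Rightarrow> int \<Rightarrow> ('g, 's) free_mod \<Rightarrow> ('g, 's) free_mod set \<Rightarrow> ('g, 's) free_mod set" where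
  "affine_fun K n m A = (if A \<in> cosets K then (\<lambda>v. m + (nx n * ny n) *\<^sub>L v) ` A else A)"

definition affine :: "('g, 's::field) free_mod set \<Rightarrow> int \<Rightarrow> ('g, 's) free_mod \<Rightarrow> ('g, 's) free_mod set bijection" where
  "affine K n m = Abs_bijection (affine_fun K n m)"

text \<open>Multiplication by the unit \<open>(xy)^n\<close> maps a submodule onto itself,
  surjectivity being supplied by the inverse monomial.\<close>

lemma affine_image_coset:
  assumes K: "free.subspace K"
  shows "(\<lambda>v. m + (nx n * ny n) *\<^sub>L v) ` ((+) w ` K) = (+) (m + (nx n * ny n) *\<^sub>L w) ` K"
proof -
  have "(*\<^sub>L) (nx n * ny n) ` K = K"
  proof (rule antisym)
    show "(*\<^sub>L) (nx n * ny n) ` K \<subseteq> K" using K by (auto intro: free.subspace_scale)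
    show "K \<subseteq> (*\<^sub>L) (nx n * ny n) ` K"
    proof
      fix k assume "k \<in> K"
      then show "k \<in> (*\<^sub>L) (nx n * ny n) ` K"
        using K by (intro image_eqI[of _ _ "(nx (- n) * ny (- n)) *\<^sub>L k"]) (auto simp: nx_ny_inverse intro: free.subspace_scale)
    qed
  qed
  then have "(+) (m + (nx n * ny n) *\<^sub>L w) ` K = (+) (m + (nx n * ny n) *\<^sub>L w) ` (*\<^sub>L) (nx n * ny n) ` K" by simp
  then show ?thesis by (simp add: image_image free.scale_right_distrib add.assoc)
qed

lemma affine_fun_add:
  assumes K: "free.subspace K"
  shows "affine_fun K n m (affine_fun K n' m' A) = affine_fun K (n + n') (m + (nx n * ny n) *\<^sub>L m') A"
proof (cases "A \<in> cosets K")
  case True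
  then obtain w where w: "A = (+) w ` K" by (auto simp: cosets_def)
  have "(\<lambda>v. m' + (nx n' * ny n') *\<^sub>L v) ` A \<in> cosets K"
    unfolding w affine_image_coset[OF K] cosets_def by blast
  then show ?thesis
    using True by (simp add: affine_fun_def image_image free_algebra nx_add ny_add mult_ac add.assoc)
qed (simp add: affine_fun_def)

lemma affine_fun_zero: "affine_fun K 0 0 = id"
  by (rule ext) (simp add: affine_fun_def nx_simps ny_simps)

lemma affine_fun_inverse:
  assumes "free.subspace K"
  shows "affine_fun K n m (affine_fun K (- n) (- ((nx (- n) * ny (- n)) *\<^sub>L m)) A) = A"
    "affine_fun K (- n) (- ((nx (- n) * ny (- n)) *\<^sub>L m)) (affine_fun K n m A) = A"
proof -
  show "affine_fun K n m (affine_fun K (- n) (- ((nx (- n) * ny (- n)) *\<^sub>L m)) A) = A"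
    "affine_fun K (- n) (- ((nx (- n) * ny (- n)) *\<^sub>L m)) (affine_fun K n m A) = A"
    unfolding affine_fun_add[OF assms] by (simp_all add: affine_fun_zero nx_ny_inverse)
qed

lemma bij_affine_fun: "free.subspace K \<Longrightarrow> bij (affine_fun K n m)"
  by (rule o_bij[of "affine_fun K (- n) (- ((nx (- n) * ny (- n)) *\<^sub>L m))"])
    (auto simp: fun_eq_iff affine_fun_inverse)

lemma affine_add:
  assumes K: "free.subspace K"
  shows "affine K n m + affine K n' m' = affine K (n + n') (m + (nx n * ny n) *\<^sub>L m')"
  by (rule Rep_bijection_inject[THEN iffD1], rule ext)
    (simp add: affine_def plus_bijection.rep_eq Abs_bijection_inverse bij_affine_fun[OF K] affine_fun_add[OF K])

lemma affine_zero: "affine K 0 0 = 0"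
  by (simp add: affine_def affine_fun_zero zero_bijection_def)

lemma affine_minus:
  assumes K: "free.subspace K"
  shows "- affine K n m = affine K (- n) (- ((nx (- n) * ny (- n)) *\<^sub>L m))"
proof (rule minus_unique)
  show "affine K n m + affine K (- n) (- ((nx (- n) * ny (- n)) *\<^sub>L m)) = 0"
    unfolding affine_add[OF K] by (simp add: affine_zero nx_ny_inverse)
qed

text \<open>The translation part modulo \<open>K\<close> is recovered by applying the map to the
  coset \<open>K\<close> itself.\<close>

lemma affine_eq_iff:
  assumes K: "free.subspace K"
  shows "affine K n m = affine K n m' \<longleftrightarrow> m - m' \<in> K"
proof
  assume "affine K n m = affine K n m'"
  then have "affine_fun K n m = affine_fun K n m'"
    unfolding affine_def by (subst (asm) Abs_bijection_inject) (auto simp: bij_affine_fun[OF K])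
  then have "affine_fun K n m ((+) 0 ` K) = affine_fun K n m' ((+) 0 ` K)" by simp
  moreover have "(+) 0 ` K \<in> cosets K" unfolding cosets_def by blast
  ultimately have "(+) m ` K = (+) m' ` K"
    unfolding affine_fun_def using affine_image_coset[OF K, of _ n 0] by simp
  moreover have "m \<in> (+) m ` K" using free.subspace_0[OF K] by (intro image_eqI[of _ _ 0]) auto
  ultimately show "m - m' \<in> K" by auto
next
  assume d: "m - m' \<in> K"
  have "(+) (m + v) ` K = (+) (m' + v) ` K" for v
  proof -
    have "(+) (m + v) ` K \<subseteq> (+) (m' + v) ` K" if "m - m' \<in> K" for m m'
    proof
      fix z assume "z \<in> (+) (m + v) ` K"
      then obtain k where "k \<in> K" "z = m + v + k" by blast
      then show "z \<in> (+) (m' + v) ` K"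
        using that by (intro image_eqI[of _ _ "m - m' + k"]) (auto intro: free.subspace_add[OF K])
    qed
    moreover have "m' - m \<in> K" using free.subspace_neg[OF K d] by simp
    ultimately show ?thesis using d by blast
  qed
  note coset_eq = this
  have eq: "affine_fun K n m A = affine_fun K n m' A" for A
  proof (cases "A \<in> cosets K")
    case True
    then obtain w where w: "A = (+) w ` K" by (auto simp: cosets_def)
    have "affine_fun K n l A = (\<lambda>v. l + (nx n * ny n) *\<^sub>L v) ` A" for l
      unfolding affine_fun_def using True by (rule if_P)
    then have e: "affine_fun K n l A = (+) (l + (nx n * ny n) *\<^sub>L w) ` K" for l
      unfolding w affine_image_coset[OF K] .
    show ?thesis by (rule trans[OF e[of m] trans[OF coset_eq sym[OF e[of m']]]])
  qed (simp add: affine_fun_def)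
  show "affine K n m = affine K n m'" unfolding affine_def by (rule arg_cong[OF ext[OF eq]])
qed

text \<open>The group element assigned to a region of index \<open>n\<close> that is labelled by \<open>g\<close>. The
  factor \<open>(-x)\<^sup>n\<close> turns the heap operation \<open>a - b + c\<close> into the ternary operations.\<close>

definition tag :: "('g, 's::field) free_mod set \<Rightarrow> int \<Rightarrow> ('g, 's) free_mod \<Rightarrow> int \<times> ('g, 's) free_mod set bijection" where
  "tag K n g = (n, affine K n (nx n *\<^sub>L g))"

lemma fst_tag [simp]: "fst (tag K n g) = n"
  by (simp add: tag_def)

lemma tag_eq_iff:
  assumes K: "free.subspace K"
  shows "tag K n g = tag K n' g' \<longleftrightarrow> n = n' \<and> g - g' \<in> K"
proof -
  have "nx n *\<^sub>L g - nx n *\<^sub>L g' \<in> K \<longleftrightarrow> g - g' \<in> K"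
  proof
    assume "nx n *\<^sub>L g - nx n *\<^sub>L g' \<in> K"
    then have "nx (- n) *\<^sub>L (nx n *\<^sub>L g - nx n *\<^sub>L g') \<in> K" by (rule free.subspace_scale[OF K])
    then show "g - g' \<in> K" by (simp add: free_algebra nx_inverse)
  next
    assume "g - g' \<in> K"
    then have "nx n *\<^sub>L (g - g') \<in> K" by (rule free.subspace_scale[OF K])
    then show "nx n *\<^sub>L g - nx n *\<^sub>L g' \<in> K" by (simp add: free_algebra)
  qed
  then show ?thesis unfolding tag_def using affine_eq_iff[OF K] by auto
qed

text \<open>Put \<open>k = n1 - n2\<close> and \<open>j = n2 - n3\<close>. The group law attaches
  \<open>(xy)^k\<close> to the last two labels; dividing by the scaling
  \<open>(-x)^(n1 - n2 + n3)\<close> leaves the coefficients \<open>(-x)^j\<close>,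
  \<open>-(-x)^j (-y)^k\<close> and \<open>(-y)^k\<close> of \<open>tern\<close>.\<close>

lemma tag_heap:
  fixes K :: "('g, 's::field) free_mod set"
  assumes K: "free.subspace K"
  shows "tag K n1 g1 - tag K n2 g2 + tag K n3 g3 =
    tag K (n1 - n2 + n3) (tern (n2 - n3) (n1 - n2) g1 g2 g3)"
proof -
  let ?N = "n1 - n2 + n3" and ?j = "n2 - n3" and ?k = "n1 - n2"
  have c1: "nx ?N * nx ?j = (nx n1 :: 's laurent)" by (simp flip: nx_add)
  then have c1': "nx ?N * (nx ?j * ny ?k) = (nx n1 * ny ?k :: 's laurent)" by (simp only: mult.assoc[symmetric])
  have "nx n1 * ny n1 * (nx (- n2) * ny (- n2) * nx n2) = nx n1 * (ny n1 * ny (- n2)) * (nx (- n2) * nx n2 :: 's laurent)"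
    by (simp only: mult_ac)
  then have c2: "nx n1 * ny n1 * (nx (- n2) * ny (- n2) * nx n2) = (nx n1 * ny ?k :: 's laurent)"
    by (simp only: nx_inverse mult_1_right flip: ny_add) simp
  have "nx ?N = nx ?k * (nx n3 :: 's laurent)" by (simp flip: nx_add)
  then have c3: "nx (n1 + - n2) * ny (n1 + - n2) * nx n3 = (nx ?N * ny ?k :: 's laurent)"
    by (simp add: mult_ac)
  have "affine K n1 (nx n1 *\<^sub>L g1) - affine K n2 (nx n2 *\<^sub>L g2) + affine K n3 (nx n3 *\<^sub>L g3) =
    affine K (n1 + - n2 + n3) (nx n1 *\<^sub>L g1 + (nx n1 * ny n1) *\<^sub>L (- ((nx (- n2) * ny (- n2)) *\<^sub>L (nx n2 *\<^sub>L g2)))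
      + (nx (n1 + - n2) * ny (n1 + - n2)) *\<^sub>L (nx n3 *\<^sub>L g3))"
    unfolding diff_conv_add_uminus affine_minus[OF K] affine_add[OF K] ..
  moreover have "nx n1 *\<^sub>L g1 + (nx n1 * ny n1) *\<^sub>L (- ((nx (- n2) * ny (- n2)) *\<^sub>L (nx n2 *\<^sub>L g2)))
      + (nx (n1 + - n2) * ny (n1 + - n2)) *\<^sub>L (nx n3 *\<^sub>L g3) =
      nx (n1 - n2 + n3) *\<^sub>L tern (n2 - n3) (n1 - n2) g1 g2 g3"
    unfolding tern_def free.scale_right_distrib free.scale_right_diff_distrib free.scale_minus_right free.scale_scale
      c1 c1' c2 c3 by simp
  ultimately show ?thesis unfolding tag_def by simp
qed

section \<open>Linear extensions and labels in the tridle\<close>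

definition lin :: "('g \<Rightarrow> ('h, 's::field) free_mod) \<Rightarrow> ('g, 's) free_mod \<Rightarrow> ('h, 's) free_mod" where
  "lin h m = (\<Sum>g\<in>Poly_Mapping.keys m. Poly_Mapping.lookup m g *\<^sub>L h g)"

lemma lin_superset:
  assumes "finite S" "Poly_Mapping.keys m \<subseteq> S"
  shows "lin h m = (\<Sum>g\<in>S. Poly_Mapping.lookup m g *\<^sub>L h g)"
  unfolding lin_def by (rule sum.mono_neutral_left) (use assms in \<open>auto simp: in_keys_iff\<close>)

lemma lin_add: "lin h (m + m') = lin h m + lin h m'"
proof -
  let ?S = "Poly_Mapping.keys m \<union> Poly_Mapping.keys m'"
  have "Poly_Mapping.keys (m + m') \<subseteq> ?S" by (rule keys_add)
  then show ?thesis
    using lin_superset[of ?S "m + m'" h] lin_superset[of ?S m h] lin_superset[of ?S m' h]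
    by (simp add: lookup_add free_algebra sum.distrib)
qed

lemma lin_scale: "lin h (r *\<^sub>L m) = r *\<^sub>L lin h m"
proof -
  have "Poly_Mapping.keys (r *\<^sub>L m) \<subseteq> Poly_Mapping.keys m" by (auto simp: in_keys_iff lookup_scale)
  then show ?thesis
    using lin_superset[of "Poly_Mapping.keys m" "r *\<^sub>L m" h]
    by (simp add: lin_def lookup_scale free.scale_sum_right)
qed

lemma lin_diff: "lin h (m - m') = lin h m - lin h m'"
proof -
  have "lin h (m - m') + lin h m' = lin h m" by (simp flip: lin_add)
  then show ?thesis by (simp add: algebra_simps)
qed

lemma lin_gen: "lin h (gen g) = h g"
  by (simp add: lin_def gen_def)

lemma lin_tern: "lin h (tern j k a b c) = tern j k (lin h a) (lin h b) (lin h c)"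
  by (simp add: tern_def lin_add lin_scale lin_diff)

lemma lin_F_op: "k \<in> {1, 2, 3, 4} \<Longrightarrow> lin h (F_op k a b c) = F_op k (lin h a) (lin h b) (lin h c)"
  using lin_tern[of h 1 1 a b c] lin_tern[of h "-1" 1 c b a] lin_tern[of h 1 "-1" c b a] lin_tern[of h "-1" "-1" a b c]
  by (auto simp: tern_F_op)

lemma lin_subspace: "free.subspace V \<Longrightarrow> free.subspace {m. lin h m \<in> V}"
  unfolding free.subspace_def by (auto simp: lin_add lin_scale) (simp add: lin_def)

lemma lin_span:
  assumes "free.subspace V" "\<And>m. m \<in> A \<Longrightarrow> lin h m \<in> V" "m \<in> free.span A"
  shows "lin h m \<in> V"
  using free.span_minimal[OF _ lin_subspace[OF assms(1)], of A h] assms(2,3) by blast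

lemma gen_in_free_on_regions: "R \<in> regions D \<Longrightarrow> gen R \<in> free_on_regions D"
  by (simp add: free_on_regions_def gen_def)

lemma free_on_regions_span: "free_on_regions D = free.span (gen ` regions D)"
proof (rule antisym)
  show "free.span (gen ` regions D) \<subseteq> free_on_regions D"
    by (rule free.span_minimal[OF _ subspace_free_on_regions]) (auto intro: gen_in_free_on_regions)
  show "free_on_regions D \<subseteq> free.span (gen ` regions D :: (plane set, 's::field) free_mod set)"
  proof
    fix m :: "(plane set, 's) free_mod" assume m: "m \<in> free_on_regions D"
    have "m = lin gen m"
    proof (rule poly_mapping_eqI)
      fix g
      have "Poly_Mapping.lookup (lin gen m) g = (\<Sum>r\<in>Poly_Mapping.keys m. if r = g then Poly_Mapping.lookup m r else 0)"
        unfolding lin_def lookup_sum by (rule sum.cong) (auto simp: lookup_scale gen_def lookup_single when_def)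
      also have "\<dots> = Poly_Mapping.lookup m g" by (auto simp: sum.delta in_keys_iff)
      finally show "Poly_Mapping.lookup m g = Poly_Mapping.lookup (lin gen m) g" by simp
    qed
    moreover have "lin gen m \<in> free.span (gen ` regions D)"
      unfolding lin_def using m
      by (intro free.span_sum free.span_scale free.span_base) (auto simp: free_on_regions_def)
    ultimately show "m \<in> free.span (gen ` regions D)" by simp
  qed
qed

section \<open>Maps of tridles from assignments on regions\<close>

definition relation_module :: "oriented_diagram \<Rightarrow> (plane set, 's::field) free_mod set" where
  "relation_module D = free.span (crossing_relations D)"

lemma subspace_relation_module: "free.subspace (relation_module D)"
  by (simp add: relation_module_def)

text \<open>Representatives instead of classes, so that linear extensions and tags can be applied to
  them directly.\<close>

definition labels :: "oriented_diagram \<Rightarrow> (plane set, 's::field) free_mod set" where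
  "labels D = {m \<in> free_on_regions D. cong_rel D `` {m} \<in> LT_elems D}"

lemma gen_in_labels: "R \<in> regions D \<Longrightarrow> gen R \<in> labels D"
  by (simp add: labels_def LT_elems.generator gen_in_free_on_regions)

lemma labels_F_op:
  assumes "k \<in> {1, 2, 3, 4}" "a \<in> labels D" "b \<in> labels D" "c \<in> labels D"
  shows "F_op k a b c \<in> labels D"
proof -
  have abc: "a \<in> free_on_regions D" "b \<in> free_on_regions D" "c \<in> free_on_regions D" using assms by (auto simp: labels_def)
  from abc have "F_op k a b c \<in> free_on_regions D"
    by (rule F_op_in_subspace[OF subspace_free_on_regions])
  moreover have "quot_F D k (cong_rel D `` {a}) (cong_rel D `` {b}) (cong_rel D `` {c}) = cong_rel D `` {F_op k a b c}"
    using abc by (rule quot_F_class)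
  moreover have "quot_F D k (cong_rel D `` {a}) (cong_rel D `` {b}) (cong_rel D `` {c}) \<in> LT_elems D"
    using assms by (intro LT_elems.closed) (auto simp: labels_def)
  ultimately show ?thesis by (simp add: labels_def)
qed

lemma labels_tern: "a \<in> labels D \<Longrightarrow> b \<in> labels D \<Longrightarrow> c \<in> labels D \<Longrightarrow> tern j k a b c \<in> labels D"
  by (rule tern_closed[OF labels_F_op])

lemma LT_elems_label: "A \<in> LT_elems D \<Longrightarrow> \<exists>m\<in>labels D. A = cong_rel D `` {m}"
proof (induction rule: LT_elems.induct)
  case (generator R)
  then show ?case using gen_in_labels by blast
next
  case (closed k A B C)
  then obtain a b c where abc: "a \<in> labels D" "b \<in> labels D" "c \<in> labels D"
    and eq: "A = cong_rel D `` {a}" "B = cong_rel D `` {b}" "C = cong_rel D `` {c}" by blast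
  then have "quot_F D k A B C = cong_rel D `` {F_op k a b c}"
    unfolding eq by (intro quot_F_class) (auto simp: labels_def)
  then show ?case using labels_F_op[OF closed.hyps(1) abc] by blast
qed

lemma class_eq_iff:
  "m \<in> free_on_regions D \<Longrightarrow> m' \<in> free_on_regions D \<Longrightarrow>
    cong_rel D `` {m} = cong_rel D `` {m'} \<longleftrightarrow> m - m' \<in> relation_module D"
  using eq_equiv_class_iff[OF equiv_cong_rel, of m D m'] by (simp add: cong_rel_def relation_module_def)

text \<open>The second condition lets the linear extension descend to the quotient modules. The
  first confines the values to the tridle, which is smaller than the module in general.\<close>

definition label_map ::
  "oriented_diagram \<Rightarrow> oriented_diagram \<Rightarrow> (plane set \<Rightarrow> (plane set, 's::field) free_mod) \<Rightarrow> bool" where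
  "label_map D D' h \<longleftrightarrow> (\<forall>R\<in>regions D. h R \<in> labels D') \<and>
     (\<forall>m\<in>crossing_relations D. lin h m \<in> relation_module D')"

lemma label_map_relations: "label_map D D' h \<Longrightarrow> m \<in> relation_module D \<Longrightarrow> lin h m \<in> relation_module D'"
  unfolding label_map_def relation_module_def using lin_span[OF free.subspace_span] by blast

lemma label_map_free:
  "label_map D D' h \<Longrightarrow> m \<in> free_on_regions D \<Longrightarrow> lin h m \<in> free_on_regions D'"
  unfolding free_on_regions_span[of D]
  by (rule lin_span[OF subspace_free_on_regions]) (auto simp: lin_gen label_map_def labels_def)

definition class_map where
  "class_map D' h A = (\<Union>m\<in>A. cong_rel D' `` {lin h m})"

lemma class_map_class:
  assumes h: "label_map D D' h" and m: "m \<in> free_on_regions D"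
  shows "class_map D' h (cong_rel D `` {m}) = cong_rel D' `` {lin h m}"
proof -
  have "cong_rel D' `` {lin h m'} = cong_rel D' `` {lin h m}" if "m' \<in> cong_rel D `` {m}" for m'
  proof -
    have m': "m' \<in> free_on_regions D" "m - m' \<in> relation_module D"
      using that by (auto simp: cong_rel_def relation_module_def)
    then have "lin h m - lin h m' \<in> relation_module D'"
      using label_map_relations[OF h m'(2)] by (simp add: lin_diff)
    then show ?thesis
      using class_eq_iff[OF label_map_free[OF h m] label_map_free[OF h m'(1)]] by simp
  qed
  moreover have "m \<in> cong_rel D `` {m}" using equiv_class_self[OF equiv_cong_rel m] .
  ultimately show ?thesis unfolding class_map_def by blast
qed

lemma class_map_quot_F:
  assumes h: "label_map D D' h" and n: "n \<in> {1, 2, 3, 4}"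
    and ABC: "A \<in> LT_elems D" "B \<in> LT_elems D" "C \<in> LT_elems D"
  shows "class_map D' h (quot_F D n A B C) = quot_F D' n (class_map D' h A) (class_map D' h B) (class_map D' h C)"
proof -
  obtain a b c where abc: "a \<in> labels D" "b \<in> labels D" "c \<in> labels D"
    and eq: "A = cong_rel D `` {a}" "B = cong_rel D `` {b}" "C = cong_rel D `` {c}"
    using LT_elems_label ABC by metis
  have f: "a \<in> free_on_regions D" "b \<in> free_on_regions D" "c \<in> free_on_regions D" "F_op n a b c \<in> free_on_regions D"
    using abc labels_F_op[OF n abc] by (auto simp: labels_def)
  note f' = label_map_free[OF h f(1)] label_map_free[OF h f(2)] label_map_free[OF h f(3)]
  show ?thesis
    unfolding eq quot_F_class[OF f(1-3)] class_map_class[OF h f(1)] class_map_class[OF h f(2)]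
      class_map_class[OF h f(3)] class_map_class[OF h f(4)] quot_F_class[OF f'] lin_F_op[OF n] ..
qed

lemma label_map_labels:
  assumes h: "label_map D D' h" and m: "m \<in> labels D"
  shows "lin h m \<in> labels D'"
proof -
  have "A \<in> LT_elems D \<Longrightarrow> class_map D' h A \<in> LT_elems D'" for A
  proof (induction rule: LT_elems.induct)
    case (generator R)
    then have "gen R \<in> free_on_regions D" by (rule gen_in_free_on_regions)
    then show ?case
      using generator h unfolding class_map_class[OF h \<open>gen R \<in> free_on_regions D\<close>] lin_gen
      by (simp add: label_map_def labels_def)
  next
    case (closed k A B C)
    then show ?case using class_map_quot_F[OF h closed.hyps] by (simp add: LT_elems.closed)
  qed
  then have "class_map D' h (cong_rel D `` {m}) \<in> LT_elems D'" using m by (simp add: labels_def)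
  then show ?thesis
    using m label_map_free[OF h, of m] class_map_class[OF h, of m] by (simp add: labels_def)
qed

text \<open>The elements returned modulo relations form a submodule, so a test on the generators
  suffices.\<close>

lemma class_map_inverse:
  assumes h: "label_map D D' h" and k: "label_map D' D k"
    and kh: "\<And>R. R \<in> regions D \<Longrightarrow> lin k (h R) - gen R \<in> relation_module D" and A: "A \<in> LT_elems D"
  shows "class_map D k (class_map D' h A) = A"
proof -
  obtain m where m: "m \<in> labels D" "A = cong_rel D `` {m}" using LT_elems_label[OF A] by blast
  then have f: "m \<in> free_on_regions D" by (simp add: labels_def)
  have "free.subspace {m. lin k (lin h m) - m \<in> relation_module D}"
    unfolding free.subspace_def
  proof (intro conjI ballI allI)
    fix x y c assume x: "x \<in> {m. lin k (lin h m) - m \<in> relation_module D}"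
    have eq: "lin k (lin h (x + y)) - (x + y) = (lin k (lin h x) - x) + (lin k (lin h y) - y)"
      "lin k (lin h (c *\<^sub>L x)) - c *\<^sub>L x = c *\<^sub>L (lin k (lin h x) - x)"
      by (simp_all add: lin_add lin_scale free_algebra)
    show "c *\<^sub>L x \<in> {m. lin k (lin h m) - m \<in> relation_module D}"
      using x unfolding mem_Collect_eq eq by (rule free.subspace_scale[OF subspace_relation_module])
    show "x + y \<in> {m. lin k (lin h m) - m \<in> relation_module D}"
      if "y \<in> {m. lin k (lin h m) - m \<in> relation_module D}"
      using x that unfolding mem_Collect_eq eq by (rule free.subspace_add[OF subspace_relation_module])
  qed (simp add: lin_def free.subspace_0[OF subspace_relation_module])
  then have "free.span (gen ` regions D) \<subseteq> {m. lin k (lin h m) - m \<in> relation_module D}"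
    by (intro free.span_minimal) (auto simp: lin_gen kh)
  then have "lin k (lin h m) - m \<in> relation_module D" using f unfolding free_on_regions_span by blast
  then show ?thesis
    unfolding m(2) class_map_class[OF h f] class_map_class[OF k label_map_free[OF h f]]
    using class_eq_iff[OF label_map_free[OF k label_map_free[OF h f]] f] by simp
qed

lemma tridle_isomorphicI:
  fixes h k :: "plane set \<Rightarrow> (plane set, 's::field) free_mod"
  assumes h: "label_map D D' h" and k: "label_map D' D k"
    and kh: "\<And>R. R \<in> regions D \<Longrightarrow> lin k (h R) - gen R \<in> relation_module D"
    and hk: "\<And>R. R \<in> regions D' \<Longrightarrow> lin h (k R) - gen R \<in> relation_module D'"
  shows "tridle_isomorphic (linear_tridle D :: 's quot tridle) (linear_tridle D' :: 's quot tridle)"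
proof -
  have maps: "class_map D' h A \<in> LT_elems D'" if h: "label_map D D' h" and A: "A \<in> LT_elems D"
    for D D' A and h :: "plane set \<Rightarrow> (plane set, 's) free_mod"
  proof -
    obtain m where m: "m \<in> labels D" "A = cong_rel D `` {m}" using LT_elems_label[OF A] by blast
    then have "m \<in> free_on_regions D" by (simp add: labels_def)
    from class_map_class[OF h this] show ?thesis using label_map_labels[OF h m(1)] by (simp add: m(2) labels_def)
  qed
  have "bij_betw (class_map D' h) (LT_elems D) (LT_elems D')"
    by (rule bij_betw_byWitness[of _ "class_map D k"])
      (use class_map_inverse[OF h k kh] class_map_inverse[OF k h hk] maps[OF h] maps[OF k] in auto)
  then show ?thesis
    unfolding tridle_isomorphic_def tridle_hom_def linear_tridle_def
    by (intro exI[of _ "class_map D' h"]) (auto simp: maps[OF h] class_map_quot_F[OF h])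
qed

section \<open>Regions and corners\<close>

definition region_of :: "directed_edges \<Rightarrow> plane \<Rightarrow> plane set" where
  "region_of L p = connected_component_set (- fst ` support L) p"

lemma region_of_in_regions:
  assumes "p \<notin> fst ` support L"
  shows "region_of L p \<in> regions (projection L)" "p \<in> region_of L p"
  using assms unfolding region_of_def regions_def underlying_curve_projection
  by (auto simp: components_def connected_component_refl)

lemma region_of_unique:
  assumes "R \<in> regions (projection L)" "p \<in> R"
  shows "region_of L p = R" "p \<notin> fst ` support L"
proof -
  obtain q where q: "q \<in> - fst ` support L" "R = connected_component_set (- fst ` support L) q"
    using assms(1) unfolding regions_def underlying_curve_projection components_def by blast
  show "region_of L p = R"
    using assms(2) unfolding region_of_def q(2) by (metis connected_component_eq)
  show "p \<notin> fst ` support L" using assms(2) connected_component_subset unfolding q(2) by blast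
qed

lemma region_nonempty: "R \<in> regions (projection L) \<Longrightarrow> \<exists>p. p \<in> R"
  unfolding regions_def using in_components_nonempty by blast

lemma loc_const_on_region:
  assumes "loc_const (- fst ` support L) c" "R \<in> regions (projection L)" "p \<in> R" "q \<in> R"
  shows "c p = c q"
proof (rule loc_const_connected[OF loc_const_subset[OF assms(1)] _ assms(3,4)])
  show "R \<subseteq> - fst ` support L" "connected R"
    using assms(2) in_components_subset in_components_connected
    unfolding regions_def underlying_curve_projection by blast+
qed

lemma loc_const_region_of:
  assumes "oriented_link L" shows "loc_const (- fst ` support L) (region_of L)"
proof (rule loc_constI)
  fix p assume p: "p \<in> - fst ` support L"
  have "open (- fst ` support L)" using compact_curve[OF assms] compact_imp_closed by blast
  then obtain e where e: "e > 0" "ball p e \<subseteq> - fst ` support L" using p openE by metis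
  have const: "region_of L y = region_of L p" if "y \<in> ball p e" for y
  proof -
    have "ball p e \<subseteq> connected_component_set (- fst ` support L) p"
      using e by (intro connected_component_maximal) auto
    then show ?thesis using that unfolding region_of_def by (metis connected_component_eq subsetD)
  qed
  show "\<exists>W. open W \<and> p \<in> W \<and> (\<forall>y\<in>W \<inter> - fst ` support L. region_of L y = region_of L p)"
    by (rule exI[of _ "ball p e"], intro conjI open_ball ballI) (simp add: e(1), erule IntE, erule const)
qed

lemma corner_at_corner:
  assumes L: "oriented_link L" "regular_position L" and x: "(p, u, v) \<in> crossings (projection L)" and q: "q \<in> corner L (p, u, v) s t"
  shows "at_corner (projection L) p (\<lambda>w. s * cross u w > 0 \<and> t * cross v w > 0) (region_of L q)"
  unfolding at_corner_def
proof (intro conjI exI)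
  have sub: "corner L (p, u, v) s t \<subseteq> - fst ` support L" by (rule corner_subset[OF L x])
  show "region_of L q \<in> regions (projection L)" by (rule region_of_in_regions) (use q sub in blast)
  show "fst (xbox L (p, u, v)) > 0" by (rule crossing_boxD(1)[OF L x])
  have "corner L (p, u, v) s t \<subseteq> region_of L q"
    unfolding region_of_def using q sub convex_connected[OF convex_corner] by (intro connected_component_maximal) auto
  then show "{q \<in> ball p (fst (xbox L (p, u, v))). s * cross u (q - p) > 0 \<and> t * cross v (q - p) > 0} \<subseteq> region_of L q"
    by (simp only: corner_def prod.case)
qed

lemma near_corner:
  assumes L: "oriented_link L" "regular_position L" and x: "(p, u, v) \<in> crossings (projection L)" and \<rho>: "\<rho> > 0" and st: "s \<noteq> 0" "t \<noteq> 0"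
  obtains q where "q \<in> ball p \<rho>" "q \<in> corner L (p, u, v) s t"
proof -
  define r where "r = min \<rho> (fst (xbox L (p, u, v)))"
  have r: "r > 0" using \<rho> crossing_boxD(1)[OF L x] by (simp add: r_def)
  obtain q c where q: "q \<in> ball p r" "c > 0" "cross u (q - p) = c * s" "cross v (q - p) = c * t"
    using corner_direction_exists[OF crossing_boxD(11)[OF L x] r, of p s t] by blast
  have sq: "z * (c * z) > 0" if "z \<noteq> 0" for z
  proof -
    have "z * (c * z) = c * (z * z)" by (simp only: mult_ac)
    then show ?thesis using mult_pos_pos[OF q(2), of "z * z"] that not_real_square_gt_zero[of z] by metis
  qed
  have "s * cross u (q - p) > 0" "t * cross v (q - p) > 0" unfolding q by (rule sq[OF st(1)], rule sq[OF st(2)])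
  then have "q \<in> corner L (p, u, v) s t" using q(1) by (simp add: corner_def r_def)
  moreover have "q \<in> ball p \<rho>" using q(1) by (simp add: r_def)
  ultimately show ?thesis by (rule that[rotated])
qed

lemma at_corner_point:
  assumes L: "oriented_link L" "regular_position L" and x: "(p, u, v) \<in> crossings (projection L)" and R: "at_corner (projection L) p S R"
    and S: "\<And>w. s * cross u w > 0 \<Longrightarrow> t * cross v w > 0 \<Longrightarrow> S w" and st: "s \<noteq> 0" "t \<noteq> 0"
  obtains q where "q \<in> corner L (p, u, v) s t" "q \<in> R"
proof -
  obtain \<epsilon> where \<epsilon>: "\<epsilon> > 0" "{q \<in> ball p \<epsilon>. S (q - p)} \<subseteq> R" using R unfolding at_corner_def by blast
  obtain q where q: "q \<in> ball p \<epsilon>" "q \<in> corner L (p, u, v) s t" using near_corner[OF L x \<epsilon>(1) st] by blast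
  have "S (q - p)" by (rule S) (use q(2) in \<open>simp_all add: corner_def\<close>)
  then show ?thesis using that[OF q(2)] q(1) \<epsilon>(2) by blast
qed

text \<open>The crossing condition is imposed on some small disc only; it spreads to the full
  corners because a colouring is constant on each of them.\<close>

lemma dehn_coloring_corners:
  fixes c :: "plane \<Rightarrow> 'g::group_add"
  assumes L: "oriented_link L" "regular_position L" and c: "dehn_coloring L c" and x: "x \<in> crossings (projection L)"
    and q: "qa \<in> corner L x 1 (-1)" "qb \<in> corner L x 1 1" "qc \<in> corner L x (-1) 1" "qd \<in> corner L x (-1) (-1)"
  shows "c qa - c qd = c qb - c qc"
proof -
  obtain p u v where xe: "x = (p, u, v)" by (cases x)
  note x' = x[unfolded xe] and const = coloring_constant_on_corner[OF L dehn_coloring_loc_const[OF c] x]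
  obtain r where r: "r > 0" and rel: "\<And>qa qb qc qd. qa \<in> ball p r \<Longrightarrow> qb \<in> ball p r \<Longrightarrow> qc \<in> ball p r \<Longrightarrow> qd \<in> ball p r \<Longrightarrow>
        left_of u (qa - p) \<and> right_of v (qa - p) \<and> left_of u (qb - p) \<and> left_of v (qb - p) \<and>
        right_of u (qc - p) \<and> left_of v (qc - p) \<and> right_of u (qd - p) \<and> right_of v (qd - p) \<Longrightarrow>
        c qa - c qd = c qb - c qc"
    using c x' unfolding dehn_coloring_def by fast
  have near: "\<exists>q\<in>ball p r. q \<in> corner L x s t" if "s \<noteq> 0" "t \<noteq> 0" for s t
    using near_corner[OF L x' r that] unfolding xe by blast
  obtain a where a: "a \<in> ball p r" "a \<in> corner L x 1 (-1)" using near[of 1 "-1"] by auto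
  obtain b where b: "b \<in> ball p r" "b \<in> corner L x 1 1" using near[of 1 1] by auto
  obtain b' where b': "b' \<in> ball p r" "b' \<in> corner L x (-1) 1" using near[of "-1" 1] by auto
  obtain d where d: "d \<in> ball p r" "d \<in> corner L x (-1) (-1)" using near[of "-1" "-1"] by auto
  have "c a - c d = c b - c b'"
    by (rule rel[OF a(1) b(1) b'(1) d(1)])
      (use a(2) b(2) b'(2) d(2) in \<open>simp add: corner_def xe left_of_cross right_of_cross\<close>)
  then show ?thesis
    unfolding const[OF q(1) a(2)] const[OF q(2) b(2)] const[OF q(3) b'(2)] const[OF q(4) d(2)] .
qed

text \<open>If d has index \<open>n\<close>, then a and c have \<open>n + 1\<close> and b has
  \<open>n + 2\<close>. These differences produce the exponents in
  \<open>tag_crossing\<close>.\<close>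

lemma index_coloring_crossing:
  assumes L: "oriented_link L" "regular_position L" "index_coloring L i" and x: "x \<in> crossings (projection L)"
    and q: "qa \<in> corner L x 1 (-1)" "qb \<in> corner L x 1 1" "qc \<in> corner L x (-1) 1" "qd \<in> corner L x (-1) (-1)"
  shows "i qa = i qd + 1" "i qb = i qc + 1" "i qb = i qa + 1" "i qc = i qd + 1"
  using index_coloring_corners(1)[OF L x, of "-1" qa qd] index_coloring_corners(1)[OF L x, of 1 qb qc]
    index_coloring_corners(2)[OF L x, of 1 qb qa] index_coloring_corners(2)[OF L x, of "-1" qc qd] q
  by simp_all

lemma dehn_coloringI:
  assumes L: "oriented_link L" "regular_position L" and lc: "loc_const (- fst ` support L) c"
    and rel: "\<And>x qa qb qc qd. x \<in> crossings (projection L) \<Longrightarrow> qa \<in> corner L x 1 (-1) \<Longrightarrow> qb \<in> corner L x 1 1 \<Longrightarrow>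
      qc \<in> corner L x (-1) 1 \<Longrightarrow> qd \<in> corner L x (-1) (-1) \<Longrightarrow> c qa - c qd = c qb - c qc"
  shows "dehn_coloring L c"
  unfolding dehn_coloring_def
proof (intro conjI lc ballI)
  fix x assume x: "x \<in> crossings (projection L)"
  obtain p u v where xe: "x = (p, u, v)" by (cases x)
  have "c qa - c qd = c qb - c qc"
    if "qa \<in> ball p (fst (xbox L x))" "qb \<in> ball p (fst (xbox L x))" "qc \<in> ball p (fst (xbox L x))" "qd \<in> ball p (fst (xbox L x))"
      "left_of u (qa - p) \<and> right_of v (qa - p) \<and> left_of u (qb - p) \<and> left_of v (qb - p) \<and>
        right_of u (qc - p) \<and> left_of v (qc - p) \<and> right_of u (qd - p) \<and> right_of v (qd - p)" for qa qb qc qd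
    by (rule rel[OF x]) (use that in \<open>simp_all add: corner_def xe left_of_cross right_of_cross\<close>)
  then show "case x of (p, u, v) \<Rightarrow> \<exists>r>0. \<forall>qa\<in>ball p r. \<forall>qb\<in>ball p r. \<forall>qc\<in>ball p r. \<forall>qd\<in>ball p r.
        left_of u (qa - p) \<and> right_of v (qa - p) \<and> left_of u (qb - p) \<and> left_of v (qb - p) \<and>
        right_of u (qc - p) \<and> left_of v (qc - p) \<and> right_of u (qd - p) \<and> right_of v (qd - p) \<longrightarrow>
        c qa - c qd = c qb - c qc"
    unfolding xe prod.case using crossing_boxD(1)[OF L x[unfolded xe]] by blast
qed

lemma index_coloring_dehn_coloring:
  assumes "oriented_link L" "regular_position L" "index_coloring L i" shows "dehn_coloring L i"
proof (rule dehn_coloringI[OF assms(1,2)])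
  show "loc_const (- fst ` support L) i" using assms(3) unfolding index_coloring_def by blast
qed (use index_coloring_crossing[OF assms] in simp)

section \<open>The universal colouring\<close>

text \<open>Universal because each region is labelled by its own generator: applying a linear map to
  the labels yields the other tagged colourings with the same index.\<close>

definition universal ::
  "directed_edges \<Rightarrow> (plane \<Rightarrow> int) \<Rightarrow> plane \<Rightarrow> int \<times> (plane set, 's::field) free_mod set bijection" where
  "universal L i p = tag (relation_module (projection L)) (i p) (gen (region_of L p))"

text \<open>The relation solved for its second term, \<open>b = F_op 2 c d a\<close>; the remaining
  factor \<open>x\<close> is a unit.\<close>

lemma relation_tern:
  fixes a b c d :: "('g, 's::field) free_mod"
  shows "a + x_var *\<^sub>L b + (x_var * y_var) *\<^sub>L c + y_var *\<^sub>L d = x_var *\<^sub>L (b - tern (-1) 1 a d c)"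
proof -
  have 1: "x_inv * x_var = (1 :: 's laurent)" using x_mult_inv by (simp only: mult.commute)
  have 2: "x_inv * (x_var * z) = (z :: 's laurent)" for z by (simp only: mult.assoc[symmetric] 1 mult_1)
  show ?thesis unfolding tern_def nx_simps ny_simps by (simp add: free_algebra 1 2 algebra_simps)
qed

text \<open>Solving for the colour of b turns the crossing condition into \<open>a - d + c\<close>,
  and the index differences make \<open>tag_heap\<close> produce \<open>tern (-1) 1\<close>, which
  is \<open>F_op 2\<close>.\<close>

lemma tag_crossing:
  assumes K: "free.subspace K" and n: "na = nd + 1" "nb = nc + 1" "nb = na + 1" "nc = nd + (1::int)"
  shows "tag K na a - tag K nd d = tag K nb b - tag K nc c \<longleftrightarrow> b - tern (-1) 1 a d c \<in> K"
proof -
  have e: "nd - nc = - 1" "na - nd = 1" "1 + nc = nb" using n by simp_all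
  have "tag K na a - tag K nd d = tag K nb b - tag K nc c \<longleftrightarrow> tag K nb b = tag K nb (tern (-1) 1 a d c)"
    unfolding eq_diff_eq tag_heap[OF K] e by (rule eq_commute)
  then show ?thesis by (simp add: tag_eq_iff[OF K])
qed

lemma universal_dehn_coloring:
  assumes L: "oriented_link L" "regular_position L" "index_coloring L i"
  shows "dehn_coloring L (universal L i :: plane \<Rightarrow> int \<times> (plane set, 's::field) free_mod set bijection)"
proof (rule dehn_coloringI[OF L(1,2)])
  have "loc_const (- fst ` support L) i" using L(3) unfolding index_coloring_def by blast
  then show "loc_const (- fst ` support L) (universal L i)"
    unfolding universal_def[abs_def]
    by (rule loc_const_comp2[where F = "\<lambda>n R. tag (relation_module (projection L)) n (gen R)", OF _ loc_const_region_of[OF L(1)]])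
next
  fix x qa qb qc qd
  assume x: "x \<in> crossings (projection L)"
    and q: "qa \<in> corner L x 1 (-1)" "qb \<in> corner L x 1 1" "qc \<in> corner L x (-1) 1" "qd \<in> corner L x (-1) (-1)"
  obtain p u v where xe: "x = (p, u, v)" by (cases x)
  define K :: "(plane set, 's) free_mod set" where "K = relation_module (projection L)"
  have K: "free.subspace K" unfolding K_def by (rule subspace_relation_module)
  let ?g = "\<lambda>q. gen (region_of L q) :: (plane set, 's) free_mod"
  note c = corner_at_corner[OF L(1,2) x[unfolded xe]]
  have "?g qa + x_var *\<^sub>L ?g qb + (x_var * y_var) *\<^sub>L ?g qc + y_var *\<^sub>L ?g qd \<in> crossing_relations (projection L)"
    unfolding crossing_relations_def mem_Collect_eq
  proof (intro exI conjI refl bexI[of _ x])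
    show "case x of (p, u, v) \<Rightarrow>
          at_corner (projection L) p (\<lambda>w. left_of u w \<and> right_of v w) (region_of L qa) \<and>
          at_corner (projection L) p (\<lambda>w. left_of u w \<and> left_of v w) (region_of L qb) \<and>
          at_corner (projection L) p (\<lambda>w. right_of u w \<and> left_of v w) (region_of L qc) \<and>
          at_corner (projection L) p (\<lambda>w. right_of u w \<and> right_of v w) (region_of L qd)"
      unfolding xe prod.case using c[OF q(1)[unfolded xe]] c[OF q(2)[unfolded xe]] c[OF q(3)[unfolded xe]] c[OF q(4)[unfolded xe]]
      by (simp add: left_of_cross right_of_cross)
  qed (rule refl x)+
  then have "x_inv *\<^sub>L (x_var *\<^sub>L (?g qb - tern (-1) 1 (?g qa) (?g qd) (?g qc))) \<in> K"
    unfolding relation_tern K_def relation_module_def by (intro free.span_scale free.span_base)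
  then have "?g qb - tern (-1) 1 (?g qa) (?g qd) (?g qc) \<in> K"
    by (simp add: x_mult_inv mult.commute[of x_inv])
  then show "universal L i qa - universal L i qd = universal L i qb - (universal L i qc :: int \<times> (plane set, 's) free_mod set bijection)"
    unfolding universal_def K_def[symmetric] tag_crossing[OF K index_coloring_crossing[OF L x q]] .
qed

text \<open>\<open>universal_dehn_coloring\<close> read backwards: the crossing condition on tagged
  labels becomes the crossing relation between the labels, whichever regions occupy the
  corners.\<close>

lemma label_mapI:
  fixes h :: "plane set \<Rightarrow> (plane set, 's::field) free_mod"
  assumes L: "oriented_link L" "regular_position L" "index_coloring L i" and c: "dehn_coloring L c"
    and h: "\<And>R. R \<in> regions (projection L) \<Longrightarrow> h R \<in> labels D"
    and ch: "\<And>q. q \<notin> fst ` support L \<Longrightarrow> c q = tag (relation_module D) (i q) (h (region_of L q))"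
  shows "label_map (projection L) D h"
  unfolding label_map_def
proof (intro conjI ballI h)
  fix m :: "(plane set, 's) free_mod" assume "m \<in> crossing_relations (projection L)"
  then obtain Ra Rb Rc Rd p u v where m: "m = gen Ra + x_var *\<^sub>L gen Rb + (x_var * y_var) *\<^sub>L gen Rc + y_var *\<^sub>L gen Rd"
    and x: "(p, u, v) \<in> crossings (projection L)"
    and R: "at_corner (projection L) p (\<lambda>w. left_of u w \<and> right_of v w) Ra"
      "at_corner (projection L) p (\<lambda>w. left_of u w \<and> left_of v w) Rb"
      "at_corner (projection L) p (\<lambda>w. right_of u w \<and> left_of v w) Rc"
      "at_corner (projection L) p (\<lambda>w. right_of u w \<and> right_of v w) Rd"
    unfolding crossing_relations_def by blast
  let ?x = "(p, u, v)"
  obtain qa where qa: "qa \<in> corner L ?x 1 (-1)" "qa \<in> Ra"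
    by (rule at_corner_point[OF L(1,2) x R(1), of 1 "-1"]) (auto simp: left_of_cross right_of_cross)
  obtain qb where qb: "qb \<in> corner L ?x 1 1" "qb \<in> Rb"
    by (rule at_corner_point[OF L(1,2) x R(2), of 1 1]) (auto simp: left_of_cross right_of_cross)
  obtain qc where qc: "qc \<in> corner L ?x (-1) 1" "qc \<in> Rc"
    by (rule at_corner_point[OF L(1,2) x R(3), of "-1" 1]) (auto simp: left_of_cross right_of_cross)
  obtain qd where qd: "qd \<in> corner L ?x (-1) (-1)" "qd \<in> Rd"
    by (rule at_corner_point[OF L(1,2) x R(4), of "-1" "-1"]) (auto simp: left_of_cross right_of_cross)
  have reg: "Ra \<in> regions (projection L)" "Rb \<in> regions (projection L)" "Rc \<in> regions (projection L)" "Rd \<in> regions (projection L)"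
    using R unfolding at_corner_def by blast+
  have cR: "c q = tag (relation_module D) (i q) (h R)" if "R \<in> regions (projection L)" "q \<in> R" for q R
    using ch[OF region_of_unique(2)[OF that]] region_of_unique(1)[OF that] by simp
  have "c qa - c qd = c qb - c qc"
    by (rule dehn_coloring_corners[OF L(1,2) c x qa(1) qb(1) qc(1) qd(1)])
  then have "h Rb - tern (-1) 1 (h Ra) (h Rd) (h Rc) \<in> relation_module D"
    unfolding cR[OF reg(1) qa(2)] cR[OF reg(2) qb(2)] cR[OF reg(3) qc(2)] cR[OF reg(4) qd(2)]
      tag_crossing[OF subspace_relation_module index_coloring_crossing[OF L x qa(1) qb(1) qc(1) qd(1)]] .
  then have "x_var *\<^sub>L (h Rb - tern (-1) 1 (h Ra) (h Rd) (h Rc)) \<in> relation_module D"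
    by (rule free.subspace_scale[OF subspace_relation_module])
  then show "lin h m \<in> relation_module D"
    unfolding m relation_tern by (simp only: lin_scale lin_diff lin_tern lin_gen)
qed

lemma transported_universal:
  fixes L1 L2 f g i1 i2
  assumes L1: "oriented_link L1" "regular_position L1" "index_coloring L1 i1"
    and L2: "oriented_link L2" "regular_position L2" "index_coloring L2 i2"
    and f: "link_homeo L1 L2 f g" and i: "transported f g L1 L2 i1 i2"
  obtains c :: "plane \<Rightarrow> int \<times> (plane set, 's::field) free_mod set bijection" and h
  where "transported f g L1 L2 (universal L1 i1) c"
    "\<And>q. q \<notin> fst ` support L2 \<Longrightarrow> c q = tag (relation_module (projection L1)) (i2 q) (h (region_of L2 q))"
    "label_map (projection L2) (projection L1) h"
proof -
  define K :: "(plane set, 's) free_mod set" where "K = relation_module (projection L1)"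
  have K: "free.subspace K" unfolding K_def by (rule subspace_relation_module)
  note u = universal_dehn_coloring[OF L1, where 's='s]
  obtain c :: "plane \<Rightarrow> int \<times> (plane set, 's) free_mod set bijection"
    where c: "transported f g L1 L2 (universal L1 i1) c"
    by (rule transported_exists[OF L1(1,2) L2(1) f u])
  \<comment> \<open>The first coordinate is a homomorphism, so by naturality and uniqueness the
    index of the new colour is the transported index \<open>i2\<close>.\<close>
  have "transported f g L1 L2 (\<lambda>q. fst (universal L1 i1 q :: int \<times> (plane set, 's) free_mod set bijection)) (\<lambda>q. fst (c q))"
    by (rule transported_additive[OF _ c]) simp
  then have "transported f g L1 L2 i1 (\<lambda>q. fst (c q))" by (simp add: universal_def)
  from transported_unique[OF L2(1) this i] have fst_c: "fst (c q) = i2 q" if "q \<notin> fst ` support L2" for q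
    using that by blast
  \<comment> \<open>The heap property puts the new label into the tridle and not merely into the
    module; the index is still arbitrary here.\<close>
  have heap: "c q \<in> {tag K n m |n m. m \<in> labels (projection L1)}" if q: "q \<notin> fst ` support L2" for q
  proof (rule transported_heap[OF L1(1,2) L2(1) f u c _ _ q])
    fix a b d assume "a \<in> {tag K n m |n m. m \<in> labels (projection L1)}" "b \<in> {tag K n m |n m. m \<in> labels (projection L1)}"
      "d \<in> {tag K n m |n m. m \<in> labels (projection L1)}"
    then obtain n1 m1 n2 m2 n3 m3 where "a = tag K n1 m1" "b = tag K n2 m2" "d = tag K n3 m3"
      "m1 \<in> labels (projection L1)" "m2 \<in> labels (projection L1)" "m3 \<in> labels (projection L1)" by blast
    then show "a - b + d \<in> {tag K n m |n m. m \<in> labels (projection L1)}"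
      using tag_heap[OF K] labels_tern by blast
  next
    fix q assume "q \<notin> fst ` support L1"
    from gen_in_labels[OF region_of_in_regions(1)[OF this]]
    show "universal L1 i1 q \<in> {tag K n m |n m. m \<in> labels (projection L1)}"
      unfolding universal_def K_def by blast
  qed
  have "\<exists>m. m \<in> labels (projection L1) \<and> (\<forall>q\<in>R. c q = tag K (i2 q) m)" if R: "R \<in> regions (projection L2)" for R
  proof -
    obtain p where p: "p \<in> R" using region_nonempty[OF R] by blast
    note off = region_of_unique(2)[OF R]
    obtain n m where m: "c p = tag K n m" "m \<in> labels (projection L1)" using heap[OF off[OF p]] by blast
    have lc: "loc_const (- fst ` support L2) c"
      by (rule dehn_coloring_loc_const[OF transported_dehn_coloring[OF L2(1,2) c]])
    have "c q = tag K (i2 q) m" if q: "q \<in> R" for q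
    proof -
      have e: "c q = tag K n m" using loc_const_on_region[OF lc R q p] m(1) by (rule trans)
      then have "n = i2 q" using fst_c[OF off[OF q]] by simp
      then show ?thesis using e by simp
    qed
    then show ?thesis using m(2) by blast
  qed
  then obtain h where h: "\<And>R. R \<in> regions (projection L2) \<Longrightarrow> h R \<in> labels (projection L1) \<and> (\<forall>q\<in>R. c q = tag K (i2 q) (h R))"
    by metis
  have ch: "c q = tag (relation_module (projection L1)) (i2 q) (h (region_of L2 q))" if q: "q \<notin> fst ` support L2" for q
    using h[OF region_of_in_regions(1)[OF q]] region_of_in_regions(2)[OF q] unfolding K_def by blast
  show ?thesis
  proof (rule that[OF c ch])
    show "label_map (projection L2) (projection L1) h"
      by (rule label_mapI[OF L2 transported_dehn_coloring[OF L2(1,2) c] _ ch]) (use h in blast)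
  qed
qed

lemma dehn_coloring_Pair:
  assumes L: "oriented_link L" "regular_position L" and c: "dehn_coloring L c" "dehn_coloring L c'"
  shows "dehn_coloring L (\<lambda>q. (c q, c' q))"
proof (rule dehn_coloringI[OF L(1,2)])
  show "loc_const (- fst ` support L) (\<lambda>q. (c q, c' q))"
    by (rule loc_const_comp2[where F = Pair, OF dehn_coloring_loc_const dehn_coloring_loc_const]) (rule c)+
next
  fix x qa qb qc qd
  assume x: "x \<in> crossings (projection L)"
    and q: "qa \<in> corner L x 1 (-1)" "qb \<in> corner L x 1 1" "qc \<in> corner L x (-1) 1" "qd \<in> corner L x (-1) (-1)"
  have "c qa - c qd = c qb - c qc" "c' qa - c' qd = c' qb - c' qc"
    using dehn_coloring_corners[OF L c(1) x q] dehn_coloring_corners[OF L c(2) x q] by blast+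
  then show "(c qa, c' qa) - (c qd, c' qd) = (c qb, c' qb) - (c qc, c' qc)" by simp
qed

text \<open>The universal colouring of \<open>L1\<close> and the one induced on it from
  \<open>L2\<close> are transported together in a product group, so their labels remain
  \<open>m\<close> and \<open>lin k m\<close> for a common \<open>m\<close>. The first coordinate
  shows that \<open>m\<close> is \<open>h R\<close>, the second that \<open>lin k m\<close> is
  \<open>gen R\<close>, modulo relations.\<close>

lemma label_maps_inverse:
  fixes c1 c2 :: "plane \<Rightarrow> int \<times> (plane set, 's::field) free_mod set bijection"
  assumes L1: "oriented_link L1" "regular_position L1" "index_coloring L1 i1"
    and L2: "oriented_link L2" "regular_position L2" "index_coloring L2 i2"
    and f: "link_homeo L1 L2 f g"
    and c2: "transported f g L1 L2 (universal L1 i1) c2"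
      "\<And>q. q \<notin> fst ` support L2 \<Longrightarrow> c2 q = tag (relation_module (projection L1)) (i2 q) (h (region_of L2 q))"
    and c1: "transported g f L2 L1 (universal L2 i2) c1"
      "\<And>q. q \<notin> fst ` support L1 \<Longrightarrow> c1 q = tag (relation_module (projection L2)) (i1 q) (k (region_of L1 q))"
    and k: "label_map (projection L1) (projection L2) k" and R: "R \<in> regions (projection L2)"
  shows "lin k (h R) - gen R \<in> relation_module (projection L2)"
proof -
  define K1 :: "(plane set, 's) free_mod set" where "K1 = relation_module (projection L1)"
  define K2 :: "(plane set, 's) free_mod set" where "K2 = relation_module (projection L2)"
  have K: "free.subspace K1" "free.subspace K2" unfolding K1_def K2_def by (rule subspace_relation_module)+
  define e where "e q = (universal L1 i1 q :: int \<times> (plane set, 's) free_mod set bijection, c1 q)" for q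
  have e: "dehn_coloring L1 e" unfolding e_def[abs_def]
    by (rule dehn_coloring_Pair[OF L1(1,2) universal_dehn_coloring[OF L1] transported_dehn_coloring[OF L1(1,2) c1(1)]])
  obtain e' where e': "transported f g L1 L2 e e'" by (rule transported_exists[OF L1(1,2) L2(1) f e])
  have "transported f g L1 L2 (\<lambda>q. fst (e q)) (\<lambda>q. fst (e' q))" by (rule transported_additive[OF _ e']) simp
  then have 1: "transported f g L1 L2 (universal L1 i1) (\<lambda>q. fst (e' q))" by (simp add: e_def)
  have "transported f g L1 L2 (\<lambda>q. snd (e q)) (\<lambda>q. snd (e' q))" by (rule transported_additive[OF _ e']) simp
  then have 2: "transported f g L1 L2 c1 (\<lambda>q. snd (e' q))" by (simp add: e_def)
  have 3: "transported f g L1 L2 c1 (universal L2 i2)"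
    by (rule transported_sym[OF L2(1,2) L1(1,2) link_homeo_sym[OF f] universal_dehn_coloring[OF L2] c1(1)])
  obtain q where q: "q \<in> R" using region_nonempty[OF R] by blast
  note off = region_of_unique(2)[OF R q]
  \<comment> \<open>Closed under \<open>a - b + d\<close> because \<open>lin k\<close> commutes with
    \<open>tern\<close> and both coordinates carry the same index.\<close>
  have "e' q \<in> {(tag K1 n m, tag K2 n (lin k m)) |n m. True}"
  proof (rule transported_heap[OF L1(1,2) L2(1) f e e' _ _ off])
    fix a b d assume "a \<in> {(tag K1 n m, tag K2 n (lin k m)) |n m. True}" "b \<in> {(tag K1 n m, tag K2 n (lin k m)) |n m. True}"
      "d \<in> {(tag K1 n m, tag K2 n (lin k m)) |n m. True}"
    then obtain n1 m1 n2 m2 n3 m3 where abd: "a = (tag K1 n1 m1, tag K2 n1 (lin k m1))"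
      "b = (tag K1 n2 m2, tag K2 n2 (lin k m2))" "d = (tag K1 n3 m3, tag K2 n3 (lin k m3))" by blast
    show "a - b + d \<in> {(tag K1 n m, tag K2 n (lin k m)) |n m. True}"
      unfolding abd diff_Pair add_Pair tag_heap[OF K(1)] tag_heap[OF K(2)] lin_tern[symmetric] by blast
  next
    fix q assume "q \<notin> fst ` support L1"
    from c1(2)[OF this] have "e q = (tag K1 (i1 q) (gen (region_of L1 q)), tag K2 (i1 q) (lin k (gen (region_of L1 q))))"
      unfolding e_def universal_def K1_def K2_def lin_gen by simp
    then show "e q \<in> {(tag K1 n m, tag K2 n (lin k m)) |n m. True}" by blast
  qed
  then obtain n m where m: "fst (e' q) = tag K1 n m" "snd (e' q) = tag K2 n (lin k m)" by auto
  have "tag K1 n m = tag K1 (i2 q) (h R)"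
    using transported_unique[OF L2(1) 1 c2(1) off] c2(2)[OF off] m(1) region_of_unique(1)[OF R q] unfolding K1_def by simp
  then have "m - h R \<in> K1" by (simp add: tag_eq_iff[OF K(1)])
  then have d: "lin k m - lin k (h R) \<in> K2"
    using label_map_relations[OF k] unfolding K1_def K2_def by (simp flip: lin_diff)
  have "tag K2 n (lin k m) = tag K2 (i2 q) (gen R)"
    using transported_unique[OF L2(1) 2 3 off] m(2) region_of_unique(1)[OF R q] unfolding K2_def universal_def by simp
  then have "lin k m - gen R \<in> K2" by (simp add: tag_eq_iff[OF K(2)])
  from free.subspace_diff[OF K(2) this d] show ?thesis unfolding K2_def by simp
qed

text \<open>\<open>i2\<close> is defined as the transport of \<open>i1\<close>, which keeps the
  indices of both directions consistent. That it is an index colouring again follows from the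
  preserved linking structure; this is the only use of more than the bare homeomorphism.\<close>

lemma linear_tridle_link_equiv:
  assumes L1: "oriented_link L1" "regular_position L1" and L2: "oriented_link L2" "regular_position L2"
    and f: "link_equiv L1 L2 f g"
  shows "tridle_isomorphic (linear_tridle (projection L1) :: 's::field quot tridle)
    (linear_tridle (projection L2) :: 's quot tridle)"
proof -
  have h: "link_homeo L1 L2 f g" using f unfolding link_equiv_def by blast
  obtain i1 where i1: "index_coloring L1 i1" using index_coloring_exists[OF L1] by blast
  note d1 = index_coloring_dehn_coloring[OF L1 i1]
  obtain i2 where i2: "transported f g L1 L2 i1 i2" by (rule transported_exists[OF L1 L2(1) h d1])
  have "linking L2 (\<lambda>i. f ` chart_set L1 i) (\<lambda>i j X. transition L1 i1 i j (g X))"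
    using f index_coloring_linking[OF L1 i1 d1] unfolding link_equiv_def by blast
  from holonomy_index_coloring[OF L2 this i2[unfolded transported_def]] have i2': "index_coloring L2 i2" .
  have i: "transported g f L2 L1 i2 i1" by (rule transported_sym[OF L1 L2 h d1 i2])
  obtain c2 :: "plane \<Rightarrow> int \<times> (plane set, 's) free_mod set bijection" and h2
    where c2: "transported f g L1 L2 (universal L1 i1) c2"
      "\<And>q. q \<notin> fst ` support L2 \<Longrightarrow> c2 q = tag (relation_module (projection L1)) (i2 q) (h2 (region_of L2 q))"
      and h2: "label_map (projection L2) (projection L1) h2"
    by (rule transported_universal[OF L1 i1 L2 i2' h i2]) (rule that; assumption)
  obtain c1 :: "plane \<Rightarrow> int \<times> (plane set, 's) free_mod set bijection" and h1
    where c1: "transported g f L2 L1 (universal L2 i2) c1"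
      "\<And>q. q \<notin> fst ` support L1 \<Longrightarrow> c1 q = tag (relation_module (projection L2)) (i1 q) (h1 (region_of L1 q))"
      and h1: "label_map (projection L1) (projection L2) h1"
    by (rule transported_universal[OF L2 i2' L1 i1 link_homeo_sym[OF h] i]) (rule that; assumption)
  show ?thesis
    by (rule tridle_isomorphicI[OF h1 h2])
      (rule label_maps_inverse[OF L2 i2' L1 i1 link_homeo_sym[OF h] c1 c2 h2], assumption+,
       rule label_maps_inverse[OF L1 i1 L2 i2' h c2 c1 h1], assumption+)
qed

theorem theorem2p3:
  fixes D D' :: oriented_diagram and L :: directed_edges
  assumes "oriented_link L"
    and "is_diagram_of D L" and "is_diagram_of D' L"
  shows "tridle_isomorphic (linear_tridle D :: 's::field quot tridle) (linear_tridle D' :: 's quot tridle)"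
proof -
  obtain L1 where L1: "same_oriented_link L L1" "regular_position L1" "D = projection L1"
    using assms(2) unfolding is_diagram_of_def by blast
  obtain L2 where L2: "same_oriented_link L L2" "regular_position L2" "D' = projection L2"
    using assms(3) unfolding is_diagram_of_def by blast
  have "equivclp triangle_move L1 L2"
    using L1(1) L2(1) unfolding same_oriented_link_def by (meson equivclp_sym equivclp_trans)
  then obtain f g where "link_equiv L1 L2 f g" using equivclp_link_equiv by blast
  moreover have "oriented_link L1" "oriented_link L2" using L1(1) L2(1) unfolding same_oriented_link_def by blast+
  ultimately show ?thesis unfolding L1(3) L2(3) by (intro linear_tridle_link_equiv L1(2) L2(2))
qed

end
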